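(* Let $\mathcal T$ be a compactly generated triangulated category and let $y:\mathcal T\to\mathrm{Mod}\text{-}\mathcal T^{\rm c}$ be the restricted Yoneda functor. A subcategory $\mathcal D$ of $\mathcal T$ is definable if and only if it has any of the following equivalent forms: (a) $\mathcal D=y^{-1}\mathcal F$ where $\mathcal F$ is a finite-type hereditary torsionfree class in $\mathrm{Mod}\text{-}\mathcal T^{\rm c}$; (b) $\mathcal D=y^{-1}\mathcal E$ where $\mathcal E$ is the class of absolutely pure objects in a hereditary torsionfree class of finite type in $\mathrm{Mod}\text{-}\mathcal T^{\rm c}$; (c) $\mathcal D=y^{-1}\mathcal E$ where $\mathcal E$ is a definable class of absolutely pure objects in $\mathrm{Mod}\text{-}\mathcal T^{\rm c}$.
   Context: $\mathcal T$ is a triangulated category with arbitrary coproducts. An object $A$ is compact if $\mathrm{Hom}(A,-)$ commutes with coproducts; $\mathcal T^{\rm c}$ is the full subcategory of compact objects. Compactly generated means that $\mathcal T^{\rm c}$ has only a set of isomorphism classes and that $\mathrm{Hom}(A,X)=0$ for all compact $A$ implies $X=0$. We write $(X,Y)$ for Hom groups. $\mathrm{Mod}\text{-}\mathcal T^{\rm c}$ is the category of additive functors $(\mathcal T^{\rm c})^{\rm op}\to\mathbf{Ab}$, and $yX=(-,X)\upharpoonright\mathcal T^{\rm c}$. For a class $\mathcal C$ of modules, $y^{-1}\mathcal C$ is the full subcategory of those $X\in\mathcal T$ with $yX\in\mathcal C$. A full subcategory $\mathcal D$ of $\mathcal T$ is definable if there is a set (or class) $\mathcal A$ of coherent functors with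 $\mathcal D=\{X: FX=0\ \forall F\in\mathcal A\}$; a coherent functor is a functor of the form $\mathrm{coker}((f,-):(B,-)\to(A,-)):\mathcal T\to\mathbf{Ab}$ with $f:A\to B$ in $\mathcal T^{\rm c}$. A class of modules is definable if it is closed under direct products, directed colimits and pure submodules. A module is absolutely pure (= fp-injective) if every embedding of it into another module is pure. A torsion pair (torsion theory) in $\mathrm{Mod}\text{-}\mathcal T^{\rm c}$ is a pair $(\mathscr T,\mathcal F)$ of classes, torsion and torsionfree, with $(\mathscr T,\mathcal F)=0$ and maximal such. It is hereditary if $\mathscr T$ is closed under subobjects. A hereditary torsion pair is of finite type if $\mathscr T$ is generated, as a hereditary torsion class, by finitely presented objects (equivalently, $\mathcal F$ is closed under directed colimits). A (finite-type) hereditary torsionfree class is the class $\mathcal F$ of a (finite-type) hereditary torsion pair. *)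

theory Defs
  imports "HOL-Algebra.Free_Abelian_Groups"
begin

section \<open>Smallness\<close>

text \<open>
  ``Set'' and ``class'' are made precise by a Grothendieck universe, given by a type \<open>'u\<close>
  of strongly inaccessible cardinality: a set (of elements of any type) is small, i.e. a ``set'' of
  the mathematical text, iff its cardinality is strictly below that of \<open>'u\<close>. Every small set
  is in bijection with a small subset of \<open>'u\<close>, so that nothing is lost by taking all Hom
  groups, all values of modules and all index sets inside \<open>'u\<close>.
\<close>

definition small :: "'u itself \<Rightarrow> 'b set \<Rightarrow> bool" where
  "small (_ :: 'u itself) A \<longleftrightarrow> A \<prec> (UNIV :: 'u set)"

definition strongly_inaccessible :: "'u itself \<Rightarrow> bool" where
  "strongly_inaccessible U \<longleftrightarrow>
     small U (UNIV :: nat set) \<and>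
     (\<forall>A :: 'u set. small U A \<longrightarrow> small U (Pow A)) \<and>
     (\<forall>(I :: 'u set) (A :: 'u \<Rightarrow> 'u set).
        small U I \<longrightarrow> (\<forall>i\<in>I. small U (A i)) \<longrightarrow> small U (\<Union>i\<in>I. A i))"

section \<open>Preadditive categories\<close>

text \<open>
  Hom groups are abelian groups in the multiplicative notation of HOL-Algebra: \<open>\<otimes>\<close> is
  addition of morphisms and \<open>\<one>\<close> is the zero morphism. Hom sets of different pairs of
  objects may overlap, so composition takes the objects as arguments:
  \<open>Cmp C X Y Z g f\<close> is the composite of \<open>f : X \<rightarrow> Y\<close> and
  \<open>g : Y \<rightarrow> Z\<close>.
\<close>

record ('o, 'a) pcat =
  Obj :: "'o set"
  Hom :: "'o \<Rightarrow> 'o \<Rightarrow> 'a monoid"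
  Cmp :: "'o \<Rightarrow> 'o \<Rightarrow> 'o \<Rightarrow> 'a \<Rightarrow> 'a \<Rightarrow> 'a"
  Idn :: "'o \<Rightarrow> 'a"

abbreviation arr :: "('o, 'a) pcat \<Rightarrow> 'o \<Rightarrow> 'o \<Rightarrow> 'a set" where
  "arr C X Y \<equiv> carrier (Hom C X Y)"

locale preadditive_category =
  fixes C :: "('o, 'a) pcat"
  assumes comm_group_Hom: "\<lbrakk>X \<in> Obj C; Y \<in> Obj C\<rbrakk> \<Longrightarrow> comm_group (Hom C X Y)"
    and Idn_arr: "X \<in> Obj C \<Longrightarrow> Idn C X \<in> arr C X X"
    and Cmp_arr: "\<lbrakk>X \<in> Obj C; Y \<in> Obj C; Z \<in> Obj C; f \<in> arr C X Y; g \<in> arr C Y Z\<rbrakk>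
      \<Longrightarrow> Cmp C X Y Z g f \<in> arr C X Z"
    and Cmp_Idn_right: "\<lbrakk>X \<in> Obj C; Y \<in> Obj C; f \<in> arr C X Y\<rbrakk>
      \<Longrightarrow> Cmp C X X Y f (Idn C X) = f"
    and Cmp_Idn_left: "\<lbrakk>X \<in> Obj C; Y \<in> Obj C; f \<in> arr C X Y\<rbrakk>
      \<Longrightarrow> Cmp C X Y Y (Idn C Y) f = f"
    and Cmp_assoc: "\<lbrakk>W \<in> Obj C; X \<in> Obj C; Y \<in> Obj C; Z \<in> Obj C;
        f \<in> arr C W X; g \<in> arr C X Y; h \<in> arr C Y Z\<rbrakk>
      \<Longrightarrow> Cmp C W Y Z h (Cmp C W X Y g f) = Cmp C W X Z (Cmp C X Y Z h g) f"
    and Cmp_add_right: "\<lbrakk>X \<in> Obj C; Y \<in> Obj C; Z \<in> Obj C;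
        f \<in> arr C X Y; f' \<in> arr C X Y; g \<in> arr C Y Z\<rbrakk>
      \<Longrightarrow> Cmp C X Y Z g (f \<otimes>\<^bsub>Hom C X Y\<^esub> f') =
          Cmp C X Y Z g f \<otimes>\<^bsub>Hom C X Z\<^esub> Cmp C X Y Z g f'"
    and Cmp_add_left: "\<lbrakk>X \<in> Obj C; Y \<in> Obj C; Z \<in> Obj C;
        f \<in> arr C X Y; g \<in> arr C Y Z; g' \<in> arr C Y Z\<rbrakk>
      \<Longrightarrow> Cmp C X Y Z (g \<otimes>\<^bsub>Hom C Y Z\<^esub> g') f =
          Cmp C X Y Z g f \<otimes>\<^bsub>Hom C X Z\<^esub> Cmp C X Y Z g' f"

definition op_cat :: "('o, 'a) pcat \<Rightarrow> ('o, 'a) pcat" where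
  "op_cat C = \<lparr>Obj = Obj C, Hom = (\<lambda>X Y. Hom C Y X),
     Cmp = (\<lambda>X Y Z g f. Cmp C Z Y X f g), Idn = Idn C\<rparr>"

definition full_subcat :: "('o, 'a) pcat \<Rightarrow> 'o set \<Rightarrow> ('o, 'a) pcat" where
  "full_subcat C S = C\<lparr>Obj := S\<rparr>"

definition is_isomorphism :: "('o, 'a) pcat \<Rightarrow> 'o \<Rightarrow> 'o \<Rightarrow> 'a \<Rightarrow> bool" where
  "is_isomorphism C X Y f \<longleftrightarrow> f \<in> arr C X Y \<and>
     (\<exists>g\<in>arr C Y X. Cmp C X Y X g f = Idn C X \<and> Cmp C Y X Y f g = Idn C Y)"

definition isomorphic_in :: "('o, 'a) pcat \<Rightarrow> 'o \<Rightarrow> 'o \<Rightarrow> bool" where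
  "isomorphic_in C X Y \<longleftrightarrow> (\<exists>f. is_isomorphism C X Y f)"

definition is_zero_object :: "('o, 'a) pcat \<Rightarrow> 'o \<Rightarrow> bool" where
  "is_zero_object C Z \<longleftrightarrow> Z \<in> Obj C \<and>
     (\<forall>X\<in>Obj C. arr C X Z = {\<one>\<^bsub>Hom C X Z\<^esub>} \<and> arr C Z X = {\<one>\<^bsub>Hom C Z X\<^esub>})"

definition is_monomorphism :: "('o, 'a) pcat \<Rightarrow> 'o \<Rightarrow> 'o \<Rightarrow> 'a \<Rightarrow> bool" where
  "is_monomorphism C X Y f \<longleftrightarrow> f \<in> arr C X Y \<and>
     (\<forall>W\<in>Obj C. \<forall>u\<in>arr C W X. \<forall>v\<in>arr C W X. Cmp C W X Y f u = Cmp C W X Y f v \<longrightarrow> u = v)"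

definition is_cokernel :: "('o, 'a) pcat \<Rightarrow> 'o \<Rightarrow> 'o \<Rightarrow> 'o \<Rightarrow> 'a \<Rightarrow> 'a \<Rightarrow> bool" where
  "is_cokernel C X Y Z f p \<longleftrightarrow> Z \<in> Obj C \<and> p \<in> arr C Y Z \<and>
     Cmp C X Y Z p f = \<one>\<^bsub>Hom C X Z\<^esub> \<and>
     (\<forall>W\<in>Obj C. \<forall>h\<in>arr C Y W. Cmp C X Y W h f = \<one>\<^bsub>Hom C X W\<^esub> \<longrightarrow>
        (\<exists>!k. k \<in> arr C Z W \<and> Cmp C Y Z W k p = h))"

definition is_biproduct ::
  "('o, 'a) pcat \<Rightarrow> 'o \<Rightarrow> 'o \<Rightarrow> 'o \<Rightarrow> 'a \<Rightarrow> 'a \<Rightarrow> 'a \<Rightarrow> 'a \<Rightarrow> bool" where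
  "is_biproduct C X Y P i j p q \<longleftrightarrow> P \<in> Obj C \<and>
     i \<in> arr C X P \<and> j \<in> arr C Y P \<and> p \<in> arr C P X \<and> q \<in> arr C P Y \<and>
     Cmp C X P X p i = Idn C X \<and> Cmp C Y P Y q j = Idn C Y \<and>
     Cmp C Y P X p j = \<one>\<^bsub>Hom C Y X\<^esub> \<and> Cmp C X P Y q i = \<one>\<^bsub>Hom C X Y\<^esub> \<and>
     Cmp C P X P i p \<otimes>\<^bsub>Hom C P P\<^esub> Cmp C P Y P j q = Idn C P"

definition is_product ::
  "('o, 'a) pcat \<Rightarrow> 'i set \<Rightarrow> ('i \<Rightarrow> 'o) \<Rightarrow> 'o \<Rightarrow> ('i \<Rightarrow> 'a) \<Rightarrow> bool" where
  "is_product C I X P \<pi> \<longleftrightarrow> P \<in> Obj C \<and> (\<forall>i\<in>I. \<pi> i \<in> arr C P (X i)) \<and>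
     (\<forall>W\<in>Obj C. \<forall>h. (\<forall>i\<in>I. h i \<in> arr C W (X i)) \<longrightarrow>
        (\<exists>!k. k \<in> arr C W P \<and> (\<forall>i\<in>I. Cmp C W P (X i) (\<pi> i) k = h i)))"

definition is_coproduct ::
  "('o, 'a) pcat \<Rightarrow> 'i set \<Rightarrow> ('i \<Rightarrow> 'o) \<Rightarrow> 'o \<Rightarrow> ('i \<Rightarrow> 'a) \<Rightarrow> bool" where
  "is_coproduct C I X S \<iota> \<longleftrightarrow> S \<in> Obj C \<and> (\<forall>i\<in>I. \<iota> i \<in> arr C (X i) S) \<and>
     (\<forall>W\<in>Obj C. \<forall>h. (\<forall>i\<in>I. h i \<in> arr C (X i) W) \<longrightarrow>
        (\<exists>!k. k \<in> arr C S W \<and> (\<forall>i\<in>I. Cmp C (X i) S W k (\<iota> i) = h i)))"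

definition directed_poset :: "'i set \<Rightarrow> 'i rel \<Rightarrow> bool" where
  "directed_poset I r \<longleftrightarrow> partial_order_on I r \<and> I \<noteq> {} \<and>
     (\<forall>i\<in>I. \<forall>j\<in>I. \<exists>k\<in>I. (i, k) \<in> r \<and> (j, k) \<in> r)"

definition is_direct_system ::
  "('o, 'a) pcat \<Rightarrow> 'i set \<Rightarrow> 'i rel \<Rightarrow> ('i \<Rightarrow> 'o) \<Rightarrow> ('i \<Rightarrow> 'i \<Rightarrow> 'a) \<Rightarrow> bool" where
  "is_direct_system C I r X t \<longleftrightarrow>
     (\<forall>i\<in>I. X i \<in> Obj C \<and> t i i = Idn C (X i)) \<and>
     (\<forall>(i, j)\<in>r. t i j \<in> arr C (X i) (X j)) \<and>
     (\<forall>i j k. (i, j) \<in> r \<longrightarrow> (j, k) \<in> r \<longrightarrow>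
        Cmp C (X i) (X j) (X k) (t j k) (t i j) = t i k)"

definition is_cocone :: "('o, 'a) pcat \<Rightarrow> 'i set \<Rightarrow> 'i rel \<Rightarrow> ('i \<Rightarrow> 'o) \<Rightarrow>
    ('i \<Rightarrow> 'i \<Rightarrow> 'a) \<Rightarrow> 'o \<Rightarrow> ('i \<Rightarrow> 'a) \<Rightarrow> bool" where
  "is_cocone C I r X t W h \<longleftrightarrow> (\<forall>i\<in>I. h i \<in> arr C (X i) W) \<and>
     (\<forall>(i, j)\<in>r. Cmp C (X i) (X j) W (h j) (t i j) = h i)"

definition is_directed_colimit :: "('o, 'a) pcat \<Rightarrow> 'i set \<Rightarrow> 'i rel \<Rightarrow> ('i \<Rightarrow> 'o) \<Rightarrow>
    ('i \<Rightarrow> 'i \<Rightarrow> 'a) \<Rightarrow> 'o \<Rightarrow> ('i \<Rightarrow> 'a) \<Rightarrow> bool" where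
  "is_directed_colimit C I r X t L c \<longleftrightarrow>
     directed_poset I r \<and> is_direct_system C I r X t \<and>
     L \<in> Obj C \<and> is_cocone C I r X t L c \<and>
     (\<forall>W\<in>Obj C. \<forall>h. is_cocone C I r X t W h \<longrightarrow>
        (\<exists>!k. k \<in> arr C L W \<and> (\<forall>i\<in>I. Cmp C (X i) L W k (c i) = h i)))"

section \<open>Additive functors to abelian groups\<close>

record ('o, 'a, 'u) abfun =
  FOb :: "'o \<Rightarrow> 'u monoid"
  FAr :: "'o \<Rightarrow> 'o \<Rightarrow> 'a \<Rightarrow> 'u \<Rightarrow> 'u"

text \<open>
  The category \<open>Ab\<close> consists of the small abelian groups with elements in the universe
  \<open>'u\<close>. A functor record may take arbitrary values off the objects and arrows of
  \<open>C\<close>; two records which agree on \<open>C\<close> are isomorphic in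
  \<open>abfun_cat C\<close> below.
\<close>

definition is_additive_functor :: "('o, 'a) pcat \<Rightarrow> ('o, 'a, 'u) abfun \<Rightarrow> bool" where
  "is_additive_functor C F \<longleftrightarrow>
     (\<forall>X\<in>Obj C. comm_group (FOb F X) \<and> small TYPE('u) (carrier (FOb F X)) \<and>
        (\<forall>x\<in>carrier (FOb F X). FAr F X X (Idn C X) x = x)) \<and>
     (\<forall>X\<in>Obj C. \<forall>Y\<in>Obj C. \<forall>f\<in>arr C X Y.
        FAr F X Y f \<in> hom (FOb F X) (FOb F Y) \<and>
        (\<forall>g\<in>arr C X Y. \<forall>x\<in>carrier (FOb F X).
           FAr F X Y (f \<otimes>\<^bsub>Hom C X Y\<^esub> g) x = FAr F X Y f x \<otimes>\<^bsub>FOb F Y\<^esub> FAr F X Y g x) \<and>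
        (\<forall>Z\<in>Obj C. \<forall>g\<in>arr C Y Z. \<forall>x\<in>carrier (FOb F X).
           FAr F X Z (Cmp C X Y Z g f) x = FAr F Y Z g (FAr F X Y f x)))"

text \<open>
  Natural transformations are required to be extensional (undefined off the objects of \<open>C\<close>
  and off the values of the source functor), so that equality of natural transformations is equality
  in HOL.
\<close>

definition Nat ::
  "('o, 'a) pcat \<Rightarrow> ('o, 'a, 'u) abfun \<Rightarrow> ('o, 'a, 'u) abfun \<Rightarrow> ('o \<Rightarrow> 'u \<Rightarrow> 'u) monoid" where
  "Nat C F G = \<lparr>
     carrier = {\<eta> \<in> (\<Pi>\<^sub>E X\<in>Obj C. hom (FOb F X) (FOb G X) \<inter> extensional (carrier (FOb F X))).
       \<forall>X\<in>Obj C. \<forall>Y\<in>Obj C. \<forall>f\<in>arr C X Y. \<forall>x\<in>carrier (FOb F X).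
         \<eta> Y (FAr F X Y f x) = FAr G X Y f (\<eta> X x)},
     mult = (\<lambda>\<eta> \<theta>. \<lambda>X\<in>Obj C. \<lambda>x\<in>carrier (FOb F X). \<eta> X x \<otimes>\<^bsub>FOb G X\<^esub> \<theta> X x),
     one = (\<lambda>X\<in>Obj C. \<lambda>x\<in>carrier (FOb F X). \<one>\<^bsub>FOb G X\<^esub>)\<rparr>"

definition abfun_cat ::
  "('o, 'a) pcat \<Rightarrow> (('o, 'a, 'u) abfun, 'o \<Rightarrow> 'u \<Rightarrow> 'u) pcat" where
  "abfun_cat C = \<lparr>Obj = {F. is_additive_functor C F}, Hom = Nat C,
     Cmp = (\<lambda>F G H \<theta> \<eta>. \<lambda>X\<in>Obj C. compose (carrier (FOb F X)) (\<theta> X) (\<eta> X)),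
     Idn = (\<lambda>F. \<lambda>X\<in>Obj C. \<lambda>x\<in>carrier (FOb F X). x)\<rparr>"

text \<open>
  \<open>rep C A\<close> is \<open>(A,-)\<close>, and \<open>rep_map C A B f\<close>, for
  \<open>f : A \<rightarrow> B\<close>, is \<open>(f,-) : (B,-) \<rightarrow> (A,-)\<close>.
\<close>

definition rep :: "('o, 'u) pcat \<Rightarrow> 'o \<Rightarrow> ('o, 'u, 'u) abfun" where
  "rep C A = \<lparr>FOb = (\<lambda>X. Hom C A X), FAr = (\<lambda>X Y g h. Cmp C A X Y g h)\<rparr>"

definition rep_map :: "('o, 'u) pcat \<Rightarrow> 'o \<Rightarrow> 'o \<Rightarrow> 'u \<Rightarrow> ('o \<Rightarrow> 'u \<Rightarrow> 'u)" where
  "rep_map C A B f = (\<lambda>X\<in>Obj C. \<lambda>h\<in>arr C B X. Cmp C A B X h f)"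

section \<open>Compactly generated triangulated categories\<close>

locale additive_category = preadditive_category +
  assumes zero_object: "\<exists>Z. is_zero_object C Z"
    and biproducts: "\<lbrakk>X \<in> Obj C; Y \<in> Obj C\<rbrakk> \<Longrightarrow> \<exists>P i j p q. is_biproduct C X Y P i j p q"

text \<open>
  \<open>Sh\<close>, \<open>ShA\<close> are the object and arrow parts of the shift, an additive
  autoequivalence (\<open>Sh_iso\<close>, \<open>Sh_dense\<close>), and
  \<open>Tri X Y Z f g h\<close> says that
  \<open>X \<rightarrow> Y \<rightarrow> Z \<rightarrow> Sh X\<close>, with maps \<open>f\<close>, \<open>g\<close>,
  \<open>h\<close>, is a distinguished triangle.
\<close>

locale triangulated_category = additive_category T
  for T :: "('o, 'a) pcat" +
  fixes Sh :: "'o \<Rightarrow> 'o"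
    and ShA :: "'o \<Rightarrow> 'o \<Rightarrow> 'a \<Rightarrow> 'a"
    and Tri :: "'o \<Rightarrow> 'o \<Rightarrow> 'o \<Rightarrow> 'a \<Rightarrow> 'a \<Rightarrow> 'a \<Rightarrow> bool"
  assumes Sh_obj: "X \<in> Obj T \<Longrightarrow> Sh X \<in> Obj T"
    and Sh_iso: "\<lbrakk>X \<in> Obj T; Y \<in> Obj T\<rbrakk> \<Longrightarrow> ShA X Y \<in> iso (Hom T X Y) (Hom T (Sh X) (Sh Y))"
    and Sh_Idn: "X \<in> Obj T \<Longrightarrow> ShA X X (Idn T X) = Idn T (Sh X)"
    and Sh_Cmp: "\<lbrakk>X \<in> Obj T; Y \<in> Obj T; Z \<in> Obj T; f \<in> arr T X Y; g \<in> arr T Y Z\<rbrakk>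
      \<Longrightarrow> ShA X Z (Cmp T X Y Z g f) = Cmp T (Sh X) (Sh Y) (Sh Z) (ShA Y Z g) (ShA X Y f)"
    and Sh_dense: "Y \<in> Obj T \<Longrightarrow> \<exists>X\<in>Obj T. isomorphic_in T (Sh X) Y"
    and Tri_wf: "Tri X Y Z f g h \<Longrightarrow> X \<in> Obj T \<and> Y \<in> Obj T \<and> Z \<in> Obj T \<and>
      f \<in> arr T X Y \<and> g \<in> arr T Y Z \<and> h \<in> arr T Z (Sh X)"
    and TR1_isomorphic: "\<lbrakk>Tri X Y Z f g h;
        X' \<in> Obj T; Y' \<in> Obj T; Z' \<in> Obj T;
        f' \<in> arr T X' Y'; g' \<in> arr T Y' Z'; h' \<in> arr T Z' (Sh X');
        is_isomorphism T X X' u; is_isomorphism T Y Y' v; is_isomorphism T Z Z' w;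
        Cmp T X Y Y' v f = Cmp T X X' Y' f' u;
        Cmp T Y Z Z' w g = Cmp T Y Y' Z' g' v;
        Cmp T Z (Sh X) (Sh X') (ShA X X' u) h = Cmp T Z Z' (Sh X') h' w\<rbrakk>
      \<Longrightarrow> Tri X' Y' Z' f' g' h'"
    and TR1_identity: "\<lbrakk>X \<in> Obj T; is_zero_object T Z\<rbrakk>
      \<Longrightarrow> Tri X X Z (Idn T X) \<one>\<^bsub>Hom T X Z\<^esub> \<one>\<^bsub>Hom T Z (Sh X)\<^esub>"
    and TR1_cone: "\<lbrakk>X \<in> Obj T; Y \<in> Obj T; f \<in> arr T X Y\<rbrakk> \<Longrightarrow> \<exists>Z g h. Tri X Y Z f g h"
    and TR2_rotation: "\<lbrakk>X \<in> Obj T; Y \<in> Obj T; Z \<in> Obj T;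
        f \<in> arr T X Y; g \<in> arr T Y Z; h \<in> arr T Z (Sh X)\<rbrakk>
      \<Longrightarrow> Tri X Y Z f g h \<longleftrightarrow>
          Tri Y Z (Sh X) g h (inv\<^bsub>Hom T (Sh X) (Sh Y)\<^esub> (ShA X Y f))"
    and TR3_morphism: "\<lbrakk>Tri X Y Z f g h; Tri X' Y' Z' f' g' h';
        u \<in> arr T X X'; v \<in> arr T Y Y';
        Cmp T X Y Y' v f = Cmp T X X' Y' f' u\<rbrakk>
      \<Longrightarrow> \<exists>w\<in>arr T Z Z'.
          Cmp T Y Z Z' w g = Cmp T Y Y' Z' g' v \<and>
          Cmp T Z (Sh X) (Sh X') (ShA X X' u) h = Cmp T Z Z' (Sh X') h' w"
    and TR4_octahedral: "\<lbrakk>Tri X Y U f a a'; Tri Y Z W g b b'; Tri X Z V (Cmp T X Y Z g f) c c'\<rbrakk>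
      \<Longrightarrow> \<exists>u\<in>arr T U V. \<exists>v\<in>arr T V W.
          Tri U V W u v (Cmp T W (Sh Y) (Sh U) (ShA Y U a) b') \<and>
          Cmp T Y U V u a = Cmp T Y Z V c g \<and>
          Cmp T U V (Sh X) c' u = a' \<and>
          Cmp T Z V W v c = b \<and>
          Cmp T V W (Sh Y) b' v = Cmp T V (Sh X) (Sh Y) (ShA X Y f) c'"

definition locally_small :: "('o, 'u) pcat \<Rightarrow> bool" where
  "locally_small T \<longleftrightarrow> (\<forall>X\<in>Obj T. \<forall>Y\<in>Obj T. small TYPE('u) (arr T X Y))"

definition has_small_coproducts :: "('o, 'u) pcat \<Rightarrow> bool" where
  "has_small_coproducts T \<longleftrightarrow>
     (\<forall>(I :: 'u set) X. small TYPE('u) I \<longrightarrow> (\<forall>i\<in>I. X i \<in> Obj T) \<longrightarrow>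
        (\<exists>S \<iota>. is_coproduct T I X S \<iota>))"

text \<open>
  The canonical map from the direct sum of the groups \<open>(A, X i)\<close> to
  \<open>(A, S)\<close>, where \<open>S\<close> is the coproduct of the \<open>X i\<close>.
\<close>

definition coproduct_comparison ::
  "('o, 'u) pcat \<Rightarrow> 'o \<Rightarrow> 'u set \<Rightarrow> ('u \<Rightarrow> 'o) \<Rightarrow> 'o \<Rightarrow> ('u \<Rightarrow> 'u) \<Rightarrow> ('u \<Rightarrow> 'u) \<Rightarrow> 'u" where
  "coproduct_comparison T A I X S \<iota> h =
     gfinprod (Hom T A S) (\<lambda>i. Cmp T A (X i) S (\<iota> i) (h i)) I"

definition compact_objects :: "('o, 'u) pcat \<Rightarrow> 'o set" where
  "compact_objects T = {A \<in> Obj T.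
     \<forall>(I :: 'u set) X S \<iota>. small TYPE('u) I \<longrightarrow> (\<forall>i\<in>I. X i \<in> Obj T) \<longrightarrow>
       is_coproduct T I X S \<iota> \<longrightarrow>
       coproduct_comparison T A I X S \<iota>
         \<in> iso (sum_group I (\<lambda>i. Hom T A (X i))) (Hom T A S)}"

definition compactly_generated :: "('o, 'u) pcat \<Rightarrow> bool" where
  "compactly_generated T \<longleftrightarrow>
     (\<exists>S\<subseteq>compact_objects T. small TYPE('u) S \<and>
        (\<forall>A\<in>compact_objects T. \<exists>B\<in>S. isomorphic_in T A B)) \<and>
     (\<forall>X\<in>Obj T. (\<forall>A\<in>compact_objects T. arr T A X = {\<one>\<^bsub>Hom T A X\<^esub>}) \<longrightarrow> is_zero_object T X)"

section \<open>Definable subcategories\<close>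

definition is_coherent_functor :: "('o, 'u) pcat \<Rightarrow> ('o, 'u, 'u) abfun \<Rightarrow> bool" where
  "is_coherent_functor T F \<longleftrightarrow>
     (\<exists>A\<in>compact_objects T. \<exists>B\<in>compact_objects T. \<exists>f\<in>arr T A B. \<exists>p.
        is_cokernel (abfun_cat T) (rep T B) (rep T A) F (rep_map T A B f) p)"

text \<open>Full subcategories of \<open>T\<close> are given by their classes of objects.\<close>

definition definable_subcategory :: "('o, 'u) pcat \<Rightarrow> 'o set \<Rightarrow> bool" where
  "definable_subcategory T D \<longleftrightarrow>
     (\<exists>\<A>. (\<forall>F\<in>\<A>. is_coherent_functor T F) \<and>
        D = {X \<in> Obj T. \<forall>F\<in>\<A>. carrier (FOb F X) = {\<one>\<^bsub>FOb F X\<^esub>}})"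

section \<open>Modules over the compact objects\<close>

definition Mod_compact ::
  "('o, 'u) pcat \<Rightarrow> (('o, 'u, 'u) abfun, 'o \<Rightarrow> 'u \<Rightarrow> 'u) pcat" where
  "Mod_compact T = abfun_cat (op_cat (full_subcat T (compact_objects T)))"

text \<open>
  The restricted Yoneda functor on objects, and on arrows \<open>f : X \<rightarrow> Y\<close>. As an
  object of \<open>Mod_compact T\<close> the record \<open>yoneda T X\<close> is only relevant at compact
  arguments, which is the restriction to the compact objects.
\<close>

definition yoneda :: "('o, 'u) pcat \<Rightarrow> 'o \<Rightarrow> ('o, 'u, 'u) abfun" where
  "yoneda T X = rep (op_cat T) X"

definition yoneda_map :: "('o, 'u) pcat \<Rightarrow> 'o \<Rightarrow> 'o \<Rightarrow> 'u \<Rightarrow> ('o \<Rightarrow> 'u \<Rightarrow> 'u)" where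
  "yoneda_map T X Y f = rep_map (op_cat (full_subcat T (compact_objects T))) Y X f"

definition yoneda_vimage :: "('o, 'u) pcat \<Rightarrow> ('o, 'u, 'u) abfun set \<Rightarrow> 'o set" where
  "yoneda_vimage T \<C> = {X \<in> Obj T. yoneda T X \<in> \<C>}"

definition finitely_presented :: "('o, 'u) pcat \<Rightarrow> ('o, 'u, 'u) abfun \<Rightarrow> bool" where
  "finitely_presented T M \<longleftrightarrow>
     (\<exists>A\<in>compact_objects T. \<exists>B\<in>compact_objects T. \<exists>f\<in>arr T A B. \<exists>p.
        is_cokernel (Mod_compact T) (yoneda T A) (yoneda T B) M (yoneda_map T A B f) p)"

text \<open>
  A monomorphism \<open>M \<rightarrow> N\<close> is pure iff every morphism from a finitely presented
  module to the cokernel \<open>N/M\<close> lifts to \<open>N\<close>.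
\<close>

definition is_pure_mono :: "('o, 'u) pcat \<Rightarrow> ('o, 'u, 'u) abfun \<Rightarrow> ('o, 'u, 'u) abfun \<Rightarrow>
    ('o \<Rightarrow> 'u \<Rightarrow> 'u) \<Rightarrow> bool" where
  "is_pure_mono T M N i \<longleftrightarrow> is_monomorphism (Mod_compact T) M N i \<and>
     (\<forall>L p. is_cokernel (Mod_compact T) M N L i p \<longrightarrow>
        (\<forall>G g. finitely_presented T G \<longrightarrow> g \<in> arr (Mod_compact T) G L \<longrightarrow>
           (\<exists>h\<in>arr (Mod_compact T) G N. Cmp (Mod_compact T) G N L p h = g)))"

definition absolutely_pure :: "('o, 'u) pcat \<Rightarrow> ('o, 'u, 'u) abfun \<Rightarrow> bool" where
  "absolutely_pure T M \<longleftrightarrow> M \<in> Obj (Mod_compact T) \<and>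
     (\<forall>N\<in>Obj (Mod_compact T). \<forall>i. is_monomorphism (Mod_compact T) M N i \<longrightarrow> is_pure_mono T M N i)"

definition definable_class :: "('o, 'u) pcat \<Rightarrow> ('o, 'u, 'u) abfun set \<Rightarrow> bool" where
  "definable_class T \<C> \<longleftrightarrow> \<C> \<subseteq> Obj (Mod_compact T) \<and>
     (\<forall>(I :: 'u set) M P \<pi>. small TYPE('u) I \<longrightarrow> (\<forall>i\<in>I. M i \<in> \<C>) \<longrightarrow>
        is_product (Mod_compact T) I M P \<pi> \<longrightarrow> P \<in> \<C>) \<and>
     (\<forall>(I :: 'u set) r M t L c. small TYPE('u) I \<longrightarrow> (\<forall>i\<in>I. M i \<in> \<C>) \<longrightarrow>
        is_directed_colimit (Mod_compact T) I r M t L c \<longrightarrow> L \<in> \<C>) \<and>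
     (\<forall>M\<in>Obj (Mod_compact T). \<forall>N\<in>\<C>. \<forall>i. is_pure_mono T M N i \<longrightarrow> M \<in> \<C>)"

section \<open>Torsion pairs\<close>

definition Hom_orthogonal :: "('o, 'a) pcat \<Rightarrow> 'o set \<Rightarrow> 'o set \<Rightarrow> bool" where
  "Hom_orthogonal C \<T> \<F> \<longleftrightarrow> \<T> \<subseteq> Obj C \<and> \<F> \<subseteq> Obj C \<and>
     (\<forall>X\<in>\<T>. \<forall>Y\<in>\<F>. arr C X Y = {\<one>\<^bsub>Hom C X Y\<^esub>})"

definition torsion_pair :: "('o, 'a) pcat \<Rightarrow> 'o set \<Rightarrow> 'o set \<Rightarrow> bool" where
  "torsion_pair C \<T> \<F> \<longleftrightarrow> Hom_orthogonal C \<T> \<F> \<and>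
     (\<forall>\<T>' \<F>'. Hom_orthogonal C \<T>' \<F>' \<longrightarrow> \<T> \<subseteq> \<T>' \<longrightarrow> \<F> \<subseteq> \<F>' \<longrightarrow> \<T>' = \<T> \<and> \<F>' = \<F>)"

definition hereditary_torsion_pair :: "('o, 'a) pcat \<Rightarrow> 'o set \<Rightarrow> 'o set \<Rightarrow> bool" where
  "hereditary_torsion_pair C \<T> \<F> \<longleftrightarrow> torsion_pair C \<T> \<F> \<and>
     (\<forall>X\<in>Obj C. \<forall>Y\<in>\<T>. \<forall>i. is_monomorphism C X Y i \<longrightarrow> X \<in> \<T>)"

text \<open>
  \<open>\<S>\<close> generates \<open>\<T>\<close> as a hereditary torsion class: \<open>\<T>\<close>
  is the least hereditary torsion class containing \<open>\<S>\<close>.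
\<close>

definition finite_type_hereditary_torsion_pair ::
  "('o, 'u) pcat \<Rightarrow> ('o, 'u, 'u) abfun set \<Rightarrow> ('o, 'u, 'u) abfun set \<Rightarrow> bool" where
  "finite_type_hereditary_torsion_pair T \<T> \<F> \<longleftrightarrow>
     hereditary_torsion_pair (Mod_compact T) \<T> \<F> \<and>
     (\<exists>\<S>\<subseteq>\<T>. (\<forall>G\<in>\<S>. finitely_presented T G) \<and>
        (\<forall>\<T>' \<F>'. hereditary_torsion_pair (Mod_compact T) \<T>' \<F>' \<longrightarrow> \<S> \<subseteq> \<T>' \<longrightarrow> \<T> \<subseteq> \<T>'))"

definition finite_type_hereditary_torsionfree_class ::
  "('o, 'u) pcat \<Rightarrow> ('o, 'u, 'u) abfun set \<Rightarrow> bool" where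
  "finite_type_hereditary_torsionfree_class T \<F> \<longleftrightarrow>
     (\<exists>\<T>. finite_type_hereditary_torsion_pair T \<T> \<F>)"

end

theory Submission
  imports Defs
begin

text \<open>
  In a triangle \<open>B \<rightarrow> A \<rightarrow> A'\<close> of compact objects, all maps \<open>A \<rightarrow> X\<close> factor through \<open>A'\<close> iff all
  of them vanish on \<open>B\<close>. Hence definable subcategories are those of the form
  \<open>{X. (yX)(c) = 0 for all c \<in> \<Psi>}\<close> for a class \<open>\<Psi>\<close> of arrows between compact objects.

  A hereditary torsion pair of finite type is given by the arrows presenting the generating modules,
  and on modules which are exact on triangles the torsionfree condition says that each of these arrows
  acts injectively; by exactness this is the vanishing of another arrow of the triangle. Exact
  modules are precisely the absolutely pure ones, and every \<open>yX\<close> is exact. This gives (a) and (b).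

  For (c), exactness and the vanishing of arrows pass to products, directed colimits and pure submodules.
  Conversely, let \<open>\<E>\<close> be a definable class and let \<open>M\<close> be an exact module killed by all arrows that
  vanish on \<open>\<E>\<close>. A product \<open>V\<close> of members of \<open>\<E>\<close> detects all other arrows. Being exact, \<open>M\<close> is a
  directed colimit of representable functors, so every finite part of \<open>M\<close> maps to \<open>V\<close> without losing
  a nonzero element. These maps assemble to an embedding of \<open>M\<close> into a reduced power of \<open>V\<close>, which is a directed
  colimit of products of copies of \<open>V\<close>; the embedding is pure, so \<open>M\<close> belongs to \<open>\<E>\<close>.
\<close>

section \<open>Small sets\<close>

text \<open>Arguments about modules are reduced to elements by the Yoneda lemma, without injective
  hulls and without a construction of general colimits. The first obstacle is size: values of
  modules must be small groups with elements in \<open>'u\<close>, whereas products, pushouts and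
  quotients produce functions, pairs and cosets. Each such functor is therefore built over an
  arbitrary element type and then brought into \<open>'u\<close> as a quotient, possibly by the
  trivial subfunctor. Modules are treated as covariant functors on the opposite of the compact
  objects. The module part uses no triangles, only weak kernels and weak cokernels; triangles supply
  these once compact objects are known to be closed under cones and cocones. The second obstacle is
  that torsion pairs are given by maximality alone. They are replaced by the elementwise condition
  \<open>torsionfree\<close>, which involves the generators only through their cyclic submodules, as
  these lie in every hereditary torsion class containing the generators.\<close>

lemma small_lepoll: "small U B \<Longrightarrow> A \<lesssim> B \<Longrightarrow> small U A"
  unfolding small_def using lesspoll_trans1 by blast

lemma small_subset: "small U B \<Longrightarrow> A \<subseteq> B \<Longrightarrow> small U A"
  by (meson small_lepoll subset_imp_lepoll)

lemma small_image: "small U A \<Longrightarrow> small U (f ` A)"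
  by (meson small_lepoll image_lepoll)

lemma small_inj_image: "inj_on f A \<Longrightarrow> small U (f ` A) \<longleftrightarrow> small U A"
  by (simp add: small_def)

text \<open>Definable classes are tested on products and colimits indexed by subsets of
  \<open>'u\<close>; an injection into \<open>'u\<close> lets naturally occurring indices, such as
  arrows or finite sets of relations, be replaced by codes.\<close>

lemma small_encoding:
  assumes "small TYPE('u) (A :: 'b set)"
  obtains e :: "'b \<Rightarrow> 'u" where "inj_on e A"
  using assms unfolding small_def lesspoll_def lepoll_def by blast

lemma infinite_universe: "strongly_inaccessible TYPE('u) \<Longrightarrow> infinite (UNIV :: 'u set)"
  unfolding strongly_inaccessible_def small_def
  using infinite_le_lepoll lesspoll_imp_lepoll by blast

text \<open>An infinite set is equinumerous with its square.\<close>

lemma universe_pairing: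
  assumes "strongly_inaccessible TYPE('u)"
  obtains e :: "'u \<times> 'u \<Rightarrow> 'u" where "inj e"
proof -
  have "\<exists>e :: 'u \<times> 'u \<Rightarrow> 'u. bij_betw e (UNIV \<times> UNIV) UNIV"
    using card_of_Times_same_infinite[OF infinite_universe[OF assms]]
    by (simp add: card_of_ordIso)
  then show ?thesis
    using that by (auto simp: bij_betw_def)
qed

text \<open>Inaccessibility speaks of unions of subsets of \<open>'u\<close> indexed by a subset of
  \<open>'u\<close>, so both indices and fibres are first coded in \<open>'u\<close>; such a union
  contains an injective image of the sum.\<close>

lemma small_Sigma:
  assumes si: "strongly_inaccessible TYPE('u)"
    and I: "small TYPE('u) (I :: 'i set)"
    and A: "\<And>i. i \<in> I \<Longrightarrow> small TYPE('u) (A i :: 'b set)"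
  shows "small TYPE('u) (Sigma I A)"
proof -
  obtain e :: "'i \<Rightarrow> 'u" where e: "inj_on e I"
    using small_encoding[OF I] .
  have "\<forall>i\<in>I. \<exists>d :: 'b \<Rightarrow> 'u. inj_on d (A i)"
    using A small_encoding by metis
  then obtain d :: "'i \<Rightarrow> 'b \<Rightarrow> 'u" where d: "\<And>i. i \<in> I \<Longrightarrow> inj_on (d i) (A i)"
    by metis
  obtain p :: "'u \<times> 'u \<Rightarrow> 'u" where p: "inj p"
    using universe_pairing[OF si] .
  \<comment> \<open>The fibre over the index with code \<open>u\<close>, tagged by \<open>u\<close>
    through the pairing; the tag keeps distinct fibres apart and makes \<open>h\<close> below
    injective.\<close>
  define B where "B u = (\<lambda>a. p (u, d (inv_into I e u) a)) ` A (inv_into I e u)" for u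
  have B: "small TYPE('u) (\<Union>u\<in>e ` I. B u)"
  proof -
    have "small TYPE('u) (e ` I)" "\<forall>u\<in>e ` I. small TYPE('u) (B u)"
      using I A by (auto simp: B_def small_image e)
    then show ?thesis
      using si unfolding strongly_inaccessible_def by blast
  qed
  define h where "h = (\<lambda>(i, a). p (e i, d i a))"
  have "inj_on h (Sigma I A)"
  proof (rule inj_onI)
    fix x y assume xy: "x \<in> Sigma I A" "y \<in> Sigma I A" "h x = h y"
    then have "e (fst x) = e (fst y)" "d (fst x) (snd x) = d (fst y) (snd y)"
      using injD[OF p] by (auto simp: h_def split: prod.splits)
    moreover from this have "fst x = fst y"
      using xy inj_onD[OF e] by force
    ultimately show "x = y"
      using xy inj_onD[OF d[of "fst x"], of "snd x" "snd y"] by (auto simp: prod_eq_iff)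
  qed
  moreover have "h ` Sigma I A \<subseteq> (\<Union>u\<in>e ` I. B u)"
    using e by (force simp: h_def B_def)
  ultimately show ?thesis
    using B small_inj_image small_subset by metis
qed

lemma small_Times:
  assumes "strongly_inaccessible TYPE('u)" "small TYPE('u) A" "small TYPE('u) B"
  shows "small TYPE('u) (A \<times> B)"
  by (rule small_Sigma[OF assms(1,2)]) (rule assms(3))

lemma small_Pow:
  assumes si: "strongly_inaccessible TYPE('u)" and A: "small TYPE('u) (A :: 'b set)"
  shows "small TYPE('u) (Pow A)"
proof -
  obtain e :: "'b \<Rightarrow> 'u" where e: "inj_on e A"
    using small_encoding[OF A] .
  have "small TYPE('u) (Pow (e ` A))"
    using si A e by (simp add: strongly_inaccessible_def small_image)
  then show ?thesis
    using small_inj_image inj_on_image_Pow[OF e] image_Pow_surj[of e A] by metis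
qed

text \<open>A function in the product is determined by its graph, a subset of the small set
  \<open>Sigma I A\<close>.\<close>

lemma small_PiE:
  assumes si: "strongly_inaccessible TYPE('u)"
    and I: "small TYPE('u) (I :: 'i set)"
    and A: "\<And>i. i \<in> I \<Longrightarrow> small TYPE('u) (A i :: 'b set)"
  shows "small TYPE('u) (\<Pi>\<^sub>E i\<in>I. A i)"
proof -
  define h :: "('i \<Rightarrow> 'b) \<Rightarrow> ('i \<times> 'b) set" where "h f = (\<lambda>i. (i, f i)) ` I" for f
  have "inj_on h (\<Pi>\<^sub>E i\<in>I. A i)"
    by (rule inj_onI, rule PiE_ext) (auto simp: h_def)
  moreover have "h ` (\<Pi>\<^sub>E i\<in>I. A i) \<subseteq> Pow (Sigma I A)"
    by (auto simp: h_def)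
  ultimately show ?thesis
    using small_subset[OF small_Pow[OF si small_Sigma[OF si I, of A]]]
    by (simp add: A flip: small_inj_image[of h])
qed

lemma small_finite_subsets:
  assumes "strongly_inaccessible TYPE('u)" "small TYPE('u) A"
  shows "small TYPE('u) {s. finite s \<and> s \<subseteq> A}"
  by (rule small_subset[OF small_Pow[OF assms]]) blast

section \<open>Small quotients of abelian groups\<close>

text \<open>The cosets forming \<open>G Mod K\<close> live in another type; being small, the group
  can be renamed along an injection into \<open>'u\<close>. Only a surjection with kernel
  \<open>K\<close> is exposed, so later arguments do not depend on the renaming.\<close>

lemma comm_group_quotient:
  fixes G :: "'b monoid"
  assumes G: "comm_group G" and K: "subgroup K G" and small: "small TYPE('u) (carrier G)"
  obtains H :: "'u monoid" and q where "comm_group H" "small TYPE('u) (carrier H)" "q \<in> hom G H"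
    "q ` carrier G = carrier H" "\<And>x. x \<in> carrier G \<Longrightarrow> q x = \<one>\<^bsub>H\<^esub> \<longleftrightarrow> x \<in> K"
proof -
  interpret comm_group G by fact
  interpret K: normal K G
    using subgroup_imp_normal[OF K] .
  have Mod: "comm_group (G Mod K)"
    using abelian_FactGroup[OF K] .
  interpret M: comm_group "G Mod K" by fact
  have sm: "small TYPE('u) (carrier (G Mod K))"
    using small by (simp add: carrier_FactGroup small_image)
  then obtain e :: "'b set \<Rightarrow> 'u" where e: "inj_on e (carrier (G Mod K))"
    using small_encoding by blast
  define d where "d = inv_into (carrier (G Mod K)) e"
  define H :: "'u monoid" where "H = \<lparr>carrier = e ` carrier (G Mod K),
    monoid.mult = (\<lambda>x y. e (d x \<otimes>\<^bsub>G Mod K\<^esub> d y)), one = e \<one>\<^bsub>G Mod K\<^esub>\<rparr>"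
  have de: "d (e x) = x" if "x \<in> carrier (G Mod K)" for x
    using that e by (simp add: d_def)
  have iso: "e \<in> iso (G Mod K) H"
    using e by (auto simp: iso_def hom_def bij_betw_def H_def de)
  have "group H"
  proof (rule groupI)
    fix x assume "x \<in> carrier H"
    then obtain a where a: "a \<in> carrier (G Mod K)" "x = e a" by (auto simp: H_def)
    show "\<exists>y\<in>carrier H. y \<otimes>\<^bsub>H\<^esub> x = \<one>\<^bsub>H\<^esub>"
      using a by (intro bexI[of _ "e (inv\<^bsub>G Mod K\<^esub> a)"])
        (simp_all add: H_def de M.l_inv del: mult_FactGroup one_FactGroup)
  qed (auto simp: H_def de M.m_assoc simp del: mult_FactGroup one_FactGroup)
  then have H: "comm_group H"
    by (intro group.group_comm_groupI)
      (auto simp: H_def de M.m_comm simp del: mult_FactGroup one_FactGroup)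
  define q where "q = e \<circ> (#>\<^bsub>G\<^esub>) K"
  have q: "q \<in> hom G H"
    unfolding q_def by (rule Group.hom_compose[OF K.r_coset_hom_Mod]) (use iso in \<open>simp add: iso_def\<close>)
  have 1: "q ` carrier G = carrier H"
    by (simp add: q_def H_def carrier_FactGroup image_comp)
  have 2: "q x = \<one>\<^bsub>H\<^esub> \<longleftrightarrow> x \<in> K" if x: "x \<in> carrier G" for x
  proof -
    have "q x = \<one>\<^bsub>H\<^esub> \<longleftrightarrow> K #>\<^bsub>G\<^esub> x = \<one>\<^bsub>G Mod K\<^esub>"
      using x inj_on_eq_iff[OF e, of "K #>\<^bsub>G\<^esub> x" "\<one>\<^bsub>G Mod K\<^esub>"] M.one_closed
      by (auto simp: q_def H_def carrier_FactGroup)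
    then show ?thesis
      using x coset_join1[OF _ x K] coset_join2[OF x K] by auto
  qed
  have 3: "small TYPE('u) (carrier H)"
    using sm by (simp add: H_def small_image)
  show thesis
    using that[OF H 3 q 1 2] .
qed

section \<open>Homomorphisms of abelian groups\<close>

lemma comm_group_imp_group: "comm_group G \<Longrightarrow> group G"
  by (simp add: comm_group_def)

lemma comm_group_hom_one:
  "h \<in> hom G H \<Longrightarrow> comm_group G \<Longrightarrow> comm_group H \<Longrightarrow> h \<one>\<^bsub>G\<^esub> = \<one>\<^bsub>H\<^esub>"
  by (simp add: hom_one comm_group_imp_group)

lemma comm_group_hom_inv:
  "h \<in> hom G H \<Longrightarrow> comm_group G \<Longrightarrow> comm_group H \<Longrightarrow> x \<in> carrier G \<Longrightarrow> h (inv\<^bsub>G\<^esub> x) = inv\<^bsub>H\<^esub> (h x)"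
  by (simp add: group_hom.hom_inv group_hom_def group_hom_axioms_def comm_group_imp_group)

lemma comm_group_closed:
  assumes "comm_group G"
  shows "\<one>\<^bsub>G\<^esub> \<in> carrier G" "x \<in> carrier G \<Longrightarrow> inv\<^bsub>G\<^esub> x \<in> carrier G"
    "x \<in> carrier G \<Longrightarrow> y \<in> carrier G \<Longrightarrow> x \<otimes>\<^bsub>G\<^esub> y \<in> carrier G"
proof -
  interpret comm_group G by fact
  show "\<one>\<^bsub>G\<^esub> \<in> carrier G" "x \<in> carrier G \<Longrightarrow> inv\<^bsub>G\<^esub> x \<in> carrier G"
    "x \<in> carrier G \<Longrightarrow> y \<in> carrier G \<Longrightarrow> x \<otimes>\<^bsub>G\<^esub> y \<in> carrier G"
    by auto
qed

lemma comm_group_diff_eq_one: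
  assumes "comm_group G" "x \<in> carrier G" "y \<in> carrier G"
  shows "x \<otimes>\<^bsub>G\<^esub> inv\<^bsub>G\<^esub> y = \<one>\<^bsub>G\<^esub> \<longleftrightarrow> x = y"
proof -
  interpret comm_group G by fact
  show ?thesis
    using assms(2,3) by (metis inv_closed inv_equality inv_inv r_inv)
qed

lemma comm_group_one_unique:
  assumes "comm_group G" "x \<in> carrier G" "x \<otimes>\<^bsub>G\<^esub> x = x"
  shows "x = \<one>\<^bsub>G\<^esub>"
proof -
  interpret comm_group G by fact
  show ?thesis
    using assms(2,3) by (simp add: r_cancel_one')
qed

lemma comm_group_inv_unique:
  assumes "comm_group G" "x \<in> carrier G" "y \<in> carrier G" "x \<otimes>\<^bsub>G\<^esub> y = \<one>\<^bsub>G\<^esub>"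
  shows "x = inv\<^bsub>G\<^esub> y"
proof -
  interpret comm_group G by fact
  show ?thesis
    using assms(2-4) by (metis inv_equality)
qed

lemma comm_group_diff_hom_eq:
  assumes "h \<in> hom G H" "comm_group G" "comm_group H" "x \<in> carrier G" "y \<in> carrier G"
  shows "h (x \<otimes>\<^bsub>G\<^esub> inv\<^bsub>G\<^esub> y) = \<one>\<^bsub>H\<^esub> \<longleftrightarrow> h x = h y"
  using assms comm_group_closed[OF assms(2)]
  by (simp add: hom_mult comm_group_hom_inv comm_group_diff_eq_one hom_in_carrier)

lemma subgroup_hom_image:
  "h \<in> hom G H \<Longrightarrow> comm_group G \<Longrightarrow> comm_group H \<Longrightarrow> subgroup (h ` carrier G) H"
  by (intro group_hom.img_is_subgroup)
    (simp add: group_hom_def group_hom_axioms_def comm_group_imp_group)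

section \<open>Additive functors\<close>

text \<open>Additive functors with values in an arbitrary type and without a bound on their size, so
  that products and sums of modules can be handled before they are moved into
  \<open>'u\<close>.\<close>

definition functor_on :: "('o, 'a) pcat \<Rightarrow> ('o, 'a, 'b) abfun \<Rightarrow> bool" where
  "functor_on C F \<longleftrightarrow>
     (\<forall>X\<in>Obj C. comm_group (FOb F X) \<and> (\<forall>x\<in>carrier (FOb F X). FAr F X X (Idn C X) x = x)) \<and>
     (\<forall>X\<in>Obj C. \<forall>Y\<in>Obj C. \<forall>f\<in>arr C X Y.
        FAr F X Y f \<in> hom (FOb F X) (FOb F Y) \<and>
        (\<forall>g\<in>arr C X Y. \<forall>x\<in>carrier (FOb F X).
           FAr F X Y (f \<otimes>\<^bsub>Hom C X Y\<^esub> g) x = FAr F X Y f x \<otimes>\<^bsub>FOb F Y\<^esub> FAr F X Y g x) \<and>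
        (\<forall>Z\<in>Obj C. \<forall>g\<in>arr C Y Z. \<forall>x\<in>carrier (FOb F X).
           FAr F X Z (Cmp C X Y Z g f) x = FAr F Y Z g (FAr F X Y f x)))"

lemma functor_onI:
  assumes "\<And>X. X \<in> Obj C \<Longrightarrow> comm_group (FOb F X)"
    and "\<And>X x. X \<in> Obj C \<Longrightarrow> x \<in> carrier (FOb F X) \<Longrightarrow> FAr F X X (Idn C X) x = x"
    and "\<And>X Y f. X \<in> Obj C \<Longrightarrow> Y \<in> Obj C \<Longrightarrow> f \<in> arr C X Y \<Longrightarrow>
      FAr F X Y f \<in> hom (FOb F X) (FOb F Y)"
    and "\<And>X Y f g x. X \<in> Obj C \<Longrightarrow> Y \<in> Obj C \<Longrightarrow> f \<in> arr C X Y \<Longrightarrow> g \<in> arr C X Y \<Longrightarrow>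
      x \<in> carrier (FOb F X) \<Longrightarrow>
      FAr F X Y (f \<otimes>\<^bsub>Hom C X Y\<^esub> g) x = FAr F X Y f x \<otimes>\<^bsub>FOb F Y\<^esub> FAr F X Y g x"
    and "\<And>X Y Z f g x. X \<in> Obj C \<Longrightarrow> Y \<in> Obj C \<Longrightarrow> Z \<in> Obj C \<Longrightarrow> f \<in> arr C X Y \<Longrightarrow>
      g \<in> arr C Y Z \<Longrightarrow> x \<in> carrier (FOb F X) \<Longrightarrow>
      FAr F X Z (Cmp C X Y Z g f) x = FAr F Y Z g (FAr F X Y f x)"
  shows "functor_on C F"
  unfolding functor_on_def by (intro conjI ballI assms)

lemma is_additive_functor_iff:
  "is_additive_functor C (F :: ('o, 'a, 'u) abfun) \<longleftrightarrow>
     functor_on C F \<and> (\<forall>X\<in>Obj C. small TYPE('u) (carrier (FOb F X)))"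
  unfolding is_additive_functor_def functor_on_def by blast

lemma additive_functor_on: "is_additive_functor C F \<Longrightarrow> functor_on C F"
  by (simp add: is_additive_functor_iff)

lemma additive_functor_small:
  "is_additive_functor C (F :: ('o, 'a, 'u) abfun) \<Longrightarrow> X \<in> Obj C \<Longrightarrow> small TYPE('u) (carrier (FOb F X))"
  by (simp add: is_additive_functor_iff)

lemma functor_group: "functor_on C F \<Longrightarrow> X \<in> Obj C \<Longrightarrow> comm_group (FOb F X)"
  by (simp add: functor_on_def)

lemma FAr_hom: "functor_on C F \<Longrightarrow> X \<in> Obj C \<Longrightarrow> Y \<in> Obj C \<Longrightarrow> f \<in> arr C X Y
    \<Longrightarrow> FAr F X Y f \<in> hom (FOb F X) (FOb F Y)"
  by (simp add: functor_on_def)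

lemma FAr_closed: "functor_on C F \<Longrightarrow> X \<in> Obj C \<Longrightarrow> Y \<in> Obj C \<Longrightarrow> f \<in> arr C X Y
    \<Longrightarrow> x \<in> carrier (FOb F X) \<Longrightarrow> FAr F X Y f x \<in> carrier (FOb F Y)"
  by (meson FAr_hom hom_in_carrier)

lemma FAr_mult: "functor_on C F \<Longrightarrow> X \<in> Obj C \<Longrightarrow> Y \<in> Obj C \<Longrightarrow> f \<in> arr C X Y
    \<Longrightarrow> x \<in> carrier (FOb F X) \<Longrightarrow> y \<in> carrier (FOb F X)
    \<Longrightarrow> FAr F X Y f (x \<otimes>\<^bsub>FOb F X\<^esub> y) = FAr F X Y f x \<otimes>\<^bsub>FOb F Y\<^esub> FAr F X Y f y"
  by (meson FAr_hom hom_mult)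

lemma FAr_one: "functor_on C F \<Longrightarrow> X \<in> Obj C \<Longrightarrow> Y \<in> Obj C \<Longrightarrow> f \<in> arr C X Y
    \<Longrightarrow> FAr F X Y f \<one>\<^bsub>FOb F X\<^esub> = \<one>\<^bsub>FOb F Y\<^esub>"
  by (meson FAr_hom comm_group_hom_one functor_group)

lemma FAr_inv: "functor_on C F \<Longrightarrow> X \<in> Obj C \<Longrightarrow> Y \<in> Obj C \<Longrightarrow> f \<in> arr C X Y
    \<Longrightarrow> x \<in> carrier (FOb F X) \<Longrightarrow> FAr F X Y f (inv\<^bsub>FOb F X\<^esub> x) = inv\<^bsub>FOb F Y\<^esub> (FAr F X Y f x)"
  by (meson FAr_hom comm_group_hom_inv functor_group)

lemma FAr_Idn: "functor_on C F \<Longrightarrow> X \<in> Obj C \<Longrightarrow> x \<in> carrier (FOb F X)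
    \<Longrightarrow> FAr F X X (Idn C X) x = x"
  by (simp add: functor_on_def)

lemma FAr_Cmp: "functor_on C F \<Longrightarrow> X \<in> Obj C \<Longrightarrow> Y \<in> Obj C \<Longrightarrow> Z \<in> Obj C
    \<Longrightarrow> f \<in> arr C X Y \<Longrightarrow> g \<in> arr C Y Z \<Longrightarrow> x \<in> carrier (FOb F X)
    \<Longrightarrow> FAr F X Z (Cmp C X Y Z g f) x = FAr F Y Z g (FAr F X Y f x)"
  by (simp add: functor_on_def)

lemma FAr_add: "functor_on C F \<Longrightarrow> X \<in> Obj C \<Longrightarrow> Y \<in> Obj C
    \<Longrightarrow> f \<in> arr C X Y \<Longrightarrow> g \<in> arr C X Y \<Longrightarrow> x \<in> carrier (FOb F X)
    \<Longrightarrow> FAr F X Y (f \<otimes>\<^bsub>Hom C X Y\<^esub> g) x = FAr F X Y f x \<otimes>\<^bsub>FOb F Y\<^esub> FAr F X Y g x"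
  by (simp add: functor_on_def)

lemma functor_closed:
  assumes "functor_on C F" "X \<in> Obj C"
  shows "\<one>\<^bsub>FOb F X\<^esub> \<in> carrier (FOb F X)"
    "x \<in> carrier (FOb F X) \<Longrightarrow> inv\<^bsub>FOb F X\<^esub> x \<in> carrier (FOb F X)"
    "x \<in> carrier (FOb F X) \<Longrightarrow> y \<in> carrier (FOb F X) \<Longrightarrow> x \<otimes>\<^bsub>FOb F X\<^esub> y \<in> carrier (FOb F X)"
  using comm_group_closed[OF functor_group[OF assms]] by auto

lemmas functor_simps = functor_closed functor_group FAr_closed FAr_mult FAr_one FAr_inv

definition sum_functor :: "('o, 'a, 'b) abfun \<Rightarrow> ('o, 'a, 'c) abfun \<Rightarrow> ('o, 'a, 'b \<times> 'c) abfun" where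
  "sum_functor F G = \<lparr>FOb = (\<lambda>X. FOb F X \<times>\<times> FOb G X),
     FAr = (\<lambda>X Y f (x, y). (FAr F X Y f x, FAr G X Y f y))\<rparr>"

lemma comm_group_DirProd: "comm_group G \<Longrightarrow> comm_group H \<Longrightarrow> comm_group (G \<times>\<times> H)"
  by (intro group.group_comm_groupI DirProd_group)
    (auto simp: comm_group_imp_group DirProd_def comm_group_def comm_monoid.m_comm)

lemma functor_on_sum: "functor_on C F \<Longrightarrow> functor_on C G \<Longrightarrow> functor_on C (sum_functor F G)"
  by (rule functor_onI) (auto simp: sum_functor_def comm_group_DirProd functor_group FAr_Idn FAr_Cmp FAr_add FAr_closed FAr_mult
      hom_def)

text \<open>The values consist of functions on \<open>J\<close>, outside \<open>'u\<close>; this is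
  an intermediate object that becomes a module only after passing to a quotient.\<close>

definition product_functor :: "'j set \<Rightarrow> ('j \<Rightarrow> ('o, 'a, 'b) abfun) \<Rightarrow> ('o, 'a, 'j \<Rightarrow> 'b) abfun" where
  "product_functor J V = \<lparr>FOb = (\<lambda>X. product_group J (\<lambda>j. FOb (V j) X)),
     FAr = (\<lambda>X Y f v. \<lambda>j\<in>J. FAr (V j) X Y f (v j))\<rparr>"

lemma comm_group_product_group:
  "(\<And>j. j \<in> J \<Longrightarrow> comm_group (G j)) \<Longrightarrow> comm_group (product_group J G)"
  by (intro group.group_comm_groupI product_group)
    (auto simp: comm_group_imp_group comm_group_def PiE_iff intro!: restrict_ext comm_monoid.m_comm)

lemma functor_on_product:
  "(\<And>j. j \<in> J \<Longrightarrow> functor_on C (V j)) \<Longrightarrow> functor_on C (product_functor J V)"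
  by (rule functor_onI) (auto simp: product_functor_def functor_group[of C] FAr_Idn[of C] FAr_Cmp[of C] FAr_add[of C]
      FAr_closed[of C] FAr_mult[of C] hom_def PiE_iff extensional_def restrict_def fun_eq_iff
      functor_closed[of C] intro!: comm_group_product_group)

context preadditive_category
begin

lemma Hom_closed:
  assumes "X \<in> Obj C" "Y \<in> Obj C"
  shows "\<one>\<^bsub>Hom C X Y\<^esub> \<in> arr C X Y"
    "f \<in> arr C X Y \<Longrightarrow> inv\<^bsub>Hom C X Y\<^esub> f \<in> arr C X Y"
    "f \<in> arr C X Y \<Longrightarrow> g \<in> arr C X Y \<Longrightarrow> f \<otimes>\<^bsub>Hom C X Y\<^esub> g \<in> arr C X Y"
  using comm_group_closed[OF comm_group_Hom[OF assms]] by auto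

text \<open>Additivity applied to zero plus zero shows that the value is idempotent, hence
  neutral.\<close>

lemma FAr_zero:
  assumes "functor_on C F" "X \<in> Obj C" "Y \<in> Obj C" "x \<in> carrier (FOb F X)"
  shows "FAr F X Y \<one>\<^bsub>Hom C X Y\<^esub> x = \<one>\<^bsub>FOb F Y\<^esub>"
proof -
  interpret H: comm_group "Hom C X Y" using comm_group_Hom assms by blast
  show ?thesis
    using FAr_add[OF assms(1-3) H.one_closed H.one_closed assms(4)] assms
    by (intro comm_group_one_unique[OF functor_group]) (auto simp: FAr_closed)
qed

lemma FAr_minus:
  assumes "functor_on C F" "X \<in> Obj C" "Y \<in> Obj C" "f \<in> arr C X Y" "x \<in> carrier (FOb F X)"
  shows "FAr F X Y (inv\<^bsub>Hom C X Y\<^esub> f) x = inv\<^bsub>FOb F Y\<^esub> (FAr F X Y f x)"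
proof -
  interpret H: comm_group "Hom C X Y" using comm_group_Hom assms by blast
  show ?thesis
    using FAr_add[OF assms(1-3) H.inv_closed[OF assms(4)] assms(4,5)] assms
    by (intro comm_group_inv_unique[OF functor_group]) (auto simp: FAr_closed FAr_zero)
qed

lemma preadditive_op: "preadditive_category (op_cat C)"
  by (rule preadditive_category.intro)
    (auto simp: op_cat_def comm_group_Hom Idn_arr Cmp_arr Cmp_Idn_left Cmp_Idn_right
      Cmp_add_left Cmp_add_right Cmp_assoc)

lemma preadditive_full_subcat: "S \<subseteq> Obj C \<Longrightarrow> preadditive_category (full_subcat C S)"
  by (rule preadditive_category.intro)
    (auto simp: full_subcat_def comm_group_Hom Idn_arr Cmp_arr Cmp_Idn_left Cmp_Idn_right
      Cmp_add_left Cmp_add_right Cmp_assoc subset_iff)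

lemma functor_on_rep: "A \<in> Obj C \<Longrightarrow> functor_on C (rep C A)"
  unfolding functor_on_def rep_def
  by (auto simp: comm_group_Hom Cmp_Idn_left Cmp_add_left Cmp_add_right Cmp_arr Cmp_assoc hom_def)

text \<open>This law and the three after it are the functor laws for \<open>FAr\<close>, applied to
  the functor \<open>rep C X\<close>.\<close>

lemma Cmp_zero_right: "X \<in> Obj C \<Longrightarrow> Y \<in> Obj C \<Longrightarrow> Z \<in> Obj C \<Longrightarrow> g \<in> arr C Y Z
    \<Longrightarrow> Cmp C X Y Z g \<one>\<^bsub>Hom C X Y\<^esub> = \<one>\<^bsub>Hom C X Z\<^esub>"
  using FAr_one[OF functor_on_rep, of X Y Z g] by (simp add: rep_def)

lemma Cmp_minus_right: "X \<in> Obj C \<Longrightarrow> Y \<in> Obj C \<Longrightarrow> Z \<in> Obj C \<Longrightarrow> f \<in> arr C X Y \<Longrightarrow> g \<in> arr C Y Z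
    \<Longrightarrow> Cmp C X Y Z g (inv\<^bsub>Hom C X Y\<^esub> f) = inv\<^bsub>Hom C X Z\<^esub> (Cmp C X Y Z g f)"
  using FAr_inv[OF functor_on_rep, of X Y Z g f] by (simp add: rep_def)

lemma Cmp_zero_left: "X \<in> Obj C \<Longrightarrow> Y \<in> Obj C \<Longrightarrow> Z \<in> Obj C \<Longrightarrow> f \<in> arr C X Y
    \<Longrightarrow> Cmp C X Y Z \<one>\<^bsub>Hom C Y Z\<^esub> f = \<one>\<^bsub>Hom C X Z\<^esub>"
  using FAr_zero[OF functor_on_rep, of X Y Z f] by (simp add: rep_def)

lemma Cmp_minus_left: "X \<in> Obj C \<Longrightarrow> Y \<in> Obj C \<Longrightarrow> Z \<in> Obj C \<Longrightarrow> f \<in> arr C X Y \<Longrightarrow> g \<in> arr C Y Z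
    \<Longrightarrow> Cmp C X Y Z (inv\<^bsub>Hom C Y Z\<^esub> g) f = inv\<^bsub>Hom C X Z\<^esub> (Cmp C X Y Z g f)"
  using FAr_minus[OF functor_on_rep, of X Y Z g f] by (simp add: rep_def)

end

section \<open>Natural transformations\<close>

text \<open>Elements of \<open>Nat\<close> have to be extensional; this cuts a family of maps down
  to its relevant arguments, so that transformations can be given by plain formulas.\<close>

definition natify :: "('o, 'a) pcat \<Rightarrow> ('o, 'a, 'u) abfun \<Rightarrow> ('o \<Rightarrow> 'u \<Rightarrow> 'u) \<Rightarrow> ('o \<Rightarrow> 'u \<Rightarrow> 'u)" where
  "natify C F e = (\<lambda>X\<in>Obj C. \<lambda>x\<in>carrier (FOb F X). e X x)"

lemma natify_apply [simp]: "X \<in> Obj C \<Longrightarrow> x \<in> carrier (FOb F X) \<Longrightarrow> natify C F e X x = e X x"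
  by (simp add: natify_def)

lemma Nat_hom: "\<eta> \<in> carrier (Nat C F G) \<Longrightarrow> X \<in> Obj C \<Longrightarrow> \<eta> X \<in> hom (FOb F X) (FOb G X)"
  by (auto simp: Nat_def)

lemma Nat_closed: "\<eta> \<in> carrier (Nat C F G) \<Longrightarrow> X \<in> Obj C \<Longrightarrow> x \<in> carrier (FOb F X) \<Longrightarrow> \<eta> X x \<in> carrier (FOb G X)"
  by (meson Nat_hom hom_in_carrier)

lemma Nat_mult: "\<eta> \<in> carrier (Nat C F G) \<Longrightarrow> X \<in> Obj C \<Longrightarrow> x \<in> carrier (FOb F X) \<Longrightarrow> y \<in> carrier (FOb F X)
    \<Longrightarrow> \<eta> X (x \<otimes>\<^bsub>FOb F X\<^esub> y) = \<eta> X x \<otimes>\<^bsub>FOb G X\<^esub> \<eta> X y"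
  by (meson Nat_hom hom_mult)

lemma Nat_one: "\<eta> \<in> carrier (Nat C F G) \<Longrightarrow> functor_on C F \<Longrightarrow> functor_on C G \<Longrightarrow> X \<in> Obj C
    \<Longrightarrow> \<eta> X \<one>\<^bsub>FOb F X\<^esub> = \<one>\<^bsub>FOb G X\<^esub>"
  by (meson Nat_hom comm_group_hom_one functor_group)

lemma Nat_inv: "\<eta> \<in> carrier (Nat C F G) \<Longrightarrow> functor_on C F \<Longrightarrow> functor_on C G \<Longrightarrow> X \<in> Obj C
    \<Longrightarrow> x \<in> carrier (FOb F X) \<Longrightarrow> \<eta> X (inv\<^bsub>FOb F X\<^esub> x) = inv\<^bsub>FOb G X\<^esub> (\<eta> X x)"
  by (meson Nat_hom comm_group_hom_inv functor_group)

lemma Nat_natural: "\<eta> \<in> carrier (Nat C F G) \<Longrightarrow> X \<in> Obj C \<Longrightarrow> Y \<in> Obj C \<Longrightarrow> f \<in> arr C X Y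
    \<Longrightarrow> x \<in> carrier (FOb F X) \<Longrightarrow> \<eta> Y (FAr F X Y f x) = FAr G X Y f (\<eta> X x)"
  by (simp add: Nat_def)

lemma Nat_eqI:
  assumes "\<eta> \<in> carrier (Nat C F G)" "\<theta> \<in> carrier (Nat C F G)"
    and "\<And>X x. X \<in> Obj C \<Longrightarrow> x \<in> carrier (FOb F X) \<Longrightarrow> \<eta> X x = \<theta> X x"
  shows "\<eta> = \<theta>"
proof (rule PiE_ext)
  show "\<eta> \<in> (\<Pi>\<^sub>E X\<in>Obj C. hom (FOb F X) (FOb G X) \<inter> extensional (carrier (FOb F X)))"
    "\<theta> \<in> (\<Pi>\<^sub>E X\<in>Obj C. hom (FOb F X) (FOb G X) \<inter> extensional (carrier (FOb F X)))"
    using assms(1,2) by (auto simp: Nat_def)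
  then show "\<eta> X = \<theta> X" if "X \<in> Obj C" for X
    using that assms(3) by (intro extensionalityI[of _ "carrier (FOb F X)"]) (auto simp: PiE_iff)
qed

lemma natify_Nat:
  assumes "functor_on C F"
    and "\<And>X. X \<in> Obj C \<Longrightarrow> e X \<in> hom (FOb F X) (FOb G X)"
    and "\<And>X Y f x. X \<in> Obj C \<Longrightarrow> Y \<in> Obj C \<Longrightarrow> f \<in> arr C X Y \<Longrightarrow> x \<in> carrier (FOb F X)
      \<Longrightarrow> e Y (FAr F X Y f x) = FAr G X Y f (e X x)"
  shows "natify C F e \<in> carrier (Nat C F G)"
proof -
  have "natify C F e X \<in> hom (FOb F X) (FOb G X) \<inter> extensional (carrier (FOb F X))" if "X \<in> Obj C" for X
    using assms(2)[OF that] functor_closed[OF assms(1) that] that by (auto simp: natify_def hom_def Pi_iff)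
  then show ?thesis
    using assms by (auto simp: Nat_def FAr_closed) (auto simp: natify_def)
qed

lemma Nat_one_apply: "X \<in> Obj C \<Longrightarrow> x \<in> carrier (FOb F X) \<Longrightarrow> \<one>\<^bsub>Nat C F G\<^esub> X x = \<one>\<^bsub>FOb G X\<^esub>"
  by (simp add: Nat_def)

lemma Nat_one_closed:
  assumes "functor_on C F" "functor_on C G"
  shows "\<one>\<^bsub>Nat C F G\<^esub> \<in> carrier (Nat C F G)"
proof -
  have "\<one>\<^bsub>Nat C F G\<^esub> = natify C F (\<lambda>X x. \<one>\<^bsub>FOb G X\<^esub>)"
    by (simp add: Nat_def natify_def)
  moreover have "natify C F (\<lambda>X x. \<one>\<^bsub>FOb G X\<^esub>) \<in> carrier (Nat C F G)"
    using assms
    by (intro natify_Nat) (auto simp: functor_simps hom_def Pi_iff comm_group_imp_group monoid.r_one Group.group.is_monoid)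
  ultimately show ?thesis by simp
qed

lemma Nat_eq_one_iff:
  assumes "\<eta> \<in> carrier (Nat C F G)" "functor_on C F" "functor_on C G"
  shows "\<eta> = \<one>\<^bsub>Nat C F G\<^esub> \<longleftrightarrow> (\<forall>X\<in>Obj C. \<forall>x\<in>carrier (FOb F X). \<eta> X x = \<one>\<^bsub>FOb G X\<^esub>)"
  using Nat_eqI[OF assms(1) Nat_one_closed[OF assms(2,3)]] by (auto simp: Nat_one_apply)

lemma Nat_trivial_iff:
  assumes "functor_on C F" "functor_on C G"
  shows "carrier (Nat C F G) = {\<one>\<^bsub>Nat C F G\<^esub>} \<longleftrightarrow>
    (\<forall>\<eta>\<in>carrier (Nat C F G). \<forall>X\<in>Obj C. \<forall>x\<in>carrier (FOb F X). \<eta> X x = \<one>\<^bsub>FOb G X\<^esub>)"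
  using Nat_one_closed[OF assms] Nat_eq_one_iff[OF _ assms] by blast

lemma abfun_cat_simps [simp]:
  "Obj (abfun_cat C) = {F. is_additive_functor C F}"
  "Hom (abfun_cat C) = Nat C"
  by (simp_all add: abfun_cat_def)

lemma abfun_Cmp_apply:
  "X \<in> Obj C \<Longrightarrow> x \<in> carrier (FOb F X) \<Longrightarrow> Cmp (abfun_cat C) F G H \<theta> \<eta> X x = \<theta> X (\<eta> X x)"
  by (simp add: abfun_cat_def compose_def)

lemma abfun_Cmp_closed:
  assumes F: "functor_on C F" and \<eta>: "\<eta> \<in> carrier (Nat C F G)" and \<theta>: "\<theta> \<in> carrier (Nat C G H)"
  shows "Cmp (abfun_cat C) F G H \<theta> \<eta> \<in> carrier (Nat C F H)"
proof -
  have "Cmp (abfun_cat C) F G H \<theta> \<eta> = natify C F (\<lambda>X x. \<theta> X (\<eta> X x))"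
    by (simp add: abfun_cat_def natify_def compose_def)
  moreover have "natify C F (\<lambda>X x. \<theta> X (\<eta> X x)) \<in> carrier (Nat C F H)"
    using assms by (intro natify_Nat) (auto simp: Nat_natural Nat_closed Nat_mult hom_def)
  ultimately show ?thesis by simp
qed

lemma abfun_Cmp_eq_iff:
  assumes "functor_on C F" "\<eta> \<in> carrier (Nat C F G)" "\<theta> \<in> carrier (Nat C G H)" "\<zeta> \<in> carrier (Nat C F H)"
  shows "Cmp (abfun_cat C) F G H \<theta> \<eta> = \<zeta> \<longleftrightarrow> (\<forall>X\<in>Obj C. \<forall>x\<in>carrier (FOb F X). \<theta> X (\<eta> X x) = \<zeta> X x)"
  using Nat_eqI[OF abfun_Cmp_closed[OF assms(1-3)] assms(4)] by (auto simp: abfun_Cmp_apply)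

lemma abfun_Cmp_eq_one_iff:
  assumes "functor_on C F" "functor_on C H" "\<eta> \<in> carrier (Nat C F G)" "\<theta> \<in> carrier (Nat C G H)"
  shows "Cmp (abfun_cat C) F G H \<theta> \<eta> = \<one>\<^bsub>Nat C F H\<^esub> \<longleftrightarrow>
    (\<forall>X\<in>Obj C. \<forall>x\<in>carrier (FOb F X). \<theta> X (\<eta> X x) = \<one>\<^bsub>FOb H X\<^esub>)"
  using abfun_Cmp_eq_iff[OF assms(1,3,4) Nat_one_closed[OF assms(1,2)]] by (auto simp: Nat_one_apply)

section \<open>Quotients of functors\<close>

definition subfunctor :: "('o, 'a) pcat \<Rightarrow> ('o, 'a, 'b) abfun \<Rightarrow> ('o \<Rightarrow> 'b set) \<Rightarrow> bool" where
  "subfunctor C G K \<longleftrightarrow> (\<forall>X\<in>Obj C. subgroup (K X) (FOb G X)) \<and>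
     (\<forall>X\<in>Obj C. \<forall>Y\<in>Obj C. \<forall>f\<in>arr C X Y. \<forall>x\<in>K X. FAr G X Y f x \<in> K Y)"

text \<open>An epimorphism of functors with kernel \<open>K\<close>, in a form that permits
  different element types on the two sides. No extensionality is asked of \<open>q\<close>, so it
  need not belong to \<open>Nat\<close>; \<open>natify\<close> repairs this when both sides have the
  same element type.\<close>

definition quotient_map :: "('o, 'a) pcat \<Rightarrow> ('o, 'a, 'b) abfun \<Rightarrow> ('o, 'a, 'c) abfun \<Rightarrow>
    ('o \<Rightarrow> 'b \<Rightarrow> 'c) \<Rightarrow> ('o \<Rightarrow> 'b set) \<Rightarrow> bool" where
  "quotient_map C G Q q K \<longleftrightarrow>
     (\<forall>X\<in>Obj C. q X \<in> hom (FOb G X) (FOb Q X) \<and> q X ` carrier (FOb G X) = carrier (FOb Q X) \<and>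
        (\<forall>x\<in>carrier (FOb G X). q X x = \<one>\<^bsub>FOb Q X\<^esub> \<longleftrightarrow> x \<in> K X)) \<and>
     (\<forall>X\<in>Obj C. \<forall>Y\<in>Obj C. \<forall>f\<in>arr C X Y. \<forall>x\<in>carrier (FOb G X).
        q Y (FAr G X Y f x) = FAr Q X Y f (q X x))"

lemma quotient_mapD:
  assumes "quotient_map C G Q q K" "X \<in> Obj C"
  shows "q X \<in> hom (FOb G X) (FOb Q X)"
    and "x \<in> carrier (FOb G X) \<Longrightarrow> q X x = \<one>\<^bsub>FOb Q X\<^esub> \<longleftrightarrow> x \<in> K X"
    and "x \<in> carrier (FOb G X) \<Longrightarrow> q X x \<in> carrier (FOb Q X)"
    and "y \<in> carrier (FOb Q X) \<Longrightarrow> \<exists>x\<in>carrier (FOb G X). q X x = y"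
    and "\<lbrakk>Y \<in> Obj C; f \<in> arr C X Y; x \<in> carrier (FOb G X)\<rbrakk> \<Longrightarrow> q Y (FAr G X Y f x) = FAr Q X Y f (q X x)"
proof -
  show "y \<in> carrier (FOb Q X) \<Longrightarrow> \<exists>x\<in>carrier (FOb G X). q X x = y"
    using assms unfolding quotient_map_def by (metis imageE)
qed (use assms in \<open>auto simp: quotient_map_def\<close>)

lemma quotient_map_eq_iff:
  assumes "quotient_map C G Q q K" "functor_on C G" "functor_on C Q" "X \<in> Obj C"
    and "x \<in> carrier (FOb G X)" "y \<in> carrier (FOb G X)"
  shows "q X x = q X y \<longleftrightarrow> x \<otimes>\<^bsub>FOb G X\<^esub> inv\<^bsub>FOb G X\<^esub> y \<in> K X"
  using comm_group_diff_hom_eq[OF quotient_mapD(1)[OF assms(1,4)], of x y]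
    quotient_mapD(2)[OF assms(1,4)] assms(2-)
  by (simp add: functor_simps)

lemma subfunctor_subset: "subfunctor C G K \<Longrightarrow> X \<in> Obj C \<Longrightarrow> x \<in> K X \<Longrightarrow> x \<in> carrier (FOb G X)"
  by (meson subfunctor_def subgroup.subset subsetD)

text \<open>The quotient of \<open>G\<close> takes values in \<open>'u\<close> even if \<open>G\<close> does not.\<close>

lemma functor_quotient:
  fixes G :: "('o, 'a, 'b) abfun"
  assumes G: "functor_on C G" and small: "\<And>X. X \<in> Obj C \<Longrightarrow> small TYPE('u) (carrier (FOb G X))"
    and K: "subfunctor C G K"
  obtains Q :: "('o, 'a, 'u) abfun" and q where "is_additive_functor C Q" "quotient_map C G Q q K"
proof -
  have "\<forall>X\<in>Obj C. \<exists>H :: 'u monoid. \<exists>q. comm_group H \<and> small TYPE('u) (carrier H) \<and>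
      q \<in> hom (FOb G X) H \<and> q ` carrier (FOb G X) = carrier H \<and>
      (\<forall>x\<in>carrier (FOb G X). q x = \<one>\<^bsub>H\<^esub> \<longleftrightarrow> x \<in> K X)"
  proof
    fix X assume X: "X \<in> Obj C"
    then have "subgroup (K X) (FOb G X)" using K by (simp add: subfunctor_def)
    from comm_group_quotient[OF functor_group[OF G X] this small[OF X]]
    obtain H :: "'u monoid" and q where "comm_group H" "small TYPE('u) (carrier H)"
      "q \<in> hom (FOb G X) H" "q ` carrier (FOb G X) = carrier H"
      "\<And>x. x \<in> carrier (FOb G X) \<Longrightarrow> q x = \<one>\<^bsub>H\<^esub> \<longleftrightarrow> x \<in> K X"
      by blast
    then show "\<exists>H :: 'u monoid. \<exists>q. comm_group H \<and> small TYPE('u) (carrier H) \<and>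
      q \<in> hom (FOb G X) H \<and> q ` carrier (FOb G X) = carrier H \<and>
      (\<forall>x\<in>carrier (FOb G X). q x = \<one>\<^bsub>H\<^esub> \<longleftrightarrow> x \<in> K X)"
      by blast
  qed
  from bchoice[OF this] obtain H :: "'o \<Rightarrow> 'u monoid" where
    "\<forall>X\<in>Obj C. \<exists>q. comm_group (H X) \<and> small TYPE('u) (carrier (H X)) \<and>
      q \<in> hom (FOb G X) (H X) \<and> q ` carrier (FOb G X) = carrier (H X) \<and>
      (\<forall>x\<in>carrier (FOb G X). q x = \<one>\<^bsub>H X\<^esub> \<longleftrightarrow> x \<in> K X)" ..
  from bchoice[OF this] obtain q where
    H: "\<And>X. X \<in> Obj C \<Longrightarrow> comm_group (H X)" "\<And>X. X \<in> Obj C \<Longrightarrow> small TYPE('u) (carrier (H X))"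
    and q: "\<And>X. X \<in> Obj C \<Longrightarrow> q X \<in> hom (FOb G X) (H X)"
      "\<And>X. X \<in> Obj C \<Longrightarrow> q X ` carrier (FOb G X) = carrier (H X)"
      "\<And>X x. X \<in> Obj C \<Longrightarrow> x \<in> carrier (FOb G X) \<Longrightarrow> q X x = \<one>\<^bsub>H X\<^esub> \<longleftrightarrow> x \<in> K X"
    by blast
  \<comment> \<open>A choice of preimages. Arrows act on \<open>Q\<close> by lifting, applying
    \<open>G\<close> and projecting; the choice of the lift does not matter, since two lifts differ
    by an element of the subfunctor \<open>K\<close>.\<close>
  define s where "s X = inv_into (carrier (FOb G X)) (q X)" for X
  define Q where "Q = \<lparr>FOb = H, FAr = (\<lambda>X Y f y. q Y (FAr G X Y f (s X y)))\<rparr>"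
  have qeq: "q X x = q X y \<longleftrightarrow> x \<otimes>\<^bsub>FOb G X\<^esub> inv\<^bsub>FOb G X\<^esub> y \<in> K X"
    if "X \<in> Obj C" "x \<in> carrier (FOb G X)" "y \<in> carrier (FOb G X)" for X x y
    using comm_group_diff_hom_eq[OF q(1)[OF that(1)] functor_group[OF G that(1)] H(1)[OF that(1)] that(2,3)]
      q(3) that G by (simp add: functor_simps)
  have s: "s X (q X x) \<in> carrier (FOb G X)" "q X (s X (q X x)) = q X x"
    if "X \<in> Obj C" "x \<in> carrier (FOb G X)" for X x
    using that by (auto simp: s_def intro: inv_into_into f_inv_into_f)
  have nat: "q Y (FAr G X Y f x) = FAr Q X Y f (q X x)"
    if XY: "X \<in> Obj C" "Y \<in> Obj C" "f \<in> arr C X Y" "x \<in> carrier (FOb G X)" for X Y f x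
  proof -
    have "x \<otimes>\<^bsub>FOb G X\<^esub> inv\<^bsub>FOb G X\<^esub> s X (q X x) \<in> K X"
      using qeq[of X x "s X (q X x)"] s XY by auto
    then have "FAr G X Y f (x \<otimes>\<^bsub>FOb G X\<^esub> inv\<^bsub>FOb G X\<^esub> s X (q X x)) \<in> K Y"
      using K XY by (simp add: subfunctor_def)
    then show ?thesis
      using XY s G by (simp add: Q_def qeq functor_simps)
  qed
  have surj: "\<exists>x\<in>carrier (FOb G X). y = q X x" if "X \<in> Obj C" "y \<in> carrier (FOb Q X)" for X y
    using that q(2)[of X] by (auto simp: Q_def)
  have qc: "q X x \<in> carrier (FOb Q X)" if "X \<in> Obj C" "x \<in> carrier (FOb G X)" for X x
    using that q(2)[of X] by (auto simp: Q_def)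
  have qm: "q X (x \<otimes>\<^bsub>FOb G X\<^esub> y) = q X x \<otimes>\<^bsub>FOb Q X\<^esub> q X y"
    if "X \<in> Obj C" "x \<in> carrier (FOb G X)" "y \<in> carrier (FOb G X)" for X x y
    using that q(1) by (simp add: Q_def hom_mult)
  have "functor_on C Q"
  proof (rule functor_onI)
    show "comm_group (FOb Q X)" if "X \<in> Obj C" for X using H that by (simp add: Q_def)
    show "FAr Q X X (Idn C X) y = y" if "X \<in> Obj C" "y \<in> carrier (FOb Q X)" for X y
      using that s surj[OF that] by (auto simp: Q_def FAr_Idn[OF G])
    show "FAr Q X Y f \<in> hom (FOb Q X) (FOb Q Y)" if XY: "X \<in> Obj C" "Y \<in> Obj C" "f \<in> arr C X Y" for X Y f
    proof (rule homI)
      fix y y' assume y: "y \<in> carrier (FOb Q X)" "y' \<in> carrier (FOb Q X)"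
      then obtain x x' where x: "x \<in> carrier (FOb G X)" "y = q X x" "x' \<in> carrier (FOb G X)" "y' = q X x'"
        using surj XY by meson
      show "FAr Q X Y f y \<in> carrier (FOb Q Y)"
        using x XY G by (simp add: functor_simps qc flip: nat)
      have "FAr Q X Y f (q X (x \<otimes>\<^bsub>FOb G X\<^esub> x')) = q Y (FAr G X Y f (x \<otimes>\<^bsub>FOb G X\<^esub> x'))"
        using x XY G by (simp add: functor_simps flip: nat)
      also have "\<dots> = q Y (FAr G X Y f x) \<otimes>\<^bsub>FOb Q Y\<^esub> q Y (FAr G X Y f x')"
        using x XY G by (simp add: functor_simps qm)
      also have "\<dots> = FAr Q X Y f (q X x) \<otimes>\<^bsub>FOb Q Y\<^esub> FAr Q X Y f (q X x')"
        using x XY by (simp add: nat)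
      finally have "FAr Q X Y f (q X (x \<otimes>\<^bsub>FOb G X\<^esub> x')) = FAr Q X Y f (q X x) \<otimes>\<^bsub>FOb Q Y\<^esub> FAr Q X Y f (q X x')" .
      then show "FAr Q X Y f (y \<otimes>\<^bsub>FOb Q X\<^esub> y') = FAr Q X Y f y \<otimes>\<^bsub>FOb Q Y\<^esub> FAr Q X Y f y'"
        using x XY by (metis qm)
    qed
    show "FAr Q X Y (f \<otimes>\<^bsub>Hom C X Y\<^esub> g) y = FAr Q X Y f y \<otimes>\<^bsub>FOb Q Y\<^esub> FAr Q X Y g y"
      if XY: "X \<in> Obj C" "Y \<in> Obj C" "f \<in> arr C X Y" "g \<in> arr C X Y" "y \<in> carrier (FOb Q X)" for X Y f g y
    proof -
      obtain x where x: "x \<in> carrier (FOb G X)" "y = q X x" using surj XY by meson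
      then have y: "s X y \<in> carrier (FOb G X)" using s XY by simp
      have "FAr Q X Y (f \<otimes>\<^bsub>Hom C X Y\<^esub> g) y = q Y (FAr G X Y f (s X y) \<otimes>\<^bsub>FOb G Y\<^esub> FAr G X Y g (s X y))"
        using y XY by (simp add: Q_def FAr_add[OF G])
      also have "\<dots> = q Y (FAr G X Y f (s X y)) \<otimes>\<^bsub>FOb Q Y\<^esub> q Y (FAr G X Y g (s X y))"
        using y XY by (simp add: qm FAr_closed[OF G])
      finally show ?thesis by (simp add: Q_def)
    qed
    show "FAr Q X Z (Cmp C X Y Z g f) y = FAr Q Y Z g (FAr Q X Y f y)"
      if XY: "X \<in> Obj C" "Y \<in> Obj C" "Z \<in> Obj C" "f \<in> arr C X Y" "g \<in> arr C Y Z" "y \<in> carrier (FOb Q X)"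
      for X Y Z f g y
    proof -
      obtain x where x: "x \<in> carrier (FOb G X)" "y = q X x" using surj XY by meson
      have "FAr Q X Z (Cmp C X Y Z g f) y = q Z (FAr G Y Z g (FAr G X Y f (s X y)))"
        using x XY s by (simp add: Q_def FAr_Cmp[OF G])
      also have "\<dots> = FAr Q Y Z g (FAr Q X Y f (q X (s X y)))"
        using x XY s by (simp add: FAr_closed[OF G] nat)
      finally show ?thesis using x s XY by simp
    qed
  qed
  then have "is_additive_functor C Q"
    using H by (simp add: is_additive_functor_iff Q_def)
  moreover have "quotient_map C G Q q K"
    unfolding quotient_map_def using q nat by (simp add: Q_def)
  ultimately show thesis by (rule that)
qed

lemma quotient_map_natify:
  assumes "functor_on C G" "quotient_map C G Q q K"
  shows "natify C G q \<in> carrier (Nat C G Q)" "quotient_map C G Q (natify C G q) K"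
proof -
  show q: "natify C G q \<in> carrier (Nat C G Q)"
    using assms by (intro natify_Nat) (auto simp: quotient_map_def)
  show "quotient_map C G Q (natify C G q) K"
    using assms Nat_hom[OF q] by (auto simp: quotient_map_def FAr_closed image_def)
qed

text \<open>Maps that kill \<open>K\<close> do not depend on the chosen preimage. Here
  \<open>e\<close> is only a family of homomorphisms compatible with arrows, because
  \<open>G\<close> may take values in another type than \<open>Q\<close> and
  \<open>W\<close>.\<close>

lemma quotient_factor:
  assumes q: "quotient_map C G Q q K" and G: "functor_on C G" and Q: "functor_on C Q" and W: "functor_on C W"
    and e: "\<And>X. X \<in> Obj C \<Longrightarrow> e X \<in> hom (FOb G X) (FOb W X)"
    and nat: "\<And>X Y f x. X \<in> Obj C \<Longrightarrow> Y \<in> Obj C \<Longrightarrow> f \<in> arr C X Y \<Longrightarrow> x \<in> carrier (FOb G X) \<Longrightarrow>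
      e Y (FAr G X Y f x) = FAr W X Y f (e X x)"
    and K: "\<And>X x. X \<in> Obj C \<Longrightarrow> x \<in> carrier (FOb G X) \<Longrightarrow> x \<in> K X \<Longrightarrow> e X x = \<one>\<^bsub>FOb W X\<^esub>"
  obtains k where "k \<in> carrier (Nat C Q W)"
    "\<And>X x. X \<in> Obj C \<Longrightarrow> x \<in> carrier (FOb G X) \<Longrightarrow> k X (q X x) = e X x"
proof -
  define s where "s X = inv_into (carrier (FOb G X)) (q X)" for X
  have s: "s X y \<in> carrier (FOb G X)" "q X (s X y) = y" if "X \<in> Obj C" "y \<in> carrier (FOb Q X)" for X y
    using that q by (auto simp: s_def quotient_map_def intro!: inv_into_into f_inv_into_f)
  have es: "e X (s X (q X x)) = e X x" if X: "X \<in> Obj C" "x \<in> carrier (FOb G X)" for X x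
  proof -
    have sx: "s X (q X x) \<in> carrier (FOb G X)" "q X (s X (q X x)) = q X x"
      using s X quotient_mapD(3)[OF q] by auto
    then have "e X (s X (q X x) \<otimes>\<^bsub>FOb G X\<^esub> inv\<^bsub>FOb G X\<^esub> x) = \<one>\<^bsub>FOb W X\<^esub>"
      using quotient_map_eq_iff[OF q G Q] X by (intro K) (auto simp: functor_simps[OF G])
    then show ?thesis
      using comm_group_diff_hom_eq[OF e] sx X functor_group G W by meson
  qed
  define k where "k = natify C Q (\<lambda>X y. e X (s X y))"
  have kq: "k X (q X x) = e X x" if "X \<in> Obj C" "x \<in> carrier (FOb G X)" for X x
    using that es quotient_mapD(3)[OF q] by (simp add: k_def)
  have "k \<in> carrier (Nat C Q W)"
    unfolding k_def
  proof (rule natify_Nat[OF Q])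
    fix X assume X: "X \<in> Obj C"
    show "(\<lambda>y. e X (s X y)) \<in> hom (FOb Q X) (FOb W X)"
    proof (rule homI)
      fix y y' assume y: "y \<in> carrier (FOb Q X)" "y' \<in> carrier (FOb Q X)"
      then obtain x x' where x: "x \<in> carrier (FOb G X)" "x' \<in> carrier (FOb G X)" "y = q X x" "y' = q X x'"
        using quotient_mapD(4)[OF q X] by metis
      show "e X (s X y) \<in> carrier (FOb W X)"
        using e[OF X] s[OF X y(1)] by (simp add: hom_in_carrier)
      have "y \<otimes>\<^bsub>FOb Q X\<^esub> y' = q X (x \<otimes>\<^bsub>FOb G X\<^esub> x')"
        using x quotient_mapD(1)[OF q X] by (simp add: hom_mult)
      then show "e X (s X (y \<otimes>\<^bsub>FOb Q X\<^esub> y')) = e X (s X y) \<otimes>\<^bsub>FOb W X\<^esub> e X (s X y')"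
        using x X e[OF X] by (simp add: es functor_closed[OF G] hom_mult)
    qed
    fix Y f y assume Y: "Y \<in> Obj C" "f \<in> arr C X Y" "y \<in> carrier (FOb Q X)"
    then obtain x where x: "x \<in> carrier (FOb G X)" "y = q X x"
      using quotient_mapD(4)[OF q X] by metis
    then show "e Y (s Y (FAr Q X Y f y)) = FAr W X Y f (e X (s X y))"
      using X Y by (simp add: es nat FAr_closed[OF G] flip: quotient_mapD(5)[OF q])
  qed
  then show thesis using that kq by blast
qed

lemma quotient_factor_Nat:
  assumes q: "quotient_map C G Q q K" and G: "functor_on C G" and Q: "functor_on C Q" and W: "functor_on C W"
    and h: "h \<in> carrier (Nat C G W)"
    and K: "\<And>X x. X \<in> Obj C \<Longrightarrow> x \<in> K X \<Longrightarrow> h X x = \<one>\<^bsub>FOb W X\<^esub>"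
  obtains k where "k \<in> carrier (Nat C Q W)"
    "\<And>X x. X \<in> Obj C \<Longrightarrow> x \<in> carrier (FOb G X) \<Longrightarrow> k X (q X x) = h X x"
  by (rule quotient_factor[OF q G Q W, of h]) (use Nat_hom[OF h] Nat_natural[OF h] K in auto)

lemma subfunctor_image:
  assumes F: "functor_on C F" and G: "functor_on C G" and i: "i \<in> carrier (Nat C F G)"
  shows "subfunctor C G (\<lambda>X. i X ` carrier (FOb F X))"
  unfolding subfunctor_def
proof (intro conjI ballI)
  show "subgroup (i X ` carrier (FOb F X)) (FOb G X)" if "X \<in> Obj C" for X
    using subgroup_hom_image[OF Nat_hom[OF i that] functor_group[OF F that] functor_group[OF G that]] .
  show "FAr G X Y f x \<in> i Y ` carrier (FOb F Y)"
    if "X \<in> Obj C" "Y \<in> Obj C" "f \<in> arr C X Y" "x \<in> i X ` carrier (FOb F X)" for X Y f x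
    using that by (auto simp: FAr_closed[OF F] simp flip: Nat_natural[OF i])
qed

section \<open>Cokernels and monomorphisms of modules\<close>

lemma is_cokernel_quotient:
  assumes F: "functor_on C F" and G: "functor_on C G" and Q: "is_additive_functor C Q"
    and i: "i \<in> carrier (Nat C F G)" and q: "q \<in> carrier (Nat C G Q)"
    and qm: "quotient_map C G Q q (\<lambda>X. i X ` carrier (FOb F X))"
  shows "is_cokernel (abfun_cat C) F G Q i q"
proof -
  have Q': "functor_on C Q" using Q by (rule additive_functor_on)
  have "Cmp (abfun_cat C) F G Q q i = \<one>\<^bsub>Nat C F Q\<^esub>"
    unfolding abfun_Cmp_eq_one_iff[OF F Q' i q]
    using quotient_mapD(2)[OF qm] Nat_closed[OF i] by blast
  moreover have "\<exists>!k. k \<in> carrier (Nat C Q W) \<and> Cmp (abfun_cat C) G Q W k q = h"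
    if W: "is_additive_functor C W" and h: "h \<in> carrier (Nat C G W)"
      and hi: "Cmp (abfun_cat C) F G W h i = \<one>\<^bsub>Nat C F W\<^esub>" for W h
  proof -
    have W': "functor_on C W" using W by (rule additive_functor_on)
    have "h X x = \<one>\<^bsub>FOb W X\<^esub>" if "X \<in> Obj C" "x \<in> i X ` carrier (FOb F X)" for X x
      using hi that unfolding abfun_Cmp_eq_one_iff[OF F W' i h] by auto
    then obtain k where k: "k \<in> carrier (Nat C Q W)"
        "\<And>X x. X \<in> Obj C \<Longrightarrow> x \<in> carrier (FOb G X) \<Longrightarrow> k X (q X x) = h X x"
      using quotient_factor_Nat[OF qm G Q' W' h] by metis
    show ?thesis
    proof (rule ex1I[of _ k])
      show "k \<in> carrier (Nat C Q W) \<and> Cmp (abfun_cat C) G Q W k q = h"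
        using k abfun_Cmp_eq_iff[OF G q k(1) h] by blast
      fix k' assume k': "k' \<in> carrier (Nat C Q W) \<and> Cmp (abfun_cat C) G Q W k' q = h"
      then have k'q: "k' X (q X x) = h X x" if "X \<in> Obj C" "x \<in> carrier (FOb G X)" for X x
        using that abfun_Cmp_eq_iff[OF G q _ h] by blast
      show "k' = k"
      proof (rule Nat_eqI)
        fix X y assume "X \<in> Obj C" "y \<in> carrier (FOb Q X)"
        then show "k' X y = k X y"
          using quotient_mapD(4)[OF qm] k'q k(2) by metis
      qed (use k k' in auto)
    qed
  qed
  ultimately show ?thesis
    using Q q by (simp add: is_cokernel_def)
qed

lemma cokernel_exists:
  assumes F: "is_additive_functor C F" and G: "is_additive_functor C (G :: ('o, 'a, 'u) abfun)"
    and i: "i \<in> carrier (Nat C F G)"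
  obtains Q q where "is_cokernel (abfun_cat C) F G Q i q" "q \<in> carrier (Nat C G Q)"
    "is_additive_functor C Q" "quotient_map C G Q q (\<lambda>X. i X ` carrier (FOb F X))"
proof -
  have F': "functor_on C F" and G': "functor_on C G" using F G by (simp_all add: additive_functor_on)
  from functor_quotient[OF G' additive_functor_small[OF G] subfunctor_image[OF F' G' i]]
  obtain Q :: "('o, 'a, 'u) abfun" and q where Q: "is_additive_functor C Q"
    and q: "quotient_map C G Q q (\<lambda>X. i X ` carrier (FOb F X))"
    by blast
  note qm = quotient_map_natify[OF G' q]
  show thesis
    using that[OF is_cokernel_quotient[OF F' G' Q i qm] qm(1) Q qm(2)] .
qed

lemma is_cokernelD:
  assumes "is_cokernel (abfun_cat C) F G L i p"
  shows "is_additive_functor C L" "p \<in> carrier (Nat C G L)"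
  using assms by (auto simp: is_cokernel_def)

lemma cokernel_factor:
  assumes L: "is_cokernel (abfun_cat C) F G L i p"
    and F: "functor_on C F" and G: "functor_on C G" and i: "i \<in> carrier (Nat C F G)"
    and W: "is_additive_functor C W" and h: "h \<in> carrier (Nat C G W)"
    and hi: "\<And>X x. X \<in> Obj C \<Longrightarrow> x \<in> carrier (FOb F X) \<Longrightarrow> h X (i X x) = \<one>\<^bsub>FOb W X\<^esub>"
  obtains k where "k \<in> carrier (Nat C L W)"
    "\<And>X x. X \<in> Obj C \<Longrightarrow> x \<in> carrier (FOb G X) \<Longrightarrow> k X (p X x) = h X x"
proof -
  have "Cmp (abfun_cat C) F G W h i = \<one>\<^bsub>Nat C F W\<^esub>"
    using abfun_Cmp_eq_one_iff[OF F additive_functor_on[OF W] i h] hi by blast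
  then obtain k where k: "k \<in> carrier (Nat C L W)" "Cmp (abfun_cat C) G L W k p = h"
    using L W h unfolding is_cokernel_def abfun_cat_simps by blast
  then show thesis
    using that abfun_Cmp_eq_iff[OF G is_cokernelD(2)[OF L] k(1) h] by blast
qed

text \<open>Cokernels are specified by a universal property only. Comparison with the pointwise
  quotient recovers the kernel of \<open>p\<close>, and uniqueness of factorisations yields
  surjectivity.\<close>

lemma cokernel_quotient_map:
  assumes L: "is_cokernel (abfun_cat C) F G L i p"
    and F: "is_additive_functor C F" and G: "is_additive_functor C (G :: ('o, 'a, 'u) abfun)"
    and i: "i \<in> carrier (Nat C F G)"
  shows "quotient_map C G L p (\<lambda>X. i X ` carrier (FOb F X))"
proof -
  obtain Q q where Q: "is_cokernel (abfun_cat C) F G Q i q" "q \<in> carrier (Nat C G Q)"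
    "is_additive_functor C Q" and q: "quotient_map C G Q q (\<lambda>X. i X ` carrier (FOb F X))"
    using cokernel_exists[OF F G i] .
  have F': "functor_on C F" and G': "functor_on C G" and Q': "functor_on C Q"
    using F G Q by (simp_all add: additive_functor_on)
  have La: "is_additive_functor C L" and p: "p \<in> carrier (Nat C G L)"
    using is_cokernelD[OF L] .
  have L': "functor_on C L" using La by (rule additive_functor_on)
  have ker: "p X x = \<one>\<^bsub>FOb L X\<^esub> \<longleftrightarrow> x \<in> i X ` carrier (FOb F X)" if X: "X \<in> Obj C" "x \<in> carrier (FOb G X)" for X x
  proof
    have "q X (i X x) = \<one>\<^bsub>FOb Q X\<^esub>" if "X \<in> Obj C" "x \<in> carrier (FOb F X)" for X x
      using that quotient_mapD(2)[OF q] Nat_closed[OF i] by blast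
    then obtain k where k: "k \<in> carrier (Nat C L Q)"
        "\<And>X x. X \<in> Obj C \<Longrightarrow> x \<in> carrier (FOb G X) \<Longrightarrow> k X (p X x) = q X x"
      using cokernel_factor[OF L F' G' i Q(3,2)] by metis
    assume "p X x = \<one>\<^bsub>FOb L X\<^esub>"
    then have "q X x = \<one>\<^bsub>FOb Q X\<^esub>"
      using k(2)[OF X] Nat_one[OF k(1) L' Q' X(1)] by simp
    then show "x \<in> i X ` carrier (FOb F X)"
      using quotient_mapD(2)[OF q X(1,2)] by simp
  next
    have "Cmp (abfun_cat C) F G L p i = \<one>\<^bsub>Nat C F L\<^esub>"
      using L by (simp add: is_cokernel_def)
    then show "x \<in> i X ` carrier (FOb F X) \<Longrightarrow> p X x = \<one>\<^bsub>FOb L X\<^esub>"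
      using X unfolding abfun_Cmp_eq_one_iff[OF F' L' i p] by blast
  qed
  \<comment> \<open>Surjectivity: the cokernel map \<open>r\<close> of \<open>p\<close> and the zero
    map both give zero after \<open>p\<close>, so they coincide, and everything in \<open>L\<close>
    lies in the image of \<open>p\<close>.\<close>
  obtain R r where R: "is_cokernel (abfun_cat C) G L R p r" "r \<in> carrier (Nat C L R)"
    "is_additive_functor C R" and r: "quotient_map C L R r (\<lambda>X. p X ` carrier (FOb G X))"
    using cokernel_exists[OF G La p] .
  have R': "functor_on C R" using R(3) by (rule additive_functor_on)
  note one = Nat_one_closed[OF L' R'] and one' = Nat_one_closed[OF G' R']
  have "r = \<one>\<^bsub>Nat C L R\<^esub>"
  proof -
    have "Cmp (abfun_cat C) G L R r p = \<one>\<^bsub>Nat C G R\<^esub>" "Cmp (abfun_cat C) G L R \<one>\<^bsub>Nat C L R\<^esub> p = \<one>\<^bsub>Nat C G R\<^esub>"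
      using abfun_Cmp_eq_one_iff[OF G' R' p R(2)] abfun_Cmp_eq_one_iff[OF G' R' p one]
        quotient_mapD(2)[OF r] Nat_closed[OF p] by (auto simp: Nat_one_apply)
    moreover have "Cmp (abfun_cat C) F G R \<one>\<^bsub>Nat C G R\<^esub> i = \<one>\<^bsub>Nat C F R\<^esub>"
      using abfun_Cmp_eq_one_iff[OF F' R' i one'] Nat_closed[OF i] by (auto simp: Nat_one_apply)
    moreover have ex: "\<exists>!k. k \<in> carrier (Nat C L R) \<and> Cmp (abfun_cat C) G L R k p = \<one>\<^bsub>Nat C G R\<^esub>"
      using L R(3) one' calculation(3) by (simp add: is_cokernel_def)
    ultimately show ?thesis
      using the1_equality[OF ex, of r] the1_equality[OF ex, of "\<one>\<^bsub>Nat C L R\<^esub>"] R(2) one by simp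
  qed
  then have "y \<in> p X ` carrier (FOb G X)" if "X \<in> Obj C" "y \<in> carrier (FOb L X)" for X y
    using quotient_mapD(2)[OF r that] that by (simp add: Nat_one_apply)
  then have surj: "p X ` carrier (FOb G X) = carrier (FOb L X)" if "X \<in> Obj C" for X
    using that Nat_closed[OF p that] by blast
  show ?thesis
    unfolding quotient_map_def
    by (intro conjI ballI) (use ker surj Nat_hom[OF p] Nat_natural[OF p] in auto)
qed

lemma is_monomorphismI:
  assumes M: "functor_on C M" and N: "functor_on C N" and i: "i \<in> carrier (Nat C M N)"
    and inj: "\<And>X x. X \<in> Obj C \<Longrightarrow> x \<in> carrier (FOb M X) \<Longrightarrow> i X x = \<one>\<^bsub>FOb N X\<^esub> \<Longrightarrow> x = \<one>\<^bsub>FOb M X\<^esub>"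
  shows "is_monomorphism (abfun_cat C) M N i"
  unfolding is_monomorphism_def abfun_cat_simps
proof (intro conjI ballI impI i)
  fix W u v assume W: "W \<in> {F. is_additive_functor C F}" and u: "u \<in> carrier (Nat C W M)"
    and v: "v \<in> carrier (Nat C W M)" and eq: "Cmp (abfun_cat C) W M N i u = Cmp (abfun_cat C) W M N i v"
  have W': "functor_on C W" using W by (simp add: additive_functor_on)
  show "u = v"
  proof (rule Nat_eqI[OF u v])
    fix X x assume X: "X \<in> Obj C" "x \<in> carrier (FOb W X)"
    have "i X (u X x) = i X (v X x)"
      using abfun_Cmp_eq_iff[OF W' u i abfun_Cmp_closed[OF W' v i]] eq X by (simp add: abfun_Cmp_apply)
    then have "u X x \<otimes>\<^bsub>FOb M X\<^esub> inv\<^bsub>FOb M X\<^esub> v X x = \<one>\<^bsub>FOb M X\<^esub>"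
      using comm_group_diff_hom_eq[OF Nat_hom[OF i X(1)] functor_group[OF M X(1)] functor_group[OF N X(1)]]
        inj X Nat_closed[OF u] Nat_closed[OF v] by (simp add: functor_closed[OF M])
    then show "u X x = v X x"
      using comm_group_diff_eq_one[OF functor_group[OF M X(1)]] X Nat_closed[OF u] Nat_closed[OF v] by blast
  qed
qed

section \<open>The Yoneda lemma\<close>

locale small_preadditive_category = preadditive_category C
  for C :: "('o, 'u) pcat" +
  assumes inaccessible: "strongly_inaccessible TYPE('u)"
    and small_arr: "X \<in> Obj C \<Longrightarrow> Y \<in> Obj C \<Longrightarrow> small TYPE('u) (arr C X Y)"
begin

lemma additive_rep: "A \<in> Obj C \<Longrightarrow> is_additive_functor C (rep C A)"
  by (simp add: is_additive_functor_iff functor_on_rep) (simp add: rep_def small_arr)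

lemma rep_simps [simp]: "FOb (rep C A) = Hom C A" "FAr (rep C A) X Y = Cmp C A X Y"
  by (auto simp: rep_def)

text \<open>The transformation out of \<open>(A,-)\<close> that the Yoneda lemma assigns to an
  element \<open>x\<close> of \<open>F(A)\<close>.\<close>

definition yon :: "('o, 'u, 'u) abfun \<Rightarrow> 'o \<Rightarrow> 'u \<Rightarrow> ('o \<Rightarrow> 'u \<Rightarrow> 'u)" where
  "yon F A x = natify C (rep C A) (\<lambda>X h. FAr F A X h x)"

lemma yon_apply: "X \<in> Obj C \<Longrightarrow> h \<in> arr C A X \<Longrightarrow> yon F A x X h = FAr F A X h x"
  by (simp add: yon_def)

lemma yon_Nat:
  assumes F: "functor_on C F" and A: "A \<in> Obj C" and x: "x \<in> carrier (FOb F A)"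
  shows "yon F A x \<in> carrier (Nat C (rep C A) F)"
  unfolding yon_def using assms
  by (intro natify_Nat[OF functor_on_rep]) (auto simp: hom_def FAr_closed FAr_add FAr_Cmp)

lemma yon_Idn:
  assumes F: "functor_on C F" and A: "A \<in> Obj C" and x: "x \<in> carrier (FOb F A)"
  shows "yon F A x A (Idn C A) = x"
  using assms by (simp add: yon_apply Idn_arr FAr_Idn)

lemma Nat_rep_apply:
  assumes F: "functor_on C F" and A: "A \<in> Obj C" and \<eta>: "\<eta> \<in> carrier (Nat C (rep C A) F)"
    and X: "X \<in> Obj C" "h \<in> arr C A X"
  shows "\<eta> X h = FAr F A X h (\<eta> A (Idn C A))"
  using Nat_natural[OF \<eta> A X(1), of h "Idn C A"] assms by (simp add: Idn_arr Cmp_Idn_right)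

lemma rep_map_Nat:
  assumes "A \<in> Obj C" "B \<in> Obj C" "f \<in> arr C A B"
  shows "rep_map C A B f \<in> carrier (Nat C (rep C B) (rep C A))"
proof -
  have "rep_map C A B f = yon (rep C A) B f"
    by (simp add: rep_map_def yon_def natify_def)
  then show ?thesis
    using yon_Nat[of "rep C A" B f] assms by (simp add: functor_on_rep)
qed

lemma rep_map_apply: "X \<in> Obj C \<Longrightarrow> h \<in> arr C B X \<Longrightarrow> rep_map C A B f X h = Cmp C A B X h f"
  by (simp add: rep_map_def)

text \<open>Representable functors suffice as test objects: \<open>x\<close> and the neutral element
  give maps \<open>(X,-) \<rightarrow> M\<close> that agree after \<open>i\<close>.\<close>

lemma monomorphism_inj:
  fixes M N :: "('o, 'u, 'u) abfun"
  assumes i: "is_monomorphism (abfun_cat C) M N i" and M: "functor_on C M" and N: "functor_on C N"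
    and X: "X \<in> Obj C" "x \<in> carrier (FOb M X)" "i X x = \<one>\<^bsub>FOb N X\<^esub>"
  shows "x = \<one>\<^bsub>FOb M X\<^esub>"
proof -
  have iN: "i \<in> carrier (Nat C M N)" using i by (simp add: is_monomorphism_def)
  have one: "\<one>\<^bsub>FOb M X\<^esub> \<in> carrier (FOb M X)" using functor_closed[OF M X(1)] by simp
  have "Cmp (abfun_cat C) (rep C X) M N i (yon M X x) = Cmp (abfun_cat C) (rep C X) M N i (yon M X \<one>\<^bsub>FOb M X\<^esub>)"
    using abfun_Cmp_closed[OF functor_on_rep yon_Nat iN] M X one
    by (intro Nat_eqI[of _ C "rep C X" N])
      (auto simp: abfun_Cmp_apply yon_apply Nat_natural[OF iN] Nat_one[OF iN M N] FAr_one[OF N])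
  then have "yon M X x = yon M X \<one>\<^bsub>FOb M X\<^esub>"
    using i X M one additive_rep[OF X(1)] unfolding is_monomorphism_def abfun_cat_simps
    by (metis mem_Collect_eq yon_Nat)
  then show ?thesis
    using yon_Idn[OF M X(1)] X one by metis
qed

text \<open>By the Yoneda lemma, maps from \<open>G\<close> to a module \<open>F\<close> correspond to the elements of the kernel of
  \<open>F(f) : F(A) \<rightarrow> F(B)\<close>.\<close>

definition rep_cokernel :: "'o \<Rightarrow> 'o \<Rightarrow> 'u \<Rightarrow> ('o, 'u, 'u) abfun \<Rightarrow> ('o \<Rightarrow> 'u \<Rightarrow> 'u) \<Rightarrow> bool" where
  "rep_cokernel A B f G p \<longleftrightarrow> A \<in> Obj C \<and> B \<in> Obj C \<and> f \<in> arr C A B \<and>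
     is_cokernel (abfun_cat C) (rep C B) (rep C A) G (rep_map C A B f) p"

lemma rep_cokernel_exists:
  assumes "A \<in> Obj C" "B \<in> Obj C" "f \<in> arr C A B"
  obtains G p where "rep_cokernel A B f G p"
  using cokernel_exists[OF additive_rep additive_rep rep_map_Nat] assms
  unfolding rep_cokernel_def by metis

lemma rep_cokernelD:
  assumes "rep_cokernel A B f G p"
  shows "A \<in> Obj C" "B \<in> Obj C" "f \<in> arr C A B" "is_additive_functor C G" "functor_on C G"
    "p \<in> carrier (Nat C (rep C A) G)"
    "quotient_map C (rep C A) G p (\<lambda>X. {Cmp C A B X h f | h. h \<in> arr C B X})"
proof -
  show *: "A \<in> Obj C" "B \<in> Obj C" "f \<in> arr C A B" "is_additive_functor C G"
    "p \<in> carrier (Nat C (rep C A) G)"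
    using assms by (auto simp: rep_cokernel_def is_cokernel_def)
  then show "functor_on C G" by (simp add: additive_functor_on)
  have "quotient_map C (rep C A) G p (\<lambda>X. rep_map C A B f X ` carrier (FOb (rep C B) X))"
    using assms * cokernel_quotient_map[OF _ additive_rep additive_rep rep_map_Nat]
    unfolding rep_cokernel_def by blast
  moreover have "rep_map C A B f X ` carrier (FOb (rep C B) X) = {Cmp C A B X h f | h. h \<in> arr C B X}"
    if "X \<in> Obj C" for X
    using that by (auto simp: rep_map_apply image_def)
  ultimately show "quotient_map C (rep C A) G p (\<lambda>X. {Cmp C A B X h f | h. h \<in> arr C B X})"
    unfolding quotient_map_def by simp
qed

text \<open>The image of the identity of \<open>A\<close> is the universal element killed by
  \<open>f\<close>; through it, maps out of \<open>G\<close> are handled as elements.\<close>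

lemma rep_cokernel_generator:
  assumes "rep_cokernel A B f G p"
  shows "p A (Idn C A) \<in> carrier (FOb G A)" "FAr G A B f (p A (Idn C A)) = \<one>\<^bsub>FOb G B\<^esub>"
    "\<And>X h. X \<in> Obj C \<Longrightarrow> h \<in> arr C A X \<Longrightarrow> p X h = FAr G A X h (p A (Idn C A))"
    "\<And>X y. X \<in> Obj C \<Longrightarrow> y \<in> carrier (FOb G X) \<Longrightarrow> \<exists>h\<in>arr C A X. y = FAr G A X h (p A (Idn C A))"
proof -
  note * = rep_cokernelD[OF assms]
  show g: "p A (Idn C A) \<in> carrier (FOb G A)"
    using Nat_closed[OF *(6,1)] * by (simp add: Idn_arr)
  show ph: "p X h = FAr G A X h (p A (Idn C A))" if "X \<in> Obj C" "h \<in> arr C A X" for X h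
    using that * Nat_rep_apply by blast
  show "FAr G A B f (p A (Idn C A)) = \<one>\<^bsub>FOb G B\<^esub>"
    using ph[OF *(2,3)] quotient_mapD(2)[OF *(7,2), of f] *(1-3) Cmp_Idn_left[OF *(1-3)] Idn_arr[OF *(2)] by auto
  show "\<exists>h\<in>arr C A X. y = FAr G A X h (p A (Idn C A))" if "X \<in> Obj C" "y \<in> carrier (FOb G X)" for X y
    using quotient_mapD(4)[OF *(7), of X y] that ph by auto
qed

lemma rep_cokernel_map:
  assumes G: "rep_cokernel A B f G p" and F: "is_additive_functor C F"
    and x: "x \<in> carrier (FOb F A)" "FAr F A B f x = \<one>\<^bsub>FOb F B\<^esub>"
  obtains k where "k \<in> carrier (Nat C G F)" "k A (p A (Idn C A)) = x"
    "\<And>X h. X \<in> Obj C \<Longrightarrow> h \<in> arr C A X \<Longrightarrow> k X (p X h) = FAr F A X h x"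
proof -
  note * = rep_cokernelD[OF G]
  have F': "functor_on C F" using F by (rule additive_functor_on)
  have "yon F A x X (rep_map C A B f X h) = \<one>\<^bsub>FOb F X\<^esub>" if "X \<in> Obj C" "h \<in> carrier (FOb (rep C B) X)" for X h
    using that * x F' by (simp add: rep_map_apply yon_apply Cmp_arr FAr_Cmp FAr_one)
  from cokernel_factor[OF _ functor_on_rep functor_on_rep rep_map_Nat F yon_Nat[OF F' *(1) x(1)] this]
  obtain k where k: "k \<in> carrier (Nat C G F)"
    "\<And>X h. X \<in> Obj C \<Longrightarrow> h \<in> carrier (FOb (rep C A) X) \<Longrightarrow> k X (p X h) = yon F A x X h"
    using G unfolding rep_cokernel_def by metis
  show thesis
    using that[OF k(1)] k(2) x *(1) F' by (simp add: yon_apply Idn_arr FAr_Idn)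
qed

lemma rep_cokernel_Nat_eqI:
  assumes G: "rep_cokernel A B f G p" and F: "functor_on C F"
    and k: "k \<in> carrier (Nat C G F)" "k' \<in> carrier (Nat C G F)"
    and eq: "k A (p A (Idn C A)) = k' A (p A (Idn C A))"
  shows "k = k'"
proof (rule Nat_eqI[OF k])
  fix X y assume X: "X \<in> Obj C" "y \<in> carrier (FOb G X)"
  then obtain h where "h \<in> arr C A X" "y = FAr G A X h (p A (Idn C A))"
    using rep_cokernel_generator(4)[OF G] by blast
  then show "k X y = k' X y"
    using X eq rep_cokernelD[OF G] rep_cokernel_generator(1)[OF G]
    by (simp add: Nat_natural[OF k(1)] Nat_natural[OF k(2)])
qed

end

section \<open>Hereditary torsion pairs generated by finitely presented modules\<close>

definition left_orthogonal :: "('o, 'a) pcat \<Rightarrow> 'o set \<Rightarrow> 'o set" where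
  "left_orthogonal C \<F> = {X \<in> Obj C. \<forall>Y\<in>\<F>. arr C X Y = {\<one>\<^bsub>Hom C X Y\<^esub>}}"

definition right_orthogonal :: "('o, 'a) pcat \<Rightarrow> 'o set \<Rightarrow> 'o set" where
  "right_orthogonal C \<T> = {Y \<in> Obj C. \<forall>X\<in>\<T>. arr C X Y = {\<one>\<^bsub>Hom C X Y\<^esub>}}"

lemma Hom_orthogonal_iff_left:
  "Hom_orthogonal C \<T> \<F> \<longleftrightarrow> \<F> \<subseteq> Obj C \<and> \<T> \<subseteq> left_orthogonal C \<F>"
  by (auto simp: Hom_orthogonal_def left_orthogonal_def)

lemma Hom_orthogonal_iff_right:
  "Hom_orthogonal C \<T> \<F> \<longleftrightarrow> \<T> \<subseteq> Obj C \<and> \<F> \<subseteq> right_orthogonal C \<T>"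
  by (auto simp: Hom_orthogonal_def right_orthogonal_def)

text \<open>Otherwise one side could be enlarged to the full orthogonal of the other, against
  maximality.\<close>

lemma torsion_pair_orthogonal:
  assumes "torsion_pair C \<T> \<F>"
  shows "\<T> = left_orthogonal C \<F>" "\<F> = right_orthogonal C \<T>"
proof -
  have orth: "Hom_orthogonal C \<T> \<F>"
    and max: "\<And>\<T>' \<F>'. Hom_orthogonal C \<T>' \<F>' \<Longrightarrow> \<T> \<subseteq> \<T>' \<Longrightarrow> \<F> \<subseteq> \<F>' \<Longrightarrow> \<T>' = \<T> \<and> \<F>' = \<F>"
    using assms by (auto simp: torsion_pair_def)
  show "\<T> = left_orthogonal C \<F>"
    using max[of "left_orthogonal C \<F>" \<F>] orth unfolding Hom_orthogonal_iff_left by blast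
  show "\<F> = right_orthogonal C \<T>"
    using max[of \<T> "right_orthogonal C \<T>"] orth unfolding Hom_orthogonal_iff_right by blast
qed

context small_preadditive_category
begin

text \<open>\<open>(A, B, b)\<close> stands for an arrow \<open>b : A \<rightarrow> B\<close>; the module it presents is the cokernel
  of \<open>(b,-)\<close>. The submodule of that cokernel generated by the image of
  \<open>a : A \<rightarrow> D\<close> is \<open>(D,-)\<close> modulo \<open>annihilator A B b D a\<close>.\<close>

definition annihilator :: "'o \<Rightarrow> 'o \<Rightarrow> 'u \<Rightarrow> 'o \<Rightarrow> 'u \<Rightarrow> 'o \<Rightarrow> 'u set" where
  "annihilator A B b D a W = {u \<in> arr C D W. \<exists>v\<in>arr C B W. Cmp C A D W u a = Cmp C A B W v b}"

definition arrows :: "('o \<times> 'o \<times> 'u) set \<Rightarrow> bool" where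
  "arrows \<Phi> \<longleftrightarrow> (\<forall>(A, B, b)\<in>\<Phi>. A \<in> Obj C \<and> B \<in> Obj C \<and> b \<in> arr C A B)"

text \<open>An \<open>x\<close> killed by the annihilator is the same as a map to \<open>M\<close>
  from the cyclic submodule generated by \<open>a\<close>. So the members are the modules that
  receive no nonzero map from a cyclic submodule of a module presented by an arrow in
  \<open>\<Phi>\<close>.\<close>

definition torsionfree :: "('o \<times> 'o \<times> 'u) set \<Rightarrow> ('o, 'u, 'u) abfun set" where
  "torsionfree \<Phi> = {M. is_additive_functor C M \<and>
     (\<forall>(A, B, b)\<in>\<Phi>. \<forall>D\<in>Obj C. \<forall>a\<in>arr C A D. \<forall>x\<in>carrier (FOb M D).
        (\<forall>W\<in>Obj C. \<forall>u\<in>annihilator A B b D a W. FAr M D W u x = \<one>\<^bsub>FOb M W\<^esub>) \<longrightarrow> x = \<one>\<^bsub>FOb M D\<^esub>)}"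

lemma torsionfreeD:
  assumes "M \<in> torsionfree \<Phi>"
  shows "is_additive_functor C M"
    and "\<lbrakk>(A, B, b) \<in> \<Phi>; D \<in> Obj C; a \<in> arr C A D; x \<in> carrier (FOb M D);
      \<And>W u. W \<in> Obj C \<Longrightarrow> u \<in> annihilator A B b D a W \<Longrightarrow> FAr M D W u x = \<one>\<^bsub>FOb M W\<^esub>\<rbrakk>
      \<Longrightarrow> x = \<one>\<^bsub>FOb M D\<^esub>"
  using assms by (fastforce simp: torsionfree_def)+

lemma annihilator_subfunctor:
  assumes A: "A \<in> Obj C" "B \<in> Obj C" "b \<in> arr C A B" "D \<in> Obj C" "a \<in> arr C A D"
  shows "subfunctor C (rep C D) (annihilator A B b D a)"
  unfolding subfunctor_def rep_simps
proof (intro conjI ballI)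
  fix W assume W: "W \<in> Obj C"
  interpret H: comm_group "Hom C D W" using comm_group_Hom A W by blast
  show "subgroup (annihilator A B b D a W) (Hom C D W)"
  proof (rule H.subgroupI)
    show "annihilator A B b D a W \<noteq> {}"
      using Cmp_zero_left[OF A(1,4) W A(5)] Cmp_zero_left[OF A(1,2) W A(3)] Hom_closed(1)[OF A(2) W]
      by (auto simp: annihilator_def intro!: exI[of _ "\<one>\<^bsub>Hom C D W\<^esub>"] bexI[of _ "\<one>\<^bsub>Hom C B W\<^esub>"])
  next
    fix u assume "u \<in> annihilator A B b D a W"
    then obtain v where "u \<in> arr C D W" "v \<in> arr C B W" "Cmp C A D W u a = Cmp C A B W v b"
      by (auto simp: annihilator_def)
    then show "inv\<^bsub>Hom C D W\<^esub> u \<in> annihilator A B b D a W"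
      using A W by (auto simp: annihilator_def Hom_closed Cmp_minus_left intro!: bexI[of _ "inv\<^bsub>Hom C B W\<^esub> v"])
  next
    fix u u' assume "u \<in> annihilator A B b D a W" "u' \<in> annihilator A B b D a W"
    then obtain v v' where "u \<in> arr C D W" "v \<in> arr C B W" "Cmp C A D W u a = Cmp C A B W v b"
      "u' \<in> arr C D W" "v' \<in> arr C B W" "Cmp C A D W u' a = Cmp C A B W v' b"
      by (auto simp: annihilator_def)
    then show "u \<otimes>\<^bsub>Hom C D W\<^esub> u' \<in> annihilator A B b D a W"
      using A W by (auto simp: annihilator_def Hom_closed Cmp_add_left intro!: bexI[of _ "v \<otimes>\<^bsub>Hom C B W\<^esub> v'"])
  qed (auto simp: annihilator_def)
next
  fix W Z g u assume W: "W \<in> Obj C" "Z \<in> Obj C" "g \<in> arr C W Z" and u: "u \<in> annihilator A B b D a W"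
  then obtain v where v: "u \<in> arr C D W" "v \<in> arr C B W" "Cmp C A D W u a = Cmp C A B W v b"
    by (auto simp: annihilator_def)
  then have "Cmp C A D Z (Cmp C D W Z g u) a = Cmp C A B Z (Cmp C B W Z g v) b"
    using A W by (simp flip: Cmp_assoc)
  then show "Cmp C D W Z g u \<in> annihilator A B b D a Z"
    using A W v Cmp_arr by (auto simp: annihilator_def)
qed

text \<open>The cyclic submodule is realised as a quotient of \<open>(D,-)\<close>; its embedding
  into the presented module is supplied only where heredity is applied.\<close>

lemma cyclic_module:
  assumes "A \<in> Obj C" "B \<in> Obj C" "b \<in> arr C A B" "D \<in> Obj C" "a \<in> arr C A D"
  obtains Q q where "is_additive_functor C Q" "q \<in> carrier (Nat C (rep C D) Q)"
    "quotient_map C (rep C D) Q q (annihilator A B b D a)"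
proof -
  have R: "functor_on C (rep C D)" using assms functor_on_rep by blast
  obtain Q :: "('o, 'u, 'u) abfun" and q where Q: "is_additive_functor C Q"
    "quotient_map C (rep C D) Q q (annihilator A B b D a)"
    using functor_quotient[OF R _ annihilator_subfunctor[OF assms]] additive_functor_small[OF additive_rep]
      assms by metis
  show thesis using that[OF Q(1) quotient_map_natify[OF R Q(2)]] .
qed

lemma rep_quotient_map:
  fixes M Q :: "('o, 'u, 'u) abfun"
  assumes q: "quotient_map C (rep C D) Q q K" and Q: "functor_on C Q" and M: "functor_on C M" and D: "D \<in> Obj C"
    and x: "x \<in> carrier (FOb M D)" and ann: "\<And>W u. W \<in> Obj C \<Longrightarrow> u \<in> K W \<Longrightarrow> u \<in> arr C D W \<and> FAr M D W u x = \<one>\<^bsub>FOb M W\<^esub>"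
  obtains k where "k \<in> carrier (Nat C Q M)" "\<And>W u. W \<in> Obj C \<Longrightarrow> u \<in> arr C D W \<Longrightarrow> k W (q W u) = FAr M D W u x"
proof -
  have "yon M D x W u = \<one>\<^bsub>FOb M W\<^esub>" if "W \<in> Obj C" "u \<in> K W" for W u
    using ann that by (simp add: yon_apply)
  from quotient_factor_Nat[OF q functor_on_rep[OF D] Q M yon_Nat[OF M D x] this]
  obtain k where "k \<in> carrier (Nat C Q M)"
    "\<And>X h. X \<in> Obj C \<Longrightarrow> h \<in> carrier (FOb (rep C D) X) \<Longrightarrow> k X (q X h) = yon M D x X h"
    by metis
  then show thesis using that by (simp add: yon_apply)
qed

text \<open>The image of the identity of \<open>D\<close> generates \<open>Q\<close>.\<close>

lemma quotient_rep_trivial: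
  assumes q: "quotient_map C (rep C D) Q q K" and D: "D \<in> Obj C" and Q: "functor_on C Q" and M: "functor_on C M"
    and \<eta>: "\<eta> \<in> carrier (Nat C Q M)" and one: "\<eta> D (q D (Idn C D)) = \<one>\<^bsub>FOb M D\<^esub>"
    and W: "W \<in> Obj C" "y \<in> carrier (FOb Q W)"
  shows "\<eta> W y = \<one>\<^bsub>FOb M W\<^esub>"
proof -
  obtain u where u: "u \<in> arr C D W" "y = q W u"
    using quotient_mapD(4)[OF q W] by auto
  have "q W u = FAr Q D W u (q D (Idn C D))"
    using quotient_mapD(5)[OF q D W(1) u(1), of "Idn C D"] u D W by (simp add: Idn_arr Cmp_Idn_right)
  then have "\<eta> W y = FAr M D W u (\<eta> D (q D (Idn C D)))"
    using u D W Nat_natural[OF \<eta>] quotient_mapD(3)[OF q D] by (simp add: Idn_arr)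
  then show ?thesis using one FAr_one[OF M D W(1) u(1)] by simp
qed

text \<open>A map out of the cyclic module is determined by the image of its generator, and this
  image is killed by the whole annihilator.\<close>

lemma torsionfree_cyclic_trivial:
  assumes \<Phi>: "(A, B, b) \<in> \<Phi>" and D: "D \<in> Obj C" "a \<in> arr C A D" and M: "M \<in> torsionfree \<Phi>"
    and Q: "functor_on C Q" and q: "quotient_map C (rep C D) Q q (annihilator A B b D a)"
  shows "arr (abfun_cat C) Q M = {\<one>\<^bsub>Nat C Q M\<^esub>}"
proof -
  have M': "functor_on C M" using torsionfreeD(1)[OF M] by (rule additive_functor_on)
  have "\<eta> D (q D (Idn C D)) = \<one>\<^bsub>FOb M D\<^esub>" if \<eta>: "\<eta> \<in> carrier (Nat C Q M)" for \<eta>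
  proof (rule torsionfreeD(2)[OF M \<Phi> D])
    have i: "Idn C D \<in> carrier (FOb (rep C D) D)" using D by (simp add: Idn_arr)
    show "\<eta> D (q D (Idn C D)) \<in> carrier (FOb M D)"
      using Nat_closed[OF \<eta> D(1) quotient_mapD(3)[OF q D(1) i]] .
    fix W u assume W: "W \<in> Obj C" "u \<in> annihilator A B b D a W"
    then have u: "u \<in> arr C D W" by (simp add: annihilator_def)
    have "FAr M D W u (\<eta> D (q D (Idn C D))) = \<eta> W (q W (Cmp C D D W u (Idn C D)))"
      using Nat_natural[OF \<eta> D(1) W(1) u quotient_mapD(3)[OF q D(1) i]]
        quotient_mapD(5)[OF q D(1) W(1) u i] by simp
    also have "\<dots> = \<one>\<^bsub>FOb M W\<^esub>"
      using quotient_mapD(2)[OF q W(1), of u] u W D Nat_one[OF \<eta> Q M' W(1)] by (simp add: Cmp_Idn_right)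
    finally show "FAr M D W u (\<eta> D (q D (Idn C D))) = \<one>\<^bsub>FOb M W\<^esub>" .
  qed
  note one = this
  show ?thesis
    unfolding abfun_cat_simps Nat_trivial_iff[OF Q M']
    by (intro ballI, rule quotient_rep_trivial[OF q D(1) Q M']) (use one in auto)
qed

text \<open>Hereditariness: instead of an injective hull of \<open>M\<close>, extend a given map \<open>f : X \<rightarrow> M\<close> to a
  quotient of \<open>Y \<supseteq> X\<close> which is as small as possible; this quotient is again torsionfree.\<close>

lemma torsionfree_hereditary:
  assumes \<Phi>: "arrows \<Phi>" and X: "is_additive_functor C X" and i: "is_monomorphism (abfun_cat C) X Y i"
    and Y: "Y \<in> left_orthogonal (abfun_cat C) (torsionfree \<Phi>)"
  shows "X \<in> left_orthogonal (abfun_cat C) (torsionfree \<Phi>)"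
proof -
  have Ya: "is_additive_functor C Y" using Y by (simp add: left_orthogonal_def)
  have Y': "functor_on C Y" and X': "functor_on C X" using Ya X by (simp_all add: additive_functor_on)
  have iN: "i \<in> carrier (Nat C X Y)" using i by (simp add: is_monomorphism_def)
  have "f A x = \<one>\<^bsub>FOb M A\<^esub>"
    if M: "M \<in> torsionfree \<Phi>" and f: "f \<in> carrier (Nat C X M)" and A: "A \<in> Obj C" "x \<in> carrier (FOb X A)" for M f A x
  proof -
    have M': "functor_on C M" using torsionfreeD(1)[OF M] by (rule additive_functor_on)
    \<comment> \<open>Subfunctors of \<open>Y\<close> are coded as sets of pairs of an object and an
      element, which makes inclusion the order for Zorn's lemma. Good ones meet \<open>X\<close>
      only inside the kernel of \<open>f\<close>, so that \<open>f\<close> still factors through the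
      image of \<open>X\<close> in the quotient.\<close>
    define good where "good S \<longleftrightarrow> S \<subseteq> Obj C \<times> UNIV \<and> subfunctor C Y (\<lambda>A. {y. (A, y) \<in> S}) \<and>
      (\<forall>A\<in>Obj C. \<forall>x\<in>carrier (FOb X A). (A, i A x) \<in> S \<longrightarrow> f A x = \<one>\<^bsub>FOb M A\<^esub>)" for S
    have "\<exists>S\<in>Collect good. \<forall>S'\<in>Collect good. S \<subseteq> S' \<longrightarrow> S' = S"
    proof (rule subset_Zorn_nonempty)
      have "good {(A, \<one>\<^bsub>FOb Y A\<^esub>) | A. A \<in> Obj C}"
        unfolding good_def subfunctor_def
      proof (intro conjI ballI impI)
        show "subgroup {y. (A, y) \<in> {(A, \<one>\<^bsub>FOb Y A\<^esub>) | A. A \<in> Obj C}} (FOb Y A)" if "A \<in> Obj C" for A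
        proof -
          have "{y. (A, y) \<in> {(A, \<one>\<^bsub>FOb Y A\<^esub>) | A. A \<in> Obj C}} = {\<one>\<^bsub>FOb Y A\<^esub>}" using that by auto
          then show ?thesis using group.triv_subgroup[OF comm_group_imp_group[OF functor_group[OF Y' that]]] by simp
        qed
        show "f A x = \<one>\<^bsub>FOb M A\<^esub>"
          if "A \<in> Obj C" "x \<in> carrier (FOb X A)" "(A, i A x) \<in> {(A, \<one>\<^bsub>FOb Y A\<^esub>) | A. A \<in> Obj C}" for A x
        proof -
          have "x = \<one>\<^bsub>FOb X A\<^esub>" using monomorphism_inj[OF i X' Y' that(1,2)] that(3) by blast
          then show ?thesis using Nat_one[OF f X' M' that(1)] by simp
        qed
      qed (auto simp: FAr_one[OF Y'])
      then show "Collect good \<noteq> {}" by blast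
    next
      fix \<C> assume ne: "\<C> \<noteq> {}" and ch: "subset.chain (Collect good) \<C>"
      have g: "good S" if "S \<in> \<C>" for S using ch that by (auto simp: subset.chain_def)
      have tot: "S \<subseteq> S' \<or> S' \<subseteq> S" if "S \<in> \<C>" "S' \<in> \<C>" for S S'
        using ch that by (auto simp: subset.chain_def)
      have "subgroup {y. (A, y) \<in> \<Union>\<C>} (FOb Y A)" if A: "A \<in> Obj C" for A
      proof -
        have sg: "subgroup {y. (A, y) \<in> S} (FOb Y A)" if "S \<in> \<C>" for S
          using g[OF that] A by (simp add: good_def subfunctor_def)
        show ?thesis
        proof (rule group.subgroupI[OF comm_group_imp_group[OF functor_group[OF Y' A]]])
          show "{y. (A, y) \<in> \<Union>\<C>} \<subseteq> carrier (FOb Y A)"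
            using subgroup.subset[OF sg] by blast
          obtain S where "S \<in> \<C>" using ne by blast
          then show "{y. (A, y) \<in> \<Union>\<C>} \<noteq> {}"
            using subgroup.one_closed[OF sg] by blast
          show "inv\<^bsub>FOb Y A\<^esub> y \<in> {y. (A, y) \<in> \<Union>\<C>}" if "y \<in> {y. (A, y) \<in> \<Union>\<C>}" for y
            using that subgroup.m_inv_closed[OF sg] by blast
          show "y \<otimes>\<^bsub>FOb Y A\<^esub> z \<in> {y. (A, y) \<in> \<Union>\<C>}"
            if yz: "y \<in> {y. (A, y) \<in> \<Union>\<C>}" "z \<in> {y. (A, y) \<in> \<Union>\<C>}" for y z
          proof -
            obtain S S' where S: "S \<in> \<C>" "S' \<in> \<C>" "(A, y) \<in> S" "(A, z) \<in> S'" using yz by blast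
            then obtain R where "R \<in> \<C>" "(A, y) \<in> R" "(A, z) \<in> R" using tot[OF S(1,2)] by blast
            then show ?thesis using subgroup.m_closed[OF sg[of R], of y z] by blast
          qed
        qed
      qed
      moreover have "(B, FAr Y A B h y) \<in> \<Union>\<C>" if "A \<in> Obj C" "B \<in> Obj C" "h \<in> arr C A B" "(A, y) \<in> \<Union>\<C>" for A B h y
      proof -
        from that(4) obtain S where "S \<in> \<C>" "(A, y) \<in> S" by blast
        moreover from this have "(B, FAr Y A B h y) \<in> S"
          using g[of S] that(1-3) by (simp add: good_def subfunctor_def)
        ultimately show ?thesis by blast
      qed
      moreover have "f A x = \<one>\<^bsub>FOb M A\<^esub>" if "A \<in> Obj C" "x \<in> carrier (FOb X A)" "(A, i A x) \<in> \<Union>\<C>" for A x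
        using that g by (auto simp: good_def)
      moreover have "\<Union>\<C> \<subseteq> Obj C \<times> UNIV" using g by (auto simp: good_def)
      ultimately show "\<Union>\<C> \<in> Collect good"
        by (auto simp: good_def subfunctor_def)
    qed
    then obtain S where S: "good S" and max: "\<And>S'. good S' \<Longrightarrow> S \<subseteq> S' \<Longrightarrow> S' = S"
      by auto
    define K where "K A = {y. (A, y) \<in> S}" for A
    have K: "subfunctor C Y K" using S unfolding good_def K_def by blast
    have Ksub: "subgroup (K A) (FOb Y A)" if "A \<in> Obj C" for A using K that by (simp add: subfunctor_def)
    have Kf: "f A x = \<one>\<^bsub>FOb M A\<^esub>" if "A \<in> Obj C" "x \<in> carrier (FOb X A)" "i A x \<in> K A" for A x
      using S that by (simp add: good_def K_def)
    obtain Q :: "('o, 'u, 'u) abfun" and q0 where Q: "is_additive_functor C Q" and q0: "quotient_map C Y Q q0 K"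
      using functor_quotient[OF Y' additive_functor_small[OF Ya] K] .
    define q where "q = natify C Y q0"
    have qN: "q \<in> carrier (Nat C Y Q)" and q: "quotient_map C Y Q q K"
      using quotient_map_natify[OF Y' q0] by (simp_all add: q_def)
    have Q': "functor_on C Q" using Q by (rule additive_functor_on)
    \<comment> \<open>Maximality of \<open>K\<close> makes the quotient of \<open>Y\<close> by
      \<open>K\<close> torsionfree: an element \<open>y\<close> violating this could be added to
      \<open>K\<close>.\<close>
    have KD: "y \<in> K D" if \<Phi>': "(A, B, b) \<in> \<Phi>" and D: "D \<in> Obj C" "a \<in> arr C A D" and y: "y \<in> carrier (FOb Y D)"
        and ann: "\<And>W u. W \<in> Obj C \<Longrightarrow> u \<in> annihilator A B b D a W \<Longrightarrow> FAr Y D W u y \<in> K W" for A B b D a y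
    proof -
      have A: "A \<in> Obj C" "B \<in> Obj C" "b \<in> arr C A B" using \<Phi> \<Phi>' by (auto simp: arrows_def)
      \<comment> \<open>The subfunctor generated by \<open>K\<close> and \<open>y\<close>.\<close>
      define K' where "K' W = {k \<otimes>\<^bsub>FOb Y W\<^esub> FAr Y D W v y | k v. k \<in> K W \<and> v \<in> arr C D W}" for W
      define S' where "S' = {(W, z). W \<in> Obj C \<and> z \<in> K' W}"
      have Kc: "k \<in> carrier (FOb Y W)" if "W \<in> Obj C" "k \<in> K W" for W k
        using subfunctor_subset[OF K] that by blast
      have "subgroup (K' W) (FOb Y W)" if W: "W \<in> Obj C" for W
      proof -
        interpret G: comm_group "FOb Y W" using functor_group[OF Y' W] .
        interpret KW: subgroup "K W" "FOb Y W" using Ksub[OF W] .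
        show ?thesis
        proof (rule G.subgroupI)
          show "K' W \<subseteq> carrier (FOb Y W)"
            using Kc[OF W] FAr_closed[OF Y' D(1) W _ y] by (auto simp: K'_def)
          show "K' W \<noteq> {}"
            unfolding K'_def using KW.one_closed Hom_closed(1)[OF D(1) W] by blast
          show "inv\<^bsub>FOb Y W\<^esub> z \<in> K' W" if "z \<in> K' W" for z
          proof -
            from that obtain k v where kv: "z = k \<otimes>\<^bsub>FOb Y W\<^esub> FAr Y D W v y" "k \<in> K W" "v \<in> arr C D W"
              by (auto simp: K'_def)
            then have "inv\<^bsub>FOb Y W\<^esub> z = inv\<^bsub>FOb Y W\<^esub> k \<otimes>\<^bsub>FOb Y W\<^esub> FAr Y D W (inv\<^bsub>Hom C D W\<^esub> v) y"
              using Kc[OF W] W D y FAr_closed[OF Y' D(1) W _ y]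
              by (simp add: FAr_minus[OF Y'] G.inv_mult)
            then show ?thesis using kv KW.m_inv_closed Hom_closed(2)[OF D(1) W] by (auto simp: K'_def)
          qed
          show "z \<otimes>\<^bsub>FOb Y W\<^esub> z' \<in> K' W" if z: "z \<in> K' W" "z' \<in> K' W" for z z'
          proof -
            obtain k v k' v' where kv: "z = k \<otimes>\<^bsub>FOb Y W\<^esub> FAr Y D W v y" "k \<in> K W" "v \<in> arr C D W"
              "z' = k' \<otimes>\<^bsub>FOb Y W\<^esub> FAr Y D W v' y" "k' \<in> K W" "v' \<in> arr C D W"
              using z by (auto simp: K'_def)
            have "z \<otimes>\<^bsub>FOb Y W\<^esub> z' = (k \<otimes>\<^bsub>FOb Y W\<^esub> k') \<otimes>\<^bsub>FOb Y W\<^esub> FAr Y D W (v \<otimes>\<^bsub>Hom C D W\<^esub> v') y"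
              using kv Kc[OF W] W D y FAr_closed[OF Y' D(1) W _ y]
              by (simp add: FAr_add[OF Y'] G.m_ac)
            then show ?thesis using kv KW.m_closed Hom_closed(3)[OF D(1) W] by (auto simp: K'_def)
          qed
        qed
      qed
      moreover have "FAr Y W Z h z \<in> K' Z" if W: "W \<in> Obj C" "Z \<in> Obj C" "h \<in> arr C W Z" "z \<in> K' W" for W Z h z
      proof -
        obtain k v where kv: "z = k \<otimes>\<^bsub>FOb Y W\<^esub> FAr Y D W v y" "k \<in> K W" "v \<in> arr C D W"
          using W by (auto simp: K'_def)
        then have "FAr Y W Z h z = FAr Y W Z h k \<otimes>\<^bsub>FOb Y Z\<^esub> FAr Y D Z (Cmp C D W Z h v) y"
          using W D y Kc by (simp add: FAr_mult[OF Y'] FAr_Cmp[OF Y'] FAr_closed[OF Y'])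
        moreover have "FAr Y W Z h k \<in> K Z" using K W kv by (simp add: subfunctor_def)
        ultimately show ?thesis using Cmp_arr[OF D(1) W(1,2) kv(3) W(3)] by (auto simp: K'_def)
      qed
      \<comment> \<open>Goodness survives the enlargement: if \<open>x\<close> falls into
        \<open>K' W\<close> through the arrow \<open>v\<close>, the annihilator of
        \<open>Cmp C A D W v a\<close> carries \<open>x\<close> into \<open>K\<close>, hence carries
        \<open>f W x\<close> to zero, and \<open>M\<close> is torsionfree.\<close>
      moreover have "f W x = \<one>\<^bsub>FOb M W\<^esub>" if W: "W \<in> Obj C" "x \<in> carrier (FOb X W)" "i W x \<in> K' W" for W x
      proof -
        obtain k v where kv: "i W x = k \<otimes>\<^bsub>FOb Y W\<^esub> FAr Y D W v y" "k \<in> K W" "v \<in> arr C D W"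
          using W by (auto simp: K'_def)
        show ?thesis
        proof (rule torsionfreeD(2)[OF M \<Phi>' W(1)])
          show "Cmp C A D W v a \<in> arr C A W" using Cmp_arr A D W kv by blast
          show "f W x \<in> carrier (FOb M W)" using Nat_closed[OF f W(1,2)] .
          fix Z u assume Z: "Z \<in> Obj C" and u: "u \<in> annihilator A B b W (Cmp C A D W v a) Z"
          then obtain v' where u': "u \<in> arr C W Z" "v' \<in> arr C B Z"
            "Cmp C A W Z u (Cmp C A D W v a) = Cmp C A B Z v' b"
            by (auto simp: annihilator_def)
          have uv: "Cmp C D W Z u v \<in> annihilator A B b D a Z"
            using u' A D W Z kv Cmp_assoc[OF A(1) D(1) W(1) Z D(2) kv(3) u'(1)] by (auto simp: annihilator_def Cmp_arr)
          have "i Z (FAr X W Z u x) = FAr Y W Z u k \<otimes>\<^bsub>FOb Y Z\<^esub> FAr Y D Z (Cmp C D W Z u v) y"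
            using W Z u' D y kv Kc
            by (simp add: Nat_natural[OF iN] FAr_mult[OF Y'] FAr_Cmp[OF Y'] FAr_closed[OF Y'])
          moreover have "FAr Y W Z u k \<in> K Z" using K W Z u' kv by (simp add: subfunctor_def)
          ultimately have "i Z (FAr X W Z u x) \<in> K Z"
            using ann[OF Z uv] subgroup.m_closed[OF Ksub[OF Z]] by simp
          then have "f Z (FAr X W Z u x) = \<one>\<^bsub>FOb M Z\<^esub>"
            using Kf[OF Z] FAr_closed[OF X' W(1) Z u'(1) W(2)] by blast
          then show "FAr M W Z u (f W x) = \<one>\<^bsub>FOb M Z\<^esub>"
            using Nat_natural[OF f W(1) Z u'(1) W(2)] by simp
        qed
      qed
      ultimately have "good S'"
        by (auto simp: good_def S'_def subfunctor_def)
      moreover have "S \<subseteq> S'"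
      proof clarify
        fix W k assume k: "(W, k) \<in> S"
        then have W: "W \<in> Obj C" and kK: "k \<in> K W" using S by (auto simp: good_def K_def)
        interpret G: comm_group "FOb Y W" using functor_group[OF Y' W] .
        have "k = k \<otimes>\<^bsub>FOb Y W\<^esub> FAr Y D W \<one>\<^bsub>Hom C D W\<^esub> y"
          using FAr_zero[OF Y' D(1) W y] Kc[OF W kK] by simp
        then show "(W, k) \<in> S'"
          using W kK Hom_closed(1)[OF D(1) W] by (auto simp: S'_def K'_def)
      qed
      ultimately have "S' = S" by (rule max)
      moreover have "(D, y) \<in> S'"
      proof -
        interpret G: comm_group "FOb Y D" using functor_group[OF Y' D(1)] .
        have "y = \<one>\<^bsub>FOb Y D\<^esub> \<otimes>\<^bsub>FOb Y D\<^esub> FAr Y D D (Idn C D) y"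
          using FAr_Idn[OF Y' D(1) y] y by simp
        then show ?thesis
          using D Idn_arr subgroup.one_closed[OF Ksub[OF D(1)]] by (auto simp: S'_def K'_def)
      qed
      ultimately show "y \<in> K D" by (simp add: K_def)
    qed
    have "Q \<in> torsionfree \<Phi>"
      unfolding torsionfree_def
    proof (clarsimp simp: Q)
      fix A B b D a z assume \<Phi>': "(A, B, b) \<in> \<Phi>" and D: "D \<in> Obj C" "a \<in> arr C A D" and z: "z \<in> carrier (FOb Q D)"
        and ann: "\<forall>W\<in>Obj C. \<forall>u\<in>annihilator A B b D a W. FAr Q D W u z = \<one>\<^bsub>FOb Q W\<^esub>"
      obtain y where y: "y \<in> carrier (FOb Y D)" "z = q D y"
        using quotient_mapD(4)[OF q D(1) z] by blast
      have "y \<in> K D"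
      proof (rule KD[OF \<Phi>' D y(1)])
        fix W u assume W: "W \<in> Obj C" "u \<in> annihilator A B b D a W"
        then have u: "u \<in> arr C D W" by (simp add: annihilator_def)
        show "FAr Y D W u y \<in> K W"
          using W u y D ann quotient_mapD(2)[OF q W(1) FAr_closed[OF Y' D(1) W(1) u y(1)]]
            quotient_mapD(5)[OF q D(1) W(1) u y(1)] by simp
      qed
      then show "z = \<one>\<^bsub>FOb Q D\<^esub>" using y quotient_mapD(2)[OF q D(1) y(1)] by simp
    qed
    \<comment> \<open>\<open>Y\<close> has no nonzero map to a torsionfree module, so the maximal
      good subfunctor is all of \<open>Y\<close>, and \<open>f\<close> vanishes.\<close>
    then have "carrier (Nat C Y Q) = {\<one>\<^bsub>Nat C Y Q\<^esub>}"
      using Y by (simp add: left_orthogonal_def)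
    then have "q = \<one>\<^bsub>Nat C Y Q\<^esub>" using qN by blast
    then have "i A x \<in> K A"
      using quotient_mapD(2)[OF q A(1) Nat_closed[OF iN A]] Nat_closed[OF iN A] A by (simp add: Nat_one_apply)
    then show ?thesis using Kf A by blast
  qed
  then show ?thesis
    using X Nat_trivial_iff[OF X' additive_functor_on[OF torsionfreeD(1)]]
    by (auto simp: left_orthogonal_def)
qed

text \<open>Maximality on the torsionfree side holds because the cyclic modules lie in the left
  orthogonal, so that anything orthogonal to it satisfies the elementwise condition. The torsion
  side is a full orthogonal by definition, and hereditary by the preceding lemma.\<close>

lemma torsionfree_hereditary_pair:
  assumes \<Phi>: "arrows \<Phi>"
  shows "hereditary_torsion_pair (abfun_cat C) (left_orthogonal (abfun_cat C) (torsionfree \<Phi>)) (torsionfree \<Phi>)"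
    (is "hereditary_torsion_pair ?M ?T ?F")
proof -
  have "\<T>' = ?T \<and> \<F>' = ?F" if orth: "Hom_orthogonal ?M \<T>' \<F>'" and T: "?T \<subseteq> \<T>'" and F: "?F \<subseteq> \<F>'" for \<T>' \<F>'
  proof -
    have "M \<in> ?F" if M: "M \<in> \<F>'" for M
    proof -
      have Ma: "is_additive_functor C M" using orth M by (auto simp: Hom_orthogonal_def)
      have M': "functor_on C M" using Ma by (rule additive_functor_on)
      have "x = \<one>\<^bsub>FOb M D\<^esub>" if \<Phi>': "(A, B, b) \<in> \<Phi>" and D: "D \<in> Obj C" "a \<in> arr C A D" and x: "x \<in> carrier (FOb M D)"
          and ann: "\<And>W u. W \<in> Obj C \<Longrightarrow> u \<in> annihilator A B b D a W \<Longrightarrow> FAr M D W u x = \<one>\<^bsub>FOb M W\<^esub>" for A B b D a x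
      proof -
        have A: "A \<in> Obj C" "B \<in> Obj C" "b \<in> arr C A B" using \<Phi> \<Phi>' by (auto simp: arrows_def)
        obtain Q q where Q: "is_additive_functor C Q" "q \<in> carrier (Nat C (rep C D) Q)"
          and q: "quotient_map C (rep C D) Q q (annihilator A B b D a)"
          using cyclic_module[OF A D] .
        have Q': "functor_on C Q" using Q(1) by (rule additive_functor_on)
        have "Q \<in> ?T"
          using Q torsionfree_cyclic_trivial[OF \<Phi>' D _ Q' q] by (auto simp: left_orthogonal_def)
        then have triv: "carrier (Nat C Q M) = {\<one>\<^bsub>Nat C Q M\<^esub>}"
          using T orth M by (auto simp: Hom_orthogonal_def)
        have "u \<in> arr C D W \<and> FAr M D W u x = \<one>\<^bsub>FOb M W\<^esub>" if "W \<in> Obj C" "u \<in> annihilator A B b D a W" for W u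
          using ann that by (simp add: annihilator_def)
        from rep_quotient_map[OF q Q' M' D(1) x this]
        obtain k where k: "k \<in> carrier (Nat C Q M)" "\<And>W u. W \<in> Obj C \<Longrightarrow> u \<in> arr C D W \<Longrightarrow> k W (q W u) = FAr M D W u x"
          by metis
        have "k D (q D (Idn C D)) = \<one>\<^bsub>FOb M D\<^esub>"
          using k(1) triv D Nat_closed[OF Q(2) D(1)] by (auto simp: Nat_one_apply Idn_arr)
        then show ?thesis
          using k(2)[OF D(1) Idn_arr[OF D(1)]] FAr_Idn[OF M' D(1) x] by simp
      qed
      then show ?thesis using Ma by (fastforce simp: torsionfree_def)
    qed
    then have "\<F>' = ?F" using F by blast
    then show ?thesis using orth T unfolding Hom_orthogonal_iff_left by blast
  qed
  moreover have "Hom_orthogonal ?M ?T ?F"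
    using torsionfreeD(1) by (auto simp: Hom_orthogonal_iff_left)
  ultimately show ?thesis
    using torsionfree_hereditary[OF \<Phi>] by (auto simp: hereditary_torsion_pair_def torsion_pair_def)
qed

text \<open>Cyclic submodules of modules in \<open>\<T>\<close> are again in \<open>\<T>\<close> by
  heredity, so no member of \<open>\<F>\<close> receives a nonzero map from them. Hence
  \<open>torsionfree \<Phi>\<close> belongs to the smallest hereditary torsion class containing the
  presented modules.\<close>

lemma torsionfree_largest:
  assumes pair: "hereditary_torsion_pair (abfun_cat C) \<T> \<F>"
    and \<Phi>: "\<And>A B b. (A, B, b) \<in> \<Phi> \<Longrightarrow> \<exists>G p. rep_cokernel A B b G p \<and> G \<in> \<T>"
  shows "\<F> \<subseteq> torsionfree \<Phi>"
proof
  fix M assume M: "M \<in> \<F>"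
  have orth: "Hom_orthogonal (abfun_cat C) \<T> \<F>" using pair by (simp add: hereditary_torsion_pair_def torsion_pair_def)
  have Ma: "is_additive_functor C M" using orth M by (auto simp: Hom_orthogonal_def)
  have M': "functor_on C M" using Ma by (rule additive_functor_on)
  have "x = \<one>\<^bsub>FOb M D\<^esub>" if \<Phi>': "(A, B, b) \<in> \<Phi>" and D: "D \<in> Obj C" "a \<in> arr C A D" and x: "x \<in> carrier (FOb M D)"
      and ann: "\<And>W u. W \<in> Obj C \<Longrightarrow> u \<in> annihilator A B b D a W \<Longrightarrow> FAr M D W u x = \<one>\<^bsub>FOb M W\<^esub>" for A B b D a x
  proof -
    obtain G p where G: "rep_cokernel A B b G p" "G \<in> \<T>" using \<Phi>[OF \<Phi>'] by blast
    note * = rep_cokernelD[OF G(1)]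
    obtain Q q where Q: "is_additive_functor C Q" "q \<in> carrier (Nat C (rep C D) Q)"
      and q: "quotient_map C (rep C D) Q q (annihilator A B b D a)"
      using cyclic_module[OF *(1-3) D] .
    have Q': "functor_on C Q" using Q(1) by (rule additive_functor_on)
    have pa: "p D a \<in> carrier (FOb G D)" using Nat_closed[OF *(6) D(1)] D by simp
    have Gp: "FAr G D W u (p D a) = p W (Cmp C A D W u a)" if "W \<in> Obj C" "u \<in> arr C D W" for W u
      using Nat_natural[OF *(6) D(1) that, of a] D by simp
    have Gpu: "FAr G D W u (p D a) = \<one>\<^bsub>FOb G W\<^esub> \<longleftrightarrow> u \<in> annihilator A B b D a W"
      if "W \<in> Obj C" "u \<in> arr C D W" for W u
      using quotient_mapD(2)[OF *(7) that(1), of "Cmp C A D W u a"] that D * by (auto simp: Gp annihilator_def Cmp_arr)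
    have "u \<in> arr C D W \<and> FAr G D W u (p D a) = \<one>\<^bsub>FOb G W\<^esub>" if "W \<in> Obj C" "u \<in> annihilator A B b D a W" for W u
      using Gpu that by (simp add: annihilator_def)
    from rep_quotient_map[OF q Q' *(5) D(1) pa this]
    obtain k where k: "k \<in> carrier (Nat C Q G)"
      "\<And>W u. W \<in> Obj C \<Longrightarrow> u \<in> arr C D W \<Longrightarrow> k W (q W u) = FAr G D W u (p D a)" by metis
    \<comment> \<open>The annihilator is exactly the kernel of the map
      \<open>(D,-) \<rightarrow> G\<close> given by \<open>a\<close>, so the cyclic quotient embeds
      in \<open>G\<close>.\<close>
    have "is_monomorphism (abfun_cat C) Q G k"
    proof (rule is_monomorphismI[OF Q' *(5) k(1)])
      fix W y assume W: "W \<in> Obj C" "y \<in> carrier (FOb Q W)" "k W y = \<one>\<^bsub>FOb G W\<^esub>"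
      obtain u where u: "u \<in> arr C D W" "y = q W u"
        using quotient_mapD(4)[OF q W(1,2)] by auto
      then show "y = \<one>\<^bsub>FOb Q W\<^esub>"
        using Gpu[OF W(1) u(1)] k(2)[OF W(1) u(1)] W quotient_mapD(2)[OF q W(1), of u] by simp
    qed
    then have "Q \<in> \<T>" using pair G Q by (auto simp: hereditary_torsion_pair_def)
    then have triv: "carrier (Nat C Q M) = {\<one>\<^bsub>Nat C Q M\<^esub>}"
      using orth M by (auto simp: Hom_orthogonal_def)
    have "u \<in> arr C D W \<and> FAr M D W u x = \<one>\<^bsub>FOb M W\<^esub>" if "W \<in> Obj C" "u \<in> annihilator A B b D a W" for W u
      using ann that by (simp add: annihilator_def)
    from rep_quotient_map[OF q Q' M' D(1) x this]
    obtain k where k: "k \<in> carrier (Nat C Q M)" "\<And>W u. W \<in> Obj C \<Longrightarrow> u \<in> arr C D W \<Longrightarrow> k W (q W u) = FAr M D W u x"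
      by metis
    have "k D (q D (Idn C D)) = \<one>\<^bsub>FOb M D\<^esub>"
      using k(1) triv D Nat_closed[OF Q(2) D(1)] by (auto simp: Nat_one_apply Idn_arr)
    then show ?thesis
      using k(2)[OF D(1) Idn_arr[OF D(1)]] FAr_Idn[OF M' D(1) x] by simp
  qed
  then show "M \<in> torsionfree \<Phi>" using Ma by (fastforce simp: torsionfree_def)
qed

text \<open>A presented module is its own cyclic submodule generated by the identity, so it falls
  under the cyclic case.\<close>

lemma rep_cokernel_torsion:
  assumes G: "rep_cokernel A B b G p" and \<Phi>: "(A, B, b) \<in> \<Phi>"
  shows "G \<in> left_orthogonal (abfun_cat C) (torsionfree \<Phi>)"
proof -
  note * = rep_cokernelD[OF G]
  have "annihilator A B b A (Idn C A) W = {Cmp C A B W h b | h. h \<in> arr C B W}" if "W \<in> Obj C" for W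
    using that * by (auto simp: annihilator_def Cmp_Idn_right Cmp_arr)
  then have "quotient_map C (rep C A) G p (annihilator A B b A (Idn C A))"
    using *(7) unfolding quotient_map_def by simp
  from torsionfree_cyclic_trivial[OF \<Phi> *(1) Idn_arr[OF *(1)] _ *(5) this] show ?thesis
    using *(4) by (auto simp: left_orthogonal_def)
qed

text \<open>The finite type condition with the generating class made explicit and without reference
  to compact objects.\<close>

definition generated_torsion_pair ::
  "('o, 'u, 'u) abfun set \<Rightarrow> ('o, 'u, 'u) abfun set \<Rightarrow> ('o, 'u, 'u) abfun set \<Rightarrow> bool" where
  "generated_torsion_pair \<S> \<T> \<F> \<longleftrightarrow> hereditary_torsion_pair (abfun_cat C) \<T> \<F> \<and> \<S> \<subseteq> \<T> \<and>
     (\<forall>\<T>' \<F>'. hereditary_torsion_pair (abfun_cat C) \<T>' \<F>' \<longrightarrow> \<S> \<subseteq> \<T>' \<longrightarrow> \<T> \<subseteq> \<T>')"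

text \<open>All presentations of members of \<open>\<S>\<close> are collected into
  \<open>\<Phi>\<close>. One inclusion is heredity; the other holds because the pair built from
  \<open>torsionfree \<Phi>\<close> competes in the minimality of \<open>\<T>\<close>.\<close>

lemma generated_torsion_pair_torsionfree:
  assumes \<S>: "\<And>G. G \<in> \<S> \<Longrightarrow> \<exists>A B b p. rep_cokernel A B b G p"
    and gen: "generated_torsion_pair \<S> \<T> \<F>"
  shows "\<exists>\<Phi>. arrows \<Phi> \<and> \<F> = torsionfree \<Phi>"
proof -
  define \<Phi> where "\<Phi> = {(A, B, b). \<exists>G\<in>\<S>. \<exists>p. rep_cokernel A B b G p}"
  have \<Phi>: "arrows \<Phi>" by (auto simp: arrows_def \<Phi>_def dest: rep_cokernelD)
  have pair: "hereditary_torsion_pair (abfun_cat C) \<T> \<F>" and sub: "\<S> \<subseteq> \<T>"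
    using gen by (simp_all add: generated_torsion_pair_def)
  have "\<F> \<subseteq> torsionfree \<Phi>"
    using sub by (intro torsionfree_largest[OF pair]) (auto simp: \<Phi>_def)
  moreover have "torsionfree \<Phi> \<subseteq> \<F>"
  proof -
    have "\<S> \<subseteq> left_orthogonal (abfun_cat C) (torsionfree \<Phi>)"
    proof
      fix G assume "G \<in> \<S>"
      then obtain A B b p where "rep_cokernel A B b G p" "(A, B, b) \<in> \<Phi>" using \<S> by (fastforce simp: \<Phi>_def)
      then show "G \<in> left_orthogonal (abfun_cat C) (torsionfree \<Phi>)" by (rule rep_cokernel_torsion)
    qed
    then have "\<T> \<subseteq> left_orthogonal (abfun_cat C) (torsionfree \<Phi>)"
      using gen torsionfree_hereditary_pair[OF \<Phi>] unfolding generated_torsion_pair_def by blast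
    then have "torsionfree \<Phi> \<subseteq> right_orthogonal (abfun_cat C) \<T>"
      using torsionfreeD(1) by (auto simp: left_orthogonal_def right_orthogonal_def)
    then show ?thesis
      using torsion_pair_orthogonal(2) pair by (auto simp: hereditary_torsion_pair_def)
  qed
  ultimately show ?thesis using \<Phi> by blast
qed

lemma torsionfree_generated:
  assumes \<Phi>: "arrows \<Phi>"
  shows "\<exists>\<S> \<T>. (\<forall>G\<in>\<S>. \<exists>(A, B, b)\<in>\<Phi>. \<exists>p. rep_cokernel A B b G p) \<and> generated_torsion_pair \<S> \<T> (torsionfree \<Phi>)"
proof -
  define \<S> where "\<S> = {G. \<exists>(A, B, b)\<in>\<Phi>. \<exists>p. rep_cokernel A B b G p}"
  have "left_orthogonal (abfun_cat C) (torsionfree \<Phi>) \<subseteq> \<T>'"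
    if pair: "hereditary_torsion_pair (abfun_cat C) \<T>' \<F>'" and sub: "\<S> \<subseteq> \<T>'" for \<T>' \<F>'
  proof -
    have "\<exists>G p. rep_cokernel A B b G p \<and> G \<in> \<T>'" if "(A, B, b) \<in> \<Phi>" for A B b
    proof -
      have "A \<in> Obj C" "B \<in> Obj C" "b \<in> arr C A B" using \<Phi> that by (auto simp: arrows_def)
      then obtain G p where "rep_cokernel A B b G p" by (rule rep_cokernel_exists)
      then show ?thesis using that sub by (fastforce simp: \<S>_def)
    qed
    then have "\<F>' \<subseteq> torsionfree \<Phi>" by (rule torsionfree_largest[OF pair])
    then show ?thesis
      using torsion_pair_orthogonal(1)[of "abfun_cat C" \<T>' \<F>'] pair
      by (auto simp: hereditary_torsion_pair_def left_orthogonal_def)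
  qed
  moreover have "\<S> \<subseteq> left_orthogonal (abfun_cat C) (torsionfree \<Phi>)"
    using rep_cokernel_torsion by (auto simp: \<S>_def)
  ultimately have "generated_torsion_pair \<S> (left_orthogonal (abfun_cat C) (torsionfree \<Phi>)) (torsionfree \<Phi>)"
    using torsionfree_hereditary_pair[OF \<Phi>] by (auto simp: generated_torsion_pair_def)
  moreover have "\<forall>G\<in>\<S>. \<exists>(A, B, b)\<in>\<Phi>. \<exists>p. rep_cokernel A B b G p" by (simp add: \<S>_def)
  ultimately show ?thesis by blast
qed

end

section \<open>Products and directed colimits of modules\<close>

lemma product_functor_simps [simp]:
  "carrier (FOb (product_functor J V) X) = (\<Pi>\<^sub>E j\<in>J. carrier (FOb (V j) X))"
  "\<one>\<^bsub>FOb (product_functor J V) X\<^esub> = (\<lambda>j\<in>J. \<one>\<^bsub>FOb (V j) X\<^esub>)"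
  "v \<otimes>\<^bsub>FOb (product_functor J V) X\<^esub> w = (\<lambda>j\<in>J. v j \<otimes>\<^bsub>FOb (V j) X\<^esub> w j)"
  "FAr (product_functor J V) X Y f v = (\<lambda>j\<in>J. FAr (V j) X Y f (v j))"
  by (simp_all add: product_functor_def)

text \<open>The kernel of the passage from the product to the reduced product over the filter
  generated by the tails of \<open>J\<close>.\<close>

definition eventually_zero ::
  "'j set \<Rightarrow> 'j rel \<Rightarrow> ('j \<Rightarrow> ('o, 'a, 'b) abfun) \<Rightarrow> 'o \<Rightarrow> ('j \<Rightarrow> 'b) set" where
  "eventually_zero J r V X = {v \<in> \<Pi>\<^sub>E j\<in>J. carrier (FOb (V j) X).
     \<exists>j\<in>J. \<forall>k\<in>J. (j, k) \<in> r \<longrightarrow> v k = \<one>\<^bsub>FOb (V k) X\<^esub>}"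

lemma directed_posetD:
  assumes "directed_poset J r"
  shows "J \<noteq> {}" "\<And>i. i \<in> J \<Longrightarrow> (i, i) \<in> r" "\<And>i j. (i, j) \<in> r \<Longrightarrow> i \<in> J \<and> j \<in> J"
    "\<And>i j k. (i, j) \<in> r \<Longrightarrow> (j, k) \<in> r \<Longrightarrow> (i, k) \<in> r"
    "\<And>i j. i \<in> J \<Longrightarrow> j \<in> J \<Longrightarrow> \<exists>k\<in>J. (i, k) \<in> r \<and> (j, k) \<in> r"
  using assms
  by (auto simp: directed_poset_def partial_order_on_def preorder_on_def refl_on_def dest: transD)

lemma functor_on_product_inv:
  assumes "\<And>j. j \<in> J \<Longrightarrow> functor_on C (V j)" "X \<in> Obj C" "v \<in> (\<Pi>\<^sub>E j\<in>J. carrier (FOb (V j) X))"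
  shows "inv\<^bsub>FOb (product_functor J V) X\<^esub> v = (\<lambda>j\<in>J. inv\<^bsub>FOb (V j) X\<^esub> v j)"
  using assms by (simp add: product_functor_def comm_group_imp_group functor_group[of C])

lemma subfunctor_eventually_zero:
  assumes J: "directed_poset J r" and V: "\<And>j. j \<in> J \<Longrightarrow> functor_on C (V j)"
  shows "subfunctor C (product_functor J V) (eventually_zero J r V)"
  unfolding subfunctor_def
proof (intro conjI ballI)
  note * = directed_posetD[OF J]
  fix X assume X: "X \<in> Obj C"
  note V1 = functor_closed[OF V X]
  have VG: "comm_group (FOb (V j) X)" if "j \<in> J" for j using functor_group[OF V[OF that] X] .
  have one: "\<one>\<^bsub>FOb (V j) X\<^esub> \<otimes>\<^bsub>FOb (V j) X\<^esub> \<one>\<^bsub>FOb (V j) X\<^esub> = \<one>\<^bsub>FOb (V j) X\<^esub>"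
    "inv\<^bsub>FOb (V j) X\<^esub> \<one>\<^bsub>FOb (V j) X\<^esub> = \<one>\<^bsub>FOb (V j) X\<^esub>" if "j \<in> J" for j
    using comm_group_imp_group[OF VG[OF that]]
    by (simp_all add: monoid.inv_one monoid.r_one V1(1)[OF that] Group.group.is_monoid)
  show "subgroup (eventually_zero J r V X) (FOb (product_functor J V) X)"
  proof (rule group.subgroupI[OF comm_group_imp_group[OF functor_group[OF functor_on_product[OF V] X]]])
    show "eventually_zero J r V X \<noteq> {}"
    proof -
      obtain j where "j \<in> J" using *(1) by blast
      then have "(\<lambda>j\<in>J. \<one>\<^bsub>FOb (V j) X\<^esub>) \<in> eventually_zero J r V X"
        using V1(1) by (auto simp: eventually_zero_def)
      then show ?thesis by blast
    qed
    show "inv\<^bsub>FOb (product_functor J V) X\<^esub> v \<in> eventually_zero J r V X"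
      if v: "v \<in> eventually_zero J r V X" for v
    proof -
      from v obtain j where j: "j \<in> J" "\<forall>k\<in>J. (j, k) \<in> r \<longrightarrow> v k = \<one>\<^bsub>FOb (V k) X\<^esub>"
        by (auto simp: eventually_zero_def)
      have vc: "v \<in> (\<Pi>\<^sub>E j\<in>J. carrier (FOb (V j) X))" using v by (simp add: eventually_zero_def)
      have "(\<lambda>j\<in>J. inv\<^bsub>FOb (V j) X\<^esub> v j) \<in> eventually_zero J r V X"
        using j vc V1(2) one(2) by (auto simp: eventually_zero_def PiE_iff intro!: bexI[of _ j])
      then show ?thesis using functor_on_product_inv[OF V X vc] by simp
    qed
    show "v \<otimes>\<^bsub>FOb (product_functor J V) X\<^esub> w \<in> eventually_zero J r V X"
      if vw: "v \<in> eventually_zero J r V X" "w \<in> eventually_zero J r V X" for v w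
    proof -
      from vw obtain i j where i: "i \<in> J" "\<forall>k\<in>J. (i, k) \<in> r \<longrightarrow> v k = \<one>\<^bsub>FOb (V k) X\<^esub>"
        and j: "j \<in> J" "\<forall>k\<in>J. (j, k) \<in> r \<longrightarrow> w k = \<one>\<^bsub>FOb (V k) X\<^esub>"
        by (auto simp: eventually_zero_def)
      obtain l where l: "l \<in> J" "(i, l) \<in> r" "(j, l) \<in> r" using *(5)[OF i(1) j(1)] by blast
      have "\<forall>k\<in>J. (l, k) \<in> r \<longrightarrow> (\<lambda>j\<in>J. v j \<otimes>\<^bsub>FOb (V j) X\<^esub> w j) k = \<one>\<^bsub>FOb (V k) X\<^esub>"
        using i(2) j(2) one(1) *(4)[OF l(2)] *(4)[OF l(3)] by simp
      moreover have "(\<lambda>j\<in>J. v j \<otimes>\<^bsub>FOb (V j) X\<^esub> w j) \<in> (\<Pi>\<^sub>E j\<in>J. carrier (FOb (V j) X))"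
        using vw V1(3) by (auto simp: eventually_zero_def PiE_iff)
      ultimately show ?thesis using l(1) by (auto simp: eventually_zero_def)
    qed
  qed (auto simp: eventually_zero_def)
next
  fix X Y f v assume X: "X \<in> Obj C" "Y \<in> Obj C" "f \<in> arr C X Y" and v: "v \<in> eventually_zero J r V X"
  from v obtain j where j: "j \<in> J" "\<forall>k\<in>J. (j, k) \<in> r \<longrightarrow> v k = \<one>\<^bsub>FOb (V k) X\<^esub>"
    by (auto simp: eventually_zero_def)
  then show "FAr (product_functor J V) X Y f v \<in> eventually_zero J r V Y"
    using v X FAr_closed[OF V X] FAr_one[OF V X]
    by (auto simp: eventually_zero_def PiE_iff intro!: bexI[of _ j])
qed

context small_preadditive_category
begin

lemma small_product_functor:
  assumes "small TYPE('u) J" "\<And>j. j \<in> J \<Longrightarrow> is_additive_functor C (V j :: ('o, 'u, 'u) abfun)" "X \<in> Obj C"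
  shows "small TYPE('u) (carrier (FOb (product_functor J V) X))"
  using assms by (auto intro!: small_PiE inaccessible additive_functor_small)

lemma reduced_product:
  assumes J: "small TYPE('u) J" "directed_poset J r"
    and V: "\<And>j. j \<in> J \<Longrightarrow> is_additive_functor C (V j :: ('o, 'u, 'u) abfun)"
  obtains N :: "('o, 'u, 'u) abfun" and \<gamma> where "is_additive_functor C N"
    "quotient_map C (product_functor J V) N \<gamma> (eventually_zero J r V)"
proof -
  have V': "functor_on C (V j)" if "j \<in> J" for j using V that additive_functor_on by blast
  have PV: "functor_on C (product_functor J V)" using functor_on_product[OF V'] .
  have "subfunctor C (product_functor J V) (eventually_zero J r V)"
    using subfunctor_eventually_zero[OF J(2) V'] .
  then show thesis
    using functor_quotient[OF PV small_product_functor[OF J(1) V]] that by blast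
qed

text \<open>Dividing by the trivial subfunctor changes nothing but the element type: the product
  becomes a module with values in \<open>'u\<close>.\<close>

lemma product_quotient:
  assumes J: "small TYPE('u) J"
    and V: "\<And>j. j \<in> J \<Longrightarrow> is_additive_functor C (V j :: ('o, 'u, 'u) abfun)"
  obtains P :: "('o, 'u, 'u) abfun" and \<gamma> where "is_additive_functor C P"
    "quotient_map C (product_functor J V) P \<gamma> (\<lambda>X. {\<one>\<^bsub>FOb (product_functor J V) X\<^esub>})"
proof -
  have V': "functor_on C (V j)" if "j \<in> J" for j using V that additive_functor_on by blast
  have PV: "functor_on C (product_functor J V)" using functor_on_product[OF V'] .
  have "subfunctor C (product_functor J V) (\<lambda>X. {\<one>\<^bsub>FOb (product_functor J V) X\<^esub>})"
    unfolding subfunctor_def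
    using FAr_one[OF PV] group.triv_subgroup[OF comm_group_imp_group[OF functor_group[OF PV]]] by blast
  then show thesis
    using functor_quotient[OF PV small_product_functor[OF J V]] that by blast
qed

lemma product_quotient_is_product:
  assumes V: "\<And>j. j \<in> J \<Longrightarrow> is_additive_functor C (V j :: ('o, 'u, 'u) abfun)"
    and P: "is_additive_functor C P"
    and \<gamma>: "quotient_map C (product_functor J V) P \<gamma> (\<lambda>X. {\<one>\<^bsub>FOb (product_functor J V) X\<^esub>})"
  shows "\<exists>\<pi>. is_product (abfun_cat C) J V P \<pi> \<and>
    (\<forall>j\<in>J. \<forall>X\<in>Obj C. \<forall>v\<in>(\<Pi>\<^sub>E j\<in>J. carrier (FOb (V j) X)). \<pi> j X (\<gamma> X v) = v j)"
proof -
  have V': "functor_on C (V j)" if "j \<in> J" for j using V that additive_functor_on by blast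
  have PV: "functor_on C (product_functor J V)" using functor_on_product[OF V'] .
  have P': "functor_on C P" using P by (rule additive_functor_on)
  have "\<forall>j\<in>J. \<exists>k. k \<in> carrier (Nat C P (V j)) \<and>
    (\<forall>X\<in>Obj C. \<forall>v\<in>(\<Pi>\<^sub>E j\<in>J. carrier (FOb (V j) X)). k X (\<gamma> X v) = v j)"
  proof
    fix j assume j: "j \<in> J"
    obtain k where "k \<in> carrier (Nat C P (V j))"
      "\<And>X v. X \<in> Obj C \<Longrightarrow> v \<in> carrier (FOb (product_functor J V) X) \<Longrightarrow> k X (\<gamma> X v) = v j"
      by (rule quotient_factor[OF \<gamma> PV P' V'[OF j], of "\<lambda>X v. v j"])
        (use j in \<open>auto simp: hom_def PiE_iff\<close>)
    then show "\<exists>k. k \<in> carrier (Nat C P (V j)) \<and>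
      (\<forall>X\<in>Obj C. \<forall>v\<in>(\<Pi>\<^sub>E j\<in>J. carrier (FOb (V j) X)). k X (\<gamma> X v) = v j)"
      by auto
  qed
  from bchoice[OF this] obtain \<pi> where \<pi>: "\<And>j. j \<in> J \<Longrightarrow> \<pi> j \<in> carrier (Nat C P (V j))"
    and \<pi>\<gamma>: "\<And>j X v. j \<in> J \<Longrightarrow> X \<in> Obj C \<Longrightarrow> v \<in> (\<Pi>\<^sub>E j\<in>J. carrier (FOb (V j) X)) \<Longrightarrow> \<pi> j X (\<gamma> X v) = v j"
    by blast
  have "\<exists>!k. k \<in> carrier (Nat C W P) \<and> (\<forall>j\<in>J. Cmp (abfun_cat C) W P (V j) (\<pi> j) k = h j)"
    if W: "is_additive_functor C W" and h: "\<And>j. j \<in> J \<Longrightarrow> h j \<in> carrier (Nat C W (V j))" for W h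
  proof -
    have W': "functor_on C W" using W by (rule additive_functor_on)
    define e where "e X w = (\<lambda>j\<in>J. h j X w)" for X w
    have e: "e X w \<in> carrier (FOb (product_functor J V) X)" if "X \<in> Obj C" "w \<in> carrier (FOb W X)" for X w
      using that Nat_closed[OF h] by (auto simp: e_def)
    define k where "k = natify C W (\<lambda>X w. \<gamma> X (e X w))"
    have kapp: "k X w = \<gamma> X (e X w)" if "X \<in> Obj C" "w \<in> carrier (FOb W X)" for X w
      using that by (simp add: k_def)
    have k: "k \<in> carrier (Nat C W P)"
      unfolding k_def
    proof (rule natify_Nat[OF W'])
      fix X assume X: "X \<in> Obj C"
      show "(\<lambda>w. \<gamma> X (e X w)) \<in> hom (FOb W X) (FOb P X)"
      proof (rule homI)
        fix w w' assume w: "w \<in> carrier (FOb W X)" "w' \<in> carrier (FOb W X)"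
        show "\<gamma> X (e X w) \<in> carrier (FOb P X)" using quotient_mapD(3)[OF \<gamma> X e[OF X w(1)]] .
        have "e X (w \<otimes>\<^bsub>FOb W X\<^esub> w') = e X w \<otimes>\<^bsub>FOb (product_functor J V) X\<^esub> e X w'"
          using w X Nat_mult[OF h] by (auto simp: e_def)
        then show "\<gamma> X (e X (w \<otimes>\<^bsub>FOb W X\<^esub> w')) = \<gamma> X (e X w) \<otimes>\<^bsub>FOb P X\<^esub> \<gamma> X (e X w')"
          using hom_mult[OF quotient_mapD(1)[OF \<gamma> X] e[OF X w(1)] e[OF X w(2)]] by simp
      qed
      fix Y f w assume Y: "Y \<in> Obj C" "f \<in> arr C X Y" "w \<in> carrier (FOb W X)"
      have "e Y (FAr W X Y f w) = FAr (product_functor J V) X Y f (e X w)"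
        using X Y Nat_natural[OF h] by (auto simp: e_def)
      then show "\<gamma> Y (e Y (FAr W X Y f w)) = FAr P X Y f (\<gamma> X (e X w))"
        using quotient_mapD(5)[OF \<gamma> X Y(1,2) e[OF X Y(3)]] by simp
    qed
    show ?thesis
    proof (rule ex1I[of _ k])
      show "k \<in> carrier (Nat C W P) \<and> (\<forall>j\<in>J. Cmp (abfun_cat C) W P (V j) (\<pi> j) k = h j)"
      proof (intro conjI ballI k)
        fix j assume j: "j \<in> J"
        have "\<pi> j X (k X w) = h j X w" if "X \<in> Obj C" "w \<in> carrier (FOb W X)" for X w
          using \<pi>\<gamma>[OF j that(1), of "e X w"] e[OF that] j by (simp add: kapp[OF that] e_def)
        then show "Cmp (abfun_cat C) W P (V j) (\<pi> j) k = h j"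
          unfolding abfun_Cmp_eq_iff[OF W' k \<pi>[OF j] h[OF j]] by blast
      qed
      fix k' assume k': "k' \<in> carrier (Nat C W P) \<and> (\<forall>j\<in>J. Cmp (abfun_cat C) W P (V j) (\<pi> j) k' = h j)"
      then have k'N: "k' \<in> carrier (Nat C W P)" by blast
      show "k' = k"
      proof (rule Nat_eqI[OF k'N k])
        fix X w assume X: "X \<in> Obj C" "w \<in> carrier (FOb W X)"
        obtain v where v: "v \<in> (\<Pi>\<^sub>E j\<in>J. carrier (FOb (V j) X))" "\<gamma> X v = k' X w"
          using quotient_mapD(4)[OF \<gamma> X(1) Nat_closed[OF k'N X]] by auto
        have "v j = h j X w" if "j \<in> J" for j
          using k' \<pi>\<gamma>[OF that X(1) v(1)] abfun_Cmp_eq_iff[OF W' k'N \<pi>[OF that] h[OF that]] X that v(2) by auto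
        then have "v = e X w" using v(1) by (auto simp: e_def PiE_iff extensional_def)
        then show "k' X w = k X w" using v(2) kapp[OF X] by simp
      qed
    qed
  qed
  then have "is_product (abfun_cat C) J V P \<pi>"
    using P \<pi> by (simp add: is_product_def)
  then show ?thesis using \<pi>\<gamma> by blast
qed

text \<open>By the Yoneda lemma, elements of \<open>P(A)\<close> are maps
  \<open>(A,-) \<rightarrow> P\<close>, to which the universal property applies. This gives access
  to the elements of an arbitrary categorical product.\<close>

lemma is_product_pointwise:
  assumes P: "is_product (abfun_cat C) I M P \<pi>" and M: "\<And>i. i \<in> I \<Longrightarrow> is_additive_functor C (M i :: ('o, 'u, 'u) abfun)"
    and A: "A \<in> Obj C"
  shows "(\<And>i. i \<in> I \<Longrightarrow> x i \<in> carrier (FOb (M i) A)) \<Longrightarrow> \<exists>p\<in>carrier (FOb P A). \<forall>i\<in>I. \<pi> i A p = x i"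
    and "p \<in> carrier (FOb P A) \<Longrightarrow> (\<And>i. i \<in> I \<Longrightarrow> \<pi> i A p = \<one>\<^bsub>FOb (M i) A\<^esub>) \<Longrightarrow> p = \<one>\<^bsub>FOb P A\<^esub>"
proof -
  have Pa: "is_additive_functor C P" and \<pi>: "\<And>i. i \<in> I \<Longrightarrow> \<pi> i \<in> carrier (Nat C P (M i))"
    using P by (auto simp: is_product_def)
  have univ: "\<exists>!k. k \<in> carrier (Nat C W P) \<and> (\<forall>i\<in>I. Cmp (abfun_cat C) W P (M i) (\<pi> i) k = h i)"
    if "is_additive_functor C W" "\<And>i. i \<in> I \<Longrightarrow> h i \<in> carrier (Nat C W (M i))" for W h
    using P that by (simp add: is_product_def)
  have P': "functor_on C P" using Pa by (rule additive_functor_on)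
  have M': "functor_on C (M i)" if "i \<in> I" for i using M that additive_functor_on by blast
  have R: "is_additive_functor C (rep C A)" "functor_on C (rep C A)" using additive_rep[OF A] functor_on_rep[OF A] by auto
  have yc: "Cmp (abfun_cat C) (rep C A) P (M i) (\<pi> i) (yon P A p) = yon (M i) A (\<pi> i A p)"
    if "i \<in> I" "p \<in> carrier (FOb P A)" for i p
    unfolding abfun_Cmp_eq_iff[OF R(2) yon_Nat[OF P' A that(2)] \<pi>[OF that(1)]
        yon_Nat[OF M'[OF that(1)] A Nat_closed[OF \<pi>[OF that(1)] A that(2)]]]
    using that A by (simp add: yon_apply Nat_natural[OF \<pi>])
  {
    assume x: "\<And>i. i \<in> I \<Longrightarrow> x i \<in> carrier (FOb (M i) A)"
    have "\<exists>!k. k \<in> carrier (Nat C (rep C A) P) \<and>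
        (\<forall>i\<in>I. Cmp (abfun_cat C) (rep C A) P (M i) (\<pi> i) k = yon (M i) A (x i))"
      by (rule univ[OF R(1)]) (rule yon_Nat[OF M' A x])
    then obtain k where k: "k \<in> carrier (Nat C (rep C A) P)"
        "\<And>i. i \<in> I \<Longrightarrow> Cmp (abfun_cat C) (rep C A) P (M i) (\<pi> i) k = yon (M i) A (x i)"
      by blast
    have "\<pi> i A (k A (Idn C A)) = x i" if "i \<in> I" for i
      using abfun_Cmp_eq_iff[OF R(2) k(1) \<pi>[OF that] yon_Nat[OF M'[OF that] A x[OF that]]] k(2)[OF that]
        A Idn_arr yon_Idn[OF M'[OF that] A x[OF that]] by auto
    moreover have "k A (Idn C A) \<in> carrier (FOb P A)"
      using Nat_closed[OF k(1) A] A by (simp add: Idn_arr)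
    ultimately show "\<exists>p\<in>carrier (FOb P A). \<forall>i\<in>I. \<pi> i A p = x i" by blast
  }
  {
    assume p: "p \<in> carrier (FOb P A)" and p1: "\<And>i. i \<in> I \<Longrightarrow> \<pi> i A p = \<one>\<^bsub>FOb (M i) A\<^esub>"
    have one: "\<one>\<^bsub>FOb P A\<^esub> \<in> carrier (FOb P A)" using functor_closed[OF P' A] by simp
    have "\<exists>!k. k \<in> carrier (Nat C (rep C A) P) \<and>
        (\<forall>i\<in>I. Cmp (abfun_cat C) (rep C A) P (M i) (\<pi> i) k = yon (M i) A \<one>\<^bsub>FOb (M i) A\<^esub>)"
      by (rule univ[OF R(1)]) (rule yon_Nat[OF M' A functor_closed(1)[OF M' A]])
    moreover have "yon P A p \<in> carrier (Nat C (rep C A) P) \<and>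
        (\<forall>i\<in>I. Cmp (abfun_cat C) (rep C A) P (M i) (\<pi> i) (yon P A p) = yon (M i) A \<one>\<^bsub>FOb (M i) A\<^esub>)"
      using yon_Nat[OF P' A p] yc p p1 by simp
    moreover have "yon P A \<one>\<^bsub>FOb P A\<^esub> \<in> carrier (Nat C (rep C A) P) \<and>
        (\<forall>i\<in>I. Cmp (abfun_cat C) (rep C A) P (M i) (\<pi> i) (yon P A \<one>\<^bsub>FOb P A\<^esub>) = yon (M i) A \<one>\<^bsub>FOb (M i) A\<^esub>)"
      using yon_Nat[OF P' A one] yc one Nat_one[OF \<pi> P' M' A] by simp
    ultimately have "yon P A p = yon P A \<one>\<^bsub>FOb P A\<^esub>" by blast
    then show "p = \<one>\<^bsub>FOb P A\<^esub>" using yon_Idn[OF P' A] p one by metis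
  }
qed

text \<open>The colimit is known only through its universal property, and both facts come from
  testing it on a suitable module: the quotient of \<open>L\<close> by everything that comes from
  some \<open>M i\<close>, and the reduced product of all the \<open>M i\<close>.\<close>

lemma directed_colimit_pointwise:
  assumes L: "is_directed_colimit (abfun_cat C) I r M t L c" and I: "small TYPE('u) I"
    and M: "\<And>i. i \<in> I \<Longrightarrow> is_additive_functor C (M i :: ('o, 'u, 'u) abfun)"
  shows "\<And>X y. X \<in> Obj C \<Longrightarrow> y \<in> carrier (FOb L X) \<Longrightarrow> \<exists>i\<in>I. \<exists>m\<in>carrier (FOb (M i) X). y = c i X m"
    and "\<And>X i m. X \<in> Obj C \<Longrightarrow> i \<in> I \<Longrightarrow> m \<in> carrier (FOb (M i) X) \<Longrightarrow> c i X m = \<one>\<^bsub>FOb L X\<^esub> \<Longrightarrow>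
      \<exists>j. (i, j) \<in> r \<and> t i j X m = \<one>\<^bsub>FOb (M j) X\<^esub>"
proof -
  have dir: "directed_poset I r" and sys: "is_direct_system (abfun_cat C) I r M t"
    and La: "is_additive_functor C L" and coc: "is_cocone (abfun_cat C) I r M t L c"
    using L by (auto simp: is_directed_colimit_def)
  have univ: "\<exists>!k. k \<in> carrier (Nat C L W) \<and> (\<forall>i\<in>I. Cmp (abfun_cat C) (M i) L W k (c i) = h i)"
    if "is_additive_functor C W" "is_cocone (abfun_cat C) I r M t W h" for W h
    using L that by (simp add: is_directed_colimit_def)
  note d = directed_posetD[OF dir]
  have L': "functor_on C L" using La by (rule additive_functor_on)
  have M': "functor_on C (M i)" if "i \<in> I" for i using M that additive_functor_on by blast
  have c: "c i \<in> carrier (Nat C (M i) L)" if "i \<in> I" for i using coc that by (simp add: is_cocone_def)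
  have t: "t i j \<in> carrier (Nat C (M i) (M j))" if "(i, j) \<in> r" for i j
    using sys that by (auto simp: is_direct_system_def)
  have ct: "c j X (t i j X m) = c i X m" if "(i, j) \<in> r" "X \<in> Obj C" "m \<in> carrier (FOb (M i) X)" for i j X m
  proof -
    have "Cmp (abfun_cat C) (M i) (M j) L (c j) (t i j) = c i"
      using coc that by (auto simp: is_cocone_def)
    then show ?thesis using abfun_Cmp_apply[OF that(2,3), of "M j" L "c j" "t i j"] by simp
  qed
  have tt: "t j k X (t i j X m) = t i k X m"
    if "(i, j) \<in> r" "(j, k) \<in> r" "X \<in> Obj C" "m \<in> carrier (FOb (M i) X)" for i j k X m
  proof -
    have "Cmp (abfun_cat C) (M i) (M j) (M k) (t j k) (t i j) = t i k"
      using sys that by (auto simp: is_direct_system_def)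
    then show ?thesis using abfun_Cmp_apply[OF that(3,4), of "M j" "M k" "t j k" "t i j"] by simp
  qed
  {
    fix X y assume X: "X \<in> Obj C" "y \<in> carrier (FOb L X)"
    \<comment> \<open>The part of \<open>L\<close> covered by the \<open>M i\<close>; directedness
      makes it a subfunctor. The projection to the quotient by it and the zero map restrict to the
      same cocone, so they agree.\<close>
    define K where "K X = {c i X m | i m. i \<in> I \<and> m \<in> carrier (FOb (M i) X)}" for X
    have K: "subfunctor C L K"
      unfolding subfunctor_def
    proof (intro conjI ballI)
      fix X assume X: "X \<in> Obj C"
      show "subgroup (K X) (FOb L X)"
      proof (rule group.subgroupI[OF comm_group_imp_group[OF functor_group[OF L' X]]])
        show "K X \<subseteq> carrier (FOb L X)" using Nat_closed[OF c X] by (auto simp: K_def)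
        obtain i where i: "i \<in> I" using d(1) by blast
        then show "K X \<noteq> {}" using functor_closed(1)[OF M' X] unfolding K_def by blast
        show "inv\<^bsub>FOb L X\<^esub> z \<in> K X" if "z \<in> K X" for z
        proof -
          from that obtain i m where im: "z = c i X m" "i \<in> I" "m \<in> carrier (FOb (M i) X)" by (auto simp: K_def)
          then have "inv\<^bsub>FOb L X\<^esub> z = c i X (inv\<^bsub>FOb (M i) X\<^esub> m)" using Nat_inv[OF c M' L' X] by simp
          then show ?thesis using im functor_closed(2)[OF M' X] unfolding K_def by blast
        qed
        show "z \<otimes>\<^bsub>FOb L X\<^esub> z' \<in> K X" if zz: "z \<in> K X" "z' \<in> K X" for z z'
        proof -
          from zz obtain i m i' m' where im: "z = c i X m" "i \<in> I" "m \<in> carrier (FOb (M i) X)"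
            "z' = c i' X m'" "i' \<in> I" "m' \<in> carrier (FOb (M i') X)" by (auto simp: K_def)
          obtain k where k: "k \<in> I" "(i, k) \<in> r" "(i', k) \<in> r" using d(5)[OF im(2,5)] by blast
          have mm: "t i k X m \<in> carrier (FOb (M k) X)" "t i' k X m' \<in> carrier (FOb (M k) X)"
            using Nat_closed[OF t X] k im by auto
          have "z \<otimes>\<^bsub>FOb L X\<^esub> z' = c k X (t i k X m \<otimes>\<^bsub>FOb (M k) X\<^esub> t i' k X m')"
            using Nat_mult[OF c[OF k(1)] X mm] ct[OF k(2) X im(3)] ct[OF k(3) X im(6)] im by simp
          then show ?thesis using k(1) functor_closed(3)[OF M'[OF k(1)] X mm] unfolding K_def by blast
        qed
      qed
    next
      fix X Y f z assume X: "X \<in> Obj C" "Y \<in> Obj C" "f \<in> arr C X Y" "z \<in> K X"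
      then obtain i m where im: "z = c i X m" "i \<in> I" "m \<in> carrier (FOb (M i) X)" by (auto simp: K_def)
      then have "FAr L X Y f z = c i Y (FAr (M i) X Y f m)" using Nat_natural[OF c] X by simp
      then show "FAr L X Y f z \<in> K Y" using im FAr_closed[OF M' X(1-3)] unfolding K_def by blast
    qed
    obtain R :: "('o, 'u, 'u) abfun" and q0 where R: "is_additive_functor C R" and q0: "quotient_map C L R q0 K"
      using functor_quotient[OF L' additive_functor_small[OF La] K] .
    have R': "functor_on C R" using R by (rule additive_functor_on)
    define q where "q = natify C L q0"
    have qN: "q \<in> carrier (Nat C L R)" and q: "quotient_map C L R q K"
      using quotient_map_natify[OF L' q0] by (simp_all add: q_def)
    note one = Nat_one_closed[OF L' R']
    have cocone: "is_cocone (abfun_cat C) I r M t R (\<lambda>i. \<one>\<^bsub>Nat C (M i) R\<^esub>)"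
    proof -
      have "Cmp (abfun_cat C) (M i) (M j) R \<one>\<^bsub>Nat C (M j) R\<^esub> (t i j) = \<one>\<^bsub>Nat C (M i) R\<^esub>" if "(i, j) \<in> r" for i j
        using abfun_Cmp_eq_one_iff[OF M' R' t[OF that] Nat_one_closed[OF M' R']] d(3)[OF that] Nat_closed[OF t[OF that]]
        by (auto simp: Nat_one_apply)
      then show ?thesis using Nat_one_closed[OF M' R'] by (auto simp: is_cocone_def)
    qed
    have "\<forall>i\<in>I. Cmp (abfun_cat C) (M i) L R q (c i) = \<one>\<^bsub>Nat C (M i) R\<^esub>"
    proof
      fix i assume i: "i \<in> I"
      have "c i X m \<in> K X" if "m \<in> carrier (FOb (M i) X)" for X m using i that unfolding K_def by blast
      then show "Cmp (abfun_cat C) (M i) L R q (c i) = \<one>\<^bsub>Nat C (M i) R\<^esub>"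
        unfolding abfun_Cmp_eq_one_iff[OF M'[OF i] R' c[OF i] qN]
        using quotient_mapD(2)[OF q] Nat_closed[OF c[OF i]] by simp
    qed
    moreover have "\<forall>i\<in>I. Cmp (abfun_cat C) (M i) L R \<one>\<^bsub>Nat C L R\<^esub> (c i) = \<one>\<^bsub>Nat C (M i) R\<^esub>"
      using abfun_Cmp_eq_one_iff[OF M' R' c one] Nat_closed[OF c] by (auto simp: Nat_one_apply)
    ultimately have "q = \<one>\<^bsub>Nat C L R\<^esub>"
      using univ[OF R cocone] qN one by blast
    then have "y \<in> K X" using quotient_mapD(2)[OF q X] X by (simp add: Nat_one_apply)
    then show "\<exists>i\<in>I. \<exists>m\<in>carrier (FOb (M i) X). y = c i X m" unfolding K_def by blast
  }
  {
    fix X0 i0 m0 assume X0: "X0 \<in> Obj C" and i0: "i0 \<in> I" and m0: "m0 \<in> carrier (FOb (M i0) X0)"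
      and c0: "c i0 X0 m0 = \<one>\<^bsub>FOb L X0\<^esub>"
    obtain N :: "('o, 'u, 'u) abfun" and \<gamma> where N: "is_additive_functor C N"
      and \<gamma>: "quotient_map C (product_functor I M) N \<gamma> (eventually_zero I r M)"
      using reduced_product[OF I dir M] .
    have N': "functor_on C N" using N by (rule additive_functor_on)
    have PV: "functor_on C (product_functor I M)" using functor_on_product[OF M'] .
    \<comment> \<open>The family of all later images of \<open>m\<close>, with zero at indices not
      above \<open>i\<close>. Modulo families vanishing on a tail these maps form a cocone, so
      \<open>m\<close> dies in \<open>L\<close> only if its images vanish from some index
      on.\<close>
    define s where "s i X m = (\<lambda>k\<in>I. if (i, k) \<in> r then t i k X m else \<one>\<^bsub>FOb (M k) X\<^esub>)" for i X m
    have s: "s i X m \<in> carrier (FOb (product_functor I M) X)" if "i \<in> I" "X \<in> Obj C" "m \<in> carrier (FOb (M i) X)" for i X m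
      using that Nat_closed[OF t] functor_closed(1)[OF M'] by (auto simp: s_def)
    define h where "h i = natify C (M i) (\<lambda>X m. \<gamma> X (s i X m))" for i
    have happ: "h i X m = \<gamma> X (s i X m)" if "X \<in> Obj C" "m \<in> carrier (FOb (M i) X)" for i X m
      using that by (simp add: h_def)
    have h: "h i \<in> carrier (Nat C (M i) N)" if i: "i \<in> I" for i
      unfolding h_def
    proof (rule natify_Nat[OF M'[OF i]])
      fix X assume X: "X \<in> Obj C"
      show "(\<lambda>m. \<gamma> X (s i X m)) \<in> hom (FOb (M i) X) (FOb N X)"
      proof (rule homI)
        fix m m' assume m: "m \<in> carrier (FOb (M i) X)" "m' \<in> carrier (FOb (M i) X)"
        show "\<gamma> X (s i X m) \<in> carrier (FOb N X)" using quotient_mapD(3)[OF \<gamma> X s[OF i X m(1)]] .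
        have "\<one>\<^bsub>FOb (M k) X\<^esub> \<otimes>\<^bsub>FOb (M k) X\<^esub> \<one>\<^bsub>FOb (M k) X\<^esub> = \<one>\<^bsub>FOb (M k) X\<^esub>" if "k \<in> I" for k
          using comm_group_imp_group[OF functor_group[OF M'[OF that] X]]
          by (simp add: monoid.r_one functor_closed(1)[OF M'[OF that] X] Group.group.is_monoid)
        then have "s i X (m \<otimes>\<^bsub>FOb (M i) X\<^esub> m') = s i X m \<otimes>\<^bsub>FOb (product_functor I M) X\<^esub> s i X m'"
          using m X Nat_mult[OF t] by (auto simp: s_def)
        then show "\<gamma> X (s i X (m \<otimes>\<^bsub>FOb (M i) X\<^esub> m')) = \<gamma> X (s i X m) \<otimes>\<^bsub>FOb N X\<^esub> \<gamma> X (s i X m')"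
          using hom_mult[OF quotient_mapD(1)[OF \<gamma> X] s[OF i X m(1)] s[OF i X m(2)]] by simp
      qed
      fix Y f m assume Y: "Y \<in> Obj C" "f \<in> arr C X Y" "m \<in> carrier (FOb (M i) X)"
      have "s i Y (FAr (M i) X Y f m) = FAr (product_functor I M) X Y f (s i X m)"
        using X Y Nat_natural[OF t] FAr_one[OF M' X Y(1,2)] by (auto simp: s_def)
      then show "\<gamma> Y (s i Y (FAr (M i) X Y f m)) = FAr N X Y f (\<gamma> X (s i X m))"
        using quotient_mapD(5)[OF \<gamma> X Y(1,2) s[OF i X Y(3)]] by simp
    qed
    have "is_cocone (abfun_cat C) I r M t N h"
    proof -
      have "Cmp (abfun_cat C) (M i) (M j) N (h j) (t i j) = h i" if ij: "(i, j) \<in> r" for i j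
      proof -
        have i: "i \<in> I" "j \<in> I" using d(3)[OF ij] by auto
        have "h j X (t i j X m) = h i X m" if X: "X \<in> Obj C" "m \<in> carrier (FOb (M i) X)" for X m
        proof -
          have tm: "t i j X m \<in> carrier (FOb (M j) X)" using Nat_closed[OF t[OF ij] X] .
          note sj = s[OF i(2) X(1) tm] and si = s[OF i(1) X]
          have "s j X (t i j X m) \<otimes>\<^bsub>FOb (product_functor I M) X\<^esub> inv\<^bsub>FOb (product_functor I M) X\<^esub> s i X m
              \<in> eventually_zero I r M X" (is "?z \<in> _")
          proof -
            have z: "?z \<in> carrier (FOb (product_functor I M) X)"
              using sj si functor_closed[OF PV X(1)] by simp
            have "?z k = \<one>\<^bsub>FOb (M k) X\<^esub>" if k: "k \<in> I" "(j, k) \<in> r" for k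
            proof -
              have ik: "(i, k) \<in> r" using d(4)[OF ij k(2)] .
              have "?z k = t i k X m \<otimes>\<^bsub>FOb (M k) X\<^esub> inv\<^bsub>FOb (M k) X\<^esub> t i k X m"
                using functor_on_product_inv[OF M' X(1) si[unfolded product_functor_simps]] k ik tt[OF ij k(2) X]
                by (simp add: s_def)
              then show ?thesis
                using comm_group_diff_eq_one[OF functor_group[OF M'[OF k(1)] X(1)]] Nat_closed[OF t[OF ik] X] by simp
            qed
            then show ?thesis using z i(2) unfolding eventually_zero_def product_functor_simps(1) by blast
          qed
          then show ?thesis
            using quotient_map_eq_iff[OF \<gamma> PV N' X(1) sj si] by (simp add: happ X tm)
        qed
        then show ?thesis unfolding abfun_Cmp_eq_iff[OF M'[OF i(1)] t[OF ij] h[OF i(2)] h[OF i(1)]] by blast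
      qed
      then show ?thesis using h by (auto simp: is_cocone_def)
    qed
    then obtain k where k: "k \<in> carrier (Nat C L N)" "\<And>i. i \<in> I \<Longrightarrow> Cmp (abfun_cat C) (M i) L N k (c i) = h i"
      using univ[OF N] by blast
    have "h i0 X0 m0 = \<one>\<^bsub>FOb N X0\<^esub>"
      using abfun_Cmp_apply[OF X0 m0, of L N k "c i0"] k(2)[OF i0] c0 Nat_one[OF k(1) L' N' X0] by simp
    then have "s i0 X0 m0 \<in> eventually_zero I r M X0"
      using quotient_mapD(2)[OF \<gamma> X0 s[OF i0 X0 m0]] by (simp add: happ X0 m0)
    then obtain j where j: "j \<in> I" "\<forall>k\<in>I. (j, k) \<in> r \<longrightarrow> s i0 X0 m0 k = \<one>\<^bsub>FOb (M k) X0\<^esub>"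
      by (auto simp: eventually_zero_def)
    obtain l where l: "l \<in> I" "(i0, l) \<in> r" "(j, l) \<in> r" using d(5)[OF i0 j(1)] by blast
    then have "t i0 l X0 m0 = \<one>\<^bsub>FOb (M l) X0\<^esub>"
      using bspec[OF j(2) l(1)] by (simp add: s_def)
    then show "\<exists>j. (i0, j) \<in> r \<and> t i0 j X0 m0 = \<one>\<^bsub>FOb (M j) X0\<^esub>"
      using l(2) by blast
  }
qed

end

section \<open>Reduced products as directed colimits of products\<close>

context small_preadditive_category
begin

text \<open>The stages are the products over the tails \<open>{k\<in>J. (j, k) \<in> r}\<close> with
  restriction as transition maps: two families agree in the reduced product iff they agree on a
  common tail. The least index \<open>j0\<close> makes the full product one of the stages, and every
  element of \<open>N\<close> comes from it. This brings reduced products within reach of a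
  definable class.\<close>

lemma reduced_product_colimit:
  fixes V :: "'j \<Rightarrow> ('o, 'u, 'u) abfun"
  assumes J: "small TYPE('u) J" "directed_poset J r" and j0: "j0 \<in> J" "\<And>j. j \<in> J \<Longrightarrow> (j0, j) \<in> r"
    and V: "\<And>j. j \<in> J \<Longrightarrow> is_additive_functor C (V j)"
    and N: "is_additive_functor C N" and \<gamma>: "quotient_map C (product_functor J V) N \<gamma> (eventually_zero J r V)"
  obtains P \<pi> t c where "\<And>j. j \<in> J \<Longrightarrow> is_product (abfun_cat C) {k\<in>J. (j, k) \<in> r} V (P j) (\<pi> j)"
    "is_directed_colimit (abfun_cat C) J r P t N c"
proof -
  note d = directed_posetD[OF J(2)]
  define up where "up j = {k\<in>J. (j, k) \<in> r}" for j
  have upJ: "up j \<subseteq> J" for j by (auto simp: up_def)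
  have upm: "up k \<subseteq> up j" if "(j, k) \<in> r" for j k using d(4)[OF that] by (auto simp: up_def)
  have up0: "up j0 = J" using j0 by (auto simp: up_def)
  have V': "functor_on C (V j)" if "j \<in> J" for j using V that additive_functor_on by blast
  have V1: "\<one>\<^bsub>FOb (V j) X\<^esub> \<in> carrier (FOb (V j) X)" if "j \<in> J" "X \<in> Obj C" for j X
    using functor_closed(1)[OF V'[OF that(1)] that(2)] .
  have V11: "\<one>\<^bsub>FOb (V j) X\<^esub> \<otimes>\<^bsub>FOb (V j) X\<^esub> \<one>\<^bsub>FOb (V j) X\<^esub> = \<one>\<^bsub>FOb (V j) X\<^esub>" if "j \<in> J" "X \<in> Obj C" for j X
    using comm_group_imp_group[OF functor_group[OF V'[OF that(1)] that(2)]]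
    by (simp add: monoid.r_one V1 that Group.group.is_monoid)
  have N': "functor_on C N" using N by (rule additive_functor_on)
  have PV: "functor_on C (product_functor J V)" using functor_on_product[OF V'] .
  have PVj: "functor_on C (product_functor (up j) V)" for j
    using functor_on_product[of "up j" C V] V' upJ by blast
  have "\<forall>j\<in>J. \<exists>P :: ('o, 'u, 'u) abfun. is_additive_functor C P \<and> (\<exists>g. quotient_map C (product_functor (up j) V) P g
      (\<lambda>X. {\<one>\<^bsub>FOb (product_functor (up j) V) X\<^esub>}))"
  proof
    fix j assume "j \<in> J"
    have "small TYPE('u) (up j)" using small_subset[OF J(1) upJ] .
    then show "\<exists>P :: ('o, 'u, 'u) abfun. is_additive_functor C P \<and> (\<exists>g. quotient_map C (product_functor (up j) V) P g
      (\<lambda>X. {\<one>\<^bsub>FOb (product_functor (up j) V) X\<^esub>}))"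
      by (rule product_quotient[of "up j" V]) (use V upJ in blast)+
  qed
  from bchoice[OF this] obtain P :: "'j \<Rightarrow> ('o, 'u, 'u) abfun" where
    P: "\<And>j. j \<in> J \<Longrightarrow> is_additive_functor C (P j)" and
    "\<forall>j\<in>J. \<exists>g. quotient_map C (product_functor (up j) V) (P j) g
      (\<lambda>X. {\<one>\<^bsub>FOb (product_functor (up j) V) X\<^esub>})" by blast
  from bchoice[OF this(2)] obtain g where
    g: "\<And>j. j \<in> J \<Longrightarrow> quotient_map C (product_functor (up j) V) (P j) (g j)
      (\<lambda>X. {\<one>\<^bsub>FOb (product_functor (up j) V) X\<^esub>})" by blast
  have P': "functor_on C (P j)" if "j \<in> J" for j using P that additive_functor_on by blast
  have "\<forall>j\<in>J. \<exists>\<pi>. is_product (abfun_cat C) (up j) V (P j) \<pi>"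
    using product_quotient_is_product[OF _ P g] V upJ by blast
  from bchoice[OF this] obtain \<pi> where \<pi>: "\<And>j. j \<in> J \<Longrightarrow> is_product (abfun_cat C) (up j) V (P j) (\<pi> j)"
    by blast
  have gsurj: "\<exists>v\<in>carrier (FOb (product_functor (up j) V) X). y = g j X v"
    if "j \<in> J" "X \<in> Obj C" "y \<in> carrier (FOb (P j) X)" for j X y
    using quotient_mapD(4)[OF g[OF that(1)] that(2,3)] by blast
  define res where "res j v = restrict v (up j)" for j and v :: "'j \<Rightarrow> 'u"
  \<comment> \<open>Extension by zero; any other extension gives the same element of
    \<open>N\<close>, which ignores what happens off a tail.\<close>
  define ext where "ext j X v = (\<lambda>k\<in>J. if k \<in> up j then v k else \<one>\<^bsub>FOb (V k) X\<^esub>)" for j X and v :: "'j \<Rightarrow> 'u"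
  have res: "res k v \<in> carrier (FOb (product_functor (up k) V) X)"
    if "(j, k) \<in> r" "v \<in> carrier (FOb (product_functor (up j) V) X)" for j k X v
    using that upm[OF that(1)] by (auto simp: res_def)
  have ext: "ext j X v \<in> carrier (FOb (product_functor J V) X)"
    if "X \<in> Obj C" "v \<in> carrier (FOb (product_functor (up j) V) X)" for j X v
    using that V1 by (auto simp: ext_def)
  have "\<forall>j\<in>J. \<forall>k\<in>J. \<exists>t. (j, k) \<in> r \<longrightarrow> t \<in> carrier (Nat C (P j) (P k)) \<and>
    (\<forall>X\<in>Obj C. \<forall>v\<in>carrier (FOb (product_functor (up j) V) X). t X (g j X v) = g k X (res k v))"
  proof (intro ballI)
    fix j k assume jk: "j \<in> J" "k \<in> J"
    show "\<exists>t. (j, k) \<in> r \<longrightarrow> t \<in> carrier (Nat C (P j) (P k)) \<and>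
    (\<forall>X\<in>Obj C. \<forall>v\<in>carrier (FOb (product_functor (up j) V) X). t X (g j X v) = g k X (res k v))"
    proof (cases "(j, k) \<in> r")
      case True
      obtain t where "t \<in> carrier (Nat C (P j) (P k))"
        "\<And>X v. X \<in> Obj C \<Longrightarrow> v \<in> carrier (FOb (product_functor (up j) V) X) \<Longrightarrow> t X (g j X v) = g k X (res k v)"
      proof (rule quotient_factor[OF g[OF jk(1)] PVj P'[OF jk(1)] P'[OF jk(2)], of "\<lambda>X v. g k X (res k v)"])
        fix X assume X: "X \<in> Obj C"
        show "(\<lambda>v. g k X (res k v)) \<in> hom (FOb (product_functor (up j) V) X) (FOb (P k) X)"
        proof (rule homI)
          fix v w assume v: "v \<in> carrier (FOb (product_functor (up j) V) X)" "w \<in> carrier (FOb (product_functor (up j) V) X)"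
          show "g k X (res k v) \<in> carrier (FOb (P k) X)"
            using quotient_mapD(3)[OF g[OF jk(2)] X res[OF True v(1)]] .
          have "res k (v \<otimes>\<^bsub>FOb (product_functor (up j) V) X\<^esub> w) = res k v \<otimes>\<^bsub>FOb (product_functor (up k) V) X\<^esub> res k w"
            using upm[OF True] by (auto simp: res_def restrict_def fun_eq_iff)
          then show "g k X (res k (v \<otimes>\<^bsub>FOb (product_functor (up j) V) X\<^esub> w)) = g k X (res k v) \<otimes>\<^bsub>FOb (P k) X\<^esub> g k X (res k w)"
            using hom_mult[OF quotient_mapD(1)[OF g[OF jk(2)] X] res[OF True v(1)] res[OF True v(2)]] by simp
        qed
        show "g k X (res k v) = \<one>\<^bsub>FOb (P k) X\<^esub>"
          if "v \<in> carrier (FOb (product_functor (up j) V) X)" "v \<in> {\<one>\<^bsub>FOb (product_functor (up j) V) X\<^esub>}" for v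
        proof -
          have "res k v = \<one>\<^bsub>FOb (product_functor (up k) V) X\<^esub>"
            using that(2) upm[OF True] by (auto simp: res_def restrict_def fun_eq_iff)
          then show ?thesis using quotient_mapD(2)[OF g[OF jk(2)] X res[OF True that(1)]] by blast
        qed
        fix Y f v assume Y: "Y \<in> Obj C" "f \<in> arr C X Y" "v \<in> carrier (FOb (product_functor (up j) V) X)"
        have "res k (FAr (product_functor (up j) V) X Y f v) = FAr (product_functor (up k) V) X Y f (res k v)"
          using upm[OF True] by (auto simp: res_def restrict_def fun_eq_iff)
        then show "g k Y (res k (FAr (product_functor (up j) V) X Y f v)) = FAr (P k) X Y f (g k X (res k v))"
          using quotient_mapD(5)[OF g[OF jk(2)] X Y(1,2) res[OF True Y(3)]] by simp
      qed (blast intro: that)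
      then show ?thesis by blast
    qed blast
  qed
  then have "\<exists>t. \<forall>j\<in>J. \<forall>k\<in>J. (j, k) \<in> r \<longrightarrow> t j k \<in> carrier (Nat C (P j) (P k)) \<and>
    (\<forall>X\<in>Obj C. \<forall>v\<in>carrier (FOb (product_functor (up j) V) X). t j k X (g j X v) = g k X (res k v))"
    by metis
  then obtain t where tN: "\<And>j k. (j, k) \<in> r \<Longrightarrow> t j k \<in> carrier (Nat C (P j) (P k))"
    and tg: "\<And>j k X v. (j, k) \<in> r \<Longrightarrow> X \<in> Obj C \<Longrightarrow> v \<in> carrier (FOb (product_functor (up j) V) X) \<Longrightarrow>
      t j k X (g j X v) = g k X (res k v)"
    using d(3) by metis
  have "\<forall>j\<in>J. \<exists>c. c \<in> carrier (Nat C (P j) N) \<and>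
    (\<forall>X\<in>Obj C. \<forall>v\<in>carrier (FOb (product_functor (up j) V) X). c X (g j X v) = \<gamma> X (ext j X v))"
  proof
    fix j assume j: "j \<in> J"
    obtain c where "c \<in> carrier (Nat C (P j) N)"
      "\<And>X v. X \<in> Obj C \<Longrightarrow> v \<in> carrier (FOb (product_functor (up j) V) X) \<Longrightarrow> c X (g j X v) = \<gamma> X (ext j X v)"
    proof (rule quotient_factor[OF g[OF j] PVj P'[OF j] N', of "\<lambda>X v. \<gamma> X (ext j X v)"])
      fix X assume X: "X \<in> Obj C"
      show "(\<lambda>v. \<gamma> X (ext j X v)) \<in> hom (FOb (product_functor (up j) V) X) (FOb N X)"
      proof (rule homI)
        fix v w assume v: "v \<in> carrier (FOb (product_functor (up j) V) X)" "w \<in> carrier (FOb (product_functor (up j) V) X)"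
        show "\<gamma> X (ext j X v) \<in> carrier (FOb N X)"
          using quotient_mapD(3)[OF \<gamma> X ext[OF X v(1)]] .
        have "ext j X (v \<otimes>\<^bsub>FOb (product_functor (up j) V) X\<^esub> w) = ext j X v \<otimes>\<^bsub>FOb (product_functor J V) X\<^esub> ext j X w"
          using V11[OF _ X] by (auto simp: ext_def)
        then show "\<gamma> X (ext j X (v \<otimes>\<^bsub>FOb (product_functor (up j) V) X\<^esub> w)) = \<gamma> X (ext j X v) \<otimes>\<^bsub>FOb N X\<^esub> \<gamma> X (ext j X w)"
          using hom_mult[OF quotient_mapD(1)[OF \<gamma> X] ext[OF X v(1)] ext[OF X v(2)]] by simp
      qed
      show "\<gamma> X (ext j X v) = \<one>\<^bsub>FOb N X\<^esub>"
        if "v \<in> carrier (FOb (product_functor (up j) V) X)" "v \<in> {\<one>\<^bsub>FOb (product_functor (up j) V) X\<^esub>}" for v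
      proof -
        have "ext j X v = \<one>\<^bsub>FOb (product_functor J V) X\<^esub>"
          using that(2) by (auto simp: ext_def)
        then show ?thesis using comm_group_hom_one[OF quotient_mapD(1)[OF \<gamma> X] functor_group[OF PV X] functor_group[OF N' X]] by simp
      qed
      fix Y f v assume Y: "Y \<in> Obj C" "f \<in> arr C X Y" "v \<in> carrier (FOb (product_functor (up j) V) X)"
      have "ext j Y (FAr (product_functor (up j) V) X Y f v) = FAr (product_functor J V) X Y f (ext j X v)"
        using FAr_one[OF V' X Y(1,2)] by (auto simp: ext_def)
      then show "\<gamma> Y (ext j Y (FAr (product_functor (up j) V) X Y f v)) = FAr N X Y f (\<gamma> X (ext j X v))"
        using quotient_mapD(5)[OF \<gamma> X Y(1,2) ext[OF X Y(3)]] by simp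
    qed (blast intro: that)
    then show "\<exists>c. c \<in> carrier (Nat C (P j) N) \<and>
    (\<forall>X\<in>Obj C. \<forall>v\<in>carrier (FOb (product_functor (up j) V) X). c X (g j X v) = \<gamma> X (ext j X v))" by blast
  qed
  from bchoice[OF this] obtain c where cN: "\<And>j. j \<in> J \<Longrightarrow> c j \<in> carrier (Nat C (P j) N)"
    and cg: "\<And>j X v. j \<in> J \<Longrightarrow> X \<in> Obj C \<Longrightarrow> v \<in> carrier (FOb (product_functor (up j) V) X) \<Longrightarrow>
      c j X (g j X v) = \<gamma> X (ext j X v)"
    by blast
  have gc: "g j X v \<in> carrier (FOb (P j) X)" if "j \<in> J" "X \<in> Obj C" "v \<in> carrier (FOb (product_functor (up j) V) X)" for j X v
    using quotient_mapD(3)[OF g[OF that(1)] that(2,3)] .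
  have sys: "is_direct_system (abfun_cat C) J r P t"
    unfolding is_direct_system_def
  proof (intro conjI ballI allI impI; (clarify)?)
    show "P j \<in> Obj (abfun_cat C)" if "j \<in> J" for j using P that by simp
    show "t j k \<in> arr (abfun_cat C) (P j) (P k)" if "(j, k) \<in> r" for j k using tN that by simp
    show "t j j = Idn (abfun_cat C) (P j)" if j: "j \<in> J" for j
    proof -
      have jj: "(j, j) \<in> r" using d(2) j .
      have "Idn (abfun_cat C) (P j) = natify C (P j) (\<lambda>X x. x)"
        by (simp add: abfun_cat_def natify_def)
      moreover have "natify C (P j) (\<lambda>X x. x) \<in> carrier (Nat C (P j) (P j))"
        by (rule natify_Nat[OF P'[OF j]]) (auto simp: hom_def)
      moreover have "t j j X y = y" if X: "X \<in> Obj C" "y \<in> carrier (FOb (P j) X)" for X y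
      proof -
        obtain v where v: "v \<in> carrier (FOb (product_functor (up j) V) X)" "y = g j X v"
          using gsurj[OF j X] by blast
        moreover have "res j v = v" using v(1) by (simp add: res_def PiE_restrict)
        ultimately show ?thesis using tg[OF jj X(1) v(1)] by simp
      qed
      ultimately show ?thesis using tN[OF jj] by (intro Nat_eqI[of "t j j" C "P j" "P j"]) auto
    qed
    show "Cmp (abfun_cat C) (P i) (P j) (P k) (t j k) (t i j) = t i k" if ij: "(i, j) \<in> r" "(j, k) \<in> r" for i j k
    proof -
      have ik: "(i, k) \<in> r" using d(4) ij by blast
      have I: "i \<in> J" "j \<in> J" "k \<in> J" using d(3) ij by auto
      have "t j k X (t i j X y) = t i k X y" if X: "X \<in> Obj C" "y \<in> carrier (FOb (P i) X)" for X y
      proof -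
        obtain v where v: "v \<in> carrier (FOb (product_functor (up i) V) X)" "y = g i X v"
          using gsurj[OF I(1) X] by blast
        moreover have "res k (res j v) = res k v" using upm[OF ij(2)] by (auto simp: res_def restrict_def fun_eq_iff)
        ultimately show ?thesis using tg[OF ij(1) X(1) v(1)] tg[OF ik X(1) v(1)] tg[OF ij(2) X(1) res[OF ij(1) v(1)]] by simp
      qed
      then show ?thesis unfolding abfun_Cmp_eq_iff[OF P'[OF I(1)] tN[OF ij(1)] tN[OF ij(2)] tN[OF ik]] by blast
    qed
  qed
  have coc: "is_cocone (abfun_cat C) J r P t N c"
    unfolding is_cocone_def
  proof (intro conjI ballI; (clarify)?)
    show "c j \<in> arr (abfun_cat C) (P j) N" if "j \<in> J" for j using cN that by simp
    show "Cmp (abfun_cat C) (P i) (P j) N (c j) (t i j) = c i" if ij: "(i, j) \<in> r" for i j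
    proof -
      have I: "i \<in> J" "j \<in> J" using d(3) ij by auto
      have "c j X (t i j X y) = c i X y" if X: "X \<in> Obj C" "y \<in> carrier (FOb (P i) X)" for X y
      proof -
        obtain v where v: "v \<in> carrier (FOb (product_functor (up i) V) X)" "y = g i X v"
          using gsurj[OF I(1) X] by blast
        have rv: "res j v \<in> carrier (FOb (product_functor (up j) V) X)" using res[OF ij v(1)] .
        note e1 = ext[OF X(1) rv] and e2 = ext[OF X(1) v(1)]
        have "ext j X (res j v) \<otimes>\<^bsub>FOb (product_functor J V) X\<^esub> inv\<^bsub>FOb (product_functor J V) X\<^esub> ext i X v
          \<in> eventually_zero J r V X" (is "?z \<in> _")
        proof -
          have z: "?z \<in> carrier (FOb (product_functor J V) X)"
            using e1 e2 functor_closed[OF PV X(1)] by simp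
          have "?z k = \<one>\<^bsub>FOb (V k) X\<^esub>" if k: "k \<in> J" "(j, k) \<in> r" for k
          proof -
            have up: "k \<in> up j" "k \<in> up i" using k upm[OF ij] by (auto simp: up_def)
            have "?z k = v k \<otimes>\<^bsub>FOb (V k) X\<^esub> inv\<^bsub>FOb (V k) X\<^esub> v k"
              using functor_on_product_inv[OF V' X(1) e2[unfolded product_functor_simps]] k up
              by (simp add: ext_def res_def)
            moreover have "v k \<in> carrier (FOb (V k) X)" using v(1) up by auto
            ultimately show ?thesis
              using comm_group_diff_eq_one[OF functor_group[OF V'[OF k(1)] X(1)]] by simp
          qed
          then show ?thesis using z I(2) unfolding eventually_zero_def product_functor_simps(1) by blast
        qed
        then have "\<gamma> X (ext j X (res j v)) = \<gamma> X (ext i X v)"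
          using quotient_map_eq_iff[OF \<gamma> PV N' X(1) e1 e2] by simp
        then show ?thesis using tg[OF ij X(1) v(1)] cg[OF I(1) X(1) v(1)] cg[OF I(2) X(1) rv] v(2) by simp
      qed
      then show ?thesis unfolding abfun_Cmp_eq_iff[OF P'[OF I(1)] tN[OF ij] cN[OF I(2)] cN[OF I(1)]] by blast
    qed
  qed
  have univ: "\<exists>!k. k \<in> carrier (Nat C N W) \<and> (\<forall>i\<in>J. Cmp (abfun_cat C) (P i) N W k (c i) = h i)"
    if W: "is_additive_functor C W" and h: "is_cocone (abfun_cat C) J r P t W h" for W h
  proof -
    have W': "functor_on C W" using W by (rule additive_functor_on)
    have hN: "h j \<in> carrier (Nat C (P j) W)" if "j \<in> J" for j using h that by (simp add: is_cocone_def)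
    \<comment> \<open>All components of the cocone are determined by the one at the least index, so
      the required map is induced by \<open>h j0\<close> on the full product; it kills eventually
      zero families because some restriction of such a family is zero.\<close>
    have ht: "h j X (g j X (res j v)) = h j0 X (g j0 X v)"
      if j: "j \<in> J" and X: "X \<in> Obj C" and v: "v \<in> carrier (FOb (product_functor J V) X)" for j X v
    proof -
      have v': "v \<in> carrier (FOb (product_functor (up j0) V) X)" using v up0 by simp
      have "Cmp (abfun_cat C) (P j0) (P j) W (h j) (t j0 j) = h j0"
        using h j0(2)[OF j] by (auto simp: is_cocone_def)
      then show ?thesis
        using abfun_Cmp_apply[OF X gc[OF j0(1) X v'], of "P j" W "h j" "t j0 j"] tg[OF j0(2)[OF j] X v'] by simp
    qed
    have gh: "g j0 X \<in> hom (FOb (product_functor J V) X) (FOb (P j0) X)" if "X \<in> Obj C" for X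
      using quotient_mapD(1)[OF g[OF j0(1)] that] up0 by simp
    obtain k where k: "k \<in> carrier (Nat C N W)"
      "\<And>X v. X \<in> Obj C \<Longrightarrow> v \<in> carrier (FOb (product_functor J V) X) \<Longrightarrow> k X (\<gamma> X v) = h j0 X (g j0 X v)"
    proof (rule quotient_factor[OF \<gamma> PV N' W', of "\<lambda>X v. h j0 X (g j0 X v)"])
      fix X assume X: "X \<in> Obj C"
      show "(\<lambda>v. h j0 X (g j0 X v)) \<in> hom (FOb (product_functor J V) X) (FOb W X)"
        using Group.hom_compose[OF gh[OF X] Nat_hom[OF hN[OF j0(1)] X]] by (simp add: comp_def)
      show "h j0 X (g j0 X v) = \<one>\<^bsub>FOb W X\<^esub>"
        if v: "v \<in> carrier (FOb (product_functor J V) X)" "v \<in> eventually_zero J r V X" for v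
      proof -
        obtain j where j: "j \<in> J" "\<forall>k\<in>J. (j, k) \<in> r \<longrightarrow> v k = \<one>\<^bsub>FOb (V k) X\<^esub>"
          using v(2) by (auto simp: eventually_zero_def)
        then have "res j v = \<one>\<^bsub>FOb (product_functor (up j) V) X\<^esub>"
          by (auto simp: res_def up_def)
        then have "g j X (res j v) = \<one>\<^bsub>FOb (P j) X\<^esub>"
          using comm_group_hom_one[OF quotient_mapD(1)[OF g[OF j(1)] X] functor_group[OF PVj X] functor_group[OF P'[OF j(1)] X]] by simp
        then show ?thesis using ht[OF j(1) X v(1)] Nat_one[OF hN[OF j(1)] P'[OF j(1)] W' X] by simp
      qed
      fix Y f v assume Y: "Y \<in> Obj C" "f \<in> arr C X Y" "v \<in> carrier (FOb (product_functor J V) X)"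
      have v': "v \<in> carrier (FOb (product_functor (up j0) V) X)" using Y up0 by simp
      show "h j0 Y (g j0 Y (FAr (product_functor J V) X Y f v)) = FAr W X Y f (h j0 X (g j0 X v))"
        using quotient_mapD(5)[OF g[OF j0(1)] X Y(1,2) v'] Nat_natural[OF hN[OF j0(1)] X Y(1,2) gc[OF j0(1) X v']] up0 by simp
    qed (blast intro: that)
    show ?thesis
    proof (rule ex1I[of _ k])
      show "k \<in> carrier (Nat C N W) \<and> (\<forall>j\<in>J. Cmp (abfun_cat C) (P j) N W k (c j) = h j)"
      proof (intro conjI ballI k(1))
        fix j assume j: "j \<in> J"
        have "k X (c j X y) = h j X y" if X: "X \<in> Obj C" "y \<in> carrier (FOb (P j) X)" for X y
        proof -
          obtain v where v: "v \<in> carrier (FOb (product_functor (up j) V) X)" "y = g j X v"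
            using gsurj[OF j X] by blast
          have "res j (ext j X v) = v" using v(1) upJ by (auto simp: res_def ext_def PiE_iff extensional_def restrict_def fun_eq_iff)
          then show ?thesis
            using cg[OF j X(1) v(1)] k(2)[OF X(1) ext[OF X(1) v(1)]] ht[OF j X(1) ext[OF X(1) v(1)]] v(2) by simp
        qed
        then show "Cmp (abfun_cat C) (P j) N W k (c j) = h j"
          unfolding abfun_Cmp_eq_iff[OF P'[OF j] cN[OF j] k(1) hN[OF j]] by blast
      qed
      fix k' assume k': "k' \<in> carrier (Nat C N W) \<and> (\<forall>j\<in>J. Cmp (abfun_cat C) (P j) N W k' (c j) = h j)"
      then have k'N: "k' \<in> carrier (Nat C N W)" by blast
      show "k' = k"
      proof (rule Nat_eqI[OF k'N k(1)])
        fix X y assume X: "X \<in> Obj C" "y \<in> carrier (FOb N X)"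
        obtain v where v: "v \<in> carrier (FOb (product_functor J V) X)" "\<gamma> X v = y"
          using quotient_mapD(4)[OF \<gamma> X] by auto
        have v': "v \<in> carrier (FOb (product_functor (up j0) V) X)" using v up0 by simp
        have "ext j0 X v = v" using v(1) up0 by (auto simp: ext_def PiE_iff extensional_def restrict_def fun_eq_iff)
        then have "c j0 X (g j0 X v) = y" using cg[OF j0(1) X(1) v'] v(2) by simp
        moreover have "k' X (c j0 X (g j0 X v)) = h j0 X (g j0 X v)"
          using k' j0(1) abfun_Cmp_eq_iff[OF P'[OF j0(1)] cN[OF j0(1)] k'N hN[OF j0(1)]] gc[OF j0(1) X(1) v'] X by blast
        ultimately show "k' X y = k X y" using k(2)[OF X(1) v(1)] v(2) by simp
      qed
    qed
  qed
  have "is_directed_colimit (abfun_cat C) J r P t N c"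
    using J(2) sys N coc univ by (simp add: is_directed_colimit_def)
  from that[OF \<pi>[unfolded up_def] this] show thesis .
qed

section \<open>Purity and exactness\<close>

definition pure_monomorphism :: "('o, 'u, 'u) abfun \<Rightarrow> ('o, 'u, 'u) abfun \<Rightarrow> ('o \<Rightarrow> 'u \<Rightarrow> 'u) \<Rightarrow> bool" where
  "pure_monomorphism M N i \<longleftrightarrow> is_monomorphism (abfun_cat C) M N i \<and>
     (\<forall>L p. is_cokernel (abfun_cat C) M N L i p \<longrightarrow>
        (\<forall>G g. (\<exists>A B b q. rep_cokernel A B b G q) \<longrightarrow> g \<in> arr (abfun_cat C) G L \<longrightarrow>
           (\<exists>h\<in>arr (abfun_cat C) G N. Cmp (abfun_cat C) G N L p h = g)))"

text \<open>Factorisation without uniqueness, which is all that a triangle provides.\<close>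

definition weak_cokernel :: "'o \<Rightarrow> 'o \<Rightarrow> 'o \<Rightarrow> 'u \<Rightarrow> 'u \<Rightarrow> bool" where
  "weak_cokernel A B Z b k \<longleftrightarrow> A \<in> Obj C \<and> B \<in> Obj C \<and> Z \<in> Obj C \<and> b \<in> arr C A B \<and> k \<in> arr C B Z \<and>
     Cmp C A B Z k b = \<one>\<^bsub>Hom C A Z\<^esub> \<and>
     (\<forall>W\<in>Obj C. \<forall>h\<in>arr C B W. Cmp C A B W h b = \<one>\<^bsub>Hom C A W\<^esub> \<longrightarrow> (\<exists>h'\<in>arr C Z W. h = Cmp C B Z W h' k))"

text \<open>This plays the role of exactness on triangles, stated so that triangles need not be
  mentioned.\<close>

definition exact_functor :: "('o, 'u, 'u) abfun \<Rightarrow> bool" where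
  "exact_functor M \<longleftrightarrow> (\<forall>A B Z b k. weak_cokernel A B Z b k \<longrightarrow>
     (\<forall>x\<in>carrier (FOb M B). FAr M B Z k x = \<one>\<^bsub>FOb M Z\<^esub> \<longrightarrow> (\<exists>z\<in>carrier (FOb M A). FAr M A B b z = x)))"

lemma exact_functorD:
  "exact_functor M \<Longrightarrow> weak_cokernel A B Z b k \<Longrightarrow> x \<in> carrier (FOb M B) \<Longrightarrow> FAr M B Z k x = \<one>\<^bsub>FOb M Z\<^esub>
    \<Longrightarrow> \<exists>z\<in>carrier (FOb M A). FAr M A B b z = x"
  unfolding exact_functor_def by blast

lemma weak_cokernelD:
  assumes "weak_cokernel A B Z b k"
  shows "A \<in> Obj C" "B \<in> Obj C" "Z \<in> Obj C" "b \<in> arr C A B" "k \<in> arr C B Z" "Cmp C A B Z k b = \<one>\<^bsub>Hom C A Z\<^esub>"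
    "\<And>W h. W \<in> Obj C \<Longrightarrow> h \<in> arr C B W \<Longrightarrow> Cmp C A B W h b = \<one>\<^bsub>Hom C A W\<^esub> \<Longrightarrow> \<exists>h'\<in>arr C Z W. h = Cmp C B Z W h' k"
  using assms by (auto simp: weak_cokernel_def)

text \<open>The residue of \<open>n\<close> modulo \<open>M\<close> is killed by \<open>b\<close>
  and gives a map from the module presented by \<open>b\<close> to \<open>N/M\<close>. A lift of it
  to \<open>N\<close> yields \<open>n'\<close> with the same residue and \<open>b n' = 0\<close>,
  and then \<open>n - n'\<close> is a solution in \<open>M\<close>.\<close>

lemma pure_monomorphism_solve:
  assumes pure: "pure_monomorphism M N i" and M: "is_additive_functor C M" and N: "is_additive_functor C N"
    and b: "A \<in> Obj C" "B \<in> Obj C" "b \<in> arr C A B" and x: "x \<in> carrier (FOb M B)"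
    and n: "n \<in> carrier (FOb N A)" "FAr N A B b n = i B x"
  shows "\<exists>z\<in>carrier (FOb M A). FAr M A B b z = x"
proof -
  have M': "functor_on C M" and N': "functor_on C N" using M N by (simp_all add: additive_functor_on)
  have mono: "is_monomorphism (abfun_cat C) M N i" using pure by (simp add: pure_monomorphism_def)
  then have i: "i \<in> carrier (Nat C M N)" by (simp add: is_monomorphism_def)
  obtain L p where L: "is_cokernel (abfun_cat C) M N L i p" "p \<in> carrier (Nat C N L)" "is_additive_functor C L"
    and p: "quotient_map C N L p (\<lambda>X. i X ` carrier (FOb M X))"
    using cokernel_exists[OF M N i] .
  have L': "functor_on C L" using L(3) by (rule additive_functor_on)
  obtain G q where G: "rep_cokernel A B b G q" using rep_cokernel_exists[OF b] .
  define e where "e = q A (Idn C A)"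
  have e: "e \<in> carrier (FOb G A)" "FAr G A B b e = \<one>\<^bsub>FOb G B\<^esub>"
    using rep_cokernel_generator[OF G] by (auto simp: e_def)
  have G': "functor_on C G" using rep_cokernelD[OF G] by blast
  have pn: "p A n \<in> carrier (FOb L A)" using Nat_closed[OF L(2) b(1) n(1)] .
  have "FAr L A B b (p A n) = p B (i B x)"
    using Nat_natural[OF L(2) b n(1)] n(2) by simp
  also have "\<dots> = \<one>\<^bsub>FOb L B\<^esub>" using quotient_mapD(2)[OF p b(2) Nat_closed[OF i b(2) x]] x by blast
  finally obtain g where g: "g \<in> carrier (Nat C G L)" "g A e = p A n"
    using rep_cokernel_map[OF G L(3) pn] unfolding e_def by metis
  then obtain h where h: "h \<in> carrier (Nat C G N)" "Cmp (abfun_cat C) G N L p h = g"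
    using pure L(1) G unfolding pure_monomorphism_def abfun_cat_simps by blast
  have ph: "p A (h A e) = p A n"
    using abfun_Cmp_apply[OF b(1) e(1), of N L p h] h(2) g(2) by simp
  have hc: "h A e \<in> carrier (FOb N A)" using Nat_closed[OF h(1) b(1) e(1)] .
  have hb: "FAr N A B b (h A e) = \<one>\<^bsub>FOb N B\<^esub>"
    using Nat_natural[OF h(1) b e(1)] e(2) Nat_one[OF h(1) G' N' b(2)] by simp
  have "n \<otimes>\<^bsub>FOb N A\<^esub> inv\<^bsub>FOb N A\<^esub> h A e \<in> i A ` carrier (FOb M A)"
    using quotient_map_eq_iff[OF p N' L' b(1) n(1) hc] ph by simp
  then obtain z where z: "z \<in> carrier (FOb M A)" "i A z = n \<otimes>\<^bsub>FOb N A\<^esub> inv\<^bsub>FOb N A\<^esub> h A e" by force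
  interpret NB: comm_group "FOb N B" using functor_group[OF N' b(2)] .
  have ix: "i B x \<in> carrier (FOb N B)" using Nat_closed[OF i b(2) x] .
  have "i B (FAr M A B b z) = FAr N A B b (n \<otimes>\<^bsub>FOb N A\<^esub> inv\<^bsub>FOb N A\<^esub> h A e)"
    using Nat_natural[OF i b z(1)] z(2) by simp
  also have "\<dots> = i B x"
    using n hc hb b functor_closed[OF N' b(1)] ix by (simp add: FAr_mult[OF N'] FAr_inv[OF N'])
  finally have "i B (FAr M A B b z \<otimes>\<^bsub>FOb M B\<^esub> inv\<^bsub>FOb M B\<^esub> x) = \<one>\<^bsub>FOb N B\<^esub>"
    using comm_group_diff_hom_eq[OF Nat_hom[OF i b(2)] functor_group[OF M' b(2)] functor_group[OF N' b(2)]]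
      x FAr_closed[OF M' b z(1)] by simp
  then have "FAr M A B b z \<otimes>\<^bsub>FOb M B\<^esub> inv\<^bsub>FOb M B\<^esub> x = \<one>\<^bsub>FOb M B\<^esub>"
    using monomorphism_inj[OF mono M' N' b(2)] x FAr_closed[OF M' b z(1)] functor_closed[OF M' b(2)] by simp
  then show ?thesis
    using comm_group_diff_eq_one[OF functor_group[OF M' b(2)] FAr_closed[OF M' b z(1)] x] z(1) by blast
qed

lemma pure_monomorphism_exact:
  assumes pure: "pure_monomorphism M N i" and M: "is_additive_functor C M" and N: "is_additive_functor C N"
    and ex: "exact_functor N"
  shows "exact_functor M"
  unfolding exact_functor_def
proof (intro allI impI ballI)
  fix A B Z b k x assume wc: "weak_cokernel A B Z b k" and x: "x \<in> carrier (FOb M B)" "FAr M B Z k x = \<one>\<^bsub>FOb M Z\<^esub>"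
  note w = weak_cokernelD[OF wc]
  have M': "functor_on C M" and N': "functor_on C N" using M N by (simp_all add: additive_functor_on)
  have i: "i \<in> carrier (Nat C M N)" using pure by (simp add: pure_monomorphism_def is_monomorphism_def)
  have "FAr N B Z k (i B x) = \<one>\<^bsub>FOb N Z\<^esub>"
    using Nat_natural[OF i w(2,3,5) x(1)] x(2) Nat_one[OF i M' N' w(3)] by simp
  then obtain n where "n \<in> carrier (FOb N A)" "FAr N A B b n = i B x"
    using exact_functorD[OF ex wc Nat_closed[OF i w(2) x(1)]] by blast
  then show "\<exists>z\<in>carrier (FOb M A). FAr M A B b z = x"
    using pure_monomorphism_solve[OF pure M N w(1,2,4) x(1)] by blast
qed

text \<open>A map from the module presented by \<open>b\<close> to \<open>N/M\<close> is a residue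
  class killed by \<open>b\<close>. For a representative \<open>n\<close>, the element
  \<open>b n\<close> lies in \<open>M\<close> and is killed by the weak cokernel \<open>k\<close>,
  so exactness writes it as \<open>b z\<close> with \<open>z\<close> in \<open>M\<close>; then
  \<open>n - z\<close> gives the lift.\<close>

lemma exact_pure_monomorphism:
  assumes wc: "\<And>A B b. A \<in> Obj C \<Longrightarrow> B \<in> Obj C \<Longrightarrow> b \<in> arr C A B \<Longrightarrow> \<exists>Z k. weak_cokernel A B Z b k"
    and M: "is_additive_functor C M" and ex: "exact_functor M" and N: "is_additive_functor C N"
    and mono: "is_monomorphism (abfun_cat C) M N i"
  shows "pure_monomorphism M N i"
  unfolding pure_monomorphism_def
proof (intro conjI allI impI mono)
  fix L p G g assume L: "is_cokernel (abfun_cat C) M N L i p" and "\<exists>A B b q. rep_cokernel A B b G q"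
    and "g \<in> arr (abfun_cat C) G L"
  then obtain A B b q where G: "rep_cokernel A B b G q" and g: "g \<in> carrier (Nat C G L)" by auto
  have M': "functor_on C M" and N': "functor_on C N" using M N by (simp_all add: additive_functor_on)
  have i: "i \<in> carrier (Nat C M N)" using mono by (simp add: is_monomorphism_def)
  have La: "is_additive_functor C L" and pN: "p \<in> carrier (Nat C N L)" using is_cokernelD[OF L] by auto
  have L': "functor_on C L" using La by (rule additive_functor_on)
  have p: "quotient_map C N L p (\<lambda>X. i X ` carrier (FOb M X))"
    using cokernel_quotient_map[OF L M N i] .
  note b = rep_cokernelD(1-3)[OF G]
  have G': "functor_on C G" using rep_cokernelD[OF G] by blast
  define e where "e = q A (Idn C A)"
  have e: "e \<in> carrier (FOb G A)" "FAr G A B b e = \<one>\<^bsub>FOb G B\<^esub>"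
    using rep_cokernel_generator[OF G] by (auto simp: e_def)
  obtain Z k where k: "weak_cokernel A B Z b k" using wc[OF b] by blast
  note w = weak_cokernelD[OF k]
  obtain n where n: "n \<in> carrier (FOb N A)" "p A n = g A e"
    using quotient_mapD(4)[OF p b(1) Nat_closed[OF g b(1) e(1)]] by blast
  have "p B (FAr N A B b n) = \<one>\<^bsub>FOb L B\<^esub>"
    using Nat_natural[OF pN b n(1)] n(2) Nat_natural[OF g b e(1)] e(2) Nat_one[OF g G' L' b(2)] by simp
  then obtain x where x: "x \<in> carrier (FOb M B)" "i B x = FAr N A B b n"
    using quotient_mapD(2)[OF p b(2) FAr_closed[OF N' b n(1)]] by force
  have "i Z (FAr M B Z k x) = \<one>\<^bsub>FOb N Z\<^esub>"
    using Nat_natural[OF i w(2,3,5) x(1)] x(2) FAr_Cmp[OF N' w(1-5) n(1)] w(6) FAr_zero[OF N' w(1,3) n(1)] by simp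
  then have "FAr M B Z k x = \<one>\<^bsub>FOb M Z\<^esub>"
    using monomorphism_inj[OF mono M' N' w(3) FAr_closed[OF M' w(2,3,5) x(1)]] by simp
  then obtain z where z: "z \<in> carrier (FOb M A)" "FAr M A B b z = x"
    using exact_functorD[OF ex k x(1)] by blast
  have iz: "i A z \<in> carrier (FOb N A)" using Nat_closed[OF i b(1) z(1)] .
  define n' where "n' = n \<otimes>\<^bsub>FOb N A\<^esub> inv\<^bsub>FOb N A\<^esub> i A z"
  have n': "n' \<in> carrier (FOb N A)" using n(1) iz functor_closed[OF N' b(1)] by (simp add: n'_def)
  have "FAr N A B b n' = \<one>\<^bsub>FOb N B\<^esub>"
    unfolding n'_def
    using comm_group_diff_hom_eq[OF FAr_hom[OF N' b] functor_group[OF N' b(1)] functor_group[OF N' b(2)] n(1) iz]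
      Nat_natural[OF i b z(1)] z(2) x(2) by simp
  then obtain h where h: "h \<in> carrier (Nat C G N)" "h A e = n'"
    using rep_cokernel_map[OF G N n'] unfolding e_def by metis
  have "p A n' = g A e"
  proof -
    interpret NA: comm_group "FOb N A" using functor_group[OF N' b(1)] .
    have "n' \<otimes>\<^bsub>FOb N A\<^esub> inv\<^bsub>FOb N A\<^esub> n = i A (inv\<^bsub>FOb M A\<^esub> z)"
      using n(1) iz Nat_inv[OF i M' N' b(1) z(1)]
      by (simp add: n'_def NA.m_comm[of n "inv\<^bsub>FOb N A\<^esub> i A z"] NA.m_assoc)
    then have "n' \<otimes>\<^bsub>FOb N A\<^esub> inv\<^bsub>FOb N A\<^esub> n \<in> i A ` carrier (FOb M A)"
      using functor_closed(2)[OF M' b(1) z(1)] by blast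
    then show ?thesis using quotient_map_eq_iff[OF p N' L' b(1) n' n(1)] n(2) by simp
  qed
  then have "Cmp (abfun_cat C) G N L p h = g"
    using rep_cokernel_Nat_eqI[OF G L' abfun_Cmp_closed[OF G' h(1) pN] g] h(2)
      abfun_Cmp_apply[OF b(1) e(1), of N L p h] by (simp add: e_def)
  then show "\<exists>h\<in>arr (abfun_cat C) G N. Cmp (abfun_cat C) G N L p h = g" using h(1) by auto
qed

text \<open>Conversely, \<open>M\<close> embeds into the pushout of \<open>M\<close> and \<open>(A,-)\<close> along \<open>x\<close> and \<open>(b,-)\<close>,
  where \<open>x\<close> becomes divisible by \<open>b\<close>.\<close>

lemma pure_imp_exact:
  assumes M: "is_additive_functor C M"
    and pure: "\<And>N i. is_additive_functor C N \<Longrightarrow> is_monomorphism (abfun_cat C) M N i \<Longrightarrow> pure_monomorphism M N i"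
  shows "exact_functor M"
  unfolding exact_functor_def
proof (intro allI impI ballI)
  fix A B Z b k x assume wc: "weak_cokernel A B Z b k" and x: "x \<in> carrier (FOb M B)" "FAr M B Z k x = \<one>\<^bsub>FOb M Z\<^esub>"
  note w = weak_cokernelD[OF wc]
  have M': "functor_on C M" using M by (rule additive_functor_on)
  define S where "S = sum_functor M (rep C A)"
  have S: "functor_on C S" using functor_on_sum[OF M' functor_on_rep[OF w(1)]] by (simp add: S_def)
  have Sc: "carrier (FOb S X) = carrier (FOb M X) \<times> arr C A X" for X
    by (simp add: S_def sum_functor_def)
  have S1: "\<one>\<^bsub>FOb S X\<^esub> = (\<one>\<^bsub>FOb M X\<^esub>, \<one>\<^bsub>Hom C A X\<^esub>)" for X
    by (simp add: S_def sum_functor_def DirProd_def)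
  have Sm: "(m, u) \<otimes>\<^bsub>FOb S X\<^esub> (m', u') = (m \<otimes>\<^bsub>FOb M X\<^esub> m', u \<otimes>\<^bsub>Hom C A X\<^esub> u')" for X m u m' u'
    by (simp add: S_def sum_functor_def)
  have Si: "inv\<^bsub>FOb S X\<^esub> (m, u) = (inv\<^bsub>FOb M X\<^esub> m, inv\<^bsub>Hom C A X\<^esub> u)"
    if "X \<in> Obj C" "m \<in> carrier (FOb M X)" "u \<in> arr C A X" for X m u
    using that w(1) by (simp add: S_def sum_functor_def inv_DirProd comm_group_imp_group functor_group[OF M'] comm_group_Hom)
  have Sf: "FAr S X Y f (m, u) = (FAr M X Y f m, Cmp C A X Y f u)" for X Y f m u
    by (simp add: S_def sum_functor_def)
  \<comment> \<open>Dividing by these pairs identifies \<open>x\<close> in \<open>M\<close> with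
    \<open>b\<close> in \<open>(A,-)\<close>; the quotient is the pushout.\<close>
  define K where "K X = {(FAr M B X u x, inv\<^bsub>Hom C A X\<^esub> (Cmp C A B X u b)) | u. u \<in> arr C B X}" for X
  have K: "subfunctor C S K"
    unfolding subfunctor_def
  proof (intro conjI ballI)
    fix X assume X: "X \<in> Obj C"
    interpret GA: comm_group "Hom C A X" using comm_group_Hom w(1) X by blast
    interpret GM: comm_group "FOb M X" using functor_group[OF M' X] .
    have Kin: "(FAr M B X u x, inv\<^bsub>Hom C A X\<^esub> (Cmp C A B X u b)) \<in> K X" if "u \<in> arr C B X" for u
      using that by (auto simp: K_def)
    have cl: "FAr M B X u x \<in> carrier (FOb M X)" "Cmp C A B X u b \<in> arr C A X" if "u \<in> arr C B X" for u
      using FAr_closed[OF M' w(2) X that x(1)] Cmp_arr[OF w(1,2) X w(4) that] by auto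
    show "subgroup (K X) (FOb S X)"
    proof (rule group.subgroupI[OF comm_group_imp_group[OF functor_group[OF S X]]])
      show "K X \<subseteq> carrier (FOb S X)" using cl by (auto simp: K_def Sc)
      show "K X \<noteq> {}" using Kin Hom_closed(1)[OF w(2) X] by blast
      show "inv\<^bsub>FOb S X\<^esub> s \<in> K X" if "s \<in> K X" for s
      proof -
        from that obtain u where u: "u \<in> arr C B X" "s = (FAr M B X u x, inv\<^bsub>Hom C A X\<^esub> (Cmp C A B X u b))"
          by (auto simp: K_def)
        then show ?thesis
          using Kin[OF Hom_closed(2)[OF w(2) X u(1)]] cl[OF u(1)] X x(1) w
          by (simp add: Si FAr_minus[OF M'] Cmp_minus_left)
      qed
      show "s \<otimes>\<^bsub>FOb S X\<^esub> s' \<in> K X" if ss: "s \<in> K X" "s' \<in> K X" for s s'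
      proof -
        from ss obtain u u' where u: "u \<in> arr C B X" "s = (FAr M B X u x, inv\<^bsub>Hom C A X\<^esub> (Cmp C A B X u b))"
          "u' \<in> arr C B X" "s' = (FAr M B X u' x, inv\<^bsub>Hom C A X\<^esub> (Cmp C A B X u' b))"
          by (auto simp: K_def)
        then show ?thesis
          using Kin[OF Hom_closed(3)[OF w(2) X u(1,3)]] cl[OF u(1)] cl[OF u(3)] X x(1) w
          by (simp add: Sm FAr_add[OF M'] Cmp_add_left GA.inv_mult)
      qed
    qed
  next
    fix X Y f s assume X: "X \<in> Obj C" "Y \<in> Obj C" "f \<in> arr C X Y" and "s \<in> K X"
    then obtain u where u: "u \<in> arr C B X" "s = (FAr M B X u x, inv\<^bsub>Hom C A X\<^esub> (Cmp C A B X u b))"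
      by (auto simp: K_def)
    have "Cmp C B X Y f u \<in> arr C B Y" using Cmp_arr[OF w(2) X(1,2) u(1) X(3)] .
    moreover have "FAr S X Y f s = (FAr M B Y (Cmp C B X Y f u) x, inv\<^bsub>Hom C A Y\<^esub> (Cmp C A B Y (Cmp C B X Y f u) b))"
      using u X w x(1) by (simp add: Sf FAr_Cmp[OF M'] Cmp_minus_right Cmp_arr flip: Cmp_assoc)
    ultimately show "FAr S X Y f s \<in> K Y" by (auto simp: K_def)
  qed
  have sm: "small TYPE('u) (carrier (FOb S X))" if "X \<in> Obj C" for X
    unfolding Sc using small_Times[OF inaccessible additive_functor_small[OF M that] small_arr[OF w(1) that]] .
  obtain N :: "('o, 'u, 'u) abfun" and q where N: "is_additive_functor C N" and q: "quotient_map C S N q K"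
    using functor_quotient[OF S sm K] .
  have N': "functor_on C N" using N by (rule additive_functor_on)
  define i where "i = natify C M (\<lambda>X m. q X (m, \<one>\<^bsub>Hom C A X\<^esub>))"
  have iapp: "i X m = q X (m, \<one>\<^bsub>Hom C A X\<^esub>)" if "X \<in> Obj C" "m \<in> carrier (FOb M X)" for X m
    using that by (simp add: i_def)
  have m1: "(m, \<one>\<^bsub>Hom C A X\<^esub>) \<in> carrier (FOb S X)" if "X \<in> Obj C" "m \<in> carrier (FOb M X)" for X m
    using that Hom_closed(1)[OF w(1)] by (simp add: Sc)
  have iN: "i \<in> carrier (Nat C M N)"
    unfolding i_def
  proof (rule natify_Nat[OF M'])
    fix X assume X: "X \<in> Obj C"
    interpret GA: comm_group "Hom C A X" using comm_group_Hom w(1) X by blast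
    show "(\<lambda>m. q X (m, \<one>\<^bsub>Hom C A X\<^esub>)) \<in> hom (FOb M X) (FOb N X)"
    proof (rule homI)
      fix m m' assume m: "m \<in> carrier (FOb M X)" "m' \<in> carrier (FOb M X)"
      show "q X (m, \<one>\<^bsub>Hom C A X\<^esub>) \<in> carrier (FOb N X)" using quotient_mapD(3)[OF q X m1[OF X m(1)]] .
      show "q X (m \<otimes>\<^bsub>FOb M X\<^esub> m', \<one>\<^bsub>Hom C A X\<^esub>) = q X (m, \<one>\<^bsub>Hom C A X\<^esub>) \<otimes>\<^bsub>FOb N X\<^esub> q X (m', \<one>\<^bsub>Hom C A X\<^esub>)"
        using hom_mult[OF quotient_mapD(1)[OF q X] m1[OF X m(1)] m1[OF X m(2)]] by (simp add: Sm)
    qed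
    fix Y f m assume Y: "Y \<in> Obj C" "f \<in> arr C X Y" "m \<in> carrier (FOb M X)"
    show "q Y (FAr M X Y f m, \<one>\<^bsub>Hom C A Y\<^esub>) = FAr N X Y f (q X (m, \<one>\<^bsub>Hom C A X\<^esub>))"
      using quotient_mapD(5)[OF q X Y(1,2) m1[OF X Y(3)]] Cmp_zero_right[OF w(1) X Y(1,2)] by (simp add: Sf)
  qed
  \<comment> \<open>If \<open>m\<close> dies in the pushout, then \<open>m = u x\<close> with
    \<open>u b = 0\<close>, so \<open>u\<close> factors through the weak cokernel \<open>k\<close>,
    which kills \<open>x\<close>.\<close>
  have mono: "is_monomorphism (abfun_cat C) M N i"
  proof (rule is_monomorphismI[OF M' N' iN])
    fix X m assume X: "X \<in> Obj C" and m: "m \<in> carrier (FOb M X)" and "i X m = \<one>\<^bsub>FOb N X\<^esub>"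
    then have "(m, \<one>\<^bsub>Hom C A X\<^esub>) \<in> K X" using quotient_mapD(2)[OF q X m1[OF X m]] iapp[OF X m] by simp
    then obtain u where u: "u \<in> arr C B X" "m = FAr M B X u x" "inv\<^bsub>Hom C A X\<^esub> (Cmp C A B X u b) = \<one>\<^bsub>Hom C A X\<^esub>"
      by (auto simp: K_def)
    interpret GA: comm_group "Hom C A X" using comm_group_Hom w(1) X by blast
    have "Cmp C A B X u b = \<one>\<^bsub>Hom C A X\<^esub>"
      using u(3) Cmp_arr[OF w(1,2) X w(4) u(1)] by (metis GA.inv_inv GA.inv_one)
    then obtain u' where u': "u' \<in> arr C Z X" "u = Cmp C B Z X u' k" using w(7)[OF X u(1)] by blast
    then have "m = FAr M Z X u' (FAr M B Z k x)" using u(2) FAr_Cmp[OF M' w(2,3) X w(5) u'(1) x(1)] by simp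
    then show "m = \<one>\<^bsub>FOb M X\<^esub>" using x(2) FAr_one[OF M' w(3) X u'(1)] by simp
  qed
  \<comment> \<open>The image of the identity of \<open>A\<close> is the element that
    \<open>b\<close> carries to the image of \<open>x\<close>.\<close>
  define n where "n = q A (\<one>\<^bsub>FOb M A\<^esub>, Idn C A)"
  have s0: "(\<one>\<^bsub>FOb M A\<^esub>, Idn C A) \<in> carrier (FOb S A)" using functor_closed(1)[OF M' w(1)] Idn_arr[OF w(1)] by (simp add: Sc)
  have n: "n \<in> carrier (FOb N A)" using quotient_mapD(3)[OF q w(1) s0] by (simp add: n_def)
  have "FAr N A B b n = i B x"
  proof -
    interpret GB: comm_group "Hom C A B" using comm_group_Hom w(1,2) by blast
    interpret MB: comm_group "FOb M B" using functor_group[OF M' w(2)] .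
    have s1: "(\<one>\<^bsub>FOb M B\<^esub>, b) \<in> carrier (FOb S B)" using w by (simp add: Sc)
    have "FAr N A B b n = q B (\<one>\<^bsub>FOb M B\<^esub>, b)"
      using quotient_mapD(5)[OF q w(1,2,4) s0] w by (simp add: n_def Sf FAr_one[OF M'] Cmp_Idn_right)
    also have "\<dots> = q B (x, \<one>\<^bsub>Hom C A B\<^esub>)"
    proof -
      have "(\<one>\<^bsub>FOb M B\<^esub>, b) \<otimes>\<^bsub>FOb S B\<^esub> inv\<^bsub>FOb S B\<^esub> (x, \<one>\<^bsub>Hom C A B\<^esub>) =
          (FAr M B B (inv\<^bsub>Hom C B B\<^esub> Idn C B) x, inv\<^bsub>Hom C A B\<^esub> (Cmp C A B B (inv\<^bsub>Hom C B B\<^esub> Idn C B) b))"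
        using w x(1) by (simp add: Si Sm FAr_minus[OF M'] Cmp_minus_left Idn_arr FAr_Idn[OF M'] Cmp_Idn_left)
      then have "(\<one>\<^bsub>FOb M B\<^esub>, b) \<otimes>\<^bsub>FOb S B\<^esub> inv\<^bsub>FOb S B\<^esub> (x, \<one>\<^bsub>Hom C A B\<^esub>) \<in> K B"
        using Hom_closed(2)[OF w(2,2) Idn_arr[OF w(2)]] unfolding K_def by blast
      then show ?thesis using quotient_map_eq_iff[OF q S N' w(2) s1 m1[OF w(2) x(1)]] by simp
    qed
    finally show ?thesis using iapp[OF w(2) x(1)] by simp
  qed
  then show "\<exists>z\<in>carrier (FOb M A). FAr M A B b z = x"
    using pure_monomorphism_solve[OF pure[OF N mono] M N w(1,2,4) x(1) n] by blast
qed

end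

section \<open>Definable classes of modules\<close>

context small_preadditive_category
begin

definition definable_modules :: "('o, 'u, 'u) abfun set \<Rightarrow> bool" where
  "definable_modules \<E> \<longleftrightarrow> \<E> \<subseteq> Obj (abfun_cat C) \<and>
     (\<forall>(I :: 'u set) M P \<pi>. small TYPE('u) I \<longrightarrow> (\<forall>i\<in>I. M i \<in> \<E>) \<longrightarrow>
        is_product (abfun_cat C) I M P \<pi> \<longrightarrow> P \<in> \<E>) \<and>
     (\<forall>(I :: 'u set) r M t L c. small TYPE('u) I \<longrightarrow> (\<forall>i\<in>I. M i \<in> \<E>) \<longrightarrow>
        is_directed_colimit (abfun_cat C) I r M t L c \<longrightarrow> L \<in> \<E>) \<and>
     (\<forall>M\<in>Obj (abfun_cat C). \<forall>N\<in>\<E>. \<forall>i. pure_monomorphism M N i \<longrightarrow> M \<in> \<E>)"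

lemma definable_modulesD:
  assumes "definable_modules \<E>"
  shows "M \<in> \<E> \<Longrightarrow> is_additive_functor C M"
    and "\<lbrakk>small TYPE('u) (I :: 'u set); \<And>i. i \<in> I \<Longrightarrow> M' i \<in> \<E>; is_product (abfun_cat C) I M' P \<pi>\<rbrakk> \<Longrightarrow> P \<in> \<E>"
    and "\<lbrakk>small TYPE('u) (I :: 'u set); \<And>i. i \<in> I \<Longrightarrow> M' i \<in> \<E>; is_directed_colimit (abfun_cat C) I r M' t L c\<rbrakk> \<Longrightarrow> L \<in> \<E>"
    and "\<lbrakk>is_additive_functor C M; N \<in> \<E>; pure_monomorphism M N i\<rbrakk> \<Longrightarrow> M \<in> \<E>"
proof -
  show "M \<in> \<E> \<Longrightarrow> is_additive_functor C M" using assms unfolding definable_modules_def by auto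
  show "\<lbrakk>small TYPE('u) (I :: 'u set); \<And>i. i \<in> I \<Longrightarrow> M' i \<in> \<E>; is_product (abfun_cat C) I M' P \<pi>\<rbrakk> \<Longrightarrow> P \<in> \<E>"
    using assms unfolding definable_modules_def by blast
  show "\<lbrakk>small TYPE('u) (I :: 'u set); \<And>i. i \<in> I \<Longrightarrow> M' i \<in> \<E>; is_directed_colimit (abfun_cat C) I r M' t L c\<rbrakk> \<Longrightarrow> L \<in> \<E>"
    using assms unfolding definable_modules_def by blast
  show "M \<in> \<E>" if "is_additive_functor C M" "N \<in> \<E>" "pure_monomorphism M N i"
  proof -
    have "M \<in> Obj (abfun_cat C)" using that(1) by simp
    then show ?thesis using assms that(2,3) unfolding definable_modules_def by blast
  qed
qed

text \<open>The normal form of a definable class of absolutely pure modules: with absolute purity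
  expressed as exactness, only the arrows that act as zero remain to be prescribed.\<close>

definition exact_class :: "('o \<times> 'o \<times> 'u) set \<Rightarrow> ('o, 'u, 'u) abfun set" where
  "exact_class \<Psi> = {M. is_additive_functor C M \<and> exact_functor M \<and>
     (\<forall>(A, B, c)\<in>\<Psi>. \<forall>x\<in>carrier (FOb M A). FAr M A B c x = \<one>\<^bsub>FOb M B\<^esub>)}"

lemma exact_classD:
  assumes "M \<in> exact_class \<Psi>"
  shows "is_additive_functor C M" "functor_on C M" "exact_functor M"
    "(A, B, c) \<in> \<Psi> \<Longrightarrow> x \<in> carrier (FOb M A) \<Longrightarrow> FAr M A B c x = \<one>\<^bsub>FOb M B\<^esub>"
  using assms by (auto simp: exact_class_def additive_functor_on)

lemma exact_classI:
  assumes "is_additive_functor C M" "exact_functor M"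
    "\<And>A B c x. (A, B, c) \<in> \<Psi> \<Longrightarrow> x \<in> carrier (FOb M A) \<Longrightarrow> FAr M A B c x = \<one>\<^bsub>FOb M B\<^esub>"
  shows "M \<in> exact_class \<Psi>"
  using assms by (auto simp: exact_class_def)

text \<open>Preimages chosen in each factor combine to one in the product, and equality in the
  product is tested factorwise.\<close>

lemma exact_class_product:
  assumes \<Psi>: "arrows \<Psi>" and M: "\<And>i. i \<in> I \<Longrightarrow> M i \<in> exact_class \<Psi>" and P: "is_product (abfun_cat C) I M P \<pi>"
  shows "P \<in> exact_class \<Psi>"
proof (rule exact_classI)
  have \<pi>: "\<pi> i \<in> carrier (Nat C P (M i))" if "i \<in> I" for i using P that by (simp add: is_product_def)
  show Pa: "is_additive_functor C P" using P by (simp add: is_product_def)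
  then have P': "functor_on C P" by (rule additive_functor_on)
  note M' = exact_classD(2)[OF M]
  note pw = is_product_pointwise[OF P exact_classD(1)[OF M]]
  show "exact_functor P"
    unfolding exact_functor_def
  proof (intro allI impI ballI)
    fix A B Z b k x assume wc: "weak_cokernel A B Z b k" and x: "x \<in> carrier (FOb P B)" "FAr P B Z k x = \<one>\<^bsub>FOb P Z\<^esub>"
    note w = weak_cokernelD[OF wc]
    have "\<forall>i\<in>I. \<exists>z. z \<in> carrier (FOb (M i) A) \<and> FAr (M i) A B b z = \<pi> i B x"
    proof
      fix i assume i: "i \<in> I"
      have "FAr (M i) B Z k (\<pi> i B x) = \<one>\<^bsub>FOb (M i) Z\<^esub>"
        using Nat_natural[OF \<pi>[OF i] w(2,3,5) x(1)] x(2) Nat_one[OF \<pi>[OF i] P' M'[OF i] w(3)] by simp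
      then show "\<exists>z. z \<in> carrier (FOb (M i) A) \<and> FAr (M i) A B b z = \<pi> i B x"
        using exact_functorD[OF exact_classD(3)[OF M[OF i]] wc Nat_closed[OF \<pi>[OF i] w(2) x(1)]] by blast
    qed
    from bchoice[OF this] obtain z where z: "\<And>i. i \<in> I \<Longrightarrow> z i \<in> carrier (FOb (M i) A)"
      "\<And>i. i \<in> I \<Longrightarrow> FAr (M i) A B b (z i) = \<pi> i B x" by blast
    obtain p where p: "p \<in> carrier (FOb P A)" "\<And>i. i \<in> I \<Longrightarrow> \<pi> i A p = z i"
      using pw(1)[OF _ w(1), of z] z(1) by metis
    have pb: "FAr P A B b p \<in> carrier (FOb P B)" using FAr_closed[OF P' w(1,2,4) p(1)] .
    have "FAr P A B b p \<otimes>\<^bsub>FOb P B\<^esub> inv\<^bsub>FOb P B\<^esub> x = \<one>\<^bsub>FOb P B\<^esub>"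
    proof (rule pw(2)[OF _ w(2)])
      fix i assume i: "i \<in> I"
      have "\<pi> i B (FAr P A B b p) = \<pi> i B x"
        using Nat_natural[OF \<pi>[OF i] w(1,2,4) p(1)] p(2)[OF i] z(2)[OF i] by simp
      then show "\<pi> i B (FAr P A B b p \<otimes>\<^bsub>FOb P B\<^esub> inv\<^bsub>FOb P B\<^esub> x) = \<one>\<^bsub>FOb (M i) B\<^esub>"
        using comm_group_diff_hom_eq[OF Nat_hom[OF \<pi>[OF i] w(2)] functor_group[OF P' w(2)]
          functor_group[OF M'[OF i] w(2)] pb x(1)] by simp
    qed (use pb x functor_closed[OF P' w(2)] in auto)
    then have "FAr P A B b p = x" using comm_group_diff_eq_one[OF functor_group[OF P' w(2)] pb x(1)] by simp
    then show "\<exists>z\<in>carrier (FOb P A). FAr P A B b z = x" using p(1) by blast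
  qed
  fix A B c x assume c: "(A, B, c) \<in> \<Psi>" and x: "x \<in> carrier (FOb P A)"
  have AB: "A \<in> Obj C" "B \<in> Obj C" "c \<in> arr C A B" using \<Psi> c by (auto simp: arrows_def)
  show "FAr P A B c x = \<one>\<^bsub>FOb P B\<^esub>"
  proof (rule pw(2)[OF _ AB(2) FAr_closed[OF P' AB x]])
    fix i assume i: "i \<in> I"
    show "\<pi> i B (FAr P A B c x) = \<one>\<^bsub>FOb (M i) B\<^esub>"
      using Nat_natural[OF \<pi>[OF i] AB x] exact_classD(4)[OF M[OF i] c Nat_closed[OF \<pi>[OF i] AB(1) x]] by simp
  qed
qed

text \<open>An element and the single relation saying that \<open>k\<close> kills it are visible at
  one stage, after moving far enough along the directed set; exactness is applied there.\<close>

lemma exact_class_directed_colimit: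
  assumes \<Psi>: "arrows \<Psi>" and I: "small TYPE('u) I" and M: "\<And>i. i \<in> I \<Longrightarrow> M i \<in> exact_class \<Psi>"
    and L: "is_directed_colimit (abfun_cat C) I r M t L c"
  shows "L \<in> exact_class \<Psi>"
proof (rule exact_classI)
  show La: "is_additive_functor C L" using L by (simp add: is_directed_colimit_def)
  then have L': "functor_on C L" by (rule additive_functor_on)
  note M' = exact_classD(2)[OF M]
  note pw = directed_colimit_pointwise[OF L I exact_classD(1)[OF M]]
  have dir: "directed_poset I r" using L by (simp add: is_directed_colimit_def)
  note d = directed_posetD[OF dir]
  have cN: "c i \<in> carrier (Nat C (M i) L)" if "i \<in> I" for i using L that by (simp add: is_directed_colimit_def is_cocone_def)
  have tN: "t i j \<in> carrier (Nat C (M i) (M j))" if "(i, j) \<in> r" for i j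
    using L that by (auto simp: is_directed_colimit_def is_direct_system_def)
  have ct: "c j X (t i j X m) = c i X m" if "(i, j) \<in> r" "X \<in> Obj C" "m \<in> carrier (FOb (M i) X)" for i j X m
  proof -
    have "Cmp (abfun_cat C) (M i) (M j) L (c j) (t i j) = c i"
      using L that by (auto simp: is_directed_colimit_def is_cocone_def)
    then show ?thesis using abfun_Cmp_apply[OF that(2,3), of "M j" L "c j" "t i j"] by simp
  qed
  show "exact_functor L"
    unfolding exact_functor_def
  proof (intro allI impI ballI)
    fix A B Z b k x assume wc: "weak_cokernel A B Z b k" and x: "x \<in> carrier (FOb L B)" "FAr L B Z k x = \<one>\<^bsub>FOb L Z\<^esub>"
    note w = weak_cokernelD[OF wc]
    obtain i m where i: "i \<in> I" and m: "m \<in> carrier (FOb (M i) B)" "x = c i B m"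
      using pw(1)[OF _ w(2) x(1)] by blast
    have km: "FAr (M i) B Z k m \<in> carrier (FOb (M i) Z)" using FAr_closed[OF M'[OF i] w(2,3,5) m(1)] .
    have "c i Z (FAr (M i) B Z k m) = \<one>\<^bsub>FOb L Z\<^esub>"
      using Nat_natural[OF cN[OF i] w(2,3,5) m(1)] m(2) x(2) by simp
    then obtain j where j: "(i, j) \<in> r" "t i j Z (FAr (M i) B Z k m) = \<one>\<^bsub>FOb (M j) Z\<^esub>"
      using pw(2)[OF _ w(3) i km] by blast
    have jI: "j \<in> I" using d(3)[OF j(1)] by simp
    have tm: "t i j B m \<in> carrier (FOb (M j) B)" using Nat_closed[OF tN[OF j(1)] w(2) m(1)] .
    have "FAr (M j) B Z k (t i j B m) = \<one>\<^bsub>FOb (M j) Z\<^esub>"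
      using Nat_natural[OF tN[OF j(1)] w(2,3,5) m(1)] j(2) by simp
    then obtain z where z: "z \<in> carrier (FOb (M j) A)" "FAr (M j) A B b z = t i j B m"
      using exact_functorD[OF exact_classD(3)[OF M[OF jI]] wc tm] by blast
    have "FAr L A B b (c j A z) = x"
      using Nat_natural[OF cN[OF jI] w(1,2,4) z(1)] z(2) ct[OF j(1) w(2) m(1)] m(2) by simp
    then show "\<exists>z\<in>carrier (FOb L A). FAr L A B b z = x"
      using Nat_closed[OF cN[OF jI] w(1) z(1)] by blast
  qed
  fix A B h x assume h: "(A, B, h) \<in> \<Psi>" and x: "x \<in> carrier (FOb L A)"
  have AB: "A \<in> Obj C" "B \<in> Obj C" "h \<in> arr C A B" using \<Psi> h by (auto simp: arrows_def)
  obtain i m where i: "i \<in> I" and m: "m \<in> carrier (FOb (M i) A)" "x = c i A m"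
    using pw(1)[OF _ AB(1) x] by blast
  show "FAr L A B h x = \<one>\<^bsub>FOb L B\<^esub>"
    using Nat_natural[OF cN[OF i] AB m(1)] m(2) exact_classD(4)[OF M[OF i] h m(1)] Nat_one[OF cN[OF i] M'[OF i] L' AB(2)] by simp
qed

lemma definable_exact_class:
  assumes \<Psi>: "arrows \<Psi>"
  shows "definable_modules (exact_class \<Psi>)"
proof -
  have "M \<in> exact_class \<Psi>" if M: "is_additive_functor C M" and N: "N \<in> exact_class \<Psi>" and i: "pure_monomorphism M N i" for M N i
  proof (rule exact_classI[OF M])
    note N' = exact_classD[OF N]
    have M': "functor_on C M" using M by (rule additive_functor_on)
    show "exact_functor M" using pure_monomorphism_exact[OF i M N'(1,3)] .
    have mono: "is_monomorphism (abfun_cat C) M N i" using i by (simp add: pure_monomorphism_def)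
    have iN: "i \<in> carrier (Nat C M N)" using mono by (simp add: is_monomorphism_def)
    fix A B c x assume c: "(A, B, c) \<in> \<Psi>" and x: "x \<in> carrier (FOb M A)"
    have AB: "A \<in> Obj C" "B \<in> Obj C" "c \<in> arr C A B" using \<Psi> c by (auto simp: arrows_def)
    have "i B (FAr M A B c x) = \<one>\<^bsub>FOb N B\<^esub>"
      using Nat_natural[OF iN AB x] N'(4)[OF c Nat_closed[OF iN AB(1) x]] by simp
    then show "FAr M A B c x = \<one>\<^bsub>FOb M B\<^esub>"
      using monomorphism_inj[OF mono M' N'(2) AB(2) FAr_closed[OF M' AB x]] by blast
  qed
  then show ?thesis
    unfolding definable_modules_def
  proof (intro conjI allI impI ballI)
    show "exact_class \<Psi> \<subseteq> Obj (abfun_cat C)" using exact_classD(1) by auto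
    show "P \<in> exact_class \<Psi>" if "\<forall>i\<in>I. M i \<in> exact_class \<Psi>" "is_product (abfun_cat C) I M P \<pi>"
      for I :: "'u set" and M P \<pi>
      using exact_class_product[OF \<Psi> _ that(2)] that(1) by blast
    show "L \<in> exact_class \<Psi>" if "small TYPE('u) I" "\<forall>i\<in>I. M i \<in> exact_class \<Psi>"
      "is_directed_colimit (abfun_cat C) I r M t L c" for I :: "'u set" and r M t L c
      using exact_class_directed_colimit[OF \<Psi> that(1) _ that(3)] that(2) by blast
  qed auto
qed

end

section \<open>Modules over categories with weak kernels and weak cokernels\<close>

text \<open>The assumption \<open>weak_kernel_exists\<close> is phrased through
  \<open>weak_cokernel\<close>: it makes every arrow a weak cokernel of some other one, which for
  triangles is achieved by completing an arrow on the appropriate side.\<close>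

locale coherent_category = small_preadditive_category C
  for C :: "('o, 'u) pcat" +
  assumes zero_object: "\<exists>Z. is_zero_object C Z"
    and biproducts: "\<lbrakk>X \<in> Obj C; Y \<in> Obj C\<rbrakk> \<Longrightarrow> \<exists>P i j p q. is_biproduct C X Y P i j p q"
    and weak_cokernel_exists: "\<lbrakk>A \<in> Obj C; B \<in> Obj C; b \<in> arr C A B\<rbrakk> \<Longrightarrow> \<exists>Z k. weak_cokernel A B Z b k"
    and weak_kernel_exists: "\<lbrakk>B \<in> Obj C; Z \<in> Obj C; k \<in> arr C B Z\<rbrakk> \<Longrightarrow> \<exists>A b. weak_cokernel A B Z b k"
    and small_skeleton: "\<exists>S\<subseteq>Obj C. small TYPE('u) S \<and> (\<forall>A\<in>Obj C. \<exists>B\<in>S. isomorphic_in C A B)"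
begin

lemma absolutely_pure_iff_exact:
  assumes "is_additive_functor C M"
  shows "(\<forall>N\<in>Obj (abfun_cat C). \<forall>i. is_monomorphism (abfun_cat C) M N i \<longrightarrow> pure_monomorphism M N i) \<longleftrightarrow>
    exact_functor M"
  using pure_imp_exact[OF assms] exact_pure_monomorphism[OF weak_cokernel_exists assms] by auto

lemma biproductE:
  assumes "X \<in> Obj C" "Y \<in> Obj C"
  obtains P i j p q where "P \<in> Obj C" "i \<in> arr C X P" "j \<in> arr C Y P" "p \<in> arr C P X" "q \<in> arr C P Y"
     "Cmp C X P X p i = Idn C X" "Cmp C Y P Y q j = Idn C Y"
     "Cmp C Y P X p j = \<one>\<^bsub>Hom C Y X\<^esub>" "Cmp C X P Y q i = \<one>\<^bsub>Hom C X Y\<^esub>"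
     "Cmp C P X P i p \<otimes>\<^bsub>Hom C P P\<^esub> Cmp C P Y P j q = Idn C P"
  using biproducts[OF assms] unfolding is_biproduct_def by blast

text \<open>Exactness says that the image of \<open>b\<close> is the kernel of \<open>k\<close>, so
  one is trivial iff the other is. This exchanges the two ways of cutting out a class by
  arrows.\<close>

lemma exact_zero_iff_injective:
  assumes M: "functor_on C M" and ex: "exact_functor M" and wc: "weak_cokernel A B Z b k"
  shows "(\<forall>x\<in>carrier (FOb M A). FAr M A B b x = \<one>\<^bsub>FOb M B\<^esub>) \<longleftrightarrow>
    (\<forall>x\<in>carrier (FOb M B). FAr M B Z k x = \<one>\<^bsub>FOb M Z\<^esub> \<longrightarrow> x = \<one>\<^bsub>FOb M B\<^esub>)"
proof -
  note w = weak_cokernelD[OF wc]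
  have "FAr M B Z k (FAr M A B b x) = \<one>\<^bsub>FOb M Z\<^esub>" if "x \<in> carrier (FOb M A)" for x
    using FAr_Cmp[OF M w(1-5) that] w(6) FAr_zero[OF M w(1,3) that] by simp
  then show ?thesis
    using exact_functorD[OF ex wc] FAr_closed[OF M w(1,2,4)] by metis
qed

text \<open>Taking \<open>a\<close> to be the identity gives injectivity of \<open>b\<close>.
  Conversely, injectivity of \<open>b\<close> yields the condition for all \<open>a\<close>, by
  exactness at the weak cokernel of the arrow
  \<open>(a, b) : A \<rightarrow> D \<oplus> B\<close>.\<close>

lemma exact_torsionfree_iff:
  assumes \<Phi>: "arrows \<Phi>" and M: "is_additive_functor C M" and ex: "exact_functor M"
  shows "M \<in> torsionfree \<Phi> \<longleftrightarrow>
    (\<forall>(A, B, b)\<in>\<Phi>. \<forall>x\<in>carrier (FOb M A). FAr M A B b x = \<one>\<^bsub>FOb M B\<^esub> \<longrightarrow> x = \<one>\<^bsub>FOb M A\<^esub>)" (is "?L \<longleftrightarrow> ?R")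
proof
  have M': "functor_on C M" using M by (rule additive_functor_on)
  {
    assume L: ?L
    show ?R
    proof clarify
      fix A B b x assume \<Phi>': "(A, B, b) \<in> \<Phi>" and x: "x \<in> carrier (FOb M A)" "FAr M A B b x = \<one>\<^bsub>FOb M B\<^esub>"
      have A: "A \<in> Obj C" "B \<in> Obj C" "b \<in> arr C A B" using \<Phi> \<Phi>' by (auto simp: arrows_def)
      show "x = \<one>\<^bsub>FOb M A\<^esub>"
      proof (rule torsionfreeD(2)[OF L \<Phi>' A(1) Idn_arr[OF A(1)] x(1)])
        fix W u assume W: "W \<in> Obj C" "u \<in> annihilator A B b A (Idn C A) W"
        then obtain v where "v \<in> arr C B W" "u = Cmp C A B W v b"
          using A by (auto simp: annihilator_def Cmp_Idn_right)
        then show "FAr M A W u x = \<one>\<^bsub>FOb M W\<^esub>"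
          using x A W by (simp add: FAr_Cmp[OF M'] FAr_one[OF M'])
      qed
    qed
  }
  {
    assume R: ?R
    have "x = \<one>\<^bsub>FOb M D\<^esub>" if \<Phi>': "(A, B, b) \<in> \<Phi>" and D: "D \<in> Obj C" "a \<in> arr C A D" and x: "x \<in> carrier (FOb M D)"
      and ann: "\<And>W u. W \<in> Obj C \<Longrightarrow> u \<in> annihilator A B b D a W \<Longrightarrow> FAr M D W u x = \<one>\<^bsub>FOb M W\<^esub>" for A B b D a x
    proof -
      have A: "A \<in> Obj C" "B \<in> Obj C" "b \<in> arr C A B" using \<Phi> \<Phi>' by (auto simp: arrows_def)
      obtain P i j p q where P: "P \<in> Obj C" and i: "i \<in> arr C D P" "j \<in> arr C B P" and p: "p \<in> arr C P D" "q \<in> arr C P B"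
        and e: "Cmp C D P D p i = Idn C D" "Cmp C B P B q j = Idn C B"
        "Cmp C B P D p j = \<one>\<^bsub>Hom C B D\<^esub>" "Cmp C D P B q i = \<one>\<^bsub>Hom C D B\<^esub>"
        using biproductE[OF D(1) A(2)] by metis
      have ia: "Cmp C A D P i a \<in> arr C A P" "Cmp C A B P j b \<in> arr C A P"
        using Cmp_arr A D P i by auto
      interpret AP: comm_group "Hom C A P" using comm_group_Hom A P by blast
      \<comment> \<open>The arrow with components \<open>a\<close> and \<open>b\<close>. If
        \<open>w\<close> is its weak cokernel, the \<open>D\<close>-component of \<open>w\<close>
        composed with \<open>a\<close> is minus the \<open>B\<close>-component composed with
        \<open>b\<close>; so the \<open>D\<close>-component lies in the annihilator and kills
        \<open>x\<close>.\<close>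
      define g where "g = Cmp C A D P i a \<otimes>\<^bsub>Hom C A P\<^esub> Cmp C A B P j b"
      have g: "g \<in> arr C A P" using ia by (simp add: g_def)
      have pg: "Cmp C A P D p g = a"
      proof -
        interpret AD: comm_group "Hom C A D" using comm_group_Hom A D by blast
        have "Cmp C A P D p g = Cmp C A P D p (Cmp C A D P i a) \<otimes>\<^bsub>Hom C A D\<^esub> Cmp C A P D p (Cmp C A B P j b)"
          unfolding g_def using Cmp_add_right[OF A(1) P D(1) ia p(1)] .
        also have "\<dots> = a"
          using A D P i p e ia by (simp add: Cmp_assoc Cmp_Idn_left Cmp_zero_left)
        finally show ?thesis .
      qed
      have qg: "Cmp C A P B q g = b"
      proof -
        interpret AB: comm_group "Hom C A B" using comm_group_Hom A by blast
        have "Cmp C A P B q g = Cmp C A P B q (Cmp C A D P i a) \<otimes>\<^bsub>Hom C A B\<^esub> Cmp C A P B q (Cmp C A B P j b)"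
          unfolding g_def using Cmp_add_right[OF A(1) P A(2) ia p(2)] .
        also have "\<dots> = b"
          using A D P i p e ia by (simp add: Cmp_assoc Cmp_Idn_left Cmp_zero_left)
        finally show ?thesis .
      qed
      obtain Z w where wc: "weak_cokernel A P Z g w" using weak_cokernel_exists[OF A(1) P g] by blast
      note w = weak_cokernelD[OF wc]
      have wi: "Cmp C D P Z w i \<in> arr C D Z" "Cmp C B P Z w j \<in> arr C B Z"
        using Cmp_arr w(2,3,5) i A D by auto
      have "Cmp C D P Z w i \<in> annihilator A B b D a Z"
      proof -
        interpret AZ: comm_group "Hom C A Z" using comm_group_Hom A w(3) by blast
        have "Cmp C A D Z (Cmp C D P Z w i) a \<otimes>\<^bsub>Hom C A Z\<^esub> Cmp C A B Z (Cmp C B P Z w j) b = Cmp C A P Z w g"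
          unfolding g_def using A D P i w ia by (simp add: Cmp_add_right flip: Cmp_assoc)
        then have "Cmp C A D Z (Cmp C D P Z w i) a = inv\<^bsub>Hom C A Z\<^esub> Cmp C A B Z (Cmp C B P Z w j) b"
          using w(6) Cmp_arr A D wi w(3) by (intro comm_group_inv_unique[OF comm_group_Hom]) auto
        also have "\<dots> = Cmp C A B Z (inv\<^bsub>Hom C B Z\<^esub> Cmp C B P Z w j) b"
          using A w(3) wi by (simp add: Cmp_minus_left)
        finally show ?thesis using wi Hom_closed(2)[OF A(2) w(3) wi(2)] by (auto simp: annihilator_def)
      qed
      then have "FAr M P Z w (FAr M D P i x) = \<one>\<^bsub>FOb M Z\<^esub>"
        using ann[OF w(3)] FAr_Cmp[OF M' D(1) P w(3) i(1) w(5) x] by simp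
      \<comment> \<open>Exactness gives \<open>z\<close> with \<open>a z = x\<close> and
        \<open>b z = 0\<close>; injectivity of \<open>b\<close> forces \<open>z\<close>, and with it
        \<open>x\<close>, to be zero.\<close>
      then obtain z where z: "z \<in> carrier (FOb M A)" "FAr M A P g z = FAr M D P i x"
        using exact_functorD[OF ex wc FAr_closed[OF M' D(1) P i(1) x]] by blast
      have "FAr M A B b z = FAr M P B q (FAr M D P i x)"
        using FAr_Cmp[OF M' A(1) P A(2) g p(2) z(1)] qg z(2) by simp
      also have "\<dots> = \<one>\<^bsub>FOb M B\<^esub>"
        using FAr_Cmp[OF M' D(1) P A(2) i(1) p(2) x] e(4) FAr_zero[OF M' D(1) A(2) x] by simp
      finally have "z = \<one>\<^bsub>FOb M A\<^esub>" using R \<Phi>' z(1) by fastforce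
      moreover have "FAr M A D a z = FAr M P D p (FAr M D P i x)"
        using FAr_Cmp[OF M' A(1) P D(1) g p(1) z(1)] pg z(2) by simp
      moreover have "\<dots> = x"
        using FAr_Cmp[OF M' D(1) P D(1) i(1) p(1) x] e(1) FAr_Idn[OF M' D(1) x] by simp
      ultimately show ?thesis using FAr_one[OF M' A(1) D] by simp
    qed
    then show ?L using M by (fastforce simp: torsionfree_def)
  }
qed

text \<open>An exact functor is a directed colimit of representable functors: finitely many elements and
  relations between them come from a single \<open>x \<in> M(D)\<close> and arrows out of \<open>D\<close>.\<close>

lemma exact_cover_elements:
  assumes M: "functor_on C M" and "finite E" and "\<And>B m. (B, m) \<in> E \<Longrightarrow> B \<in> Obj C \<and> m \<in> carrier (FOb M B)"
  shows "\<exists>D\<in>Obj C. \<exists>x\<in>carrier (FOb M D). \<forall>(B, m)\<in>E. \<exists>w\<in>arr C D B. FAr M D B w x = m"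
  using assms(2,3)
proof (induction E rule: finite_induct)
  case empty
  obtain Z where "is_zero_object C Z" using zero_object by blast
  then have Z: "Z \<in> Obj C" by (simp add: is_zero_object_def)
  show ?case by (intro bexI[OF _ Z] bexI[OF _ functor_closed(1)[OF M Z]]) simp
next
  case (insert e E)
  obtain B m where e: "e = (B, m)" by force
  have B: "B \<in> Obj C" "m \<in> carrier (FOb M B)" using insert.prems e by auto
  obtain D x where D: "D \<in> Obj C" "x \<in> carrier (FOb M D)" and E: "\<forall>(B, m)\<in>E. \<exists>w\<in>arr C D B. FAr M D B w x = m"
    using insert.IH insert.prems by blast
  obtain P i j p q where P: "P \<in> Obj C" and i: "i \<in> arr C D P" "j \<in> arr C B P" and p: "p \<in> arr C P D" "q \<in> arr C P B"
    and eq: "Cmp C D P D p i = Idn C D" "Cmp C B P B q j = Idn C B"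
    "Cmp C B P D p j = \<one>\<^bsub>Hom C B D\<^esub>" "Cmp C D P B q i = \<one>\<^bsub>Hom C D B\<^esub>"
    using biproductE[OF D(1) B(1)] by metis
  \<comment> \<open>Placing \<open>x\<close> and \<open>m\<close> side by side in the biproduct
    gives one element from which the projections recover both.\<close>
  define y where "y = FAr M D P i x \<otimes>\<^bsub>FOb M P\<^esub> FAr M B P j m"
  have ix: "FAr M D P i x \<in> carrier (FOb M P)" "FAr M B P j m \<in> carrier (FOb M P)"
    using FAr_closed[OF M] D B P i by auto
  then have y: "y \<in> carrier (FOb M P)" using functor_closed[OF M P] by (simp add: y_def)
  have py: "FAr M P D p y = x"
  proof -
    interpret G: comm_group "FOb M D" using functor_group[OF M D(1)] .
    have "FAr M P D p (FAr M D P i x) = x" "FAr M P D p (FAr M B P j m) = \<one>\<^bsub>FOb M D\<^esub>"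
      using FAr_Cmp[OF M D(1) P D(1) i(1) p(1) D(2)] FAr_Cmp[OF M B(1) P D(1) i(2) p(1) B(2)] eq
        FAr_Idn[OF M D] FAr_zero[OF M B(1) D(1) B(2)] by auto
    then show ?thesis
      unfolding y_def FAr_mult[OF M P D(1) p(1) ix] using D(2) by simp
  qed
  have qy: "FAr M P B q y = m"
  proof -
    interpret G: comm_group "FOb M B" using functor_group[OF M B(1)] .
    have "FAr M P B q (FAr M D P i x) = \<one>\<^bsub>FOb M B\<^esub>" "FAr M P B q (FAr M B P j m) = m"
      using FAr_Cmp[OF M D(1) P B(1) i(1) p(2) D(2)] FAr_Cmp[OF M B(1) P B(1) i(2) p(2) B(2)] eq
        FAr_Idn[OF M B] FAr_zero[OF M D(1) B(1) D(2)] by auto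
    then show ?thesis
      unfolding y_def FAr_mult[OF M P B(1) p(2) ix] using B(2) by simp
  qed
  have "\<exists>w\<in>arr C P B'. FAr M P B' w y = m'" if "(B', m') \<in> insert e E" for B' m'
  proof (cases "(B', m') = e")
    case True
    then show ?thesis using p(2) qy e by auto
  next
    case False
    then have "(B', m') \<in> E" using that by simp
    from bspec[OF E this] obtain w where w: "w \<in> arr C D B'" "FAr M D B' w x = m'" by auto
    have B': "B' \<in> Obj C" using insert.prems[OF that] by simp
    have "FAr M P B' (Cmp C P D B' w p) y = m'"
      using FAr_Cmp[OF M P D(1) B' p(1) w(1) y] py w(2) by simp
    then show ?thesis
      using Cmp_arr[OF P D(1) B' p(1) w(1)] by blast
  qed
  then show ?case using P y by blast
qed

lemma exact_cover_relations:
  assumes M: "functor_on C M" and ex: "exact_functor M" and D: "D \<in> Obj C" "x \<in> carrier (FOb M D)" and "finite R"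
    and "\<And>B u v. (B, u, v) \<in> R \<Longrightarrow> B \<in> Obj C \<and> u \<in> arr C D B \<and> v \<in> arr C D B \<and> FAr M D B u x = FAr M D B v x"
  shows "\<exists>D'\<in>Obj C. \<exists>g\<in>arr C D' D. \<exists>x'\<in>carrier (FOb M D'). FAr M D' D g x' = x \<and>
    (\<forall>(B, u, v)\<in>R. Cmp C D' D B u g = Cmp C D' D B v g)"
  using assms(5,6)
proof (induction R rule: finite_induct)
  case empty
  show ?case
    by (intro bexI[OF _ D(1)] bexI[OF _ Idn_arr[OF D(1)]] bexI[OF _ D(2)]) (simp add: FAr_Idn[OF M D])
next
  case (insert e R)
  obtain B u v where e: "e = (B, u, v)" by (metis prod.exhaust)
  have B: "B \<in> Obj C" "u \<in> arr C D B" "v \<in> arr C D B" "FAr M D B u x = FAr M D B v x" using insert.prems e by auto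
  obtain D' g x' where D': "D' \<in> Obj C" and g: "g \<in> arr C D' D" and x': "x' \<in> carrier (FOb M D')" "FAr M D' D g x' = x"
    and R: "\<forall>(B, u, v)\<in>R. Cmp C D' D B u g = Cmp C D' D B v g"
    using insert.IH insert.prems by blast
  \<comment> \<open>The difference of the two composites kills \<open>x'\<close>. Hence
    \<open>x'\<close> lifts along an arrow \<open>g'\<close> of which \<open>d\<close> is a weak
    cokernel, and precomposing with \<open>g'\<close> makes the relation hold between the arrows
    themselves.\<close>
  define d where "d = Cmp C D' D B u g \<otimes>\<^bsub>Hom C D' B\<^esub> inv\<^bsub>Hom C D' B\<^esub> Cmp C D' D B v g"
  have ug: "Cmp C D' D B u g \<in> arr C D' B" "Cmp C D' D B v g \<in> arr C D' B"
    using Cmp_arr D' D B g by auto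
  have d: "d \<in> arr C D' B" unfolding d_def using ug Hom_closed[OF D' B(1)] by simp
  interpret G: comm_group "FOb M B" using functor_group[OF M B(1)] .
  have "FAr M D' B d x' = FAr M D B u x \<otimes>\<^bsub>FOb M B\<^esub> inv\<^bsub>FOb M B\<^esub> FAr M D B v x"
    unfolding d_def using ug Hom_closed[OF D' B(1)] D' D B g x'
    by (simp add: FAr_add[OF M] FAr_minus[OF M] FAr_Cmp[OF M])
  also have "\<dots> = \<one>\<^bsub>FOb M B\<^esub>" using B FAr_closed[OF M D(1) B(1) _ D(2)] by simp
  finally have dx: "FAr M D' B d x' = \<one>\<^bsub>FOb M B\<^esub>" .
  obtain D'' g' where wc: "weak_cokernel D'' D' B g' d" using weak_kernel_exists[OF D' B(1) d] by blast
  note w = weak_cokernelD[OF wc]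
  obtain x'' where x'': "x'' \<in> carrier (FOb M D'')" "FAr M D'' D' g' x'' = x'"
    using exact_functorD[OF ex wc x'(1) dx] by blast
  have gg: "Cmp C D'' D' D g g' \<in> arr C D'' D" using Cmp_arr[OF w(1) D' D(1) w(4) g] .
  have "Cmp C D'' D B u (Cmp C D'' D' D g g') = Cmp C D'' D B v (Cmp C D'' D' D g g')"
  proof -
    have ugg: "Cmp C D'' D' B (Cmp C D' D B u g) g' \<in> arr C D'' B" "Cmp C D'' D' B (Cmp C D' D B v g) g' \<in> arr C D'' B"
      using Cmp_arr[OF w(1) D' B(1) w(4)] ug by auto
    have "Cmp C D'' D' B (Cmp C D' D B u g) g' \<otimes>\<^bsub>Hom C D'' B\<^esub> inv\<^bsub>Hom C D'' B\<^esub> Cmp C D'' D' B (Cmp C D' D B v g) g'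
      = \<one>\<^bsub>Hom C D'' B\<^esub>"
      using w(6) ug w(1,4) D' B Hom_closed[OF D' B(1)] by (simp add: d_def Cmp_add_left Cmp_minus_left)
    then have "Cmp C D'' D' B (Cmp C D' D B u g) g' = Cmp C D'' D' B (Cmp C D' D B v g) g'"
      using comm_group_diff_eq_one[OF comm_group_Hom[OF w(1) B(1)] ugg] by simp
    then show ?thesis using Cmp_assoc[OF w(1) D' D(1) B(1) w(4) g] B by simp
  qed
  moreover have "Cmp C D'' D B' u' (Cmp C D'' D' D g g') = Cmp C D'' D B' v' (Cmp C D'' D' D g g')"
    if r: "(B', u', v') \<in> R" for B' u' v'
  proof -
    have "B' \<in> Obj C" "u' \<in> arr C D B'" "v' \<in> arr C D B'" using insert.prems r by auto
    moreover have "Cmp C D' D B' u' g = Cmp C D' D B' v' g" using R r by blast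
    ultimately show ?thesis using Cmp_assoc[OF w(1) D' D(1) _ w(4) g] by metis
  qed
  moreover have "FAr M D'' D (Cmp C D'' D' D g g') x'' = x"
    using FAr_Cmp[OF M w(1) D' D(1) w(4) g x''(1)] x'' x'(2) by simp
  ultimately show ?case
    using w(1) gg x''(1) e by (intro bexI[of _ D''] bexI[of _ "Cmp C D'' D' D g g'"] bexI[of _ x'']) auto
qed

end

section \<open>Embedding an exact module into a reduced power\<close>

context coherent_category
begin

lemma isomorphic_inE:
  assumes "isomorphic_in C A B"
  obtains f g where "f \<in> arr C A B" "g \<in> arr C B A" "Cmp C A B A g f = Idn C A" "Cmp C B A B f g = Idn C B"
  using assms unfolding isomorphic_in_def is_isomorphism_def by blast

text \<open>A single module of \<open>\<E>\<close> detects, on chosen elements, every arrow of the skeleton which does not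
  vanish on \<open>\<E>\<close>.\<close>

lemma definable_separating_module:
  assumes E: "definable_modules \<E>" and S: "S \<subseteq> Obj C" "small TYPE('u) S" "\<And>A. A \<in> Obj C \<Longrightarrow> \<exists>B\<in>S. isomorphic_in C A B"
  obtains V y where "V \<in> \<E>" "\<And>D. D \<in> S \<Longrightarrow> y D \<in> carrier (FOb V D)"
    "\<And>D B c N z. D \<in> S \<Longrightarrow> B \<in> Obj C \<Longrightarrow> c \<in> arr C D B \<Longrightarrow> FAr V D B c (y D) = \<one>\<^bsub>FOb V B\<^esub> \<Longrightarrow>
      N \<in> \<E> \<Longrightarrow> z \<in> carrier (FOb N D) \<Longrightarrow> FAr N D B c z = \<one>\<^bsub>FOb N B\<^esub>"
proof -
  \<comment> \<open>Restricting to arrows inside the skeleton keeps the family of witnesses small,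
    so that their product exists and belongs to \<open>\<E>\<close>.\<close>
  define Q where "Q = {(D, B, c). D \<in> S \<and> B \<in> S \<and> c \<in> arr C D B \<and>
    (\<exists>N\<in>\<E>. \<exists>z\<in>carrier (FOb N D). FAr N D B c z \<noteq> \<one>\<^bsub>FOb N B\<^esub>)}"
  have "small TYPE('u) (Sigma S (\<lambda>D. Sigma S (\<lambda>B. arr C D B)))"
    using S by (intro small_Sigma inaccessible small_arr) auto
  then have Qs: "small TYPE('u) Q" by (rule small_subset) (auto simp: Q_def)
  then obtain e :: "'o \<times> 'o \<times> 'u \<Rightarrow> 'u" where e: "inj_on e Q" using small_encoding by blast
  have "\<forall>q\<in>Q. \<exists>N z. N \<in> \<E> \<and> z \<in> carrier (FOb N (fst q)) \<and>
    FAr N (fst q) (fst (snd q)) (snd (snd q)) z \<noteq> \<one>\<^bsub>FOb N (fst (snd q))\<^esub>"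
    by (force simp: Q_def)
  from bchoice[OF this] obtain Nf where
    "\<forall>q\<in>Q. \<exists>z. Nf q \<in> \<E> \<and> z \<in> carrier (FOb (Nf q) (fst q)) \<and>
      FAr (Nf q) (fst q) (fst (snd q)) (snd (snd q)) z \<noteq> \<one>\<^bsub>FOb (Nf q) (fst (snd q))\<^esub>" ..
  from bchoice[OF this] obtain zf where N: "\<And>q. q \<in> Q \<Longrightarrow> Nf q \<in> \<E>"
    and zf: "\<And>q. q \<in> Q \<Longrightarrow> zf q \<in> carrier (FOb (Nf q) (fst q))"
      "\<And>q. q \<in> Q \<Longrightarrow> FAr (Nf q) (fst q) (fst (snd q)) (snd (snd q)) (zf q) \<noteq> \<one>\<^bsub>FOb (Nf q) (fst (snd q))\<^esub>"
    by blast
  define I where "I = e ` Q"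
  define d where "d = inv_into Q e"
  have d: "d i \<in> Q" if "i \<in> I" for i using that by (auto simp: I_def d_def inv_into_into)
  have de: "d (e q) = q" if "q \<in> Q" for q using that e by (simp add: d_def)
  define F where "F i = Nf (d i)" for i
  have F: "is_additive_functor C (F i)" if "i \<in> I" for i using definable_modulesD(1)[OF E N[OF d[OF that]]] by (simp add: F_def)
  have F': "functor_on C (F i)" if "i \<in> I" for i using F[OF that] by (rule additive_functor_on)
  have Is: "small TYPE('u) I" unfolding I_def using Qs by (rule small_image)
  obtain V :: "('o, 'u, 'u) abfun" and \<gamma> where V: "is_additive_functor C V"
    and \<gamma>: "quotient_map C (product_functor I F) V \<gamma> (\<lambda>X. {\<one>\<^bsub>FOb (product_functor I F) X\<^esub>})"
    using product_quotient[OF Is F] .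
  obtain \<pi> where \<pi>: "is_product (abfun_cat C) I F V \<pi>" using product_quotient_is_product[OF F V \<gamma>] by blast
  have VE: "V \<in> \<E>" by (rule definable_modulesD(2)[OF E Is _ \<pi>]) (simp add: F_def N d)
  have V': "functor_on C V" using V by (rule additive_functor_on)
  \<comment> \<open>At the coordinate of an arrow out of \<open>D\<close> this has the chosen
    witness, elsewhere zero; a single element thus detects all arrows out of \<open>D\<close> at
    once.\<close>
  define v where "v D = (\<lambda>i\<in>I. if fst (d i) = D then zf (d i) else \<one>\<^bsub>FOb (F i) D\<^esub>)" for D
  have v: "v D \<in> carrier (FOb (product_functor I F) D)" if "D \<in> S" for D
    using functor_closed(1)[OF F' subsetD[OF S(1) that]] zf(1)[OF d] by (auto simp: v_def F_def)
  define y where "y D = \<gamma> D (v D)" for D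
  have y: "y D \<in> carrier (FOb V D)" if "D \<in> S" for D
    using quotient_mapD(3)[OF \<gamma> _ v[OF that]] S that by (auto simp: y_def)
  have sep: "FAr N D B c z = \<one>\<^bsub>FOb N B\<^esub>"
    if D: "D \<in> S" and B: "B \<in> S" and c: "c \<in> arr C D B" and one: "FAr V D B c (y D) = \<one>\<^bsub>FOb V B\<^esub>"
      and N: "N \<in> \<E>" "z \<in> carrier (FOb N D)" for D B c N z
  proof (rule ccontr)
    assume "FAr N D B c z \<noteq> \<one>\<^bsub>FOb N B\<^esub>"
    then have q: "(D, B, c) \<in> Q" using D B c N by (auto simp: Q_def)
    then have i: "e (D, B, c) \<in> I" by (simp add: I_def)
    have DB: "D \<in> Obj C" "B \<in> Obj C" using S D B by auto
    have "FAr (product_functor I F) D B c (v D) \<in> carrier (FOb (product_functor I F) B)"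
      using FAr_closed[OF functor_on_product[OF F'] DB c v[OF D]] .
    then have "FAr (product_functor I F) D B c (v D) = \<one>\<^bsub>FOb (product_functor I F) B\<^esub>"
      using quotient_mapD(5)[OF \<gamma> DB(1,2) c v[OF D]] quotient_mapD(2)[OF \<gamma> DB(2)] one by (simp add: y_def)
    from fun_cong[OF this, of "e (D, B, c)"] have "FAr (Nf (D, B, c)) D B c (zf (D, B, c)) = \<one>\<^bsub>FOb (Nf (D, B, c)) B\<^esub>"
      using i q by (simp add: v_def F_def de)
    then show False using zf(2)[OF q] by simp
  qed
  \<comment> \<open>An arbitrary target is replaced by an isomorphic object of the skeleton.\<close>
  have "FAr N D B c z = \<one>\<^bsub>FOb N B\<^esub>"
    if D: "D \<in> S" and B: "B \<in> Obj C" and c: "c \<in> arr C D B" and one: "FAr V D B c (y D) = \<one>\<^bsub>FOb V B\<^esub>"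
      and N: "N \<in> \<E>" "z \<in> carrier (FOb N D)" for D B c N z
  proof -
    obtain B' where B': "B' \<in> S" "isomorphic_in C B B'" using S(3)[OF B] by blast
    obtain f g where f: "f \<in> arr C B B'" and g: "g \<in> arr C B' B" and gf: "Cmp C B B' B g f = Idn C B"
      using isomorphic_inE[OF B'(2)] by metis
    have O: "D \<in> Obj C" "B' \<in> Obj C" using S D B' by auto
    have N': "functor_on C N" using definable_modulesD(1)[OF E N(1)] by (rule additive_functor_on)
    have "FAr V D B' (Cmp C D B B' f c) (y D) = \<one>\<^bsub>FOb V B'\<^esub>"
      using FAr_Cmp[OF V' O(1) B O(2) c f y[OF D]] one FAr_one[OF V' B O(2) f] by simp
    then have "FAr N D B' (Cmp C D B B' f c) z = \<one>\<^bsub>FOb N B'\<^esub>"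
      using sep[OF D B'(1) Cmp_arr[OF O(1) B O(2) c f] _ N] by simp
    then have 1: "FAr N B B' f (FAr N D B c z) = \<one>\<^bsub>FOb N B'\<^esub>"
      using FAr_Cmp[OF N' O(1) B O(2) c f N(2)] by simp
    have cz: "FAr N D B c z \<in> carrier (FOb N B)" using FAr_closed[OF N' O(1) B c N(2)] .
    have "FAr N D B c z = FAr N B' B g (FAr N B B' f (FAr N D B c z))"
      using FAr_Cmp[OF N' B O(2) B f g cz] gf FAr_Idn[OF N' B cz] by simp
    then show ?thesis using 1 FAr_one[OF N' O(2) B g] by simp
  qed
  then show thesis using that[OF VE y] by blast
qed

text \<open>The relations \<open>m = M(u\<^sub>1)(m\<^sub>1) + M(u\<^sub>2)(m\<^sub>2)\<close> encode additivity (\<open>u\<^sub>1\<close>, \<open>u\<^sub>2\<close> identities)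
  and naturality (\<open>u\<^sub>2 = 0\<close>) at once.\<close>

definition linear_relations :: "'o set \<Rightarrow> ('o, 'u, 'u) abfun \<Rightarrow> (('o \<times> 'u \<times> 'u) \<times> ('o \<times> 'u \<times> 'u) \<times> 'o) set" where
  "linear_relations S M = {((B1, m1, u1), (B2, m2, u2), B). B1 \<in> S \<and> B2 \<in> S \<and> B \<in> S \<and>
     m1 \<in> carrier (FOb M B1) \<and> m2 \<in> carrier (FOb M B2) \<and> u1 \<in> arr C B1 B \<and> u2 \<in> arr C B2 B}"

lemma small_linear_relations:
  assumes S: "S \<subseteq> Obj C" "small TYPE('u) S" and M: "is_additive_functor C M"
  shows "small TYPE('u) (linear_relations S M)"
proof -
  define U where "U B' = snd ` (Sigma S (\<lambda>B. arr C B' B))" for B'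
  have U: "small TYPE('u) (U B')" if "B' \<in> S" for B'
    unfolding U_def using S that by (intro small_image small_Sigma inaccessible small_arr) auto
  define T where "T = Sigma S (\<lambda>B'. carrier (FOb M B') \<times> U B')"
  have "small TYPE('u) T"
    unfolding T_def using S by (intro small_Sigma[OF inaccessible] small_Times[OF inaccessible] U additive_functor_small[OF M]) auto
  then have "small TYPE('u) (T \<times> T \<times> S)" using S by (intro small_Times[OF inaccessible])
  moreover have "linear_relations S M \<subseteq> T \<times> T \<times> S"
    by (force simp: linear_relations_def T_def U_def image_def)
  ultimately show ?thesis by (rule small_subset)
qed

text \<open>By the two covering lemmas, the finitely many elements involved have the form
  \<open>w x0\<close> for one \<open>x0\<close> in \<open>M(D0)\<close>, with the relations holding
  between the arrows \<open>w\<close> themselves. Sending \<open>w x0\<close> to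
  \<open>w (y D0)\<close> then preserves the relations, and \<open>sep\<close> prevents nonzero
  elements from becoming zero.\<close>

lemma exact_finite_approximation:
  assumes M: "functor_on C M" and ex: "exact_functor M" and V: "functor_on C V"
    and S: "S \<subseteq> Obj C" "\<And>A. A \<in> Obj C \<Longrightarrow> \<exists>B\<in>S. isomorphic_in C A B"
    and y: "\<And>D. D \<in> S \<Longrightarrow> y D \<in> carrier (FOb V D)"
    and sep: "\<And>D B c x. D \<in> S \<Longrightarrow> B \<in> Obj C \<Longrightarrow> c \<in> arr C D B \<Longrightarrow> FAr V D B c (y D) = \<one>\<^bsub>FOb V B\<^esub> \<Longrightarrow>
      x \<in> carrier (FOb M D) \<Longrightarrow> FAr M D B c x = \<one>\<^bsub>FOb M B\<^esub>"
    and s: "finite s" "s \<subseteq> linear_relations S M"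
  shows "\<exists>\<phi>. (\<forall>B\<in>Obj C. \<forall>m. \<phi> B m \<in> carrier (FOb V B)) \<and>
    (\<forall>((B1, m1, u1), (B2, m2, u2), B)\<in>s.
       \<phi> B (FAr M B1 B u1 m1 \<otimes>\<^bsub>FOb M B\<^esub> FAr M B2 B u2 m2) =
         FAr V B1 B u1 (\<phi> B1 m1) \<otimes>\<^bsub>FOb V B\<^esub> FAr V B2 B u2 (\<phi> B2 m2) \<and>
       (\<phi> B (FAr M B1 B u1 m1 \<otimes>\<^bsub>FOb M B\<^esub> FAr M B2 B u2 m2) = \<one>\<^bsub>FOb V B\<^esub> \<longrightarrow>
          FAr M B1 B u1 m1 \<otimes>\<^bsub>FOb M B\<^esub> FAr M B2 B u2 m2 = \<one>\<^bsub>FOb M B\<^esub>))"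
proof -
  define \<sigma> where "\<sigma> = (\<lambda>((B1, m1, u1), (B2, m2, u2), B). FAr M B1 B u1 m1 \<otimes>\<^bsub>FOb M B\<^esub> FAr M B2 B u2 m2)"
  \<comment> \<open>All elements that \<open>s\<close> mentions, including the sums, since these
    must have prescribed images as well.\<close>
  define E where "E = (\<lambda>((B1, m1, u1), (B2, m2, u2), B). (B1, m1)) ` s \<union>
    (\<lambda>((B1, m1, u1), (B2, m2, u2), B). (B2, m2)) ` s \<union> (\<lambda>((B1, m1, u1), (B2, m2, u2), B). (B, \<sigma> ((B1, m1, u1), (B2, m2, u2), B))) ` s"
  have rel: "B1 \<in> Obj C" "B2 \<in> Obj C" "B \<in> Obj C" "m1 \<in> carrier (FOb M B1)" "m2 \<in> carrier (FOb M B2)"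
    "u1 \<in> arr C B1 B" "u2 \<in> arr C B2 B" "\<sigma> ((B1, m1, u1), (B2, m2, u2), B) \<in> carrier (FOb M B)"
    "(B1, m1) \<in> E" "(B2, m2) \<in> E" "(B, \<sigma> ((B1, m1, u1), (B2, m2, u2), B)) \<in> E"
    if "((B1, m1, u1), (B2, m2, u2), B) \<in> s" for B1 m1 u1 B2 m2 u2 B
  proof -
    show *: "B1 \<in> Obj C" "B2 \<in> Obj C" "B \<in> Obj C" "m1 \<in> carrier (FOb M B1)" "m2 \<in> carrier (FOb M B2)"
      "u1 \<in> arr C B1 B" "u2 \<in> arr C B2 B"
      using that s S by (auto simp: linear_relations_def)
    then show "\<sigma> ((B1, m1, u1), (B2, m2, u2), B) \<in> carrier (FOb M B)"
      using M by (simp add: \<sigma>_def functor_simps)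
    show "(B1, m1) \<in> E" "(B2, m2) \<in> E" "(B, \<sigma> ((B1, m1, u1), (B2, m2, u2), B)) \<in> E"
      using that unfolding E_def by force+
  qed
  have Efin: "finite E" using s by (simp add: E_def)
  have EB: "B \<in> Obj C \<and> m \<in> carrier (FOb M B)" if "(B, m) \<in> E" for B m
    using that rel by (auto simp: E_def)
  obtain D x where D: "D \<in> Obj C" "x \<in> carrier (FOb M D)" and w0: "\<forall>(B, m)\<in>E. \<exists>w\<in>arr C D B. FAr M D B w x = m"
    using exact_cover_elements[OF M Efin EB] by blast
  from w0 have "\<forall>b\<in>E. \<exists>w. w \<in> arr C D (fst b) \<and> FAr M D (fst b) w x = snd b" by fastforce
  from bchoice[OF this] obtain w' where w': "\<forall>b\<in>E. w' b \<in> arr C D (fst b) \<and> FAr M D (fst b) (w' b) x = snd b" ..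
  define w where "w B m = w' (B, m)" for B m
  have w: "w B m \<in> arr C D B" "FAr M D B (w B m) x = m" if "(B, m) \<in> E" for B m
    using bspec[OF w' that] by (auto simp: w_def)
  \<comment> \<open>Each relation holds after evaluation at \<open>x\<close>; these are the pairs of
    arrows to be equalised.\<close>
  define R where "R = (\<lambda>((B1, m1, u1), (B2, m2, u2), B).
    (B, w B (\<sigma> ((B1, m1, u1), (B2, m2, u2), B)), Cmp C D B1 B u1 (w B1 m1) \<otimes>\<^bsub>Hom C D B\<^esub> Cmp C D B2 B u2 (w B2 m2))) ` s"
  have Rfin: "finite R" using s by (simp add: R_def)
  have "B \<in> Obj C \<and> u \<in> arr C D B \<and> v \<in> arr C D B \<and> FAr M D B u x = FAr M D B v x" if "(B, u, v) \<in> R" for B u v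
  proof -
    from that obtain B1 m1 u1 B2 m2 u2 where r: "((B1, m1, u1), (B2, m2, u2), B) \<in> s"
      and u: "u = w B (\<sigma> ((B1, m1, u1), (B2, m2, u2), B))" "v = Cmp C D B1 B u1 (w B1 m1) \<otimes>\<^bsub>Hom C D B\<^esub> Cmp C D B2 B u2 (w B2 m2)"
      by (auto simp: R_def)
    note * = rel[OF r]
    have c: "Cmp C D B1 B u1 (w B1 m1) \<in> arr C D B" "Cmp C D B2 B u2 (w B2 m2) \<in> arr C D B"
      using Cmp_arr D * w by auto
    have "FAr M D B v x = \<sigma> ((B1, m1, u1), (B2, m2, u2), B)"
      using c * D w by (simp add: u FAr_add[OF M] FAr_Cmp[OF M] \<sigma>_def)
    then show ?thesis using u * c w[OF *(11)] Hom_closed(3)[OF D(1) *(3) c] by simp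
  qed
  from exact_cover_relations[OF M ex D Rfin this]
  obtain D' g x' where D': "D' \<in> Obj C" "g \<in> arr C D' D" "x' \<in> carrier (FOb M D')" "FAr M D' D g x' = x"
    and eqR: "\<forall>(B, u, v)\<in>R. Cmp C D' D B u g = Cmp C D' D B v g" by blast
  \<comment> \<open>The elements \<open>y\<close> are available only on the skeleton, so the
    covering object is replaced by an isomorphic member of it.\<close>
  obtain D0 where D0: "D0 \<in> S" "isomorphic_in C D' D0" using S(2)[OF D'(1)] by blast
  obtain f h where f: "f \<in> arr C D' D0" and h: "h \<in> arr C D0 D'" and hf: "Cmp C D' D0 D' h f = Idn C D'"
    using isomorphic_inE[OF D0(2)] by metis
  have D0': "D0 \<in> Obj C" using D0 S by auto
  define k where "k = Cmp C D0 D' D g h"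
  have k: "k \<in> arr C D0 D" unfolding k_def using Cmp_arr[OF D0' D'(1) D(1) h D'(2)] .
  define x0 where "x0 = FAr M D' D0 f x'"
  have x0: "x0 \<in> carrier (FOb M D0)" unfolding x0_def using FAr_closed[OF M D'(1) D0' f D'(3)] .
  have "FAr M D0 D' h x0 = x'"
    using FAr_Cmp[OF M D'(1) D0' D'(1) f h D'(3)] hf FAr_Idn[OF M D'(1,3)] by (simp add: x0_def)
  then have kx: "FAr M D0 D k x0 = x"
    using FAr_Cmp[OF M D0' D'(1) D(1) h D'(2) x0] D'(4) by (simp add: k_def)
  \<comment> \<open>Outside \<open>E\<close> the value is set to zero merely to stay in the
    carrier.\<close>
  define \<phi> where "\<phi> B m = (if (B, m) \<in> E then FAr V D0 B (Cmp C D0 D B (w B m) k) (y D0) else \<one>\<^bsub>FOb V B\<^esub>)" for B m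
  have \<phi>c: "\<phi> B m \<in> carrier (FOb V B)" if "B \<in> Obj C" for B m
    using that functor_closed(1)[OF V that] w(1) FAr_closed[OF V D0' that _ y[OF D0(1)]] Cmp_arr[OF D0' D(1) that k]
    by (auto simp: \<phi>_def)
  have "\<phi> B (\<sigma> ((B1, m1, u1), (B2, m2, u2), B)) = FAr V B1 B u1 (\<phi> B1 m1) \<otimes>\<^bsub>FOb V B\<^esub> FAr V B2 B u2 (\<phi> B2 m2) \<and>
    (\<phi> B (\<sigma> ((B1, m1, u1), (B2, m2, u2), B)) = \<one>\<^bsub>FOb V B\<^esub> \<longrightarrow> \<sigma> ((B1, m1, u1), (B2, m2, u2), B) = \<one>\<^bsub>FOb M B\<^esub>)"
    if r: "((B1, m1, u1), (B2, m2, u2), B) \<in> s" for B1 m1 u1 B2 m2 u2 B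
  proof -
    note * = rel[OF r]
    let ?m = "\<sigma> ((B1, m1, u1), (B2, m2, u2), B)"
    note w1 = w[OF *(9)] and w2 = w[OF *(10)] and wm = w[OF *(11)]
    have c: "Cmp C D B1 B u1 (w B1 m1) \<in> arr C D B" "Cmp C D B2 B u2 (w B2 m2) \<in> arr C D B"
      using Cmp_arr D * w1 w2 by auto
    have ck: "Cmp C D0 D B1 (w B1 m1) k \<in> arr C D0 B1" "Cmp C D0 D B2 (w B2 m2) k \<in> arr C D0 B2" "Cmp C D0 D B (w B ?m) k \<in> arr C D0 B"
      using Cmp_arr D D0' * w1 w2 wm k by auto
    have "(B, w B ?m, Cmp C D B1 B u1 (w B1 m1) \<otimes>\<^bsub>Hom C D B\<^esub> Cmp C D B2 B u2 (w B2 m2)) \<in> R"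
      using r unfolding R_def by force
    then have "Cmp C D' D B (w B ?m) g = Cmp C D' D B (Cmp C D B1 B u1 (w B1 m1) \<otimes>\<^bsub>Hom C D B\<^esub> Cmp C D B2 B u2 (w B2 m2)) g"
      using bspec[OF eqR] by fastforce
    then have "Cmp C D0 D B (w B ?m) k = Cmp C D0 D B (Cmp C D B1 B u1 (w B1 m1) \<otimes>\<^bsub>Hom C D B\<^esub> Cmp C D B2 B u2 (w B2 m2)) k"
      using Cmp_assoc[OF D0' D'(1) D(1) *(3) h D'(2)] wm(1) Hom_closed(3)[OF D(1) *(3) c] by (simp add: k_def)
    also have "\<dots> = Cmp C D0 B1 B u1 (Cmp C D0 D B1 (w B1 m1) k) \<otimes>\<^bsub>Hom C D0 B\<^esub> Cmp C D0 B2 B u2 (Cmp C D0 D B2 (w B2 m2) k)"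
      using Cmp_add_left[OF D0' D(1) *(3) k c] Cmp_assoc[OF D0' D(1) *(1,3) k w1(1) *(6)] Cmp_assoc[OF D0' D(1) *(2,3) k w2(1) *(7)]
      by simp
    finally have "\<phi> B ?m = FAr V B1 B u1 (\<phi> B1 m1) \<otimes>\<^bsub>FOb V B\<^esub> FAr V B2 B u2 (\<phi> B2 m2)"
      using * y[OF D0(1)] ck Cmp_arr[OF D0' *(1,3) ck(1) *(6)] Cmp_arr[OF D0' *(2,3) ck(2) *(7)] D0'
      by (simp add: \<phi>_def FAr_add[OF V] FAr_Cmp[OF V])
    moreover have "?m = \<one>\<^bsub>FOb M B\<^esub>" if "\<phi> B ?m = \<one>\<^bsub>FOb V B\<^esub>"
    proof -
      have "FAr V D0 B (Cmp C D0 D B (w B ?m) k) (y D0) = \<one>\<^bsub>FOb V B\<^esub>" using that *(11) by (simp add: \<phi>_def)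
      then have "FAr M D0 B (Cmp C D0 D B (w B ?m) k) x0 = \<one>\<^bsub>FOb M B\<^esub>"
        using sep[OF D0(1) *(3) ck(3) _ x0] by blast
      then show ?thesis using FAr_Cmp[OF M D0' D(1) *(3) k wm(1) x0] kx wm(2) by simp
    qed
    ultimately show ?thesis by blast
  qed
  then have "\<forall>((B1, m1, u1), (B2, m2, u2), B)\<in>s.
       \<phi> B (FAr M B1 B u1 m1 \<otimes>\<^bsub>FOb M B\<^esub> FAr M B2 B u2 m2) =
         FAr V B1 B u1 (\<phi> B1 m1) \<otimes>\<^bsub>FOb V B\<^esub> FAr V B2 B u2 (\<phi> B2 m2) \<and>
       (\<phi> B (FAr M B1 B u1 m1 \<otimes>\<^bsub>FOb M B\<^esub> FAr M B2 B u2 m2) = \<one>\<^bsub>FOb V B\<^esub> \<longrightarrow>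
          FAr M B1 B u1 m1 \<otimes>\<^bsub>FOb M B\<^esub> FAr M B2 B u2 m2 = \<one>\<^bsub>FOb M B\<^esub>)"
    by (clarsimp simp: \<sigma>_def)
  then show ?thesis using \<phi>c by blast
qed

text \<open>Conjugation by chosen isomorphisms extends the map from the skeleton; naturality for an
  arbitrary arrow is naturality for its conjugate between skeleton objects.\<close>

lemma skeleton_monomorphism:
  assumes M: "functor_on C M" and N: "functor_on C N"
    and S: "S \<subseteq> Obj C" "\<And>A. A \<in> Obj C \<Longrightarrow> \<exists>B\<in>S. isomorphic_in C A B"
    and f: "\<And>B m. B \<in> S \<Longrightarrow> m \<in> carrier (FOb M B) \<Longrightarrow> f B m \<in> carrier (FOb N B)"
    and lin: "\<And>B1 m1 u1 B2 m2 u2 B. ((B1, m1, u1), (B2, m2, u2), B) \<in> linear_relations S M \<Longrightarrow>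
      f B (FAr M B1 B u1 m1 \<otimes>\<^bsub>FOb M B\<^esub> FAr M B2 B u2 m2) = FAr N B1 B u1 (f B1 m1) \<otimes>\<^bsub>FOb N B\<^esub> FAr N B2 B u2 (f B2 m2)"
    and inj: "\<And>B m. B \<in> S \<Longrightarrow> m \<in> carrier (FOb M B) \<Longrightarrow> f B m = \<one>\<^bsub>FOb N B\<^esub> \<Longrightarrow> m = \<one>\<^bsub>FOb M B\<^esub>"
  shows "\<exists>i. is_monomorphism (abfun_cat C) M N i"
proof -
  have "\<forall>A\<in>Obj C. \<exists>B a b. B \<in> S \<and> a \<in> arr C A B \<and> b \<in> arr C B A \<and> Cmp C A B A b a = Idn C A \<and> Cmp C B A B a b = Idn C B"
  proof
    fix A assume "A \<in> Obj C"
    then obtain B where B: "B \<in> S" "isomorphic_in C A B" using S(2) by blast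
    then show "\<exists>B a b. B \<in> S \<and> a \<in> arr C A B \<and> b \<in> arr C B A \<and> Cmp C A B A b a = Idn C A \<and> Cmp C B A B a b = Idn C B"
      using isomorphic_inE[OF B(2)] by metis
  qed
  then obtain s a b where "\<forall>A\<in>Obj C. s A \<in> S \<and> a A \<in> arr C A (s A) \<and> b A \<in> arr C (s A) A \<and>
      Cmp C A (s A) A (b A) (a A) = Idn C A \<and> Cmp C (s A) A (s A) (a A) (b A) = Idn C (s A)"
    by metis
  then have s: "s A \<in> S" "s A \<in> Obj C" "a A \<in> arr C A (s A)" "b A \<in> arr C (s A) A"
      "Cmp C A (s A) A (b A) (a A) = Idn C A" "Cmp C (s A) A (s A) (a A) (b A) = Idn C (s A)" if "A \<in> Obj C" for A
    using that S by auto
  have add: "f B (m \<otimes>\<^bsub>FOb M B\<^esub> m') = f B m \<otimes>\<^bsub>FOb N B\<^esub> f B m'"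
    if B: "B \<in> S" and m: "m \<in> carrier (FOb M B)" "m' \<in> carrier (FOb M B)" for B m m'
  proof -
    have O: "B \<in> Obj C" using S B by auto
    have "((B, m, Idn C B), (B, m', Idn C B), B) \<in> linear_relations S M"
      using B m Idn_arr[OF O] by (simp add: linear_relations_def)
    from lin[OF this] show ?thesis
      using O m f[OF B] by (simp add: FAr_Idn[OF M] FAr_Idn[OF N])
  qed
  have nat: "f B (FAr M A B u m) = FAr N A B u (f A m)"
    if A: "A \<in> S" "B \<in> S" and u: "u \<in> arr C A B" and m: "m \<in> carrier (FOb M A)" for A B u m
  proof -
    have O: "A \<in> Obj C" "B \<in> Obj C" using S A by auto
    interpret MB: comm_group "FOb M B" using functor_group[OF M O(2)] .
    interpret NB: comm_group "FOb N B" using functor_group[OF N O(2)] .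
    have "((A, m, u), (A, m, \<one>\<^bsub>Hom C A B\<^esub>), B) \<in> linear_relations S M"
      using A m u Hom_closed(1)[OF O] by (simp add: linear_relations_def)
    from lin[OF this] show ?thesis
      using O m f[OF A(1) m] u FAr_closed[OF M O u m] FAr_closed[OF N O u f[OF A(1) m]]
      by (simp add: FAr_zero[OF M] FAr_zero[OF N])
  qed
  define F where "F A m = FAr N (s A) A (b A) (f (s A) (FAr M A (s A) (a A) m))" for A m
  have am: "FAr M A (s A) (a A) m \<in> carrier (FOb M (s A))" if "A \<in> Obj C" "m \<in> carrier (FOb M A)" for A m
    using FAr_closed[OF M that(1) s(2,3)[OF that(1)] that(2)] .
  have fam: "f (s A) (FAr M A (s A) (a A) m) \<in> carrier (FOb N (s A))" if "A \<in> Obj C" "m \<in> carrier (FOb M A)" for A m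
    using f[OF s(1)[OF that(1)] am[OF that]] .
  have i: "natify C M F \<in> carrier (Nat C M N)"
  proof (rule natify_Nat[OF M])
    fix A assume A: "A \<in> Obj C"
    show "F A \<in> hom (FOb M A) (FOb N A)"
    proof (rule homI)
      fix m m' assume m: "m \<in> carrier (FOb M A)" "m' \<in> carrier (FOb M A)"
      show "F A m \<in> carrier (FOb N A)"
        unfolding F_def using FAr_closed[OF N s(2)[OF A] A s(4)[OF A] fam[OF A m(1)]] .
      show "F A (m \<otimes>\<^bsub>FOb M A\<^esub> m') = F A m \<otimes>\<^bsub>FOb N A\<^esub> F A m'"
        unfolding F_def FAr_mult[OF M A s(2,3)[OF A] m] add[OF s(1)[OF A] am[OF A m(1)] am[OF A m(2)]]
          FAr_mult[OF N s(2)[OF A] A s(4)[OF A] fam[OF A m(1)] fam[OF A m(2)]] ..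
    qed
    fix B u m assume B: "B \<in> Obj C" and u: "u \<in> arr C A B" and m: "m \<in> carrier (FOb M A)"
    define t where "t = Cmp C (s A) B (s B) (a B) (Cmp C (s A) A B u (b A))"
    have ub: "Cmp C (s A) A B u (b A) \<in> arr C (s A) B" using Cmp_arr[OF s(2)[OF A] A B s(4)[OF A] u] .
    have t: "t \<in> arr C (s A) (s B)" unfolding t_def using Cmp_arr[OF s(2)[OF A] B s(2)[OF B] ub s(3)[OF B]] .
    have 1: "FAr M (s A) (s B) t (FAr M A (s A) (a A) m) = FAr M B (s B) (a B) (FAr M A B u m)"
      using FAr_Cmp[OF M s(2)[OF A] B s(2)[OF B] ub s(3)[OF B] am[OF A m]] FAr_Cmp[OF M s(2)[OF A] A B s(4)[OF A] u am[OF A m]]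
        FAr_Cmp[OF M A s(2)[OF A] A s(3)[OF A] s(4)[OF A] m] s(5)[OF A] FAr_Idn[OF M A m] by (simp add: t_def)
    let ?z = "f (s A) (FAr M A (s A) (a A) m)"
    have z: "?z \<in> carrier (FOb N (s A))" using fam[OF A m] .
    have ubz: "FAr N (s A) B (Cmp C (s A) A B u (b A)) ?z \<in> carrier (FOb N B)" using FAr_closed[OF N s(2)[OF A] B ub z] .
    have "F B (FAr M A B u m) = FAr N (s B) B (b B) (FAr N (s A) (s B) t ?z)"
      unfolding F_def 1[symmetric] nat[OF s(1)[OF A] s(1)[OF B] t am[OF A m]] ..
    also have "FAr N (s A) (s B) t ?z = FAr N B (s B) (a B) (FAr N (s A) B (Cmp C (s A) A B u (b A)) ?z)"
      unfolding t_def using FAr_Cmp[OF N s(2)[OF A] B s(2)[OF B] ub s(3)[OF B] z] .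
    also have "FAr N (s B) B (b B) \<dots> = FAr N (s A) B (Cmp C (s A) A B u (b A)) ?z"
      using FAr_Cmp[OF N B s(2)[OF B] B s(3)[OF B] s(4)[OF B] ubz] s(5)[OF B] FAr_Idn[OF N B ubz] by simp
    also have "\<dots> = FAr N A B u (F A m)"
      unfolding F_def using FAr_Cmp[OF N s(2)[OF A] A B s(4)[OF A] u z] .
    finally show "F B (FAr M A B u m) = FAr N A B u (F A m)" .
  qed
  have "is_monomorphism (abfun_cat C) M N (natify C M F)"
  proof (rule is_monomorphismI[OF M N i])
    fix A m assume A: "A \<in> Obj C" and m: "m \<in> carrier (FOb M A)" and "natify C M F A m = \<one>\<^bsub>FOb N A\<^esub>"
    then have F1: "FAr N (s A) A (b A) (f (s A) (FAr M A (s A) (a A) m)) = \<one>\<^bsub>FOb N A\<^esub>" by (simp add: F_def)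
    have "f (s A) (FAr M A (s A) (a A) m) = FAr N A (s A) (a A) (FAr N (s A) A (b A) (f (s A) (FAr M A (s A) (a A) m)))"
      using FAr_Cmp[OF N s(2)[OF A] A s(2)[OF A] s(4)[OF A] s(3)[OF A] fam[OF A m]] s(6)[OF A] FAr_Idn[OF N s(2)[OF A] fam[OF A m]] by simp
    then have "f (s A) (FAr M A (s A) (a A) m) = \<one>\<^bsub>FOb N (s A)\<^esub>"
      using F1 FAr_one[OF N A s(2)[OF A] s(3)[OF A]] by simp
    then have am1: "FAr M A (s A) (a A) m = \<one>\<^bsub>FOb M (s A)\<^esub>" using inj[OF s(1)[OF A] am[OF A m]] by simp
    have "m = FAr M (s A) A (b A) (FAr M A (s A) (a A) m)"
      using FAr_Cmp[OF M A s(2)[OF A] A s(3)[OF A] s(4)[OF A] m] s(5)[OF A] FAr_Idn[OF M A m] by simp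
    then show "m = \<one>\<^bsub>FOb M A\<^esub>" using am1 FAr_one[OF M s(2)[OF A] A s(4)[OF A]] by simp
  qed
  then show ?thesis by blast
qed

text \<open>The reduced power is indexed by the finite sets of linear relations. An approximation
  \<open>\<phi> s\<close> need not be a homomorphism, but each relation is respected at all
  \<open>s\<close> containing it, that is, on a tail; so the family of all approximations becomes a
  monomorphism modulo families vanishing on a tail. It is pure because \<open>M\<close> is
  exact.\<close>

lemma definable_modules_contains:
  assumes E: "definable_modules \<E>" and M: "is_additive_functor C M" and ex: "exact_functor M"
    and kill: "\<And>A B c x. A \<in> Obj C \<Longrightarrow> B \<in> Obj C \<Longrightarrow> c \<in> arr C A B \<Longrightarrow>
      (\<And>N z. N \<in> \<E> \<Longrightarrow> z \<in> carrier (FOb N A) \<Longrightarrow> FAr N A B c z = \<one>\<^bsub>FOb N B\<^esub>) \<Longrightarrow>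
      x \<in> carrier (FOb M A) \<Longrightarrow> FAr M A B c x = \<one>\<^bsub>FOb M B\<^esub>"
  shows "M \<in> \<E>"
proof -
  have M': "functor_on C M" using M by (rule additive_functor_on)
  obtain S where S: "S \<subseteq> Obj C" "small TYPE('u) S" "\<And>A. A \<in> Obj C \<Longrightarrow> \<exists>B\<in>S. isomorphic_in C A B"
    using small_skeleton by blast
  obtain V y where VE: "V \<in> \<E>" and y: "\<And>D. D \<in> S \<Longrightarrow> y D \<in> carrier (FOb V D)"
    and sep: "\<And>D B c N z. D \<in> S \<Longrightarrow> B \<in> Obj C \<Longrightarrow> c \<in> arr C D B \<Longrightarrow> FAr V D B c (y D) = \<one>\<^bsub>FOb V B\<^esub> \<Longrightarrow>
      N \<in> \<E> \<Longrightarrow> z \<in> carrier (FOb N D) \<Longrightarrow> FAr N D B c z = \<one>\<^bsub>FOb N B\<^esub>"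
    using definable_separating_module[OF E S] by blast
  have V: "is_additive_functor C V" using definable_modulesD(1)[OF E VE] .
  have V': "functor_on C V" using V by (rule additive_functor_on)
  have sepM: "FAr M D B c x = \<one>\<^bsub>FOb M B\<^esub>" if "D \<in> S" "B \<in> Obj C" "c \<in> arr C D B" "FAr V D B c (y D) = \<one>\<^bsub>FOb V B\<^esub>"
    "x \<in> carrier (FOb M D)" for D B c x
    using kill[of D B c x] sep[OF that(1-4)] that S by blast
  define R where "R = linear_relations S M"
  define Fin where "Fin = {s. finite s \<and> s \<subseteq> R}"
  have Fs: "small TYPE('u) Fin"
    unfolding Fin_def R_def using small_finite_subsets[OF inaccessible small_linear_relations[OF S(1,2) M]] .
  then obtain e :: "(('o \<times> 'u \<times> 'u) \<times> ('o \<times> 'u \<times> 'u) \<times> 'o) set \<Rightarrow> 'u" where e: "inj_on e Fin"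
    using small_encoding by blast
  \<comment> \<open>Finite sets are replaced by their codes, since closure of a definable class is
    available for index sets inside \<open>'u\<close>.\<close>
  define J where "J = e ` Fin"
  define r where "r = {(e s, e t) | s t. s \<in> Fin \<and> t \<in> Fin \<and> s \<subseteq> t}"
  have Js: "small TYPE('u) J" unfolding J_def using Fs by (rule small_image)
  have eq: "e s = e t \<longleftrightarrow> s = t" if "s \<in> Fin" "t \<in> Fin" for s t using inj_on_eq_iff[OF e that] .
  have re: "(e s, e t) \<in> r \<longleftrightarrow> s \<subseteq> t" if "s \<in> Fin" "t \<in> Fin" for s t using that eq by (auto simp: r_def)
  have dir: "directed_poset J r"
    unfolding directed_poset_def partial_order_on_def preorder_on_def
  proof (intro conjI ballI)
    show "refl_on J r" by (auto simp: refl_on_def J_def r_def)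
    show "trans r"
    proof (rule transI)
      fix i j k assume "(i, j) \<in> r" "(j, k) \<in> r"
      then obtain s t t' u where "i = e s" "j = e t" "j = e t'" "k = e u" "s \<in> Fin" "t \<in> Fin" "t' \<in> Fin" "u \<in> Fin" "s \<subseteq> t" "t' \<subseteq> u"
        by (auto simp: r_def)
      then show "(i, k) \<in> r" using eq re by auto
    qed
    show "antisym r"
    proof (rule antisymI)
      fix i j assume ij: "(i, j) \<in> r" "(j, i) \<in> r"
      then obtain s t where st: "i = e s" "j = e t" "s \<in> Fin" "t \<in> Fin"
        by (auto simp: r_def)
      then show "i = j" using ij re by auto
    qed
    show "J \<noteq> {}" by (auto simp: J_def Fin_def)
    show "\<exists>k\<in>J. (i, k) \<in> r \<and> (j, k) \<in> r" if ij: "i \<in> J" "j \<in> J" for i j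
    proof -
      obtain s t where st: "s \<in> Fin" "t \<in> Fin" "i = e s" "j = e t" using ij by (auto simp: J_def)
      then have "s \<union> t \<in> Fin" by (auto simp: Fin_def)
      then show ?thesis using st re by (intro bexI[of _ "e (s \<union> t)"]) (auto simp: J_def)
    qed
    show "r \<subseteq> J \<times> J" by (auto simp: r_def J_def)
  qed
  \<comment> \<open>The empty set of relations is the least index that the description of the
    reduced product as a colimit asks for.\<close>
  have e0: "{} \<in> Fin" by (simp add: Fin_def)
  have J0: "e {} \<in> J" "\<And>j. j \<in> J \<Longrightarrow> (e {}, j) \<in> r"
    using e0 re[OF e0] unfolding J_def by blast+
  obtain N :: "('o, 'u, 'u) abfun" and \<gamma> where N: "is_additive_functor C N"
    and \<gamma>: "quotient_map C (product_functor J (\<lambda>j. V)) N \<gamma> (eventually_zero J r (\<lambda>j. V))"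
    using reduced_product[OF Js dir, of "\<lambda>j. V"] V by blast
  have N': "functor_on C N" using N by (rule additive_functor_on)
  have PV: "functor_on C (product_functor J (\<lambda>j. V))" by (rule functor_on_product) (rule V')
  have NE: "N \<in> \<E>"
  proof -
    obtain P \<pi> t c where P: "\<And>j. j \<in> J \<Longrightarrow> is_product (abfun_cat C) {k\<in>J. (j, k) \<in> r} (\<lambda>j. V) (P j) (\<pi> j)"
      and colim: "is_directed_colimit (abfun_cat C) J r P t N c"
      by (rule reduced_product_colimit[OF Js dir J0 V N \<gamma>]) blast+
    have "P j \<in> \<E>" if "j \<in> J" for j
      by (rule definable_modulesD(2)[OF E _ _ P[OF that]]) (use small_subset[OF Js] VE in auto)
    then show ?thesis by (rule definable_modulesD(3)[OF E Js _ colim])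
  qed
  have "\<forall>s\<in>Fin. \<exists>\<phi>. (\<forall>B\<in>Obj C. \<forall>m. \<phi> B m \<in> carrier (FOb V B)) \<and>
    (\<forall>((B1, m1, u1), (B2, m2, u2), B)\<in>s.
       \<phi> B (FAr M B1 B u1 m1 \<otimes>\<^bsub>FOb M B\<^esub> FAr M B2 B u2 m2) =
         FAr V B1 B u1 (\<phi> B1 m1) \<otimes>\<^bsub>FOb V B\<^esub> FAr V B2 B u2 (\<phi> B2 m2) \<and>
       (\<phi> B (FAr M B1 B u1 m1 \<otimes>\<^bsub>FOb M B\<^esub> FAr M B2 B u2 m2) = \<one>\<^bsub>FOb V B\<^esub> \<longrightarrow>
          FAr M B1 B u1 m1 \<otimes>\<^bsub>FOb M B\<^esub> FAr M B2 B u2 m2 = \<one>\<^bsub>FOb M B\<^esub>))"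
  proof
    fix s assume "s \<in> Fin"
    then have s: "finite s" "s \<subseteq> linear_relations S M" by (auto simp: Fin_def R_def)
    show "\<exists>\<phi>. (\<forall>B\<in>Obj C. \<forall>m. \<phi> B m \<in> carrier (FOb V B)) \<and>
    (\<forall>((B1, m1, u1), (B2, m2, u2), B)\<in>s.
       \<phi> B (FAr M B1 B u1 m1 \<otimes>\<^bsub>FOb M B\<^esub> FAr M B2 B u2 m2) =
         FAr V B1 B u1 (\<phi> B1 m1) \<otimes>\<^bsub>FOb V B\<^esub> FAr V B2 B u2 (\<phi> B2 m2) \<and>
       (\<phi> B (FAr M B1 B u1 m1 \<otimes>\<^bsub>FOb M B\<^esub> FAr M B2 B u2 m2) = \<one>\<^bsub>FOb V B\<^esub> \<longrightarrow>
          FAr M B1 B u1 m1 \<otimes>\<^bsub>FOb M B\<^esub> FAr M B2 B u2 m2 = \<one>\<^bsub>FOb M B\<^esub>))"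
      by (rule exact_finite_approximation[OF M' ex V' S(1,3) y sepM s])
  qed
  from bchoice[OF this] obtain \<phi> where
    \<phi>0: "\<forall>s\<in>Fin. (\<forall>B\<in>Obj C. \<forall>m. \<phi> s B m \<in> carrier (FOb V B)) \<and>
    (\<forall>((B1, m1, u1), (B2, m2, u2), B)\<in>s.
       \<phi> s B (FAr M B1 B u1 m1 \<otimes>\<^bsub>FOb M B\<^esub> FAr M B2 B u2 m2) =
         FAr V B1 B u1 (\<phi> s B1 m1) \<otimes>\<^bsub>FOb V B\<^esub> FAr V B2 B u2 (\<phi> s B2 m2) \<and>
       (\<phi> s B (FAr M B1 B u1 m1 \<otimes>\<^bsub>FOb M B\<^esub> FAr M B2 B u2 m2) = \<one>\<^bsub>FOb V B\<^esub> \<longrightarrow>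
          FAr M B1 B u1 m1 \<otimes>\<^bsub>FOb M B\<^esub> FAr M B2 B u2 m2 = \<one>\<^bsub>FOb M B\<^esub>))" ..
  then have \<phi>c: "\<phi> s B m \<in> carrier (FOb V B)" if "s \<in> Fin" "B \<in> Obj C" for s B m using that by blast
  have \<phi>lin: "\<phi> s B (FAr M B1 B u1 m1 \<otimes>\<^bsub>FOb M B\<^esub> FAr M B2 B u2 m2) =
         FAr V B1 B u1 (\<phi> s B1 m1) \<otimes>\<^bsub>FOb V B\<^esub> FAr V B2 B u2 (\<phi> s B2 m2)"
    "\<phi> s B (FAr M B1 B u1 m1 \<otimes>\<^bsub>FOb M B\<^esub> FAr M B2 B u2 m2) = \<one>\<^bsub>FOb V B\<^esub> \<Longrightarrow>
          FAr M B1 B u1 m1 \<otimes>\<^bsub>FOb M B\<^esub> FAr M B2 B u2 m2 = \<one>\<^bsub>FOb M B\<^esub>"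
    if "s \<in> Fin" "((B1, m1, u1), (B2, m2, u2), B) \<in> s" for s B1 m1 u1 B2 m2 u2 B
    using bspec[OF conjunct2[OF bspec[OF \<phi>0 that(1)]] that(2)] by simp_all
  define d where "d = inv_into Fin e"
  have d: "d j \<in> Fin" "e (d j) = j" if "j \<in> J" for j using that by (auto simp: J_def d_def inv_into_into f_inv_into_f)
  have de: "d (e s) = s" if "s \<in> Fin" for s using that e by (simp add: d_def)
  define v where "v B m = (\<lambda>j\<in>J. \<phi> (d j) B m)" for B m
  have v: "v B m \<in> carrier (FOb (product_functor J (\<lambda>j. V)) B)" if "B \<in> Obj C" for B m
    using that \<phi>c d by (auto simp: v_def)
  have single: "{\<rho>} \<in> Fin" if "\<rho> \<in> R" for \<rho> using that by (simp add: Fin_def)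
  have above: "\<rho> \<in> d j" if "\<rho> \<in> R" "j \<in> J" "(e {\<rho>}, j) \<in> r" for \<rho> j
    using that re[OF single d(1)] d by auto
  have "\<exists>i. is_monomorphism (abfun_cat C) M N i"
  proof (rule skeleton_monomorphism[OF M' N' S(1,3), of "\<lambda>B m. \<gamma> B (v B m)"])
    show "\<gamma> B (v B m) \<in> carrier (FOb N B)" if "B \<in> S" "m \<in> carrier (FOb M B)" for B m
      using quotient_mapD(3)[OF \<gamma> _ v] that S by auto
  next
    fix B1 m1 u1 B2 m2 u2 B assume \<rho>: "((B1, m1, u1), (B2, m2, u2), B) \<in> linear_relations S M"
    then have O: "B1 \<in> Obj C" "B2 \<in> Obj C" "B \<in> Obj C" and u: "u1 \<in> arr C B1 B" "u2 \<in> arr C B2 B"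
      using S by (auto simp: linear_relations_def)
    let ?m = "FAr M B1 B u1 m1 \<otimes>\<^bsub>FOb M B\<^esub> FAr M B2 B u2 m2"
    let ?P = "product_functor J (\<lambda>j. V)"
    define a where "a = FAr ?P B1 B u1 (v B1 m1)"
    define b where "b = FAr ?P B2 B u2 (v B2 m2)"
    have ab: "a \<in> carrier (FOb ?P B)" "b \<in> carrier (FOb ?P B)"
      unfolding a_def b_def using FAr_closed[OF PV _ O(3)] O u v by auto
    have abc: "a \<otimes>\<^bsub>FOb ?P B\<^esub> b \<in> carrier (FOb ?P B)" using functor_closed(3)[OF PV O(3) ab] .
    have "v B ?m \<otimes>\<^bsub>FOb ?P B\<^esub> inv\<^bsub>FOb ?P B\<^esub> (a \<otimes>\<^bsub>FOb ?P B\<^esub> b) \<in> eventually_zero J r (\<lambda>j. V) B" (is "?z \<in> _")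
    proof -
      have z: "?z \<in> carrier (FOb ?P B)" using functor_closed(3)[OF PV O(3) v[OF O(3)] functor_closed(2)[OF PV O(3) abc]] .
      \<comment> \<open>From the singleton of the given relation on, both sides agree.\<close>
      have "?z k = \<one>\<^bsub>FOb V B\<^esub>" if k: "k \<in> J" "(e {((B1, m1, u1), (B2, m2, u2), B)}, k) \<in> r" for k
      proof -
        have "((B1, m1, u1), (B2, m2, u2), B) \<in> d k" using above[OF _ k] \<rho> by (simp add: R_def)
        note l = \<phi>lin(1)[OF d(1)[OF k(1)] this]
        have "?z k = v B ?m k \<otimes>\<^bsub>FOb V B\<^esub> inv\<^bsub>FOb V B\<^esub> (a \<otimes>\<^bsub>FOb ?P B\<^esub> b) k"
          using functor_on_product_inv[of J C "\<lambda>j. V" B "a \<otimes>\<^bsub>FOb ?P B\<^esub> b"] V' O(3) abc k(1) by simp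
        also have "(a \<otimes>\<^bsub>FOb ?P B\<^esub> b) k = v B ?m k"
          using l k(1) by (simp add: a_def b_def v_def)
        also have "v B ?m k \<otimes>\<^bsub>FOb V B\<^esub> inv\<^bsub>FOb V B\<^esub> v B ?m k = \<one>\<^bsub>FOb V B\<^esub>"
          using comm_group_diff_eq_one[OF functor_group[OF V' O(3)]] \<phi>c[OF d(1)[OF k(1)] O(3)] k(1) by (simp add: v_def)
        finally show ?thesis .
      qed
      then show ?thesis
        using z single[of "((B1, m1, u1), (B2, m2, u2), B)"] \<rho> unfolding eventually_zero_def product_functor_simps(1)
        by (auto simp: J_def R_def intro!: bexI[of _ "{((B1, m1, u1), (B2, m2, u2), B)}"])
    qed
    then have "\<gamma> B (v B ?m) = \<gamma> B (a \<otimes>\<^bsub>FOb ?P B\<^esub> b)"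
      using quotient_map_eq_iff[OF \<gamma> PV N' O(3) v[OF O(3)] abc] by simp
    also have "\<dots> = \<gamma> B a \<otimes>\<^bsub>FOb N B\<^esub> \<gamma> B b" using hom_mult[OF quotient_mapD(1)[OF \<gamma> O(3)] ab] .
    also have "\<gamma> B a = FAr N B1 B u1 (\<gamma> B1 (v B1 m1))" unfolding a_def using quotient_mapD(5)[OF \<gamma> O(1,3) u(1) v[OF O(1)]] .
    also have "\<gamma> B b = FAr N B2 B u2 (\<gamma> B2 (v B2 m2))" unfolding b_def using quotient_mapD(5)[OF \<gamma> O(2,3) u(2) v[OF O(2)]] .
    finally show "\<gamma> B (v B ?m) = FAr N B1 B u1 (\<gamma> B1 (v B1 m1)) \<otimes>\<^bsub>FOb N B\<^esub> FAr N B2 B u2 (\<gamma> B2 (v B2 m2))" .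
  next
    fix B m assume B: "B \<in> S" and m: "m \<in> carrier (FOb M B)" and "\<gamma> B (v B m) = \<one>\<^bsub>FOb N B\<^esub>"
    have O: "B \<in> Obj C" using B S by auto
    have "v B m \<in> eventually_zero J r (\<lambda>j. V) B"
      using quotient_mapD(2)[OF \<gamma> O v[OF O]] \<open>\<gamma> B (v B m) = \<one>\<^bsub>FOb N B\<^esub>\<close> by simp
    then obtain j where j: "j \<in> J" "\<And>k. k \<in> J \<Longrightarrow> (j, k) \<in> r \<Longrightarrow> v B m k = \<one>\<^bsub>FOb V B\<^esub>"
      by (auto simp: eventually_zero_def)
    \<comment> \<open>The relation \<open>m = m + 0 m\<close> puts \<open>m\<close> among the
      elements controlled at every stage containing it; directedness supplies such a stage at which
      the approximation of \<open>m\<close> also vanishes.\<close>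
    define \<rho> where "\<rho> = ((B, m, Idn C B), (B, m, \<one>\<^bsub>Hom C B B\<^esub>), B)"
    have \<rho>: "\<rho> \<in> R" using B m O Idn_arr Hom_closed(1)[OF O O] by (simp add: \<rho>_def R_def linear_relations_def)
    have \<sigma>: "FAr M B B (Idn C B) m \<otimes>\<^bsub>FOb M B\<^esub> FAr M B B \<one>\<^bsub>Hom C B B\<^esub> m = m"
    proof -
      interpret G: comm_group "FOb M B" using functor_group[OF M' O] .
      show ?thesis using m O by (simp add: FAr_Idn[OF M'] FAr_zero[OF M'])
    qed
    obtain k where k: "k \<in> J" "(j, k) \<in> r" "(e {\<rho>}, k) \<in> r"
      using directed_posetD(5)[OF dir j(1), of "e {\<rho>}"] single[OF \<rho>] by (auto simp: J_def)
    have "\<rho> \<in> d k" using above[OF \<rho> k(1,3)] .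
    moreover have "\<phi> (d k) B m = \<one>\<^bsub>FOb V B\<^esub>" using j(2)[OF k(1,2)] k(1) by (simp add: v_def)
    ultimately show "m = \<one>\<^bsub>FOb M B\<^esub>"
      using \<phi>lin(2)[OF d(1)[OF k(1)], of B m "Idn C B" B m "\<one>\<^bsub>Hom C B B\<^esub>" B] \<sigma> by (simp add: \<rho>_def)
  qed
  then obtain i where i: "is_monomorphism (abfun_cat C) M N i" ..
  show ?thesis
    using definable_modulesD(4)[OF E M NE exact_pure_monomorphism[OF weak_cokernel_exists M ex N i]] .
qed

end

section \<open>Triangulated categories\<close>

context preadditive_category
begin

lemma zero_objectD:
  assumes "is_zero_object C Z"
  shows "Z \<in> Obj C" "\<And>X f. X \<in> Obj C \<Longrightarrow> f \<in> arr C X Z \<Longrightarrow> f = \<one>\<^bsub>Hom C X Z\<^esub>"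
    "\<And>X f. X \<in> Obj C \<Longrightarrow> f \<in> arr C Z X \<Longrightarrow> f = \<one>\<^bsub>Hom C Z X\<^esub>"
  using assms by (auto simp: is_zero_object_def)

lemma minus_minus:
  assumes "X \<in> Obj C" "Y \<in> Obj C" "f \<in> arr C X Y"
  shows "inv\<^bsub>Hom C X Y\<^esub> (inv\<^bsub>Hom C X Y\<^esub> f) = f"
proof -
  interpret comm_group "Hom C X Y" using comm_group_Hom assms by blast
  show ?thesis using assms by simp
qed

lemma minus_eq_iff:
  assumes "X \<in> Obj C" "Y \<in> Obj C" "f \<in> arr C X Y" "g \<in> arr C X Y"
  shows "inv\<^bsub>Hom C X Y\<^esub> f = inv\<^bsub>Hom C X Y\<^esub> g \<longleftrightarrow> f = g"
  using minus_minus[OF assms(1,2)] assms(3,4) by metis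

lemma minus_zero: "X \<in> Obj C \<Longrightarrow> Y \<in> Obj C \<Longrightarrow> inv\<^bsub>Hom C X Y\<^esub> \<one>\<^bsub>Hom C X Y\<^esub> = \<one>\<^bsub>Hom C X Y\<^esub>"
  by (meson comm_group_Hom comm_group_imp_group Group.group.is_monoid monoid.inv_one)

lemma is_isomorphism_Idn: "X \<in> Obj C \<Longrightarrow> is_isomorphism C X X (Idn C X)"
  unfolding is_isomorphism_def using Idn_arr Cmp_Idn_left by blast

end

context triangulated_category
begin

lemma ShA_hom: "X \<in> Obj T \<Longrightarrow> Y \<in> Obj T \<Longrightarrow> ShA X Y \<in> hom (Hom T X Y) (Hom T (Sh X) (Sh Y))"
  using Sh_iso by (simp add: iso_def)

lemma ShA_closed: "X \<in> Obj T \<Longrightarrow> Y \<in> Obj T \<Longrightarrow> f \<in> arr T X Y \<Longrightarrow> ShA X Y f \<in> arr T (Sh X) (Sh Y)"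
  by (rule hom_in_carrier[OF ShA_hom])

lemma ShA_add: "X \<in> Obj T \<Longrightarrow> Y \<in> Obj T \<Longrightarrow> f \<in> arr T X Y \<Longrightarrow> g \<in> arr T X Y \<Longrightarrow>
    ShA X Y (f \<otimes>\<^bsub>Hom T X Y\<^esub> g) = ShA X Y f \<otimes>\<^bsub>Hom T (Sh X) (Sh Y)\<^esub> ShA X Y g"
  by (rule hom_mult[OF ShA_hom])

lemma ShA_zero: "X \<in> Obj T \<Longrightarrow> Y \<in> Obj T \<Longrightarrow> ShA X Y \<one>\<^bsub>Hom T X Y\<^esub> = \<one>\<^bsub>Hom T (Sh X) (Sh Y)\<^esub>"
  using comm_group_hom_one[OF ShA_hom comm_group_Hom comm_group_Hom] Sh_obj by blast

lemma ShA_inj: "X \<in> Obj T \<Longrightarrow> Y \<in> Obj T \<Longrightarrow> f \<in> arr T X Y \<Longrightarrow> g \<in> arr T X Y \<Longrightarrow> ShA X Y f = ShA X Y g \<Longrightarrow> f = g"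
  using Sh_iso[of X Y] by (auto simp: iso_def bij_betw_def dest: inj_onD)

lemma ShA_surj: "X \<in> Obj T \<Longrightarrow> Y \<in> Obj T \<Longrightarrow> g \<in> arr T (Sh X) (Sh Y) \<Longrightarrow> \<exists>f\<in>arr T X Y. ShA X Y f = g"
  using Sh_iso[of X Y] by (auto simp: iso_def bij_betw_def image_iff) (metis image_iff)

lemma Tri_rotate:
  assumes "Tri X Y Z f g h"
  shows "Tri Y Z (Sh X) g h (inv\<^bsub>Hom T (Sh X) (Sh Y)\<^esub> (ShA X Y f))"
  using assms Tri_wf[OF assms] TR2_rotation by blast

text \<open>The identity of \<open>X\<close> and \<open>f\<close> extend to a morphism from the
  identity triangle of \<open>X\<close>, so \<open>g f\<close> factors through a zero
  object.\<close>

lemma Tri_comp_zero: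
  assumes tri: "Tri X Y Z f g h"
  shows "Cmp T X Y Z g f = \<one>\<^bsub>Hom T X Z\<^esub>"
proof -
  have w: "X \<in> Obj T" "Y \<in> Obj T" "Z \<in> Obj T" "f \<in> arr T X Y" "g \<in> arr T Y Z" using Tri_wf[OF tri] by auto
  obtain N0 where N0: "is_zero_object T N0" using zero_object by blast
  note z = zero_objectD[OF N0]
  have "Cmp T X X Y f (Idn T X) = Cmp T X X Y f (Idn T X)" ..
  from TR3_morphism[OF TR1_identity[OF w(1) N0] tri Idn_arr[OF w(1)] w(4) this]
  obtain u where u: "u \<in> arr T N0 Z" "Cmp T X N0 Z u \<one>\<^bsub>Hom T X N0\<^esub> = Cmp T X Y Z g f" by blast
  then show ?thesis using Cmp_zero_right[OF w(1) z(1) w(3) u(1)] by simp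
qed

text \<open>A morphism to a triangle \<open>0 \<rightarrow> W \<rightarrow> W\<close> gives the
  factorisation. Rotating the identity triangle yields such a triangle for \<open>Sh W\<close>, so
  the given triangle is rotated three times, and the shift is removed at the end because it is full
  and faithful; the signs from the rotations cancel.\<close>

lemma Tri_exact_contravariant:
  assumes tri: "Tri X Y Z f g h" and W: "W \<in> Obj T" and \<phi>: "\<phi> \<in> arr T Y W"
    and zero: "Cmp T X Y W \<phi> f = \<one>\<^bsub>Hom T X W\<^esub>"
  shows "\<exists>\<psi>\<in>arr T Z W. Cmp T Y Z W \<psi> g = \<phi>"
proof -
  have w: "X \<in> Obj T" "Y \<in> Obj T" "Z \<in> Obj T" "f \<in> arr T X Y" "g \<in> arr T Y Z" "h \<in> arr T Z (Sh X)" using Tri_wf[OF tri] by auto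
  obtain N0 where N0: "is_zero_object T N0" using zero_object by blast
  note z = zero_objectD[OF N0]
  note s = Sh_obj[OF w(1)] Sh_obj[OF w(2)] Sh_obj[OF w(3)] Sh_obj[OF W]
  let ?m = "\<lambda>X Y f. inv\<^bsub>Hom T X Y\<^esub> f"
  have t1: "Tri (Sh X) (Sh Y) (Sh Z) (?m (Sh X) (Sh Y) (ShA X Y f)) (?m (Sh Y) (Sh Z) (ShA Y Z g)) (?m (Sh Z) (Sh (Sh X)) (ShA Z (Sh X) h))"
    using Tri_rotate[OF Tri_rotate[OF Tri_rotate[OF tri]]] .
  have t2: "Tri N0 (Sh W) (Sh W) \<one>\<^bsub>Hom T N0 (Sh W)\<^esub> (?m (Sh W) (Sh W) (ShA W W (Idn T W))) (?m (Sh W) (Sh N0) (ShA W N0 \<one>\<^bsub>Hom T W N0\<^esub>))"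
    using Tri_rotate[OF Tri_rotate[OF TR1_identity[OF W N0]]] .
  have f': "?m (Sh X) (Sh Y) (ShA X Y f) \<in> arr T (Sh X) (Sh Y)" using Hom_closed(2) ShA_closed w s by blast
  have g': "ShA Y Z g \<in> arr T (Sh Y) (Sh Z)" using ShA_closed w by blast
  have \<phi>': "ShA Y W \<phi> \<in> arr T (Sh Y) (Sh W)" using ShA_closed w W \<phi> by blast
  have c: "Cmp T (Sh X) (Sh Y) (Sh W) (ShA Y W \<phi>) (?m (Sh X) (Sh Y) (ShA X Y f)) =
      Cmp T (Sh X) N0 (Sh W) \<one>\<^bsub>Hom T N0 (Sh W)\<^esub> \<one>\<^bsub>Hom T (Sh X) N0\<^esub>"
    using Cmp_minus_right[OF s(1,2,4) ShA_closed[OF w(1,2,4)] \<phi>'] Sh_Cmp[OF w(1,2) W w(4) \<phi>] zero ShA_zero[OF w(1) W]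
      minus_zero[OF s(1,4)] Cmp_zero_left[OF s(1) z(1) s(4) Hom_closed(1)[OF s(1) z(1)]] by simp
  from TR3_morphism[OF t1 t2 Hom_closed(1)[OF s(1) z(1)] \<phi>' c]
  obtain u where u: "u \<in> arr T (Sh Z) (Sh W)"
    "Cmp T (Sh Y) (Sh Z) (Sh W) u (?m (Sh Y) (Sh Z) (ShA Y Z g)) = Cmp T (Sh Y) (Sh W) (Sh W) (?m (Sh W) (Sh W) (ShA W W (Idn T W))) (ShA Y W \<phi>)"
    by blast
  have ug: "Cmp T (Sh Y) (Sh Z) (Sh W) u (ShA Y Z g) \<in> arr T (Sh Y) (Sh W)" using Cmp_arr[OF s(2-4) g' u(1)] .
  have "?m (Sh Y) (Sh W) (Cmp T (Sh Y) (Sh Z) (Sh W) u (ShA Y Z g)) = ?m (Sh Y) (Sh W) (ShA Y W \<phi>)"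
    using u(2) Cmp_minus_right[OF s(2-4) g' u(1)] Cmp_minus_left[OF s(2,4,4) \<phi>' Idn_arr[OF s(4)]]
      Cmp_Idn_left[OF s(2,4) \<phi>'] Sh_Idn[OF W] by simp
  then have eq: "Cmp T (Sh Y) (Sh Z) (Sh W) u (ShA Y Z g) = ShA Y W \<phi>" using minus_eq_iff[OF s(2,4) ug \<phi>'] by simp
  obtain \<psi> where \<psi>: "\<psi> \<in> arr T Z W" "ShA Z W \<psi> = u" using ShA_surj[OF w(3) W u(1)] by blast
  have "ShA Y W (Cmp T Y Z W \<psi> g) = ShA Y W \<phi>" using Sh_Cmp[OF w(2,3) W w(5) \<psi>(1)] \<psi>(2) eq by simp
  then have "Cmp T Y Z W \<psi> g = \<phi>" using ShA_inj[OF w(2) W Cmp_arr[OF w(2,3) W w(5) \<psi>(1)] \<phi>] by simp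
  then show ?thesis using \<psi>(1) by blast
qed

text \<open>The map \<open>\<phi>\<close> and zero form a morphism from the rotated identity
  triangle of \<open>W\<close> to the rotated given triangle. Its third component desuspends to the
  wanted map, the signs of the two rotations cancelling.\<close>

lemma Tri_exact_covariant:
  assumes tri: "Tri X Y Z f g h" and W: "W \<in> Obj T" and \<phi>: "\<phi> \<in> arr T W Y"
    and zero: "Cmp T W Y Z g \<phi> = \<one>\<^bsub>Hom T W Z\<^esub>"
  shows "\<exists>\<psi>\<in>arr T W X. Cmp T W X Y f \<psi> = \<phi>"
proof -
  have w: "X \<in> Obj T" "Y \<in> Obj T" "Z \<in> Obj T" "f \<in> arr T X Y" "g \<in> arr T Y Z" "h \<in> arr T Z (Sh X)" using Tri_wf[OF tri] by auto
  obtain N0 where N0: "is_zero_object T N0" using zero_object by blast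
  note z = zero_objectD[OF N0]
  note s = Sh_obj[OF w(1)] Sh_obj[OF w(2)] Sh_obj[OF w(3)] Sh_obj[OF W]
  let ?m = "\<lambda>X Y f. inv\<^bsub>Hom T X Y\<^esub> f"
  have c: "Cmp T W N0 Z \<one>\<^bsub>Hom T N0 Z\<^esub> \<one>\<^bsub>Hom T W N0\<^esub> = Cmp T W Y Z g \<phi>"
    using zero Cmp_zero_left[OF W z(1) w(3) Hom_closed(1)[OF W z(1)]] by simp
  from TR3_morphism[OF Tri_rotate[OF TR1_identity[OF W N0]] Tri_rotate[OF tri] \<phi> Hom_closed(1)[OF z(1) w(3)] c]
  obtain u where u: "u \<in> arr T (Sh W) (Sh X)"
    "Cmp T (Sh W) (Sh W) (Sh Y) (ShA W Y \<phi>) (?m (Sh W) (Sh W) (ShA W W (Idn T W))) = Cmp T (Sh W) (Sh X) (Sh Y) (?m (Sh X) (Sh Y) (ShA X Y f)) u"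
    by blast
  have f': "ShA X Y f \<in> arr T (Sh X) (Sh Y)" and \<phi>': "ShA W Y \<phi> \<in> arr T (Sh W) (Sh Y)"
    using ShA_closed w W \<phi> by auto
  have fu: "Cmp T (Sh W) (Sh X) (Sh Y) (ShA X Y f) u \<in> arr T (Sh W) (Sh Y)" using Cmp_arr[OF s(4,1,2) u(1) f'] .
  have "?m (Sh W) (Sh Y) (ShA W Y \<phi>) = ?m (Sh W) (Sh Y) (Cmp T (Sh W) (Sh X) (Sh Y) (ShA X Y f) u)"
    using u(2) Cmp_minus_right[OF s(4,4,2) Idn_arr[OF s(4)] \<phi>'] Cmp_minus_left[OF s(4,1,2) u(1) f']
      Cmp_Idn_right[OF s(4,2) \<phi>'] Sh_Idn[OF W] by simp
  then have eq: "Cmp T (Sh W) (Sh X) (Sh Y) (ShA X Y f) u = ShA W Y \<phi>" using minus_eq_iff[OF s(4,2) \<phi>' fu] by simp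
  obtain \<psi> where \<psi>: "\<psi> \<in> arr T W X" "ShA W X \<psi> = u" using ShA_surj[OF W w(1) u(1)] by blast
  have "ShA W Y (Cmp T W X Y f \<psi>) = ShA W Y \<phi>" using Sh_Cmp[OF W w(1,2) \<psi>(1) w(4)] \<psi>(2) eq by simp
  then have "Cmp T W X Y f \<psi> = \<phi>" using ShA_inj[OF W w(2) Cmp_arr[OF W w(1,2) \<psi>(1) w(4)] \<phi>] by simp
  then show ?thesis using \<psi>(1) by blast
qed

lemma desuspension:
  assumes "Y \<in> Obj T"
  obtains X s s' where "X \<in> Obj T" "s \<in> arr T (Sh X) Y" "s' \<in> arr T Y (Sh X)"
    "Cmp T (Sh X) Y (Sh X) s' s = Idn T (Sh X)" "Cmp T Y (Sh X) Y s s' = Idn T Y"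
  using Sh_dense[OF assms] unfolding isomorphic_in_def is_isomorphism_def by blast

text \<open>The cone of \<open>f\<close> is isomorphic to some \<open>Sh Z\<close>, as the shift is
  dense; after replacing the cone by \<open>Sh Z\<close>, the triangle can be rotated back.\<close>

lemma Tri_cocone_exists:
  assumes A: "A \<in> Obj T" "B \<in> Obj T" "f \<in> arr T A B"
  obtains Z k g where "Tri Z A B k f g"
proof -
  obtain Y g h where tri: "Tri A B Y f g h" using TR1_cone[OF A] by blast
  have w: "Y \<in> Obj T" "g \<in> arr T B Y" "h \<in> arr T Y (Sh A)" using Tri_wf[OF tri] by auto
  obtain Z s s' where Z: "Z \<in> Obj T" and s: "s \<in> arr T (Sh Z) Y" "s' \<in> arr T Y (Sh Z)"
    "Cmp T (Sh Z) Y (Sh Z) s' s = Idn T (Sh Z)" "Cmp T Y (Sh Z) Y s s' = Idn T Y"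
    using desuspension[OF w(1)] .
  note sZ = Sh_obj[OF Z] and sA = Sh_obj[OF A(1)]
  have sg: "Cmp T B Y (Sh Z) s' g \<in> arr T B (Sh Z)" using Cmp_arr[OF A(2) w(1) sZ w(2) s(2)] .
  have hs: "Cmp T (Sh Z) Y (Sh A) h s \<in> arr T (Sh Z) (Sh A)" using Cmp_arr[OF sZ w(1) sA s(1) w(3)] .
  have iso: "is_isomorphism T Y (Sh Z) s'" using s by (auto simp: is_isomorphism_def)
  have "Tri A B (Sh Z) f (Cmp T B Y (Sh Z) s' g) (Cmp T (Sh Z) Y (Sh A) h s)"
  proof (rule TR1_isomorphic[OF tri A(1,2) sZ A(3) sg hs is_isomorphism_Idn[OF A(1)] is_isomorphism_Idn[OF A(2)] iso])
    show "Cmp T A B B (Idn T B) f = Cmp T A A B f (Idn T A)" using A by (simp add: Cmp_Idn_left Cmp_Idn_right)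
    show "Cmp T B Y (Sh Z) s' g = Cmp T B B (Sh Z) (Cmp T B Y (Sh Z) s' g) (Idn T B)"
      using Cmp_Idn_right[OF A(2) sZ sg] by simp
    have "Cmp T Y (Sh Z) (Sh A) (Cmp T (Sh Z) Y (Sh A) h s) s' = Cmp T Y Y (Sh A) h (Cmp T Y (Sh Z) Y s s')"
      using Cmp_assoc[OF w(1) sZ w(1) sA s(2,1) w(3)] by simp
    then show "Cmp T Y (Sh A) (Sh A) (ShA A A (Idn T A)) h = Cmp T Y (Sh Z) (Sh A) (Cmp T (Sh Z) Y (Sh A) h s) s'"
      using s(4) Cmp_Idn_right[OF w(1) sA w(3)] Cmp_Idn_left[OF w(1) sA w(3)] Sh_Idn[OF A(1)] by simp
  qed
  \<comment> \<open>The rotation axiom puts a minus sign on the shifted map, so \<open>k\<close> is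
    chosen with the sign already inverted.\<close>
  moreover obtain k where k: "k \<in> arr T Z A" "ShA Z A k = inv\<^bsub>Hom T (Sh Z) (Sh A)\<^esub> (Cmp T (Sh Z) Y (Sh A) h s)"
    using ShA_surj[OF Z A(1) Hom_closed(2)[OF sZ sA hs]] by blast
  ultimately have "Tri A B (Sh Z) f (Cmp T B Y (Sh Z) s' g) (inv\<^bsub>Hom T (Sh Z) (Sh A)\<^esub> (ShA Z A k))"
    using minus_minus[OF sZ sA hs] by simp
  then have "Tri Z A B k f (Cmp T B Y (Sh Z) s' g)"
    using TR2_rotation[OF Z A(1,2) k(1) A(3) sg] by blast
  then show thesis by (rule that)
qed

end

section \<open>Compact objects\<close>

text \<open>The image of the canonical map from the direct sum of the groups \<open>(A, X i)\<close> to \<open>(A, S)\<close>.\<close>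

inductive_set finitely_supported ::
  "('o, 'u) pcat \<Rightarrow> 'i set \<Rightarrow> ('i \<Rightarrow> 'o) \<Rightarrow> 'o \<Rightarrow> ('i \<Rightarrow> 'u) \<Rightarrow> 'o \<Rightarrow> 'u set"
  for T I X S \<iota> A where
  zero: "\<one>\<^bsub>Hom T A S\<^esub> \<in> finitely_supported T I X S \<iota> A"
| add: "\<phi> \<in> finitely_supported T I X S \<iota> A \<Longrightarrow> i \<in> I \<Longrightarrow> h \<in> arr T A (X i) \<Longrightarrow>
    \<phi> \<otimes>\<^bsub>Hom T A S\<^esub> Cmp T A (X i) S (\<iota> i) h \<in> finitely_supported T I X S \<iota> A"

context preadditive_category
begin

lemma is_coproductD:
  assumes "is_coproduct C I X S \<iota>"
  shows "S \<in> Obj C" "i \<in> I \<Longrightarrow> \<iota> i \<in> arr C (X i) S"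
  using assms by (auto simp: is_coproduct_def)

lemma coproduct_projection:
  assumes S: "is_coproduct C I X S \<iota>" and X: "\<And>i. i \<in> I \<Longrightarrow> X i \<in> Obj C" and j: "j \<in> I"
  shows "\<exists>p\<in>arr C S (X j). Cmp C (X j) S (X j) p (\<iota> j) = Idn C (X j) \<and>
    (\<forall>i\<in>I. i \<noteq> j \<longrightarrow> Cmp C (X i) S (X j) p (\<iota> i) = \<one>\<^bsub>Hom C (X i) (X j)\<^esub>)"
proof -
  define h where "h i = (if i = j then Idn C (X j) else \<one>\<^bsub>Hom C (X i) (X j)\<^esub>)" for i
  have "\<forall>i\<in>I. h i \<in> arr C (X i) (X j)" using X j by (simp add: h_def Idn_arr Hom_closed)
  then obtain p where "p \<in> arr C S (X j)" "\<forall>i\<in>I. Cmp C (X i) S (X j) p (\<iota> i) = h i"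
    using S X[OF j] unfolding is_coproduct_def by blast
  then show ?thesis using j by (intro bexI[of _ p]) (auto simp: h_def)
qed

context
  fixes I :: "'i set" and X S \<iota>
  assumes S: "is_coproduct C I X S \<iota>" and X: "\<And>i. i \<in> I \<Longrightarrow> X i \<in> Obj C"
begin

lemmas coproductD = is_coproductD[OF S]

lemma finitely_supported_closed: "A \<in> Obj C \<Longrightarrow> \<phi> \<in> finitely_supported C I X S \<iota> A \<Longrightarrow> \<phi> \<in> arr C A S"
  by (rotate_tac 1, induction rule: finitely_supported.induct)
    (auto simp: Hom_closed coproductD X Cmp_arr)

lemma finitely_supported_mult:
  assumes A: "A \<in> Obj C" and \<phi>: "\<phi> \<in> finitely_supported C I X S \<iota> A"
    and \<psi>: "\<psi> \<in> finitely_supported C I X S \<iota> A"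
  shows "\<phi> \<otimes>\<^bsub>Hom C A S\<^esub> \<psi> \<in> finitely_supported C I X S \<iota> A"
  using \<psi>
proof (induction rule: finitely_supported.induct)
  interpret comm_group "Hom C A S" using comm_group_Hom[OF A coproductD(1)] .
  case zero
  then show ?case using \<phi> finitely_supported_closed[OF A \<phi>] by simp
next
  interpret comm_group "Hom C A S" using comm_group_Hom[OF A coproductD(1)] .
  case (add \<psi> i h)
  have "\<phi> \<otimes>\<^bsub>Hom C A S\<^esub> (\<psi> \<otimes>\<^bsub>Hom C A S\<^esub> Cmp C A (X i) S (\<iota> i) h) =
      (\<phi> \<otimes>\<^bsub>Hom C A S\<^esub> \<psi>) \<otimes>\<^bsub>Hom C A S\<^esub> Cmp C A (X i) S (\<iota> i) h"
    using finitely_supported_closed[OF A \<phi>] finitely_supported_closed[OF A add.hyps(1)]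
      Cmp_arr[OF A X[OF add.hyps(2)] coproductD(1) add.hyps(3) coproductD(2)[OF add.hyps(2)]] by (simp add: m_assoc)
  then show ?case using finitely_supported.add[OF add.IH add.hyps(2,3)] by simp
qed

lemma finitely_supported_single:
  assumes A: "A \<in> Obj C" and i: "i \<in> I" and h: "h \<in> arr C A (X i)"
  shows "Cmp C A (X i) S (\<iota> i) h \<in> finitely_supported C I X S \<iota> A"
proof -
  interpret comm_group "Hom C A S" using comm_group_Hom[OF A coproductD(1)] .
  have "\<one>\<^bsub>Hom C A S\<^esub> \<in> finitely_supported C I X S \<iota> A" by (rule finitely_supported.zero)
  from finitely_supported.add[OF this i h] show ?thesis
    using Cmp_arr[OF A X[OF i] coproductD(1) h coproductD(2)[OF i]] by simp
qed

lemma finitely_supported_Cmp: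
  assumes A: "A \<in> Obj C" and B: "B \<in> Obj C" and g: "g \<in> arr C A B" and \<phi>: "\<phi> \<in> finitely_supported C I X S \<iota> B"
  shows "Cmp C A B S \<phi> g \<in> finitely_supported C I X S \<iota> A"
  using \<phi>
proof (induction rule: finitely_supported.induct)
  case zero
  then show ?case using Cmp_zero_left[OF A B coproductD(1) g] finitely_supported.zero by metis
next
  case (add \<phi> i h)
  have hg: "Cmp C A B (X i) h g \<in> arr C A (X i)" using Cmp_arr[OF A B X[OF add.hyps(2)] g add.hyps(3)] .
  have "Cmp C A B S (\<phi> \<otimes>\<^bsub>Hom C B S\<^esub> Cmp C B (X i) S (\<iota> i) h) g =
      Cmp C A B S \<phi> g \<otimes>\<^bsub>Hom C A S\<^esub> Cmp C A (X i) S (\<iota> i) (Cmp C A B (X i) h g)"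
    using A B g add.hyps X[OF add.hyps(2)] coproductD finitely_supported_closed[OF B add.hyps(1)]
    by (simp add: Cmp_add_left Cmp_arr Cmp_assoc)
  then show ?case using finitely_supported.add[OF add.IH add.hyps(2) hg] by simp
qed

lemma finitely_supported_inv:
  assumes A: "A \<in> Obj C" and \<phi>: "\<phi> \<in> finitely_supported C I X S \<iota> A"
  shows "inv\<^bsub>Hom C A S\<^esub> \<phi> \<in> finitely_supported C I X S \<iota> A"
proof -
  have c: "\<phi> \<in> arr C A S" using finitely_supported_closed[OF A \<phi>] .
  have "inv\<^bsub>Hom C A S\<^esub> \<phi> = Cmp C A A S \<phi> (inv\<^bsub>Hom C A A\<^esub> Idn C A)"
    using Cmp_minus_right[OF A A coproductD(1) Idn_arr[OF A] c] Cmp_Idn_right[OF A coproductD(1) c] by simp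
  then show ?thesis using finitely_supported_Cmp[OF A A Hom_closed(2)[OF A A Idn_arr[OF A]] \<phi>] by simp
qed

text \<open>Finitely many components carry \<open>\<phi>\<close>, and the projection of
  \<open>S\<close> onto them is a finitely supported endomorphism that fixes \<open>\<phi>\<close>.
  Closure of compact objects under cones rests on this endomorphism.\<close>

lemma finitely_supported_absorb:
  assumes A: "A \<in> Obj C" and \<phi>: "\<phi> \<in> finitely_supported C I X S \<iota> A"
  shows "\<exists>e\<in>finitely_supported C I X S \<iota> S. Cmp C A S S e \<phi> = \<phi>"
proof -
  have S': "S \<in> Obj C" using coproductD(1) .
  interpret SS: comm_group "Hom C S S" using comm_group_Hom[OF S' S'] .
  have e: "\<exists>e\<in>finitely_supported C I X S \<iota> S. \<forall>i\<in>F. Cmp C (X i) S S e (\<iota> i) = \<iota> i" if "finite F" "F \<subseteq> I" for F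
    using that
  proof (induction F rule: finite_induct)
    case empty
    show ?case by (rule bexI[OF _ finitely_supported.zero]) simp
  next
    case (insert i F)
    obtain e where e: "e \<in> finitely_supported C I X S \<iota> S" "\<forall>i\<in>F. Cmp C (X i) S S e (\<iota> i) = \<iota> i"
      using insert by auto
    have i: "i \<in> I" using insert by simp
    note Xi = X[OF i] and \<iota>i = coproductD(2)[OF i]
    obtain p where p: "p \<in> arr C S (X i)" "Cmp C (X i) S (X i) p (\<iota> i) = Idn C (X i)"
      "\<forall>j\<in>I. j \<noteq> i \<longrightarrow> Cmp C (X j) S (X i) p (\<iota> j) = \<one>\<^bsub>Hom C (X j) (X i)\<^esub>"
      using coproduct_projection[OF S X i] by blast
    define q where "q = Cmp C S (X i) S (\<iota> i) p"
    have q: "q \<in> finitely_supported C I X S \<iota> S" unfolding q_def using finitely_supported_single[OF S' i p(1)] .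
    have qe: "Cmp C S S S e q \<in> finitely_supported C I X S \<iota> S"
      using finitely_supported_Cmp[OF S' S' finitely_supported_closed[OF S' q] e(1)] .
    \<comment> \<open>The usual join of two projections, \<open>e + q - e q\<close>: it fixes
      \<open>\<iota> i\<close> and still fixes the inclusions already fixed by
      \<open>e\<close>.\<close>
    define e' where "e' = e \<otimes>\<^bsub>Hom C S S\<^esub> (q \<otimes>\<^bsub>Hom C S S\<^esub> inv\<^bsub>Hom C S S\<^esub> Cmp C S S S e q)"
    have e': "e' \<in> finitely_supported C I X S \<iota> S"
      unfolding e'_def using finitely_supported_mult[OF S' e(1) finitely_supported_mult[OF S' q finitely_supported_inv[OF S' qe]]] .
    note c = finitely_supported_closed[OF S' e(1)] finitely_supported_closed[OF S' q] finitely_supported_closed[OF S' qe]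
    have "Cmp C (X j) S S e' (\<iota> j) = \<iota> j" if j: "j \<in> insert i F" for j
    proof -
      have jI: "j \<in> I" using j insert.prems by auto
      note Xj = X[OF jI] and \<iota>j = coproductD(2)[OF jI]
      interpret H: comm_group "Hom C (X j) S" using comm_group_Hom[OF Xj S'] .
      have qj: "Cmp C (X j) S S q (\<iota> j) = (if j = i then \<iota> j else \<one>\<^bsub>Hom C (X j) S\<^esub>)"
      proof -
        have "Cmp C (X j) S S q (\<iota> j) = Cmp C (X j) (X i) S (\<iota> i) (Cmp C (X j) S (X i) p (\<iota> j))"
          unfolding q_def using Cmp_assoc[OF Xj S' Xi S' \<iota>j p(1) \<iota>i] by simp
        then show ?thesis using p jI Cmp_Idn_right[OF Xi S' \<iota>i] Cmp_zero_right[OF Xj Xi S' \<iota>i] by auto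
      qed
      have ej: "Cmp C (X j) S S e (\<iota> j) \<in> arr C (X j) S" using Cmp_arr[OF Xj S' S' \<iota>j c(1)] .
      have "Cmp C (X j) S S e' (\<iota> j) = Cmp C (X j) S S e (\<iota> j) \<otimes>\<^bsub>Hom C (X j) S\<^esub>
          (Cmp C (X j) S S q (\<iota> j) \<otimes>\<^bsub>Hom C (X j) S\<^esub> inv\<^bsub>Hom C (X j) S\<^esub> Cmp C (X j) S S e (Cmp C (X j) S S q (\<iota> j)))"
        unfolding e'_def using Xj S' \<iota>j c
        by (simp add: Cmp_add_left Cmp_minus_left Cmp_assoc)
      also have "\<dots> = \<iota> j"
      proof (cases "j = i")
        case True
        then show ?thesis using qj ej \<iota>j H.m_lcomm[OF ej \<iota>j H.inv_closed[OF ej]] H.r_inv[OF ej] H.r_one[OF \<iota>j] by simp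
      next
        case False
        then have "j \<in> F" using j by simp
        then show ?thesis using qj False e(2) \<iota>j Cmp_zero_right[OF Xj S' S' c(1)] by simp
      qed
      finally show ?thesis .
    qed
    then show ?case using e' by blast
  qed
  have "\<exists>F. finite F \<and> F \<subseteq> I \<and> (\<forall>e\<in>arr C S S. (\<forall>i\<in>F. Cmp C (X i) S S e (\<iota> i) = \<iota> i) \<longrightarrow> Cmp C A S S e \<phi> = \<phi>)"
    using \<phi>
  proof (induction rule: finitely_supported.induct)
    case zero
    have "\<forall>e\<in>arr C S S. Cmp C A S S e \<one>\<^bsub>Hom C A S\<^esub> = \<one>\<^bsub>Hom C A S\<^esub>" using Cmp_zero_right[OF A S' S'] by blast
    then show ?case by (intro exI[of _ "{}"]) auto
  next
    case (add \<phi> i h)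
    obtain F where F: "finite F" "F \<subseteq> I"
      "\<forall>e\<in>arr C S S. (\<forall>i\<in>F. Cmp C (X i) S S e (\<iota> i) = \<iota> i) \<longrightarrow> Cmp C A S S e \<phi> = \<phi>"
      using add.IH by blast
    note Xi = X[OF add.hyps(2)] and \<iota>i = coproductD(2)[OF add.hyps(2)]
    have "Cmp C A S S e (\<phi> \<otimes>\<^bsub>Hom C A S\<^esub> Cmp C A (X i) S (\<iota> i) h) = \<phi> \<otimes>\<^bsub>Hom C A S\<^esub> Cmp C A (X i) S (\<iota> i) h"
      if e: "e \<in> arr C S S" and ei: "\<And>j. j \<in> insert i F \<Longrightarrow> Cmp C (X j) S S e (\<iota> j) = \<iota> j" for e
      using Cmp_add_right[OF A S' S' finitely_supported_closed[OF A add.hyps(1)] Cmp_arr[OF A Xi S' add.hyps(3) \<iota>i] e]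
        bspec[OF F(3) e] ei Cmp_assoc[OF A Xi S' S' add.hyps(3) \<iota>i e] by simp
    then show ?case using F(1,2) add.hyps(2) by (intro exI[of _ "insert i F"]) auto
  qed
  then obtain F where F: "finite F" "F \<subseteq> I" "\<forall>e\<in>arr C S S. (\<forall>i\<in>F. Cmp C (X i) S S e (\<iota> i) = \<iota> i) \<longrightarrow> Cmp C A S S e \<phi> = \<phi>" by blast
  obtain e where e: "e \<in> finitely_supported C I X S \<iota> S" "\<forall>i\<in>F. Cmp C (X i) S S e (\<iota> i) = \<iota> i"
    using e[OF F(1,2)] by blast
  then have "Cmp C A S S e \<phi> = \<phi>" using bspec[OF F(3) finitely_supported_closed[OF S' e(1)]] by simp
  then show ?thesis using e(1) by blast
qed

lemma comparison_hom:
  assumes A: "A \<in> Obj C"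
  shows "(\<lambda>h. gfinprod (Hom C A S) (\<lambda>i. Cmp C A (X i) S (\<iota> i) (h i)) I) \<in> hom (sum_group I (\<lambda>i. Hom C A (X i))) (Hom C A S)"
proof (rule comm_group.hom_group_sum[OF comm_group_Hom[OF A coproductD(1)]])
  fix i assume i: "i \<in> I"
  show "Cmp C A (X i) S (\<iota> i) \<in> hom (Hom C A (X i)) (Hom C A S)"
    using i A X[OF i] coproductD by (auto simp: hom_def Cmp_arr Cmp_add_right)
  show "group (Hom C A (X i))" using comm_group_imp_group[OF comm_group_Hom[OF A X[OF i]]] .
qed

text \<open>Projections onto the components make the comparison map injective for every
  \<open>A\<close>, so it is an isomorphism iff it is surjective, and its image consists of the
  finitely supported morphisms.\<close>

lemma comparison_iso_iff:
  assumes A: "A \<in> Obj C"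
  shows "(\<lambda>h. gfinprod (Hom C A S) (\<lambda>i. Cmp C A (X i) S (\<iota> i) (h i)) I)
      \<in> iso (sum_group I (\<lambda>i. Hom C A (X i))) (Hom C A S) \<longleftrightarrow> arr C A S \<subseteq> finitely_supported C I X S \<iota> A"
    (is "?c \<in> iso ?G ?H \<longleftrightarrow> _")
proof -
  have S': "S \<in> Obj C" using coproductD(1) .
  interpret H: comm_group ?H using comm_group_Hom[OF A S'] .
  have grp: "group (Hom C A (X i))" if "i \<in> I" for i using comm_group_imp_group[OF comm_group_Hom[OF A X[OF that]]] .
  have G: "group ?G" by (rule sum_group) (rule grp)
  have Gc: "carrier ?G = {x \<in> \<Pi>\<^sub>E i\<in>I. arr C A (X i). finite {i \<in> I. x i \<noteq> \<one>\<^bsub>Hom C A (X i)\<^esub>}}"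
    by (rule carrier_sum_group) (rule grp)
  note hom = comparison_hom[OF A]
  have trm: "Cmp C A (X i) S (\<iota> i) h \<in> carrier ?H" if "i \<in> I" "h \<in> arr C A (X i)" for i h
    using Cmp_arr[OF A X[OF that(1)] S' that(2) coproductD(2)[OF that(1)]] .
  have fs: "finprod ?H (\<lambda>i. Cmp C A (X i) S (\<iota> i) (h i)) F \<in> finitely_supported C I X S \<iota> A"
    if "finite F" "F \<subseteq> I" "\<And>i. i \<in> I \<Longrightarrow> h i \<in> arr C A (X i)" for F h
    using that(1,2)
  proof (induction F rule: finite_induct)
    case empty
    then show ?case using finitely_supported.zero by simp
  next
    case (insert i F)
    have "finprod ?H (\<lambda>i. Cmp C A (X i) S (\<iota> i) (h i)) (insert i F) =
        Cmp C A (X i) S (\<iota> i) (h i) \<otimes>\<^bsub>?H\<^esub> finprod ?H (\<lambda>i. Cmp C A (X i) S (\<iota> i) (h i)) F"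
      using insert that(3) trm by (intro H.finprod_insert) auto
    then show ?case
      using finitely_supported_mult[OF A finitely_supported_single[OF A, of i "h i"] insert.IH] insert that(3) by simp
  qed
  have range: "?c h \<in> finitely_supported C I X S \<iota> A" if "h \<in> carrier ?G" for h
  proof -
    have h: "h i \<in> arr C A (X i)" if "i \<in> I" for i using \<open>h \<in> carrier ?G\<close> that by (auto simp: Gc)
    show ?thesis
      unfolding gfinprod_def using fs[of "{i \<in> I. Cmp C A (X i) S (\<iota> i) (h i) \<noteq> \<one>\<^bsub>?H\<^esub>}" h] h finitely_supported.zero by auto
  qed
  have one: "\<one>\<^bsub>?G\<^esub> \<in> carrier ?G" using G by (simp add: Group.group.is_monoid monoid.one_closed del: one_sum_group)
  have surj: "\<phi> \<in> ?c ` carrier ?G" if "\<phi> \<in> finitely_supported C I X S \<iota> A" for \<phi>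
    using that
  proof (induction rule: finitely_supported.induct)
    case zero
    have "?c \<one>\<^bsub>?G\<^esub> = \<one>\<^bsub>?H\<^esub>" using hom_one[OF hom G H.is_group] .
    then show ?case using imageI[OF one, of ?c] by simp
  next
    case (add \<phi> i h)
    then obtain h' where h': "h' \<in> carrier ?G" "\<phi> = ?c h'" by blast
    define s where "s = (\<lambda>j\<in>I. if j = i then h else \<one>\<^bsub>Hom C A (X j)\<^esub>)"
    have "finite {j \<in> I. s j \<noteq> \<one>\<^bsub>Hom C A (X j)\<^esub>}" by (rule finite_subset[of _ "{i}"]) (auto simp: s_def)
    then have s: "s \<in> carrier ?G" using add.hyps X Hom_closed(1)[OF A] by (auto simp: Gc s_def)
    have sz: "Cmp C A (X j) S (\<iota> j) (s j) = \<one>\<^bsub>?H\<^esub>" if "j \<in> I" "j \<noteq> i" for j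
      using that Cmp_zero_right[OF A X[OF that(1)] S' coproductD(2)[OF that(1)]] by (simp add: s_def)
    have "?c s = gfinprod ?H (\<lambda>i. Cmp C A (X i) S (\<iota> i) (s i)) {i}"
      by (rule H.gfinprod_mono_neutral_cong_right) (use add.hyps sz trm s in \<open>auto simp: Gc\<close>)
    also have "\<dots> = Cmp C A (X i) S (\<iota> i) h"
      using add.hyps trm by (subst H.gfinprod_eq_finprod) (auto simp: s_def)
    finally have "?c (h' \<otimes>\<^bsub>?G\<^esub> s) = \<phi> \<otimes>\<^bsub>?H\<^esub> Cmp C A (X i) S (\<iota> i) h"
      using hom_mult[OF hom h'(1) s] h'(2) by simp
    moreover have hs: "h' \<otimes>\<^bsub>?G\<^esub> s \<in> carrier ?G"
      using monoid.m_closed[OF Group.group.is_monoid[OF G] h'(1) s] .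
    ultimately show ?case using imageI[OF hs, of ?c] by simp
  qed
  have inj: "h = \<one>\<^bsub>?G\<^esub>" if h: "h \<in> carrier ?G" and h1: "?c h = \<one>\<^bsub>?H\<^esub>" for h
  proof -
    have hi: "h i \<in> arr C A (X i)" if "i \<in> I" for i using h that by (auto simp: Gc)
    define F where "F = {i \<in> I. Cmp C A (X i) S (\<iota> i) (h i) \<noteq> \<one>\<^bsub>?H\<^esub>}"
    have "{i \<in> I. Cmp C A (X i) S (\<iota> i) (h i) \<noteq> \<one>\<^bsub>?H\<^esub>} \<subseteq> {i \<in> I. h i \<noteq> \<one>\<^bsub>Hom C A (X i)\<^esub>}"
      using Cmp_zero_right[OF A X S' coproductD(2)] by auto
    then have F: "finite F" "F \<subseteq> I" using h unfolding F_def Gc by (auto intro: finite_subset)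
    have "h j = \<one>\<^bsub>Hom C A (X j)\<^esub>" if j: "j \<in> I" for j
    proof -
      note Xj = X[OF j] and \<iota>j = coproductD(2)[OF j]
      obtain p where p: "p \<in> arr C S (X j)" "Cmp C (X j) S (X j) p (\<iota> j) = Idn C (X j)"
        "\<forall>i\<in>I. i \<noteq> j \<longrightarrow> Cmp C (X i) S (X j) p (\<iota> i) = \<one>\<^bsub>Hom C (X i) (X j)\<^esub>"
        using coproduct_projection[OF S X j] by blast
      interpret Aj: comm_group "Hom C A (X j)" using comm_group_Hom[OF A Xj] .
      have pterm: "Cmp C A S (X j) p (Cmp C A (X i) S (\<iota> i) (h i)) = (if i = j then h j else \<one>\<^bsub>Hom C A (X j)\<^esub>)" if i: "i \<in> I" for i
        using Cmp_assoc[OF A X[OF i] S' Xj hi[OF i] coproductD(2)[OF i] p(1)] p i Cmp_Idn_left[OF A Xj hi[OF j]]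
          Cmp_zero_left[OF A X[OF i] Xj hi[OF i]] by auto
      \<comment> \<open>The projection onto the component \<open>j\<close> picks \<open>h j\<close>
        out of the finite sum.\<close>
      have "Cmp C A S (X j) p (finprod ?H (\<lambda>i. Cmp C A (X i) S (\<iota> i) (h i)) F') = (if j \<in> F' then h j else \<one>\<^bsub>Hom C A (X j)\<^esub>)"
        if "finite F'" "F' \<subseteq> I" for F'
        using that
      proof (induction F' rule: finite_induct)
        case empty
        then show ?case using Cmp_zero_right[OF A S' Xj p(1)] by simp
      next
        case (insert i F')
        have "finprod ?H (\<lambda>i. Cmp C A (X i) S (\<iota> i) (h i)) (insert i F') =
            Cmp C A (X i) S (\<iota> i) (h i) \<otimes>\<^bsub>?H\<^esub> finprod ?H (\<lambda>i. Cmp C A (X i) S (\<iota> i) (h i)) F'"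
          using insert hi trm by (intro H.finprod_insert) auto
        moreover have "finprod ?H (\<lambda>i. Cmp C A (X i) S (\<iota> i) (h i)) F' \<in> carrier ?H"
          using insert.prems hi trm by (intro H.finprod_closed) auto
        ultimately show ?case
          using Cmp_add_right[OF A S' Xj trm[of i "h i"] _ p(1)] insert pterm[of i] hi[of i] hi[OF j] by auto
      qed
      from this[OF F] have "Cmp C A S (X j) p (?c h) = (if j \<in> F then h j else \<one>\<^bsub>Hom C A (X j)\<^esub>)"
        using F(1) by (simp add: gfinprod_def F_def)
      then have "j \<in> F \<Longrightarrow> h j = \<one>\<^bsub>Hom C A (X j)\<^esub>" using h1 Cmp_zero_right[OF A S' Xj p(1)] by simp
      moreover have "h j = \<one>\<^bsub>Hom C A (X j)\<^esub>" if "j \<notin> F"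
        using that pterm[OF j] j Cmp_zero_right[OF A S' Xj p(1)] by (simp add: F_def)
      ultimately show ?thesis by blast
    qed
    then show ?thesis using h by (auto simp: Gc PiE_iff extensional_def restrict_def fun_eq_iff)
  qed
  interpret gh: group_hom ?G ?H ?c
    using hom G H.is_group by (simp add: group_hom_def group_hom_axioms_def)
  have injc: "inj_on ?c (carrier ?G)" using gh.inj_on_one_iff inj by blast
  show ?thesis
  proof
    assume "?c \<in> iso ?G ?H"
    then have im: "?c ` carrier ?G = carrier ?H" by (simp add: iso_def bij_betw_def)
    show "arr C A S \<subseteq> finitely_supported C I X S \<iota> A"
      unfolding im[symmetric] by (rule image_subsetI) (rule range)
  next
    assume sub: "arr C A S \<subseteq> finitely_supported C I X S \<iota> A"
    have "?c ` carrier ?G = carrier ?H"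
    proof
      show "?c ` carrier ?G \<subseteq> carrier ?H" using hom_carrier[OF hom] .
      show "carrier ?H \<subseteq> ?c ` carrier ?G" by (rule subsetI, rule surj, rule subsetD[OF sub])
    qed
    then show "?c \<in> iso ?G ?H" using hom injc by (simp add: iso_def bij_betw_def)
  qed
qed

end

end

section \<open>Compactness as finite support; biproducts of compact objects\<close>

context preadditive_category
begin

lemma compact_objects_iff:
  "A \<in> compact_objects C \<longleftrightarrow> A \<in> Obj C \<and> (\<forall>(I :: 'a set) X S \<iota>. small TYPE('a) I \<longrightarrow> (\<forall>i\<in>I. X i \<in> Obj C) \<longrightarrow>
     is_coproduct C I X S \<iota> \<longrightarrow> arr C A S \<subseteq> finitely_supported C I X S \<iota> A)"
proof -
  have comp: "coproduct_comparison C A I X S \<iota> = (\<lambda>h. gfinprod (Hom C A S) (\<lambda>i. Cmp C A (X i) S (\<iota> i) (h i)) I)"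
    for I X S \<iota> by (simp add: coproduct_comparison_def fun_eq_iff)
  have "coproduct_comparison C A I X S \<iota> \<in> iso (sum_group I (\<lambda>i. Hom C A (X i))) (Hom C A S) \<longleftrightarrow>
      arr C A S \<subseteq> finitely_supported C I X S \<iota> A"
    if "A \<in> Obj C" "\<forall>i\<in>I. X i \<in> Obj C" "is_coproduct C I X S \<iota>" for I X S \<iota>
    unfolding comp by (rule comparison_iso_iff[OF that(3) _ that(1)]) (use that(2) in blast)
  then show ?thesis
    unfolding compact_objects_def mem_Collect_eq by (intro conj_cong refl all_cong imp_cong) auto
qed

lemma compact_objectsD:
  assumes "A \<in> compact_objects C"
  shows "A \<in> Obj C"
    and "\<lbrakk>small TYPE('a) (I :: 'a set); \<And>i. i \<in> I \<Longrightarrow> X i \<in> Obj C; is_coproduct C I X S \<iota>; \<phi> \<in> arr C A S\<rbrakk>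
      \<Longrightarrow> \<phi> \<in> finitely_supported C I X S \<iota> A"
  using assms unfolding compact_objects_iff by blast+

lemma compact_objectsI:
  assumes "A \<in> Obj C"
    and "\<And>(I :: 'a set) X S \<iota> \<phi>. small TYPE('a) I \<Longrightarrow> (\<And>i. i \<in> I \<Longrightarrow> X i \<in> Obj C) \<Longrightarrow> is_coproduct C I X S \<iota> \<Longrightarrow>
      \<phi> \<in> arr C A S \<Longrightarrow> \<phi> \<in> finitely_supported C I X S \<iota> A"
  shows "A \<in> compact_objects C"
  using assms unfolding compact_objects_iff by blast

text \<open>A morphism out of the biproduct is the sum of its restrictions to the summands, each
  composed with a projection; finite support passes through both operations.\<close>

lemma compact_biproduct:
  assumes A: "A \<in> compact_objects C" and B: "B \<in> compact_objects C" and P: "is_biproduct C A B P i j p q"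
  shows "P \<in> compact_objects C"
proof (rule compact_objectsI)
  note b = P[unfolded is_biproduct_def]
  show P': "P \<in> Obj C" using b by blast
  fix I :: "'a set" and X S \<iota> \<phi>
  assume I: "small TYPE('a) I" and X: "\<And>i. i \<in> I \<Longrightarrow> X i \<in> Obj C" and S: "is_coproduct C I X S \<iota>" and \<phi>: "\<phi> \<in> arr C P S"
  have S': "S \<in> Obj C" using S by (simp add: is_coproduct_def)
  note AO = compact_objectsD(1)[OF A] and BO = compact_objectsD(1)[OF B]
  have i: "i \<in> arr C A P" and j: "j \<in> arr C B P" and p: "p \<in> arr C P A" and q: "q \<in> arr C P B"
    and sum: "Cmp C P A P i p \<otimes>\<^bsub>Hom C P P\<^esub> Cmp C P B P j q = Idn C P"
    using b by auto
  have \<phi>i: "Cmp C A P S \<phi> i \<in> arr C A S" and \<phi>j: "Cmp C B P S \<phi> j \<in> arr C B S"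
    using Cmp_arr[OF AO P' S' i \<phi>] Cmp_arr[OF BO P' S' j \<phi>] .
  have "\<phi> = Cmp C P P S \<phi> (Cmp C P A P i p \<otimes>\<^bsub>Hom C P P\<^esub> Cmp C P B P j q)"
    using sum Cmp_Idn_right[OF P' S' \<phi>] by simp
  also have "\<dots> = Cmp C P P S \<phi> (Cmp C P A P i p) \<otimes>\<^bsub>Hom C P S\<^esub> Cmp C P P S \<phi> (Cmp C P B P j q)"
    using Cmp_add_right[OF P' P' S' Cmp_arr[OF P' AO P' p i] Cmp_arr[OF P' BO P' q j] \<phi>] .
  also have "\<dots> = Cmp C P A S (Cmp C A P S \<phi> i) p \<otimes>\<^bsub>Hom C P S\<^esub> Cmp C P B S (Cmp C B P S \<phi> j) q"
    using Cmp_assoc[OF P' AO P' S' p i \<phi>] Cmp_assoc[OF P' BO P' S' q j \<phi>] by simp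
  finally have eq: "\<phi> = Cmp C P A S (Cmp C A P S \<phi> i) p \<otimes>\<^bsub>Hom C P S\<^esub> Cmp C P B S (Cmp C B P S \<phi> j) q" .
  have "Cmp C P A S (Cmp C A P S \<phi> i) p \<in> finitely_supported C I X S \<iota> P"
    using finitely_supported_Cmp[OF S X P' AO p compact_objectsD(2)[OF A I X S \<phi>i]] .
  moreover have "Cmp C P B S (Cmp C B P S \<phi> j) q \<in> finitely_supported C I X S \<iota> P"
    using finitely_supported_Cmp[OF S X P' BO q compact_objectsD(2)[OF B I X S \<phi>j]] .
  ultimately show "\<phi> \<in> finitely_supported C I X S \<iota> P"
    using finitely_supported_mult[OF S X P'] eq by metis
qed

lemma compact_zero:
  assumes Z: "is_zero_object C Z"
  shows "Z \<in> compact_objects C"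
proof (rule compact_objectsI[OF zero_objectD(1)[OF Z]])
  fix I :: "'a set" and X S \<iota> \<phi> assume "is_coproduct C I X S \<iota>" and \<phi>: "\<phi> \<in> arr C Z S"
  then have "S \<in> Obj C" by (simp add: is_coproduct_def)
  then have "\<phi> = \<one>\<^bsub>Hom C Z S\<^esub>" using zero_objectD(3)[OF Z _ \<phi>] by blast
  then show "\<phi> \<in> finitely_supported C I X S \<iota> Z" using finitely_supported.zero by metis
qed

end

section \<open>Compact objects under shifts, cones and cocones\<close>

context triangulated_category
begin

text \<open>Each \<open>W\<close> is isomorphic to a shift, and the shift is full and faithful, so
  maps from \<open>Sh S\<close> to \<open>W\<close> correspond to maps out of
  \<open>S\<close>.\<close>

lemma coproduct_shift:
  assumes S: "is_coproduct T I X S \<iota>" and X: "\<And>i. i \<in> I \<Longrightarrow> X i \<in> Obj T"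
  shows "is_coproduct T I (\<lambda>i. Sh (X i)) (Sh S) (\<lambda>i. ShA (X i) S (\<iota> i))"
proof -
  note c = is_coproductD[OF S]
  note sS = Sh_obj[OF c(1)]
  have "\<exists>!k. k \<in> arr T (Sh S) W \<and> (\<forall>i\<in>I. Cmp T (Sh (X i)) (Sh S) W k (ShA (X i) S (\<iota> i)) = h i)"
    if W: "W \<in> Obj T" and h: "\<And>i. i \<in> I \<Longrightarrow> h i \<in> arr T (Sh (X i)) W" for W h
  proof -
    obtain V w w' where V: "V \<in> Obj T" and w: "w \<in> arr T (Sh V) W" "w' \<in> arr T W (Sh V)"
      "Cmp T (Sh V) W (Sh V) w' w = Idn T (Sh V)" "Cmp T W (Sh V) W w w' = Idn T W"
      using desuspension[OF W] .
    note sV = Sh_obj[OF V]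
    have "\<forall>i\<in>I. \<exists>h0. h0 \<in> arr T (X i) V \<and> ShA (X i) V h0 = Cmp T (Sh (X i)) W (Sh V) w' (h i)"
      using ShA_surj[OF X V Cmp_arr[OF Sh_obj[OF X] W sV h w(2)]] by blast
    from bchoice[OF this] obtain h0 where h0: "\<And>i. i \<in> I \<Longrightarrow> h0 i \<in> arr T (X i) V"
      "\<And>i. i \<in> I \<Longrightarrow> ShA (X i) V (h0 i) = Cmp T (Sh (X i)) W (Sh V) w' (h i)" by blast
    have "\<exists>!k. k \<in> arr T S V \<and> (\<forall>i\<in>I. Cmp T (X i) S V k (\<iota> i) = h0 i)"
      using S V h0(1) unfolding is_coproduct_def by blast
    then obtain k0 where k0: "k0 \<in> arr T S V" "\<And>i. i \<in> I \<Longrightarrow> Cmp T (X i) S V k0 (\<iota> i) = h0 i"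
      and uniq: "\<And>k. k \<in> arr T S V \<Longrightarrow> (\<And>i. i \<in> I \<Longrightarrow> Cmp T (X i) S V k (\<iota> i) = h0 i) \<Longrightarrow> k = k0" by blast
    have Shk0: "ShA S V k0 \<in> arr T (Sh S) (Sh V)" using ShA_closed[OF c(1) V k0(1)] .
    have \<iota>': "ShA (X i) S (\<iota> i) \<in> arr T (Sh (X i)) (Sh S)" if "i \<in> I" for i using ShA_closed[OF X[OF that] c(1) c(2)[OF that]] .
    have cancel: "Cmp T A (Sh V) W w (Cmp T A W (Sh V) w' f) = f" if "A \<in> Obj T" "f \<in> arr T A W" for A f
      using Cmp_assoc[OF that(1) W sV W that(2) w(2,1)] w(4) Cmp_Idn_left[OF that(1) W that(2)] by simp
    show ?thesis
    proof (rule ex1I[of _ "Cmp T (Sh S) (Sh V) W w (ShA S V k0)"])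
      show "Cmp T (Sh S) (Sh V) W w (ShA S V k0) \<in> arr T (Sh S) W \<and>
        (\<forall>i\<in>I. Cmp T (Sh (X i)) (Sh S) W (Cmp T (Sh S) (Sh V) W w (ShA S V k0)) (ShA (X i) S (\<iota> i)) = h i)"
      proof (intro conjI ballI)
        show "Cmp T (Sh S) (Sh V) W w (ShA S V k0) \<in> arr T (Sh S) W" using Cmp_arr[OF sS sV W Shk0 w(1)] .
        fix i assume i: "i \<in> I"
        have "Cmp T (Sh (X i)) (Sh S) W (Cmp T (Sh S) (Sh V) W w (ShA S V k0)) (ShA (X i) S (\<iota> i)) =
            Cmp T (Sh (X i)) (Sh V) W w (ShA (X i) V (Cmp T (X i) S V k0 (\<iota> i)))"
          using Cmp_assoc[OF Sh_obj[OF X[OF i]] sS sV W \<iota>'[OF i] Shk0 w(1)] Sh_Cmp[OF X[OF i] c(1) V c(2)[OF i] k0(1)] by simp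
        also have "\<dots> = h i" using k0(2)[OF i] h0(2)[OF i] cancel[OF Sh_obj[OF X[OF i]] h[OF i]] by simp
        finally show "Cmp T (Sh (X i)) (Sh S) W (Cmp T (Sh S) (Sh V) W w (ShA S V k0)) (ShA (X i) S (\<iota> i)) = h i" .
      qed
      fix k assume k: "k \<in> arr T (Sh S) W \<and> (\<forall>i\<in>I. Cmp T (Sh (X i)) (Sh S) W k (ShA (X i) S (\<iota> i)) = h i)"
      then have kW: "k \<in> arr T (Sh S) W" by blast
      obtain k' where k': "k' \<in> arr T S V" "ShA S V k' = Cmp T (Sh S) W (Sh V) w' k"
        using ShA_surj[OF c(1) V Cmp_arr[OF sS W sV kW w(2)]] by blast
      have "Cmp T (X i) S V k' (\<iota> i) = h0 i" if i: "i \<in> I" for i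
      proof (rule ShA_inj[OF X[OF i] V Cmp_arr[OF X[OF i] c(1) V c(2)[OF i] k'(1)] h0(1)[OF i]])
        show "ShA (X i) V (Cmp T (X i) S V k' (\<iota> i)) = ShA (X i) V (h0 i)"
          using Sh_Cmp[OF X[OF i] c(1) V c(2)[OF i] k'(1)] k'(2) h0(2)[OF i] k i
            Cmp_assoc[OF Sh_obj[OF X[OF i]] sS W sV \<iota>'[OF i] kW w(2)] by simp
      qed
      then have "k' = k0" using uniq[OF k'(1)] by blast
      then show "k = Cmp T (Sh S) (Sh V) W w (ShA S V k0)" using k'(2) cancel[OF sS kW] by simp
    qed
  qed
  then show ?thesis
    using sS ShA_closed[OF X c(1) c(2)] by (simp add: is_coproduct_def)
qed

text \<open>A diagram is a coproduct if its shift is one up to isomorphism. The isomorphisms are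
  explicit because the shift is only an equivalence, so a given object is a shift only up to
  isomorphism.\<close>

lemma coproduct_desuspension:
  assumes S: "is_coproduct T I X S \<iota>" and X: "\<And>i. i \<in> I \<Longrightarrow> X i \<in> Obj T"
    and S0: "S0 \<in> Obj T" and s: "s \<in> arr T (Sh S0) S" "s' \<in> arr T S (Sh S0)"
      "Cmp T (Sh S0) S (Sh S0) s' s = Idn T (Sh S0)" "Cmp T S (Sh S0) S s s' = Idn T S"
    and X0: "\<And>i. i \<in> I \<Longrightarrow> X0 i \<in> Obj T"
    and x: "\<And>i. i \<in> I \<Longrightarrow> x i \<in> arr T (Sh (X0 i)) (X i)" "\<And>i. i \<in> I \<Longrightarrow> x' i \<in> arr T (X i) (Sh (X0 i))"
      "\<And>i. i \<in> I \<Longrightarrow> Cmp T (Sh (X0 i)) (X i) (Sh (X0 i)) (x' i) (x i) = Idn T (Sh (X0 i))"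
      "\<And>i. i \<in> I \<Longrightarrow> Cmp T (X i) (Sh (X0 i)) (X i) (x i) (x' i) = Idn T (X i)"
    and \<iota>0: "\<And>i. i \<in> I \<Longrightarrow> \<iota>0 i \<in> arr T (X0 i) S0"
      "\<And>i. i \<in> I \<Longrightarrow> Cmp T (Sh (X0 i)) (Sh S0) S s (ShA (X0 i) S0 (\<iota>0 i)) = Cmp T (Sh (X0 i)) (X i) S (\<iota> i) (x i)"
  shows "is_coproduct T I X0 S0 \<iota>0"
proof -
  note c = is_coproductD[OF S]
  note sS0 = Sh_obj[OF S0] and sX0 = Sh_obj[OF X0]
  have \<iota>': "ShA (X0 i) S0 (\<iota>0 i) \<in> arr T (Sh (X0 i)) (Sh S0)" if "i \<in> I" for i using ShA_closed[OF X0[OF that] S0 \<iota>0(1)[OF that]] .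
  have \<iota>x: "Cmp T (X i) S (Sh S0) s' (\<iota> i) = Cmp T (X i) (Sh (X0 i)) (Sh S0) (ShA (X0 i) S0 (\<iota>0 i)) (x' i)" if i: "i \<in> I" for i
  proof -
    note a = X[OF i] sX0[OF i] c(1) sS0
    have "Cmp T (X i) S (Sh S0) s' (\<iota> i) = Cmp T (X i) S (Sh S0) s' (Cmp T (X i) (X i) S (\<iota> i) (Cmp T (X i) (Sh (X0 i)) (X i) (x i) (x' i)))"
      using x(4)[OF i] Cmp_Idn_right[OF a(1,3) c(2)[OF i]] by simp
    also have "\<dots> = Cmp T (X i) S (Sh S0) s' (Cmp T (X i) (Sh S0) S s (Cmp T (X i) (Sh (X0 i)) (Sh S0) (ShA (X0 i) S0 (\<iota>0 i)) (x' i)))"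
      using Cmp_assoc[OF a(1,2,1,3) x(2)[OF i] x(1)[OF i] c(2)[OF i]] \<iota>0(2)[OF i] Cmp_assoc[OF a(1,2,4,3) x(2)[OF i] \<iota>'[OF i] s(1)] by simp
    also have "\<dots> = Cmp T (X i) (Sh (X0 i)) (Sh S0) (ShA (X0 i) S0 (\<iota>0 i)) (x' i)"
      using Cmp_assoc[OF a(1,4,3,4) Cmp_arr[OF a(1,2,4) x(2)[OF i] \<iota>'[OF i]] s(1,2)] s(3) Cmp_Idn_left[OF a(1,4) Cmp_arr[OF a(1,2,4) x(2)[OF i] \<iota>'[OF i]]] by simp
    finally show ?thesis .
  qed
  have "\<exists>!k. k \<in> arr T S0 W \<and> (\<forall>i\<in>I. Cmp T (X0 i) S0 W k (\<iota>0 i) = h i)"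
    if W: "W \<in> Obj T" and h: "\<And>i. i \<in> I \<Longrightarrow> h i \<in> arr T (X0 i) W" for W h
  proof -
    note sW = Sh_obj[OF W]
    have Shh: "ShA (X0 i) W (h i) \<in> arr T (Sh (X0 i)) (Sh W)" if "i \<in> I" for i using ShA_closed[OF X0[OF that] W h[OF that]] .
    define h' where "h' i = Cmp T (X i) (Sh (X0 i)) (Sh W) (ShA (X0 i) W (h i)) (x' i)" for i
    have h': "\<forall>i\<in>I. h' i \<in> arr T (X i) (Sh W)" unfolding h'_def using Cmp_arr[OF X sX0 sW x(2) Shh] by blast
    have "\<exists>!k. k \<in> arr T S (Sh W) \<and> (\<forall>i\<in>I. Cmp T (X i) S (Sh W) k (\<iota> i) = h' i)"
      using S sW h' unfolding is_coproduct_def by blast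
    then obtain k where k: "k \<in> arr T S (Sh W)" "\<And>i. i \<in> I \<Longrightarrow> Cmp T (X i) S (Sh W) k (\<iota> i) = h' i"
      and uniq: "\<And>k'. k' \<in> arr T S (Sh W) \<Longrightarrow> (\<And>i. i \<in> I \<Longrightarrow> Cmp T (X i) S (Sh W) k' (\<iota> i) = h' i) \<Longrightarrow> k' = k" by blast
    have ks: "Cmp T (Sh S0) S (Sh W) k s \<in> arr T (Sh S0) (Sh W)" using Cmp_arr[OF sS0 c(1) sW s(1) k(1)] .
    obtain k0 where k0: "k0 \<in> arr T S0 W" "ShA S0 W k0 = Cmp T (Sh S0) S (Sh W) k s" using ShA_surj[OF S0 W ks] by blast
    show ?thesis
    proof (rule ex1I[of _ k0])
      show "k0 \<in> arr T S0 W \<and> (\<forall>i\<in>I. Cmp T (X0 i) S0 W k0 (\<iota>0 i) = h i)"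
      proof (intro conjI ballI k0(1))
        fix i assume i: "i \<in> I"
        note a = X[OF i] sX0[OF i] c(1) sS0
        show "Cmp T (X0 i) S0 W k0 (\<iota>0 i) = h i"
        proof (rule ShA_inj[OF X0[OF i] W Cmp_arr[OF X0[OF i] S0 W \<iota>0(1)[OF i] k0(1)] h[OF i]])
          have "ShA (X0 i) W (Cmp T (X0 i) S0 W k0 (\<iota>0 i)) = Cmp T (Sh (X0 i)) S (Sh W) k (Cmp T (Sh (X0 i)) (X i) S (\<iota> i) (x i))"
            using Sh_Cmp[OF X0[OF i] S0 W \<iota>0(1)[OF i] k0(1)] k0(2) Cmp_assoc[OF a(2,4,3) sW \<iota>'[OF i] s(1) k(1)] \<iota>0(2)[OF i] by simp
          also have "\<dots> = Cmp T (Sh (X0 i)) (X i) (Sh W) (h' i) (x i)"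
            using Cmp_assoc[OF a(2,1,3) sW x(1)[OF i] c(2)[OF i] k(1)] k(2)[OF i] by simp
          also have "\<dots> = ShA (X0 i) W (h i)"
            unfolding h'_def using Cmp_assoc[OF a(2,1,2) sW x(1)[OF i] x(2)[OF i] Shh[OF i]] x(3)[OF i] Cmp_Idn_right[OF a(2) sW Shh[OF i]] by simp
          finally show "ShA (X0 i) W (Cmp T (X0 i) S0 W k0 (\<iota>0 i)) = ShA (X0 i) W (h i)" .
        qed
      qed
      fix k' assume k': "k' \<in> arr T S0 W \<and> (\<forall>i\<in>I. Cmp T (X0 i) S0 W k' (\<iota>0 i) = h i)"
      then have k'W: "k' \<in> arr T S0 W" by blast
      have Shk': "ShA S0 W k' \<in> arr T (Sh S0) (Sh W)" using ShA_closed[OF S0 W k'W] .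
      have "Cmp T S (Sh S0) (Sh W) (ShA S0 W k') s' = k"
      proof (rule uniq)
        show "Cmp T S (Sh S0) (Sh W) (ShA S0 W k') s' \<in> arr T S (Sh W)" using Cmp_arr[OF c(1) sS0 sW s(2) Shk'] .
        fix i assume i: "i \<in> I"
        note a = X[OF i] sX0[OF i] c(1) sS0
        have "Cmp T (X i) S (Sh W) (Cmp T S (Sh S0) (Sh W) (ShA S0 W k') s') (\<iota> i) =
            Cmp T (X i) (Sh S0) (Sh W) (ShA S0 W k') (Cmp T (X i) (Sh (X0 i)) (Sh S0) (ShA (X0 i) S0 (\<iota>0 i)) (x' i))"
          using Cmp_assoc[OF a(1,3,4) sW c(2)[OF i] s(2) Shk'] \<iota>x[OF i] by simp
        also have "\<dots> = Cmp T (X i) (Sh (X0 i)) (Sh W) (ShA (X0 i) W (Cmp T (X0 i) S0 W k' (\<iota>0 i))) (x' i)"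
          using Cmp_assoc[OF a(1,2,4) sW x(2)[OF i] \<iota>'[OF i] Shk'] Sh_Cmp[OF X0[OF i] S0 W \<iota>0(1)[OF i] k'W] by simp
        finally show "Cmp T (X i) S (Sh W) (Cmp T S (Sh S0) (Sh W) (ShA S0 W k') s') (\<iota> i) = h' i"
          using k' i by (simp add: h'_def)
      qed
      then have "ShA S0 W k' = Cmp T (Sh S0) S (Sh W) k s"
        using Cmp_assoc[OF sS0 c(1) sS0 sW s(1,2) Shk'] s(3) Cmp_Idn_right[OF sS0 sW Shk'] by simp
      then show "k' = k0" using ShA_inj[OF S0 W k'W k0(1)] k0(2) by simp
    qed
  qed
  then show ?thesis using S0 \<iota>0(1) by (simp add: is_coproduct_def)
qed

text \<open>Up to isomorphism, a coproduct of the \<open>X i\<close> is the shift of a coproduct of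
  desuspensions \<open>X0 i\<close>. Morphisms from \<open>Sh A\<close> to it are then shifts of
  morphisms from \<open>A\<close>, and shifting preserves finite support.\<close>

lemma compact_shift:
  assumes A: "A \<in> compact_objects T"
  shows "Sh A \<in> compact_objects T"
proof (rule compact_objectsI)
  note AO = compact_objectsD(1)[OF A]
  show sA: "Sh A \<in> Obj T" using Sh_obj[OF AO] .
  fix I :: "'a set" and X S \<iota> \<phi>
  assume I: "small TYPE('a) I" and X: "\<And>i. i \<in> I \<Longrightarrow> X i \<in> Obj T" and S: "is_coproduct T I X S \<iota>" and \<phi>: "\<phi> \<in> arr T (Sh A) S"
  note c = is_coproductD[OF S]
  obtain S0 s s' where S0: "S0 \<in> Obj T" and s: "s \<in> arr T (Sh S0) S" "s' \<in> arr T S (Sh S0)"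
    "Cmp T (Sh S0) S (Sh S0) s' s = Idn T (Sh S0)" "Cmp T S (Sh S0) S s s' = Idn T S"
    using desuspension[OF c(1)] .
  note sS0 = Sh_obj[OF S0]
  have "\<forall>i\<in>I. \<exists>X0 x x'. X0 \<in> Obj T \<and> x \<in> arr T (Sh X0) (X i) \<and> x' \<in> arr T (X i) (Sh X0) \<and>
    Cmp T (Sh X0) (X i) (Sh X0) x' x = Idn T (Sh X0) \<and> Cmp T (X i) (Sh X0) (X i) x x' = Idn T (X i)"
    using desuspension[OF X] by metis
  then obtain X0 x x' where "\<forall>i\<in>I. X0 i \<in> Obj T \<and> x i \<in> arr T (Sh (X0 i)) (X i) \<and> x' i \<in> arr T (X i) (Sh (X0 i)) \<and>
    Cmp T (Sh (X0 i)) (X i) (Sh (X0 i)) (x' i) (x i) = Idn T (Sh (X0 i)) \<and> Cmp T (X i) (Sh (X0 i)) (X i) (x i) (x' i) = Idn T (X i)"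
    by metis
  then have X0: "X0 i \<in> Obj T" and x: "x i \<in> arr T (Sh (X0 i)) (X i)" "x' i \<in> arr T (X i) (Sh (X0 i))"
    "Cmp T (Sh (X0 i)) (X i) (Sh (X0 i)) (x' i) (x i) = Idn T (Sh (X0 i))" "Cmp T (X i) (Sh (X0 i)) (X i) (x i) (x' i) = Idn T (X i)"
    if "i \<in> I" for i using that by auto
  note sX0 = Sh_obj[OF X0]
  have \<iota>x: "Cmp T (Sh (X0 i)) (X i) S (\<iota> i) (x i) \<in> arr T (Sh (X0 i)) S" if i: "i \<in> I" for i
    using Cmp_arr[OF sX0[OF i] X[OF i] c(1) x(1)[OF i] c(2)[OF i]] .
  have "\<forall>i\<in>I. \<exists>\<iota>0. \<iota>0 \<in> arr T (X0 i) S0 \<and> ShA (X0 i) S0 \<iota>0 = Cmp T (Sh (X0 i)) S (Sh S0) s' (Cmp T (Sh (X0 i)) (X i) S (\<iota> i) (x i))"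
    using ShA_surj[OF X0 S0 Cmp_arr[OF sX0 c(1) sS0 \<iota>x s(2)]] by blast
  from bchoice[OF this] obtain \<iota>0 where \<iota>0: "\<And>i. i \<in> I \<Longrightarrow> \<iota>0 i \<in> arr T (X0 i) S0"
    "\<And>i. i \<in> I \<Longrightarrow> ShA (X0 i) S0 (\<iota>0 i) = Cmp T (Sh (X0 i)) S (Sh S0) s' (Cmp T (Sh (X0 i)) (X i) S (\<iota> i) (x i))"
    by blast
  have cancel: "Cmp T B (Sh S0) S s (Cmp T B S (Sh S0) s' f) = f" if "B \<in> Obj T" "f \<in> arr T B S" for B f
    using Cmp_assoc[OF that(1) c(1) sS0 c(1) that(2) s(2,1)] s(4) Cmp_Idn_left[OF that(1) c(1) that(2)] by simp
  have \<iota>0s: "Cmp T (Sh (X0 i)) (Sh S0) S s (ShA (X0 i) S0 (\<iota>0 i)) = Cmp T (Sh (X0 i)) (X i) S (\<iota> i) (x i)" if i: "i \<in> I" for i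
    using \<iota>0(2)[OF i] cancel[OF sX0[OF i] \<iota>x[OF i]] by simp
  have S0c: "is_coproduct T I X0 S0 \<iota>0"
    using coproduct_desuspension[OF S X S0 s X0 x \<iota>0(1) \<iota>0s] .
  note c0 = is_coproductD[OF S0c]
  have fs: "Cmp T (Sh A) (Sh S0) S s (ShA A S0 \<phi>) \<in> finitely_supported T I X S \<iota> (Sh A)"
    if "\<phi> \<in> finitely_supported T I X0 S0 \<iota>0 A" for \<phi>
    using that
  proof (induction rule: finitely_supported.induct)
    case zero
    have "Cmp T (Sh A) (Sh S0) S s (ShA A S0 \<one>\<^bsub>Hom T A S0\<^esub>) = \<one>\<^bsub>Hom T (Sh A) S\<^esub>"
      using ShA_zero[OF AO S0] Cmp_zero_right[OF sA sS0 c(1) s(1)] by simp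
    then show ?case using finitely_supported.zero by metis
  next
    case (add \<phi> i h)
    note i = add.hyps(2)
    note a = sX0[OF i] X[OF i]
    have \<phi>: "\<phi> \<in> arr T A S0" using finitely_supported_closed[OF S0c X0 AO add.hyps(1)] .
    have \<iota>h: "Cmp T A (X0 i) S0 (\<iota>0 i) h \<in> arr T A S0" using Cmp_arr[OF AO X0[OF i] S0 add.hyps(3) \<iota>0(1)[OF i]] .
    have Shh: "ShA A (X0 i) h \<in> arr T (Sh A) (Sh (X0 i))" using ShA_closed[OF AO X0[OF i] add.hyps(3)] .
    have Sh\<iota>: "ShA (X0 i) S0 (\<iota>0 i) \<in> arr T (Sh (X0 i)) (Sh S0)" using ShA_closed[OF X0[OF i] S0 \<iota>0(1)[OF i]] .
    have "Cmp T (Sh A) (Sh S0) S s (ShA A S0 (Cmp T A (X0 i) S0 (\<iota>0 i) h)) = Cmp T (Sh A) (X i) S (\<iota> i) (Cmp T (Sh A) (Sh (X0 i)) (X i) (x i) (ShA A (X0 i) h))"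
      using Sh_Cmp[OF AO X0[OF i] S0 add.hyps(3) \<iota>0(1)[OF i]] Cmp_assoc[OF sA a(1) sS0 c(1) Shh Sh\<iota> s(1)] \<iota>0s[OF i]
        Cmp_assoc[OF sA a c(1) Shh x(1)[OF i] c(2)[OF i]] by simp
    then have "Cmp T (Sh A) (Sh S0) S s (ShA A S0 (\<phi> \<otimes>\<^bsub>Hom T A S0\<^esub> Cmp T A (X0 i) S0 (\<iota>0 i) h)) =
        Cmp T (Sh A) (Sh S0) S s (ShA A S0 \<phi>) \<otimes>\<^bsub>Hom T (Sh A) S\<^esub> Cmp T (Sh A) (X i) S (\<iota> i) (Cmp T (Sh A) (Sh (X0 i)) (X i) (x i) (ShA A (X0 i) h))"
      using ShA_add[OF AO S0 \<phi> \<iota>h] Cmp_add_right[OF sA sS0 c(1) ShA_closed[OF AO S0 \<phi>] ShA_closed[OF AO S0 \<iota>h] s(1)] by simp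
    then show ?case
      using finitely_supported.add[OF add.IH i Cmp_arr[OF sA a Shh x(1)[OF i]]] by simp
  qed
  obtain \<phi>0 where \<phi>0: "\<phi>0 \<in> arr T A S0" "ShA A S0 \<phi>0 = Cmp T (Sh A) S (Sh S0) s' \<phi>"
    using ShA_surj[OF AO S0 Cmp_arr[OF sA c(1) sS0 \<phi> s(2)]] by blast
  have "\<phi>0 \<in> finitely_supported T I X0 S0 \<iota>0 A" using compact_objectsD(2)[OF A I X0 S0c \<phi>0(1)] .
  from fs[OF this] show "\<phi> \<in> finitely_supported T I X S \<iota> (Sh A)" using \<phi>0(2) cancel[OF sA \<phi>] by simp
qed

text \<open>Shifting takes the coproduct to a coproduct, where compactness of \<open>Sh Z\<close>
  applies; finite support then descends because the shift is full and faithful.\<close>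

lemma compact_desuspension:
  assumes Z: "Z \<in> Obj T" and sZc: "Sh Z \<in> compact_objects T"
  shows "Z \<in> compact_objects T"
proof (rule compact_objectsI[OF Z])
  fix I :: "'a set" and X S \<iota> \<phi>
  assume I: "small TYPE('a) I" and X: "\<And>i. i \<in> I \<Longrightarrow> X i \<in> Obj T" and S: "is_coproduct T I X S \<iota>" and \<phi>: "\<phi> \<in> arr T Z S"
  note c = is_coproductD[OF S]
  note sX = Sh_obj[OF X]
  note sc = coproduct_shift[OF S X]
  have "\<exists>\<phi>'\<in>finitely_supported T I X S \<iota> Z. \<psi> = ShA Z S \<phi>'"
    if "\<psi> \<in> finitely_supported T I (\<lambda>i. Sh (X i)) (Sh S) (\<lambda>i. ShA (X i) S (\<iota> i)) (Sh Z)" for \<psi>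
    using that
  proof (induction rule: finitely_supported.induct)
    case zero
    show ?case by (rule bexI[OF _ finitely_supported.zero]) (simp add: ShA_zero[OF Z c(1)])
  next
    case (add \<psi> i h)
    note i = add.hyps(2)
    obtain \<phi>' where \<phi>': "\<phi>' \<in> finitely_supported T I X S \<iota> Z" "\<psi> = ShA Z S \<phi>'" using add.IH by blast
    obtain h0 where h0: "h0 \<in> arr T Z (X i)" "ShA Z (X i) h0 = h" using ShA_surj[OF Z X[OF i] add.hyps(3)] by blast
    have "\<psi> \<otimes>\<^bsub>Hom T (Sh Z) (Sh S)\<^esub> Cmp T (Sh Z) (Sh (X i)) (Sh S) (ShA (X i) S (\<iota> i)) h = ShA Z S (\<phi>' \<otimes>\<^bsub>Hom T Z S\<^esub> Cmp T Z (X i) S (\<iota> i) h0)"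
      using ShA_add[OF Z c(1) finitely_supported_closed[OF S X Z \<phi>'(1)] Cmp_arr[OF Z X[OF i] c(1) h0(1) c(2)[OF i]]]
        Sh_Cmp[OF Z X[OF i] c(1) h0(1) c(2)[OF i]] \<phi>'(2) h0(2) by simp
    then show ?case using finitely_supported.add[OF \<phi>'(1) i h0(1)] by blast
  qed
  then obtain \<phi>' where \<phi>': "\<phi>' \<in> finitely_supported T I X S \<iota> Z" "ShA Z S \<phi> = ShA Z S \<phi>'"
    using compact_objectsD(2)[OF sZc I sX sc ShA_closed[OF Z c(1) \<phi>]] by blast
  then have "\<phi> = \<phi>'" using ShA_inj[OF Z c(1) \<phi> finitely_supported_closed[OF S X Z \<phi>'(1)]] by simp
  then show "\<phi> \<in> finitely_supported T I X S \<iota> Z" using \<phi>'(1) by simp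
qed

text \<open>If \<open>e\<close> is a finitely supported endomorphism fixing \<open>\<phi> g\<close>,
  then \<open>\<phi> - e \<phi>\<close> vanishes on \<open>B\<close> and so factors through the
  compact object \<open>Sh A\<close>. Both this difference and \<open>e \<phi>\<close> are finitely
  supported. The argument takes the place of the five lemma for the comparison maps.\<close>

lemma compact_cone:
  assumes tri: "Tri A B Z f g h" and A: "A \<in> compact_objects T" and B: "B \<in> compact_objects T"
  shows "Z \<in> compact_objects T"
proof (rule compact_objectsI)
  have w: "A \<in> Obj T" "B \<in> Obj T" "Z \<in> Obj T" "f \<in> arr T A B" "g \<in> arr T B Z" "h \<in> arr T Z (Sh A)" using Tri_wf[OF tri] by auto
  show "Z \<in> Obj T" using w by blast
  fix I :: "'a set" and X S \<iota> \<phi>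
  assume I: "small TYPE('a) I" and X: "\<And>i. i \<in> I \<Longrightarrow> X i \<in> Obj T" and S: "is_coproduct T I X S \<iota>" and \<phi>: "\<phi> \<in> arr T Z S"
  note c = is_coproductD[OF S]
  have \<phi>g: "Cmp T B Z S \<phi> g \<in> arr T B S" using Cmp_arr[OF w(2,3) c(1) w(5) \<phi>] .
  obtain e where e: "e \<in> finitely_supported T I X S \<iota> S" "Cmp T B S S e (Cmp T B Z S \<phi> g) = Cmp T B Z S \<phi> g"
    using finitely_supported_absorb[OF S X w(2) compact_objectsD(2)[OF B I X S \<phi>g]] by blast
  have e': "e \<in> arr T S S" using finitely_supported_closed[OF S X c(1) e(1)] .
  have e\<phi>: "Cmp T Z S S e \<phi> \<in> finitely_supported T I X S \<iota> Z" using finitely_supported_Cmp[OF S X w(3) c(1) \<phi> e(1)] .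
  have e\<phi>': "Cmp T Z S S e \<phi> \<in> arr T Z S" using finitely_supported_closed[OF S X w(3) e\<phi>] .
  interpret ZS: comm_group "Hom T Z S" using comm_group_Hom[OF w(3) c(1)] .
  interpret BS: comm_group "Hom T B S" using comm_group_Hom[OF w(2) c(1)] .
  define d where "d = \<phi> \<otimes>\<^bsub>Hom T Z S\<^esub> inv\<^bsub>Hom T Z S\<^esub> Cmp T Z S S e \<phi>"
  have d: "d \<in> arr T Z S" unfolding d_def using \<phi> e\<phi>' by simp
  have "Cmp T B Z S d g = Cmp T B Z S \<phi> g \<otimes>\<^bsub>Hom T B S\<^esub> inv\<^bsub>Hom T B S\<^esub> Cmp T B S S e (Cmp T B Z S \<phi> g)"
    unfolding d_def using w c(1) \<phi> e\<phi>' e' by (simp add: Cmp_add_left Cmp_minus_left Cmp_assoc)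
  also have "\<dots> = \<one>\<^bsub>Hom T B S\<^esub>" using e(2) \<phi>g by simp
  finally obtain \<psi> where \<psi>: "\<psi> \<in> arr T (Sh A) S" "Cmp T Z (Sh A) S \<psi> h = d"
    using Tri_exact_contravariant[OF Tri_rotate[OF tri] c(1) d] by blast
  have "d \<in> finitely_supported T I X S \<iota> Z"
    using finitely_supported_Cmp[OF S X w(3) Sh_obj[OF w(1)] w(6) compact_objectsD(2)[OF compact_shift[OF A] I X S \<psi>(1)]] \<psi>(2) by simp
  from finitely_supported_mult[OF S X w(3) this e\<phi>]
  show "\<phi> \<in> finitely_supported T I X S \<iota> Z" using \<phi> e\<phi>' by (simp add: d_def ZS.m_assoc)
qed

lemma compact_cocone:
  assumes tri: "Tri Z A B k f w" and A: "A \<in> compact_objects T" and B: "B \<in> compact_objects T"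
  shows "Z \<in> compact_objects T"
  using compact_desuspension[OF _ compact_cone[OF Tri_rotate[OF tri] A B]] Tri_wf[OF tri] by blast

end

section \<open>Modules over the compact objects\<close>

locale compactly_generated_category = triangulated_category T Sh ShA Tri
  for T :: "('o, 'u) pcat" and Sh ShA Tri +
  assumes inaccessible: "strongly_inaccessible TYPE('u)"
    and locally_small: "locally_small T"
    and compactly_generated: "compactly_generated T"
begin

text \<open>The opposite category makes modules covariant: an arrow \<open>A \<rightarrow> B\<close>
  here is a map \<open>B \<rightarrow> A\<close> of \<open>T\<close>, and composition and triangles
  are read backwards.\<close>

abbreviation "compacts \<equiv> op_cat (full_subcat T (compact_objects T))"

lemma compacts_simps [simp]:
  "Obj compacts = compact_objects T" "Hom compacts A B = Hom T B A" "Cmp compacts A B D g f = Cmp T D B A f g"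
  "Idn compacts = Idn T"
  by (simp_all add: op_cat_def full_subcat_def)

lemma compact_subset: "compact_objects T \<subseteq> Obj T"
  using compact_objectsD(1) by blast

sublocale t: small_preadditive_category T
  by unfold_locales (use inaccessible locally_small in \<open>auto simp: locally_small_def\<close>)

sublocale c: small_preadditive_category compacts
proof -
  interpret f: preadditive_category "full_subcat T (compact_objects T)"
    using preadditive_full_subcat[OF compact_subset] .
  interpret o: preadditive_category compacts using f.preadditive_op .
  show "small_preadditive_category compacts"
    by unfold_locales (use inaccessible t.small_arr compact_subset in auto)
qed

text \<open>In the opposite category, exactness for maps into the triangle becomes the weak cokernel
  property.\<close>

lemma Tri_weak_cokernel:
  assumes tri: "Tri Z B A k b w" and Z: "Z \<in> compact_objects T" and B: "B \<in> compact_objects T" and A: "A \<in> compact_objects T"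
  shows "c.weak_cokernel A B Z b k"
  unfolding c.weak_cokernel_def compacts_simps
proof (intro conjI ballI impI A B Z)
  show "b \<in> arr T B A" "k \<in> arr T Z B" using Tri_wf[OF tri] by auto
  show "Cmp T Z B A b k = \<one>\<^bsub>Hom T Z A\<^esub>" using Tri_comp_zero[OF tri] .
  fix W h assume W: "W \<in> compact_objects T" and h: "h \<in> arr T W B" and "Cmp T W B A b h = \<one>\<^bsub>Hom T W A\<^esub>"
  then show "\<exists>h'\<in>arr T W Z. h = Cmp T W Z B k h'"
    using Tri_exact_covariant[OF tri compact_objectsD(1)[OF W] h] by metis
qed

text \<open>Weak cokernels in the opposite category come from cocones and weak kernels from cones;
  compactness of the third vertex keeps them inside \<open>compacts\<close>.\<close>

sublocale c: coherent_category compacts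
proof unfold_locales
  obtain Z where Z: "is_zero_object T Z" using zero_object by blast
  then have "is_zero_object compacts Z"
    using compact_zero[OF Z] compact_subset by (auto simp: is_zero_object_def)
  then show "\<exists>Z. is_zero_object compacts Z" ..
next
  fix X Y assume "X \<in> Obj compacts" "Y \<in> Obj compacts"
  then have X: "X \<in> compact_objects T" and Y: "Y \<in> compact_objects T" by simp_all
  obtain P i j p q where P: "is_biproduct T X Y P i j p q" using biproducts X Y compact_subset by blast
  have "is_biproduct compacts X Y P p q i j"
    using P compact_biproduct[OF X Y P] by (simp add: is_biproduct_def)
  then show "\<exists>P i j p q. is_biproduct compacts X Y P i j p q" by blast
next
  fix A B b assume "A \<in> Obj compacts" "B \<in> Obj compacts" "b \<in> arr compacts A B"
  then have A: "A \<in> compact_objects T" and B: "B \<in> compact_objects T" and b: "b \<in> arr T B A" by simp_all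
  obtain Z k w where tri: "Tri Z B A k b w"
    using Tri_cocone_exists[OF compact_objectsD(1)[OF B] compact_objectsD(1)[OF A] b] .
  show "\<exists>Z k. c.weak_cokernel A B Z b k"
    using Tri_weak_cokernel[OF tri compact_cocone[OF tri B A] B A] by blast
next
  fix B Z k assume "B \<in> Obj compacts" "Z \<in> Obj compacts" "k \<in> arr compacts B Z"
  then have B: "B \<in> compact_objects T" and Z: "Z \<in> compact_objects T" and k: "k \<in> arr T Z B" by simp_all
  obtain A b w where tri: "Tri Z B A k b w"
    using TR1_cone[OF compact_objectsD(1)[OF Z] compact_objectsD(1)[OF B] k] by blast
  show "\<exists>A b. c.weak_cokernel A B Z b k"
    using Tri_weak_cokernel[OF tri Z B compact_cone[OF tri Z B]] by blast
next
  obtain S where S: "S \<subseteq> compact_objects T" "small TYPE('u) S" "\<And>A. A \<in> compact_objects T \<Longrightarrow> \<exists>B\<in>S. isomorphic_in T A B"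
    using compactly_generated unfolding compactly_generated_def by blast
  have "isomorphic_in compacts A B" if "isomorphic_in T A B" for A B
    using that by (auto simp: isomorphic_in_def is_isomorphism_def)
  then show "\<exists>S\<subseteq>Obj compacts. small TYPE('u) S \<and> (\<forall>A\<in>Obj compacts. \<exists>B\<in>S. isomorphic_in compacts A B)"
    using S by (metis compacts_simps(1))
qed

lemma yoneda_rep: "yoneda T X = rep compacts X"
  by (simp add: yoneda_def rep_def op_cat_def full_subcat_def)

lemma yoneda_simps [simp]: "FOb (yoneda T X) A = Hom T A X" "FAr (yoneda T X) A B f x = Cmp T B A X x f"
  by (simp_all add: yoneda_def rep_def op_cat_def)

lemma functor_on_yoneda:
  assumes X: "X \<in> Obj T"
  shows "functor_on compacts (yoneda T X)"
proof (rule functor_onI)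
  fix A assume "A \<in> Obj compacts"
  then have A: "A \<in> Obj T" using compact_subset by auto
  show "comm_group (FOb (yoneda T X) A)" using comm_group_Hom[OF A X] by simp
  show "FAr (yoneda T X) A A (Idn compacts A) x = x" if "x \<in> carrier (FOb (yoneda T X) A)" for x
    using that Cmp_Idn_right[OF A X] by simp
next
  fix A B f assume "A \<in> Obj compacts" "B \<in> Obj compacts" and f: "f \<in> arr compacts A B"
  then have A: "A \<in> Obj T" and B: "B \<in> Obj T" using compact_subset by auto
  show "FAr (yoneda T X) A B f \<in> hom (FOb (yoneda T X) A) (FOb (yoneda T X) B)"
    using A B X f by (auto simp: hom_def Cmp_arr Cmp_add_left)
  show "FAr (yoneda T X) A B (f \<otimes>\<^bsub>Hom compacts A B\<^esub> g) x = FAr (yoneda T X) A B f x \<otimes>\<^bsub>FOb (yoneda T X) B\<^esub> FAr (yoneda T X) A B g x"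
    if "g \<in> arr compacts A B" "x \<in> carrier (FOb (yoneda T X) A)" for g x
    using A B X f that by (simp add: Cmp_add_right)
next
  fix A B D f g x assume "A \<in> Obj compacts" "B \<in> Obj compacts" "D \<in> Obj compacts"
    and f: "f \<in> arr compacts A B" "g \<in> arr compacts B D" "x \<in> carrier (FOb (yoneda T X) A)"
  then have A: "A \<in> Obj T" "B \<in> Obj T" "D \<in> Obj T" using compact_subset by auto
  show "FAr (yoneda T X) A D (Cmp compacts A B D g f) x = FAr (yoneda T X) B D g (FAr (yoneda T X) A B f x)"
    using A X f by (simp add: Cmp_assoc)
qed

lemma additive_yoneda: "X \<in> Obj T \<Longrightarrow> is_additive_functor compacts (yoneda T X)"
  using functor_on_yoneda t.small_arr compact_subset by (auto simp: is_additive_functor_iff)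

text \<open>A weak cokernel in \<open>compacts\<close> need not come from a triangle. It is compared
  with the cocone of \<open>b\<close>: the map \<open>k'\<close> of that triangle factors through
  \<open>k\<close>, so \<open>x\<close> vanishes on it too, and exactness of the triangle
  applies.\<close>

lemma exact_yoneda:
  assumes X: "X \<in> Obj T"
  shows "c.exact_functor (yoneda T X)"
  unfolding c.exact_functor_def
proof (intro allI impI ballI)
  fix A B Z b k x assume wc: "c.weak_cokernel A B Z b k" and "x \<in> carrier (FOb (yoneda T X) B)"
    and "FAr (yoneda T X) B Z k x = \<one>\<^bsub>FOb (yoneda T X) Z\<^esub>"
  then have x: "x \<in> arr T B X" "Cmp T Z B X x k = \<one>\<^bsub>Hom T Z X\<^esub>" by simp_all
  note w = c.weak_cokernelD[OF wc, unfolded compacts_simps]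
  note AO = compact_objectsD(1)[OF w(1)] and BO = compact_objectsD(1)[OF w(2)] and ZO = compact_objectsD(1)[OF w(3)]
  obtain Z' k' w' where tri: "Tri Z' B A k' b w'" using Tri_cocone_exists[OF BO AO w(4)] .
  have Z': "Z' \<in> compact_objects T" using compact_cocone[OF tri w(2,1)] .
  have Z'O: "Z' \<in> Obj T" and k': "k' \<in> arr T Z' B" using Tri_wf[OF tri] by auto
  obtain h where h: "h \<in> arr T Z' Z" "k' = Cmp T Z' Z B k h" using w(7)[OF Z' k' Tri_comp_zero[OF tri]] by blast
  have "Cmp T Z' B X x k' = \<one>\<^bsub>Hom T Z' X\<^esub>"
    using Cmp_assoc[OF Z'O ZO BO X h(1) w(5) x(1)] h(2) x(2) Cmp_zero_left[OF Z'O ZO X h(1)] by simp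
  then show "\<exists>z\<in>carrier (FOb (yoneda T X) A). FAr (yoneda T X) A B b z = x"
    using Tri_exact_contravariant[OF tri X x(1)] by simp
qed

lemma Mod_compact_eq: "Mod_compact T = abfun_cat compacts"
  by (simp add: Mod_compact_def)

lemma finitely_presented_iff: "finitely_presented T G \<longleftrightarrow> (\<exists>A B b p. c.rep_cokernel A B b G p)"
  unfolding finitely_presented_def c.rep_cokernel_def Mod_compact_eq yoneda_map_def
  by (auto simp flip: yoneda_rep)

lemma is_pure_mono_iff: "is_pure_mono T M N i \<longleftrightarrow> c.pure_monomorphism M N i"
  unfolding is_pure_mono_def c.pure_monomorphism_def Mod_compact_eq finitely_presented_iff ..

lemma absolutely_pure_iff: "absolutely_pure T M \<longleftrightarrow> is_additive_functor compacts M \<and> c.exact_functor M"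
  using c.absolutely_pure_iff_exact[of M] unfolding absolutely_pure_def Mod_compact_eq is_pure_mono_iff by auto

lemma definable_class_iff: "definable_class T \<E> \<longleftrightarrow> c.definable_modules \<E>"
  unfolding definable_class_def c.definable_modules_def Mod_compact_eq is_pure_mono_iff ..

lemma finite_type_torsionfree_iff:
  "finite_type_hereditary_torsionfree_class T \<F> \<longleftrightarrow> (\<exists>\<Phi>. c.arrows \<Phi> \<and> \<F> = c.torsionfree \<Phi>)"
proof
  assume "finite_type_hereditary_torsionfree_class T \<F>"
  then obtain \<T> \<S> where "\<And>G. G \<in> \<S> \<Longrightarrow> finitely_presented T G" and "c.generated_torsion_pair \<S> \<T> \<F>"
    unfolding finite_type_hereditary_torsionfree_class_def finite_type_hereditary_torsion_pair_def
      c.generated_torsion_pair_def Mod_compact_eq by blast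
  then show "\<exists>\<Phi>. c.arrows \<Phi> \<and> \<F> = c.torsionfree \<Phi>"
    using c.generated_torsion_pair_torsionfree[of \<S> \<T> \<F>] by (simp add: finitely_presented_iff)
next
  assume "\<exists>\<Phi>. c.arrows \<Phi> \<and> \<F> = c.torsionfree \<Phi>"
  then obtain \<Phi> where \<Phi>: "c.arrows \<Phi>" "\<F> = c.torsionfree \<Phi>" by blast
  obtain \<S> \<T> where S: "\<forall>G\<in>\<S>. \<exists>(A, B, b)\<in>\<Phi>. \<exists>p. c.rep_cokernel A B b G p"
    and gen: "c.generated_torsion_pair \<S> \<T> \<F>"
    using c.torsionfree_generated[OF \<Phi>(1)] \<Phi>(2) by blast
  have "\<forall>G\<in>\<S>. finitely_presented T G"
    using S by (fastforce simp: finitely_presented_iff)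
  then show "finite_type_hereditary_torsionfree_class T \<F>"
    using gen unfolding finite_type_hereditary_torsionfree_class_def finite_type_hereditary_torsion_pair_def
      c.generated_torsion_pair_def Mod_compact_eq by blast
qed

section \<open>Definable subcategories\<close>

text \<open>An arrow \<open>c : A \<rightarrow> B\<close> of \<open>compacts\<close> is an arrow \<open>B \<rightarrow> A\<close> of \<open>T\<close>. In a triangle
  \<open>B \<rightarrow> A \<rightarrow> A'\<close>, all maps \<open>A \<rightarrow> X\<close> vanish on \<open>B\<close> iff all of them factor through \<open>A'\<close>.\<close>

definition annihilated :: "('o \<times> 'o \<times> 'u) set \<Rightarrow> 'o set" where
  "annihilated \<Psi> = {X \<in> Obj T. \<forall>(A, B, c)\<in>\<Psi>. \<forall>x\<in>arr T A X. Cmp T B A X x c = \<one>\<^bsub>Hom T B X\<^esub>}"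

lemma factor_iff_annihilated:
  assumes tri: "Tri B A A' c f w" and X: "X \<in> Obj T"
  shows "(\<forall>x\<in>arr T A X. \<exists>x'\<in>arr T A' X. x = Cmp T A A' X x' f) \<longleftrightarrow> (\<forall>x\<in>arr T A X. Cmp T B A X x c = \<one>\<^bsub>Hom T B X\<^esub>)"
proof -
  have w: "B \<in> Obj T" "A \<in> Obj T" "A' \<in> Obj T" "c \<in> arr T B A" "f \<in> arr T A A'" using Tri_wf[OF tri] by auto
  have "Cmp T B A X (Cmp T A A' X x' f) c = \<one>\<^bsub>Hom T B X\<^esub>" if "x' \<in> arr T A' X" for x'
    using Cmp_assoc[OF w(1-3) X w(4,5) that] Tri_comp_zero[OF tri] Cmp_zero_right[OF w(1,3) X that] by simp
  then show ?thesis using Tri_exact_contravariant[OF tri X] by metis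
qed

text \<open>Cokernels are computed pointwise, so \<open>F(X)\<close> is the group of maps
  \<open>A \<rightarrow> X\<close> modulo those that factor through \<open>f\<close>.\<close>

lemma coherent_functor_trivial_iff:
  assumes F: "t.rep_cokernel A B f F p" and X: "X \<in> Obj T"
  shows "carrier (FOb F X) = {\<one>\<^bsub>FOb F X\<^esub>} \<longleftrightarrow> (\<forall>x\<in>arr T A X. \<exists>x'\<in>arr T B X. x = Cmp T A B X x' f)"
proof -
  note q = quotient_mapD[OF t.rep_cokernelD(7)[OF F] X, unfolded t.rep_simps]
  have "\<one>\<^bsub>FOb F X\<^esub> \<in> carrier (FOb F X)" using functor_closed(1)[OF t.rep_cokernelD(5)[OF F] X] .
  then have "carrier (FOb F X) = {\<one>\<^bsub>FOb F X\<^esub>} \<longleftrightarrow> (\<forall>y\<in>carrier (FOb F X). y = \<one>\<^bsub>FOb F X\<^esub>)" by blast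
  also have "\<dots> \<longleftrightarrow> (\<forall>x\<in>arr T A X. p X x = \<one>\<^bsub>FOb F X\<^esub>)" using q(3,4) by metis
  also have "\<dots> \<longleftrightarrow> (\<forall>x\<in>arr T A X. \<exists>x'\<in>arr T B X. x = Cmp T A B X x' f)" using q(2) by auto
  finally show ?thesis .
qed

lemma is_coherent_functor_iff:
  "is_coherent_functor T F \<longleftrightarrow> (\<exists>A\<in>compact_objects T. \<exists>B\<in>compact_objects T. \<exists>f p. t.rep_cokernel A B f F p)"
  unfolding is_coherent_functor_def t.rep_cokernel_def using compact_subset by blast

text \<open>A coherent functor given by \<open>f\<close> is traded for the map preceding
  \<open>f\<close> in a triangle; conversely, an arrow in \<open>\<Psi>\<close> is traded for the
  map following it. Closure of compact objects under cocones and cones keeps both translations among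
  compact objects.\<close>

lemma definable_subcategory_iff:
  "definable_subcategory T D \<longleftrightarrow> (\<exists>\<Psi>. c.arrows \<Psi> \<and> D = annihilated \<Psi>)"
proof
  assume "definable_subcategory T D"
  then obtain \<A> where \<A>: "\<And>F. F \<in> \<A> \<Longrightarrow> is_coherent_functor T F"
    and D: "D = {X \<in> Obj T. \<forall>F\<in>\<A>. carrier (FOb F X) = {\<one>\<^bsub>FOb F X\<^esub>}}"
    unfolding definable_subcategory_def by blast
  define \<Psi> where "\<Psi> = {(A, Z, k). \<exists>F\<in>\<A>. \<exists>B\<in>compact_objects T. \<exists>f p w. A \<in> compact_objects T \<and>
    t.rep_cokernel A B f F p \<and> Tri Z A B k f w}"
  have arr: "c.arrows \<Psi>"
    unfolding c.arrows_def \<Psi>_def using compact_cocone Tri_wf by fastforce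
  have "(\<forall>F\<in>\<A>. carrier (FOb F X) = {\<one>\<^bsub>FOb F X\<^esub>}) \<longleftrightarrow> (\<forall>(A, Z, k)\<in>\<Psi>. \<forall>x\<in>arr T A X. Cmp T Z A X x k = \<one>\<^bsub>Hom T Z X\<^esub>)"
    if X: "X \<in> Obj T" for X
  proof
    assume L: "\<forall>F\<in>\<A>. carrier (FOb F X) = {\<one>\<^bsub>FOb F X\<^esub>}"
    show "\<forall>(A, Z, k)\<in>\<Psi>. \<forall>x\<in>arr T A X. Cmp T Z A X x k = \<one>\<^bsub>Hom T Z X\<^esub>"
    proof clarify
      fix A Z k x assume "(A, Z, k) \<in> \<Psi>" and x: "x \<in> arr T A X"
      then obtain F B f p w where F: "F \<in> \<A>" "t.rep_cokernel A B f F p" "Tri Z A B k f w" by (auto simp: \<Psi>_def)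
      then show "Cmp T Z A X x k = \<one>\<^bsub>Hom T Z X\<^esub>"
        using L coherent_functor_trivial_iff[OF F(2) X] factor_iff_annihilated[OF F(3) X] x by blast
    qed
  next
    assume R: "\<forall>(A, Z, k)\<in>\<Psi>. \<forall>x\<in>arr T A X. Cmp T Z A X x k = \<one>\<^bsub>Hom T Z X\<^esub>"
    show "\<forall>F\<in>\<A>. carrier (FOb F X) = {\<one>\<^bsub>FOb F X\<^esub>}"
    proof
      fix F assume F: "F \<in> \<A>"
      obtain A B f p where A: "A \<in> compact_objects T" "B \<in> compact_objects T" and rc: "t.rep_cokernel A B f F p"
        using \<A>[OF F] unfolding is_coherent_functor_iff by blast
      obtain Z k w where tri: "Tri Z A B k f w" using Tri_cocone_exists[OF t.rep_cokernelD(1-3)[OF rc]] .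
      have "(A, Z, k) \<in> \<Psi>" using F A rc tri by (auto simp: \<Psi>_def)
      from bspec[OF R this] show "carrier (FOb F X) = {\<one>\<^bsub>FOb F X\<^esub>}"
        using coherent_functor_trivial_iff[OF rc X] factor_iff_annihilated[OF tri X] by simp
    qed
  qed
  then have "D = annihilated \<Psi>" unfolding D annihilated_def by blast
  then show "\<exists>\<Psi>. c.arrows \<Psi> \<and> D = annihilated \<Psi>" using arr by blast
next
  assume "\<exists>\<Psi>. c.arrows \<Psi> \<and> D = annihilated \<Psi>"
  then obtain \<Psi> where \<Psi>: "c.arrows \<Psi>" and D: "D = annihilated \<Psi>" by blast
  define \<A> where "\<A> = {F. \<exists>(A, Z, k)\<in>\<Psi>. \<exists>B f p w. t.rep_cokernel A B f F p \<and> Tri Z A B k f w}"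
  have cone: "\<exists>B f w. B \<in> compact_objects T \<and> Tri Z A B k f w" if "(A, Z, k) \<in> \<Psi>" for A Z k
  proof -
    have A: "A \<in> compact_objects T" "Z \<in> compact_objects T" "k \<in> arr T Z A" using \<Psi> that by (auto simp: c.arrows_def)
    obtain B f w where "Tri Z A B k f w" using TR1_cone A compact_subset by blast
    then show ?thesis using compact_cone A by blast
  qed
  have coh: "is_coherent_functor T F" if F: "F \<in> \<A>" for F
  proof -
    obtain A Z k B f p w where "(A, Z, k) \<in> \<Psi>" "t.rep_cokernel A B f F p" "Tri Z A B k f w"
      using F unfolding \<A>_def by blast
    moreover from this have "A \<in> compact_objects T" "Z \<in> compact_objects T" using \<Psi> by (auto simp: c.arrows_def)
    ultimately show ?thesis unfolding is_coherent_functor_iff using compact_cone by blast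
  qed
  have "(\<forall>F\<in>\<A>. carrier (FOb F X) = {\<one>\<^bsub>FOb F X\<^esub>}) \<longleftrightarrow> (\<forall>(A, Z, k)\<in>\<Psi>. \<forall>x\<in>arr T A X. Cmp T Z A X x k = \<one>\<^bsub>Hom T Z X\<^esub>)"
    if X: "X \<in> Obj T" for X
  proof
    assume L: "\<forall>F\<in>\<A>. carrier (FOb F X) = {\<one>\<^bsub>FOb F X\<^esub>}"
    show "\<forall>(A, Z, k)\<in>\<Psi>. \<forall>x\<in>arr T A X. Cmp T Z A X x k = \<one>\<^bsub>Hom T Z X\<^esub>"
    proof clarify
      fix A Z k x assume \<Psi>': "(A, Z, k) \<in> \<Psi>" and x: "x \<in> arr T A X"
      obtain B f w where tri: "Tri Z A B k f w" using cone[OF \<Psi>'] by blast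
      have "A \<in> Obj T" "B \<in> Obj T" "f \<in> arr T A B" using Tri_wf[OF tri] by auto
      then obtain F p where rc: "t.rep_cokernel A B f F p" by (rule t.rep_cokernel_exists)
      then have "F \<in> \<A>" using \<Psi>' tri unfolding \<A>_def by blast
      then show "Cmp T Z A X x k = \<one>\<^bsub>Hom T Z X\<^esub>"
        using L coherent_functor_trivial_iff[OF rc X] factor_iff_annihilated[OF tri X] x by blast
    qed
  next
    assume R: "\<forall>(A, Z, k)\<in>\<Psi>. \<forall>x\<in>arr T A X. Cmp T Z A X x k = \<one>\<^bsub>Hom T Z X\<^esub>"
    show "\<forall>F\<in>\<A>. carrier (FOb F X) = {\<one>\<^bsub>FOb F X\<^esub>}"
    proof
      fix F assume "F \<in> \<A>"
      then obtain A Z k B f p w where \<Psi>': "(A, Z, k) \<in> \<Psi>" and rc: "t.rep_cokernel A B f F p" and tri: "Tri Z A B k f w"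
        unfolding \<A>_def by blast
      from bspec[OF R \<Psi>'] show "carrier (FOb F X) = {\<one>\<^bsub>FOb F X\<^esub>}"
        using coherent_functor_trivial_iff[OF rc X] factor_iff_annihilated[OF tri X] by simp
    qed
  qed
  then have "D = {X \<in> Obj T. \<forall>F\<in>\<A>. carrier (FOb F X) = {\<one>\<^bsub>FOb F X\<^esub>}}" unfolding D annihilated_def by blast
  then show "definable_subcategory T D" unfolding definable_subcategory_def using coh by blast
qed

lemma yoneda_vimage_torsionfree:
  assumes \<Phi>: "c.arrows \<Phi>"
  shows "yoneda_vimage T (c.torsionfree \<Phi>) =
    {X \<in> Obj T. \<forall>(A, B, b)\<in>\<Phi>. \<forall>x\<in>arr T A X. Cmp T B A X x b = \<one>\<^bsub>Hom T B X\<^esub> \<longrightarrow> x = \<one>\<^bsub>Hom T A X\<^esub>}"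
  unfolding yoneda_vimage_def
  using c.exact_torsionfree_iff[OF \<Phi> additive_yoneda exact_yoneda] by (simp cong: conj_cong)

lemma annihilated_iff_injective:
  assumes wc: "c.weak_cokernel A B Z b k" and X: "X \<in> Obj T"
  shows "(\<forall>x\<in>arr T A X. Cmp T B A X x b = \<one>\<^bsub>Hom T B X\<^esub>) \<longleftrightarrow>
    (\<forall>x\<in>arr T B X. Cmp T Z B X x k = \<one>\<^bsub>Hom T Z X\<^esub> \<longrightarrow> x = \<one>\<^bsub>Hom T B X\<^esub>)"
  using c.exact_zero_iff_injective[OF functor_on_yoneda[OF X] exact_yoneda[OF X] wc] by simp

text \<open>Injectivity of \<open>b\<close> on \<open>yoneda T X\<close> is the vanishing of any
  arrow \<open>d\<close> of which \<open>b\<close> is a weak cokernel; \<open>\<Psi>\<close>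
  collects these \<open>d\<close>.\<close>

lemma torsionfree_vimage_annihilated:
  assumes \<Phi>: "c.arrows \<Phi>"
  shows "\<exists>\<Psi>. c.arrows \<Psi> \<and> yoneda_vimage T (c.torsionfree \<Phi>) = annihilated \<Psi>"
proof -
  define \<Psi> where "\<Psi> = {(A', A, d). \<exists>B b. (A, B, b) \<in> \<Phi> \<and> c.weak_cokernel A' A B d b}"
  have "c.arrows \<Psi>" unfolding c.arrows_def \<Psi>_def using c.weak_cokernelD by fast
  moreover have "X \<in> yoneda_vimage T (c.torsionfree \<Phi>) \<longleftrightarrow> X \<in> annihilated \<Psi>" for X
  proof (cases "X \<in> Obj T")
    case X: True
    show ?thesis
    proof
      assume L: "X \<in> yoneda_vimage T (c.torsionfree \<Phi>)"
      have "\<forall>x\<in>arr T A' X. Cmp T A A' X x d = \<one>\<^bsub>Hom T A X\<^esub>" if "(A', A, d) \<in> \<Psi>" for A' A d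
      proof -
        obtain B b where b: "(A, B, b) \<in> \<Phi>" "c.weak_cokernel A' A B d b" using \<open>(A', A, d) \<in> \<Psi>\<close> by (auto simp: \<Psi>_def)
        then show ?thesis using L unfolding yoneda_vimage_torsionfree[OF \<Phi>] annihilated_iff_injective[OF b(2) X] by blast
      qed
      then show "X \<in> annihilated \<Psi>" using X unfolding annihilated_def by blast
    next
      assume R: "X \<in> annihilated \<Psi>"
      have "\<forall>x\<in>arr T A X. Cmp T B A X x b = \<one>\<^bsub>Hom T B X\<^esub> \<longrightarrow> x = \<one>\<^bsub>Hom T A X\<^esub>" if b: "(A, B, b) \<in> \<Phi>" for A B b
      proof -
        have "A \<in> Obj compacts" "B \<in> Obj compacts" "b \<in> arr compacts A B" using \<Phi> b by (auto simp: c.arrows_def)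
        then obtain A' d where d: "c.weak_cokernel A' A B d b" using c.weak_kernel_exists by blast
        then have "(A', A, d) \<in> \<Psi>" using b by (auto simp: \<Psi>_def)
        then show ?thesis using R unfolding annihilated_iff_injective[OF d X, symmetric] annihilated_def by blast
      qed
      then show "X \<in> yoneda_vimage T (c.torsionfree \<Phi>)" using X unfolding yoneda_vimage_torsionfree[OF \<Phi>] by blast
    qed
  qed (auto simp: annihilated_def yoneda_vimage_def)
  ultimately show ?thesis by blast
qed

text \<open>The same exchange in the other direction: vanishing of \<open>b\<close> is injectivity
  of its weak cokernels.\<close>

lemma annihilated_torsionfree_vimage:
  assumes \<Psi>: "c.arrows \<Psi>"
  shows "\<exists>\<Phi>. c.arrows \<Phi> \<and> annihilated \<Psi> = yoneda_vimage T (c.torsionfree \<Phi>)"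
proof -
  define \<Phi> where "\<Phi> = {(B, Z, k). \<exists>A b. (A, B, b) \<in> \<Psi> \<and> c.weak_cokernel A B Z b k}"
  have \<Phi>: "c.arrows \<Phi>" unfolding c.arrows_def \<Phi>_def using c.weak_cokernelD by fast
  have "X \<in> yoneda_vimage T (c.torsionfree \<Phi>) \<longleftrightarrow> X \<in> annihilated \<Psi>" for X
  proof (cases "X \<in> Obj T")
    case X: True
    show ?thesis
    proof
      assume L: "X \<in> yoneda_vimage T (c.torsionfree \<Phi>)"
      have "\<forall>x\<in>arr T A X. Cmp T B A X x b = \<one>\<^bsub>Hom T B X\<^esub>" if b: "(A, B, b) \<in> \<Psi>" for A B b
      proof -
        have "A \<in> Obj compacts" "B \<in> Obj compacts" "b \<in> arr compacts A B" using \<Psi> b by (auto simp: c.arrows_def)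
        then obtain Z k where k: "c.weak_cokernel A B Z b k" using c.weak_cokernel_exists by blast
        then have "(B, Z, k) \<in> \<Phi>" using b by (auto simp: \<Phi>_def)
        then show ?thesis using L unfolding yoneda_vimage_torsionfree[OF \<Phi>] annihilated_iff_injective[OF k X] by blast
      qed
      then show "X \<in> annihilated \<Psi>" using X unfolding annihilated_def by blast
    next
      assume R: "X \<in> annihilated \<Psi>"
      have "\<forall>x\<in>arr T B X. Cmp T Z B X x k = \<one>\<^bsub>Hom T Z X\<^esub> \<longrightarrow> x = \<one>\<^bsub>Hom T B X\<^esub>" if "(B, Z, k) \<in> \<Phi>" for B Z k
      proof -
        obtain A b where b: "(A, B, b) \<in> \<Psi>" "c.weak_cokernel A B Z b k" using \<open>(B, Z, k) \<in> \<Phi>\<close> by (auto simp: \<Phi>_def)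
        then show ?thesis using R unfolding annihilated_iff_injective[OF b(2) X, symmetric] annihilated_def by blast
      qed
      then show "X \<in> yoneda_vimage T (c.torsionfree \<Phi>)" using X unfolding yoneda_vimage_torsionfree[OF \<Phi>] by blast
    qed
  qed (auto simp: annihilated_def yoneda_vimage_def)
  then show ?thesis using \<Phi> by blast
qed

lemma definable_iff_torsionfree:
  "definable_subcategory T D \<longleftrightarrow> (\<exists>\<F>. finite_type_hereditary_torsionfree_class T \<F> \<and> D = yoneda_vimage T \<F>)"
  unfolding definable_subcategory_iff finite_type_torsionfree_iff
  using torsionfree_vimage_annihilated annihilated_torsionfree_vimage by metis

text \<open>Every \<open>yoneda T X\<close> is exact, hence absolutely pure.\<close>

lemma yoneda_vimage_absolutely_pure:
  "yoneda_vimage T {M \<in> \<F>. absolutely_pure T M} = yoneda_vimage T \<F>"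
  unfolding yoneda_vimage_def using absolutely_pure_iff additive_yoneda exact_yoneda by auto

lemma definable_iff_definable_class:
  "definable_subcategory T D \<longleftrightarrow> (\<exists>\<E>. definable_class T \<E> \<and> (\<forall>M\<in>\<E>. absolutely_pure T M) \<and> D = yoneda_vimage T \<E>)"
proof
  assume "definable_subcategory T D"
  then obtain \<Psi> where \<Psi>: "c.arrows \<Psi>" and D: "D = annihilated \<Psi>" unfolding definable_subcategory_iff by blast
  have "\<forall>M\<in>c.exact_class \<Psi>. absolutely_pure T M"
    using c.exact_classD(1,3) by (auto simp: absolutely_pure_iff)
  moreover have "D = yoneda_vimage T (c.exact_class \<Psi>)"
    unfolding D annihilated_def yoneda_vimage_def c.exact_class_def using additive_yoneda exact_yoneda by auto
  ultimately show "\<exists>\<E>. definable_class T \<E> \<and> (\<forall>M\<in>\<E>. absolutely_pure T M) \<and> D = yoneda_vimage T \<E>"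
    using c.definable_exact_class[OF \<Psi>] unfolding definable_class_iff by blast
next
  assume "\<exists>\<E>. definable_class T \<E> \<and> (\<forall>M\<in>\<E>. absolutely_pure T M) \<and> D = yoneda_vimage T \<E>"
  then obtain \<E> where E: "c.definable_modules \<E>" and D: "D = yoneda_vimage T \<E>"
    unfolding definable_class_iff by blast
  \<comment> \<open>All arrows that act as zero on the whole class; an exact module killed by them
    belongs to \<open>\<E>\<close> by \<open>c.definable_modules_contains\<close>.\<close>
  define \<Psi> where "\<Psi> = {(A, B, b). A \<in> compact_objects T \<and> B \<in> compact_objects T \<and> b \<in> arr T B A \<and>
    (\<forall>N\<in>\<E>. \<forall>z\<in>carrier (FOb N A). FAr N A B b z = \<one>\<^bsub>FOb N B\<^esub>)}"
  have \<Psi>: "c.arrows \<Psi>" by (auto simp: c.arrows_def \<Psi>_def)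
  have "X \<in> yoneda_vimage T \<E> \<longleftrightarrow> X \<in> annihilated \<Psi>" for X
  proof
    assume "X \<in> yoneda_vimage T \<E>"
    then have "X \<in> Obj T" "yoneda T X \<in> \<E>" by (auto simp: yoneda_vimage_def)
    then show "X \<in> annihilated \<Psi>" by (fastforce simp: annihilated_def \<Psi>_def)
  next
    assume A: "X \<in> annihilated \<Psi>"
    then have X: "X \<in> Obj T" by (simp add: annihilated_def)
    have "yoneda T X \<in> \<E>"
    proof (rule c.definable_modules_contains[OF E additive_yoneda[OF X] exact_yoneda[OF X]])
      fix A' B b x assume "A' \<in> Obj compacts" "B \<in> Obj compacts" "b \<in> arr compacts A' B"
        and "\<And>N z. N \<in> \<E> \<Longrightarrow> z \<in> carrier (FOb N A') \<Longrightarrow> FAr N A' B b z = \<one>\<^bsub>FOb N B\<^esub>"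
        and x: "x \<in> carrier (FOb (yoneda T X) A')"
      then have "(A', B, b) \<in> \<Psi>" by (simp add: \<Psi>_def)
      then show "FAr (yoneda T X) A' B b x = \<one>\<^bsub>FOb (yoneda T X) B\<^esub>"
        using A x by (auto simp: annihilated_def)
    qed
    then show "X \<in> yoneda_vimage T \<E>" using X by (simp add: yoneda_vimage_def)
  qed
  then show "definable_subcategory T D" unfolding definable_subcategory_iff D using \<Psi> by blast
qed

end

theorem theorem3p6:
  fixes T :: "('o, 'u) pcat"
    and Sh :: "'o \<Rightarrow> 'o"
    and ShA :: "'o \<Rightarrow> 'o \<Rightarrow> 'u \<Rightarrow> 'u"
    and Tri :: "'o \<Rightarrow> 'o \<Rightarrow> 'o \<Rightarrow> 'u \<Rightarrow> 'u \<Rightarrow> 'u \<Rightarrow> bool"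
    and D :: "'o set"
  assumes "strongly_inaccessible TYPE('u)"
    and "triangulated_category T Sh ShA Tri"
    and "locally_small T"
    and "has_small_coproducts T"
    and "compactly_generated T"
    and "D \<subseteq> Obj T"
  shows
    "(definable_subcategory T D \<longleftrightarrow>
        (\<exists>\<F>. finite_type_hereditary_torsionfree_class T \<F> \<and> D = yoneda_vimage T \<F>)) \<and>
     (definable_subcategory T D \<longleftrightarrow>
        (\<exists>\<F> \<E>. finite_type_hereditary_torsionfree_class T \<F> \<and>
           \<E> = {M \<in> \<F>. absolutely_pure T M} \<and> D = yoneda_vimage T \<E>)) \<and>
     (definable_subcategory T D \<longleftrightarrow>
        (\<exists>\<E>. definable_class T \<E> \<and> (\<forall>M\<in>\<E>. absolutely_pure T M) \<and>
           D = yoneda_vimage T \<E>))"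
proof -
  interpret triangulated_category T Sh ShA Tri by fact
  interpret compactly_generated_category T Sh ShA Tri
    using assms(1,3,5) by unfold_locales
  \<comment> \<open>Forms (a) and (b) have the same preimage for each torsionfree class, so (b) is
    obtained by rewriting (a).\<close>
  have "(\<exists>\<F> \<E>. finite_type_hereditary_torsionfree_class T \<F> \<and>
      \<E> = {M \<in> \<F>. absolutely_pure T M} \<and> D = yoneda_vimage T \<E>) \<longleftrightarrow>
    (\<exists>\<F>. finite_type_hereditary_torsionfree_class T \<F> \<and> D = yoneda_vimage T \<F>)"
    using yoneda_vimage_absolutely_pure by metis
  then show ?thesis
    using definable_iff_torsionfree[of D] definable_iff_definable_class[of D] by simp
qed

end
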